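(* Let $C$ be a hyperelliptic curve of genus $3$, $\mathcal{P}=\langle q_1,q_2\rangle\subset S^2\mathbf{C}^8$ the associated simple pencil of quadric forms, $p\in C$ a general point, and $s_1,s_2\in H^0(\mathcal{U}_p)$ two general sections of the same restricted spinor bundle $\mathcal{U}_p$ on $\mathrm{Gr}(\mathbf{C}^8,2,\mathcal{P})$. Then the common zero locus $S:=(s_1)_0\cap(s_2)_0\subset\mathrm{Gr}(\mathbf{C}^8,2,\mathcal{P})$ is a codimension $2$ linear section of the Segre variety $\mathbf{P}^1\times\mathbf{P}^1\times\mathbf{P}^1\times\mathbf{P}^1\subset\mathbf{P}^{15}$. The polarization $h:=\alpha|_S$ is the class of the hyperplane section with respect to the Segre embedding $\mathbf{P}^1\times\mathbf{P}^1\times\mathbf{P}^1\times\mathbf{P}^1\subset\mathbf{P}^{15}$.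
   Context: We work over $\mathbf{C}$. $\mathrm{Gr}(\mathbf{C}^8,2)$ is the Grassmann variety of $2$-dimensional quotients of $\mathbf{C}^8$, with universal quotient bundle $\mathcal{Q}$. For $q\in S^2\mathbf{C}^8=H^0(S^2\mathcal{Q})$, $\mathrm{Gr}(\mathbf{C}^8,2,q)$ is the zero locus of $q$ as a section of $S^2\mathcal{Q}$, and $\mathrm{Gr}(\mathbf{C}^8,2,\mathcal{P})=\mathrm{Gr}(\mathbf{C}^8,2,q_1)\cap\mathrm{Gr}(\mathbf{C}^8,2,q_2)$; $\alpha$ is the Plücker hyperplane class. A hyperelliptic curve $C$ of genus $3$ is associated with a pencil $\mathcal{P}=\langle q_1,q_2\rangle$ such that $C$ is the double cover $y^2=\mathrm{disc}(x_1q_1-x_2q_2)$ of $\mathbf{P}^1=\mathcal{P}$; such pencils (with $C$ smooth of genus $3$) are called simple. For $p\in C$ lying over a non-degenerate $q\in\mathcal{P}$, $\mathcal{U}_p$ is the restriction to $\mathrm{Gr}(\mathbf{C}^8,2,\mathcal{P})$ of one of the two rank-two spinor bundles on $\mathrm{Gr}(\mathbf{C}^8,2,q)$ (homogeneous bundles whose spaces of sections are the half-spin representations of type $D_4$), the two points over $q$ corresponding to the two spinor bundles. $(s)_0$ denotes the zero locus of a section $s$. *)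

theory Defs
  imports "HOL-Analysis.Analysis" "HOL-Combinatorics.Permutations"
begin

section \<open>Polynomial functions and generality\<close>

inductive_set poly_functions :: "('a \<Rightarrow> complex) set \<Rightarrow> ('a \<Rightarrow> complex) set"
  for G :: "('a \<Rightarrow> complex) set" where
  const: "(\<lambda>_. c) \<in> poly_functions G"
| gen: "g \<in> G \<Longrightarrow> g \<in> poly_functions G"
| add: "f \<in> poly_functions G \<Longrightarrow> g \<in> poly_functions G \<Longrightarrow> (\<lambda>x. f x + g x) \<in> poly_functions G"
| mult: "f \<in> poly_functions G \<Longrightarrow> g \<in> poly_functions G \<Longrightarrow> (\<lambda>x. f x * g x) \<in> poly_functions G"

definition hom_poly :: "nat \<Rightarrow> (complex ^ 'n \<Rightarrow> complex) \<Rightarrow> bool" where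
  "hom_poly d f \<longleftrightarrow>
     f \<in> poly_functions (range (\<lambda>i v. v $ i)) \<and> (\<forall>c v. f (c *s v) = c ^ d * f v)"

definition linear_functionals ::
  "('a \<Rightarrow> 'b \<Rightarrow> complex) set \<Rightarrow> (('a \<Rightarrow> 'b \<Rightarrow> complex) \<Rightarrow> complex) set" where
  "linear_functionals H =
     {l. (\<forall>s\<in>H. \<forall>t\<in>H. l (\<lambda>x y. s x y + t x y) = l s + l t) \<and>
         (\<forall>c. \<forall>s\<in>H. l (\<lambda>x y. c * s x y) = c * l s)}"

text \<open>A property of pairs of elements of a complex vector space H of functions holds for two
  general elements if it holds on a nonempty principal Zariski-open subset of H \<open>\<times>\<close> H.\<close>

definition general_pair ::
  "('a \<Rightarrow> 'b \<Rightarrow> complex) set \<Rightarrow>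
   (('a \<Rightarrow> 'b \<Rightarrow> complex) \<Rightarrow> ('a \<Rightarrow> 'b \<Rightarrow> complex) \<Rightarrow> bool) \<Rightarrow> bool" where
  "general_pair H P \<longleftrightarrow>
     (\<exists>F \<in> poly_functions ({\<lambda>st. l (fst st) |l. l \<in> linear_functionals H} \<union>
                           {\<lambda>st. l (snd st) |l. l \<in> linear_functionals H}).
        (\<exists>s\<in>H. \<exists>t\<in>H. F (s, t) \<noteq> 0) \<and> (\<forall>s\<in>H. \<forall>t\<in>H. F (s, t) \<noteq> 0 \<longrightarrow> P s t))"

section \<open>Projective varieties, regular maps, hyperplane classes\<close>

text \<open>Points of projective space are lines (one-dimensional subspaces), and a projective variety is
  given by its set of points.\<close>

definition line :: "complex ^ 'n \<Rightarrow> (complex ^ 'n) set" where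
  "line v = vec.span {v}"

definition proj :: "(complex ^ 'n) set \<Rightarrow> (complex ^ 'n) set set" where
  "proj L = {line v |v. v \<in> L \<and> v \<noteq> 0}"

definition regular_map ::
  "(complex ^ 'n) set set \<Rightarrow> (complex ^ 'm) set set \<Rightarrow>
   ((complex ^ 'n) set \<Rightarrow> (complex ^ 'm) set) \<Rightarrow> bool" where
  "regular_map X Y \<phi> \<longleftrightarrow> \<phi> ` X \<subseteq> Y \<and>
     (\<forall>x\<in>X. \<exists>d F. (\<forall>j. hom_poly d (\<lambda>v. F v $ j)) \<and>
        (\<forall>v\<in>x. v \<noteq> 0 \<longrightarrow> F v \<noteq> 0) \<and>
        (\<forall>x'\<in>X. \<forall>v\<in>x'. F v \<noteq> 0 \<longrightarrow> \<phi> x' = line (F v)))"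

definition biregular ::
  "(complex ^ 'n) set set \<Rightarrow> (complex ^ 'm) set set \<Rightarrow>
   ((complex ^ 'n) set \<Rightarrow> (complex ^ 'm) set) \<Rightarrow> bool" where
  "biregular X Y \<phi> \<longleftrightarrow> bij_betw \<phi> X Y \<and> regular_map X Y \<phi> \<and> regular_map Y X (inv_into X \<phi>)"

text \<open>The classes \<open>\<phi>\<^sup>*O(1)\<close> and \<open>O(1)|\<^sub>X\<close> in \<open>Pic X\<close> agree, expressed dually: the fibre of \<open>O(-1)\<close> at
  a point of projective space is the line which this point is, and \<open>\<Phi>\<close> is an isomorphism of line
  bundles from \<open>O(-1)|\<^sub>X\<close> to \<open>\<phi>\<^sup>*O(-1)\<close>, that is, a fibrewise linear isomorphism which locally is
  a quotient of homogeneous polynomials whose degrees differ by 1.\<close>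

definition pulls_back_hyperplane_class ::
  "(complex ^ 'n) set set \<Rightarrow> ((complex ^ 'n) set \<Rightarrow> (complex ^ 'm) set) \<Rightarrow> bool" where
  "pulls_back_hyperplane_class X \<phi> \<longleftrightarrow>
     (\<exists>\<Phi>. (\<forall>x\<in>X. \<forall>v\<in>x. \<Phi> v \<in> \<phi> x \<and> (v \<noteq> 0 \<longrightarrow> \<Phi> v \<noteq> 0) \<and> (\<forall>c. \<Phi> (c *s v) = c *s \<Phi> v)) \<and>
          (\<forall>x\<in>X. \<exists>d F g. (\<forall>j. hom_poly (Suc d) (\<lambda>v. F v $ j)) \<and> hom_poly d g \<and>
             (\<forall>v\<in>x. v \<noteq> 0 \<longrightarrow> g v \<noteq> 0) \<and>
             (\<forall>x'\<in>X. \<forall>v\<in>x'. g v \<noteq> 0 \<longrightarrow> \<Phi> v = (1 / g v) *s F v)))"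

text \<open>The dimension of a projective variety is the least k such that some linear subspace of
  codimension \<open>k + 1\<close> is disjoint from it.\<close>

definition dim_at_most :: "nat \<Rightarrow> (complex ^ 'n) set set \<Rightarrow> bool" where
  "dim_at_most k X \<longleftrightarrow>
     (\<exists>M. vec.subspace M \<and> vec.dim M + Suc k = CARD('n) \<and> X \<inter> proj M = {})"

section \<open>The Segre fourfold and its linear sections\<close>

definition tensor4 ::
  "complex ^ 2 \<Rightarrow> complex ^ 2 \<Rightarrow> complex ^ 2 \<Rightarrow> complex ^ 2 \<Rightarrow> complex ^ (2 \<times> 2 \<times> 2 \<times> 2)" where
  "tensor4 a b c d = (\<chi> t. case t of (i, j, k, l) \<Rightarrow> a $ i * b $ j * c $ k * d $ l)"

definition segre4 :: "(complex ^ (2 \<times> 2 \<times> 2 \<times> 2)) set set" where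
  "segre4 = {line (tensor4 a b c d) |a b c d. a \<noteq> 0 \<and> b \<noteq> 0 \<and> c \<noteq> 0 \<and> d \<noteq> 0}"

text \<open>Every component of \<open>segre4 \<inter> proj L\<close> has dimension at least \<open>4 - 2\<close> when L has codimension 2,
  so the last condition says that the linear section has codimension exactly 2 in the fourfold.\<close>

definition segre4_section_codim2 :: "(complex ^ (2 \<times> 2 \<times> 2 \<times> 2)) set set \<Rightarrow> bool" where
  "segre4_section_codim2 Y \<longleftrightarrow>
     (\<exists>L. vec.subspace L \<and> vec.dim L = 14 \<and> Y = segre4 \<inter> proj L \<and> dim_at_most 2 Y)"

section \<open>Pencils of quadrics and hyperelliptic curves\<close>

text \<open>An element of \<open>S\<^sup>2C\<^sup>8\<close> is a symmetric matrix, viewed as a quadratic form on the dual space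
  of \<open>C\<^sup>8\<close>. All vectors of type \<^typ>\<open>complex ^ 8\<close> below are elements of this dual space.\<close>

definition qform :: "complex ^ 8 ^ 8 \<Rightarrow> complex ^ 8 \<Rightarrow> complex" where
  "qform M \<xi> = (\<Sum>i\<in>UNIV. \<Sum>j\<in>UNIV. M $ i $ j * \<xi> $ i * \<xi> $ j)"

definition pencil :: "complex ^ 8 ^ 8 \<Rightarrow> complex ^ 8 ^ 8 \<Rightarrow> complex \<Rightarrow> complex \<Rightarrow> complex ^ 8 ^ 8" where
  "pencil M1 M2 x1 x2 = (\<chi> i j. x1 * M1 $ i $ j - x2 * M2 $ i $ j)"

definition disc :: "complex ^ 8 ^ 8 \<Rightarrow> complex ^ 8 ^ 8 \<Rightarrow> complex \<Rightarrow> complex \<Rightarrow> complex" where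
  "disc M1 M2 x1 x2 = det (pencil M1 M2 x1 x2)"

text \<open>The curve \<open>y\<^sup>2 = disc\<close> lies in the weighted projective plane \<open>P(1,1,4)\<close>; its points are
  orbits of the multiplicative group.\<close>

definition orbit114 :: "complex \<Rightarrow> complex \<Rightarrow> complex \<Rightarrow> (complex \<times> complex \<times> complex) set" where
  "orbit114 x1 x2 y = {(c * x1, c * x2, c ^ 4 * y) |c. c \<noteq> 0}"

definition hyperelliptic_curve ::
  "complex ^ 8 ^ 8 \<Rightarrow> complex ^ 8 ^ 8 \<Rightarrow> (complex \<times> complex \<times> complex) set set" where
  "hyperelliptic_curve M1 M2 =
     {orbit114 x1 x2 y |x1 x2 y. (x1, x2, y) \<noteq> (0, 0, 0) \<and> y\<^sup>2 = disc M1 M2 x1 x2}"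

text \<open>Smoothness of \<open>y\<^sup>2 - disc = 0\<close> by the Jacobian criterion. The curve avoids the singular point
  of \<open>P(1,1,4)\<close>, and if it is smooth, then it is a double cover of \<open>P\<^sup>1\<close> branched in 8 points, hence
  irreducible of genus 3, and the two forms are linearly independent.\<close>

definition simple_pencil :: "complex ^ 8 ^ 8 \<Rightarrow> complex ^ 8 ^ 8 \<Rightarrow> bool" where
  "simple_pencil M1 M2 \<longleftrightarrow> transpose M1 = M1 \<and> transpose M2 = M2 \<and>
     (\<forall>x1 x2 y. (x1, x2, y) \<noteq> (0, 0, 0) \<and> y\<^sup>2 = disc M1 M2 x1 x2 \<longrightarrow>
        (2 * y, deriv (\<lambda>t. disc M1 M2 t x2) x1, deriv (\<lambda>t. disc M1 M2 x1 t) x2) \<noteq> (0, 0, 0))"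

definition general_point ::
  "(complex \<times> complex \<times> complex) set set \<Rightarrow> ((complex \<times> complex \<times> complex) set \<Rightarrow> bool) \<Rightarrow> bool" where
  "general_point C P \<longleftrightarrow> finite {p \<in> C. \<not> P p}"

section \<open>Orthogonal Grassmannians\<close>

text \<open>A 2-dimensional quotient Q of \<open>C\<^sup>8\<close> is recorded by the 2-dimensional subspace E dual to Q of
  the dual space of \<open>C\<^sup>8\<close>. The value at Q of the section of \<open>S\<^sup>2Q\<close> given by a quadratic form is the
  restriction of this form to E.\<close>

definition Gr :: "(complex ^ 8) set set" where
  "Gr = {E. vec.subspace E \<and> vec.dim E = 2}"

definition Gr_quadric :: "complex ^ 8 ^ 8 \<Rightarrow> (complex ^ 8) set set" where
  "Gr_quadric M = {E \<in> Gr. \<forall>\<xi>\<in>E. qform M \<xi> = 0}"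

definition Gr_pencil :: "complex ^ 8 ^ 8 \<Rightarrow> complex ^ 8 ^ 8 \<Rightarrow> (complex ^ 8) set set" where
  "Gr_pencil M1 M2 = Gr_quadric M1 \<inter> Gr_quadric M2"

definition wedge :: "complex ^ 8 \<Rightarrow> complex ^ 8 \<Rightarrow> complex ^ (8 \<times> 8)" where
  "wedge \<xi> \<eta> = (\<chi> ij. \<xi> $ fst ij * \<eta> $ snd ij - \<xi> $ snd ij * \<eta> $ fst ij)"

definition plucker :: "(complex ^ 8) set \<Rightarrow> (complex ^ (8 \<times> 8)) set" where
  "plucker E = vec.span {wedge \<xi> \<eta> |\<xi> \<eta>. \<xi> \<in> E \<and> \<eta> \<in> E}"

section \<open>Spinor bundles\<close>

text \<open>A spin module of a non-degenerate form in 8 variables is a 16-dimensional module over its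
  Clifford algebra; it exists and is unique up to isomorphism, the Clifford algebra being a
  matrix algebra of size 16.\<close>

definition spin_module :: "complex ^ 8 ^ 8 \<Rightarrow> (complex ^ 8 \<Rightarrow> complex ^ 16 ^ 16) \<Rightarrow> bool" where
  "spin_module M \<gamma> \<longleftrightarrow>
     (\<forall>\<xi> \<eta>. \<gamma> (\<xi> + \<eta>) = \<gamma> \<xi> + \<gamma> \<eta>) \<and>
     (\<forall>c \<xi> s. \<gamma> (c *s \<xi>) *v s = c *s (\<gamma> \<xi> *v s)) \<and>
     (\<forall>\<xi> s. \<gamma> \<xi> *v (\<gamma> \<xi> *v s) = qform M \<xi> *s s)"

text \<open>The antisymmetrized product of the standard basis. It generates, with 1, the center of the
  even Clifford algebra, and its square is the determinant of the Gram matrix. Under a change of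
  basis, both sides of \<open>vol\<^sup>2 = det\<close> get multiplied by the squared determinant.\<close>

definition volume :: "(complex ^ 8 \<Rightarrow> complex ^ 16 ^ 16) \<Rightarrow> complex ^ 16 \<Rightarrow> complex ^ 16" where
  "volume \<gamma> s = (1 / fact 8) *s
     (\<Sum>\<pi> | \<pi> permutes (UNIV :: 8 set).
        of_int (sign \<pi>) *s foldr (\<lambda>i t. \<gamma> (axis (\<pi> (of_nat i)) 1) *v t) [0..<8] s)"

text \<open>The two half-spin modules are the eigenspaces of \<open>volume \<gamma>\<close>. Its eigenvalues are the square
  roots y of the discriminant, i.e. the points of the double cover over the given form.\<close>

definition half_spin :: "(complex ^ 8 \<Rightarrow> complex ^ 16 ^ 16) \<Rightarrow> complex \<Rightarrow> (complex ^ 16) set" where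
  "half_spin \<gamma> y = {s. volume \<gamma> s = y *s s}"

text \<open>The spinors annihilated by an isotropic E form a rank-two subbundle of the trivial bundle with
  fibre the half-spin module. The spinor bundle is its dual: it is globally generated by
  linear functionals on the half-spin module (which for \<open>D\<^sub>4\<close> is self-dual).\<close>

definition spinor_sub ::
  "(complex ^ 8 \<Rightarrow> complex ^ 16 ^ 16) \<Rightarrow> complex \<Rightarrow> (complex ^ 8) set \<Rightarrow> (complex ^ 16) set" where
  "spinor_sub \<gamma> y E = {s \<in> half_spin \<gamma> y. \<forall>\<xi>\<in>E. \<gamma> \<xi> *v s = 0}"

text \<open>Regular sections over a subvariety X of the restricted spinor bundle: at each E in X a linear
  functional on \<open>spinor_sub \<gamma> y E\<close>, locally the restriction of a functional on the spin module with
  regular functions (in Pluecker coordinates) as coefficients. The value 0 outside of the fibres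
  makes the representation of a section by a function unique.\<close>

definition spinor_sections ::
  "(complex ^ 8 \<Rightarrow> complex ^ 16 ^ 16) \<Rightarrow> complex \<Rightarrow> (complex ^ 8) set set \<Rightarrow>
   ((complex ^ 8) set \<Rightarrow> complex ^ 16 \<Rightarrow> complex) set" where
  "spinor_sections \<gamma> y X =
     {\<sigma>. (\<forall>E s. \<not> (E \<in> X \<and> s \<in> spinor_sub \<gamma> y E) \<longrightarrow> \<sigma> E s = 0) \<and>
         (\<forall>E\<in>X. \<exists>d N g. (\<forall>j. hom_poly d (\<lambda>w. N w $ j)) \<and> hom_poly d g \<and>
            (\<forall>w\<in>plucker E. w \<noteq> 0 \<longrightarrow> g w \<noteq> 0) \<and>
            (\<forall>E'\<in>X. \<forall>w\<in>plucker E'. w \<noteq> 0 \<and> g w \<noteq> 0 \<longrightarrow>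
               (\<forall>s\<in>spinor_sub \<gamma> y E'. \<sigma> E' s = (\<Sum>j\<in>UNIV. N w $ j * s $ j) / g w)))}"

definition zero_locus ::
  "(complex ^ 8 \<Rightarrow> complex ^ 16 ^ 16) \<Rightarrow> complex \<Rightarrow> (complex ^ 8) set set \<Rightarrow>
   ((complex ^ 8) set \<Rightarrow> complex ^ 16 \<Rightarrow> complex) \<Rightarrow> (complex ^ 8) set set" where
  "zero_locus \<gamma> y X \<sigma> = {E \<in> X. \<forall>s\<in>spinor_sub \<gamma> y E. \<sigma> E s = 0}"

end

theory Submission
  imports Defs "HOL-Complex_Analysis.Conformal_Mappings"
begin

text \<open>
  After diagonalizing the pencil, the half-spin module is the 8-dimensional space of triples
  \<open>(s, z, t)\<close> with \<open>z\<close> in the exterior square of a 4-dimensional space, and the pure spinors form the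
  quadric \<open>s t = pf z\<close>. A section of the spinor bundle assigns a value to every pair of a pure spinor and
  a line on the quadric surface which the second form cuts out in the corresponding isotropic 4-space.
  By Liouville's theorem this value depends only on the family of the line, and a comparison of
  the two families along pencils of residual planes, together with analytic continuation, shows that it depends only on the
  spinor; so it is a linear functional, and the sections form an 8-dimensional space.

  The functional given by a pure spinor vanishes on the planes which meet its isotropic
  4-space. A line of functionals contains two pure ones, with complementary 4-spaces \<open>A\<close> and \<open>B\<close>, so
  the common zero locus consists of the planes \<open>\<langle>a, b\<rangle>\<close> with \<open>a \<in> A\<close>, \<open>b \<in> B\<close> isotropic for the second form and
  \<open>(a, b)\<close> subject to two bilinear equations. The two quadric surfaces are products of projective lines, and
  the Pluecker embedding is the Segre embedding because \<open>a \<and> b\<close> is \<open>a \<otimes> b\<close>.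
  The dimension is bounded with an eigenbasis of the pencil on \<open>A \<times> B\<close>, which exists for generic functionals.\<close>

section \<open>Polynomial functions\<close>

text \<open>\<open>spinor_sections\<close> is defined by local regularity only, so nothing can be
  called general in it before the space of all sections is known. Compactness of the set of planes
  supplies the bounds for Liouville's theorem. On a smooth quadric surface no connected family of
  lines joins the two rulings, so a separate argument is unavoidable there. It is explicit only near
  the origin of a chart, where all forms are diagonal. The coordinates are made for this origin. The
  eight eigenvalues of the pencil are grouped into four pairs; \<open>p\<close> records the
  differences within the pairs, which must be nonzero, and \<open>r\<close> the sums, which must be
  pairwise distinct. Each genericity condition has to be a polynomial in the two sections, although
  eigenvectors and the pure functionals on a line are not. Hence the detours through injectivity of
  linear maps, adjugates and the elimination of a root. The polynomial is shown to be nonzero at a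
  single pair, the functionals with coordinates \<open>(1, 0, -1)\<close> and
  \<open>(1, 0, 1)\<close>, whose line joins the centers of two opposite charts.\<close>

lemma poly_functions_uminus: "f \<in> poly_functions G \<Longrightarrow> (\<lambda>x. - f x) \<in> poly_functions G"
  using poly_functions.mult[OF poly_functions.const[of "-1"]] by fastforce

lemma poly_functions_diff:
  "f \<in> poly_functions G \<Longrightarrow> g \<in> poly_functions G \<Longrightarrow> (\<lambda>x. f x - g x) \<in> poly_functions G"
  using poly_functions.add[OF _ poly_functions_uminus, of f G g] by simp

lemma poly_functions_power: "f \<in> poly_functions G \<Longrightarrow> (\<lambda>x. f x ^ n) \<in> poly_functions G"
  by (induction n) (auto intro: poly_functions.intros)

lemma poly_functions_sum:
  "(\<And>i. i \<in> I \<Longrightarrow> f i \<in> poly_functions G) \<Longrightarrow> (\<lambda>x. \<Sum>i\<in>I. f i x) \<in> poly_functions G"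
proof (induction I rule: infinite_finite_induct)
  case (insert i I)
  have "(\<lambda>x. f i x + (\<Sum>i\<in>I. f i x)) \<in> poly_functions G"
    by (intro poly_functions.add insert) (use insert in auto)
  then show ?case using insert by simp
qed (auto intro: poly_functions.const)

lemma poly_functions_prod:
  "(\<And>i. i \<in> I \<Longrightarrow> f i \<in> poly_functions G) \<Longrightarrow> (\<lambda>x. \<Prod>i\<in>I. f i x) \<in> poly_functions G"
proof (induction I rule: infinite_finite_induct)
  case (insert i I)
  have "(\<lambda>x. f i x * (\<Prod>i\<in>I. f i x)) \<in> poly_functions G"
    by (intro poly_functions.mult insert) (use insert in auto)
  then show ?case using insert by simp
qed (auto intro: poly_functions.const)

lemmas poly_functions_intros = poly_functions.const poly_functions.add poly_functions.mult
  poly_functions_uminus poly_functions_diff poly_functions_power poly_functions_sum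
  poly_functions_prod

lemma poly_functions_det:
  fixes A :: "'a \<Rightarrow> complex ^ 'n ^ 'n"
  assumes "\<And>i j. (\<lambda>x. A x $ i $ j) \<in> poly_functions G"
  shows "(\<lambda>x. det (A x)) \<in> poly_functions G"
  unfolding det_def by (intro poly_functions_intros assms)

lemma poly_functions_matrix_mult:
  fixes A :: "'a \<Rightarrow> complex ^ 'n ^ 'm" and B :: "'a \<Rightarrow> complex ^ 'k ^ 'n"
  assumes "\<And>i j. (\<lambda>x. A x $ i $ j) \<in> poly_functions G" "\<And>i j. (\<lambda>x. B x $ i $ j) \<in> poly_functions G"
  shows "(\<lambda>x. (A x ** B x) $ i $ j) \<in> poly_functions G"
  unfolding matrix_matrix_mult_def by (simp, intro poly_functions_intros assms)

lemma poly_functions_matrix_vector_mult: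
  fixes A :: "'a \<Rightarrow> complex ^ 'n ^ 'm"
  assumes "\<And>i j. (\<lambda>x. A x $ i $ j) \<in> poly_functions G" "\<And>i. (\<lambda>x. v x $ i) \<in> poly_functions G"
  shows "(\<lambda>x. (A x *v v x) $ i) \<in> poly_functions G"
  unfolding matrix_vector_mult_def by (simp, intro poly_functions_intros assms)

lemma poly_functions_compose:
  assumes "f \<in> poly_functions G" "\<And>g. g \<in> G \<Longrightarrow> (\<lambda>x. g (h x)) \<in> poly_functions G'"
  shows "(\<lambda>x. f (h x)) \<in> poly_functions G'"
  using assms(1) by induction (auto intro: poly_functions_intros assms(2))

lemma poly_functions_holomorphic:
  assumes "f \<in> poly_functions G" "\<And>g. g \<in> G \<Longrightarrow> (\<lambda>x. g (h x)) holomorphic_on U"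
  shows "(\<lambda>x. f (h x)) holomorphic_on U"
  using assms(1) by induction (auto intro: holomorphic_intros assms(2))

lemma poly_functions_tendsto:
  assumes "f \<in> poly_functions G" "\<And>g. g \<in> G \<Longrightarrow> ((\<lambda>x. g (h x)) \<longlongrightarrow> g a) F"
  shows "((\<lambda>x. f (h x)) \<longlongrightarrow> f a) F"
  using assms(1) by induction (auto intro: tendsto_intros assms(2))

lemma poly_functions_poly:
  assumes "f \<in> poly_functions {\<lambda>t. t}"
  shows "\<exists>p. \<forall>t. f t = poly p t"
  using assms
proof induction
  case (const c)
  show ?case by (rule exI[of _ "[:c:]"]) simp
next
  case (gen g)
  then show ?case by (intro exI[of _ "[:0,1:]"]) simp
next
  case (add f g)
  then show ?case by (metis poly_add)
next
  case (mult f g)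
  then show ?case by (metis poly_mult)
qed

lemma poly_functions_finite_zeros:
  assumes "f \<in> poly_functions {\<lambda>t. t}" "f a \<noteq> 0"
  shows "finite {t. f t = 0}"
proof -
  obtain p where p: "\<And>t. f t = poly p t" using poly_functions_poly[OF assms(1)] by auto
  then have "p \<noteq> 0" using assms(2) by auto
  then show ?thesis using poly_roots_finite[of p] p by simp
qed

section \<open>Open conditions on matrices, and elimination of a quadratic root\<close>

lemma invertible_injective:
  fixes A :: "complex ^ 'n ^ 'n"
  assumes "det A \<noteq> 0" "A *v x = 0" shows "x = 0"
proof -
  have "invertible A" using assms(1) invertible_det_nz by blast
  then obtain B where "B ** A = mat 1" by (auto simp: invertible_def)
  then show ?thesis using assms(2)
    by (metis matrix_vector_mul_assoc matrix_vector_mul_lid matrix_vector_mult_0_right)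
qed

lemma singular_kernel:
  fixes A :: "complex ^ 'n ^ 'n"
  assumes "det A = 0" shows "\<exists>x. x \<noteq> 0 \<and> A *v x = 0"
proof (rule ccontr)
  assume a: "\<not> ?thesis"
  have "inj ((*v) A)"
    by (metis (no_types, lifting) a injI matrix_vector_mult_diff_distrib right_minus_eq)
  then obtain B where B: "B ** A = mat 1" using matrix_left_invertible_injective by blast
  have "invertible A" unfolding invertible_def using B by (metis matrix_left_right_inverse)
  then show False using assms invertible_det_nz by blast
qed

text \<open>Compose with a left inverse at one parameter value and take the determinant.\<close>

lemma poly_functions_injective_open:
  fixes L :: "'a \<Rightarrow> complex ^ 'n ^ 'm"
  assumes L: "\<And>i j. (\<lambda>x. L x $ i $ j) \<in> poly_functions G"
    and inj: "\<And>v. L a *v v = 0 \<Longrightarrow> v = 0"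
  shows "\<exists>F\<in>poly_functions G. F a \<noteq> 0 \<and> (\<forall>x. F x \<noteq> 0 \<longrightarrow> (\<forall>v. L x *v v = 0 \<longrightarrow> v = 0))"
proof -
  have "inj ((*v) (L a))"
    by (metis (no_types, lifting) inj injI matrix_vector_mult_diff_distrib right_minus_eq)
  then obtain B where B: "B ** L a = mat 1" using matrix_left_invertible_injective by blast
  have 1: "(\<lambda>x. det (B ** L x)) \<in> poly_functions G"
    by (intro poly_functions_det poly_functions_matrix_mult L poly_functions.const)
  show ?thesis
  proof (intro bexI[OF _ 1] conjI allI impI)
    show "det (B ** L a) \<noteq> 0" using B by simp
    fix x v assume "det (B ** L x) \<noteq> 0" "L x *v v = 0"
    then show "v = 0"
      by (metis invertible_injective matrix_vector_mul_assoc matrix_vector_mult_0_right)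
  qed
qed

text \<open>Linear remainders modulo the monic quadratic are closed under products, and the
  remainder is the same for both roots. This removes a root \<open>t\<close> which is not polynomial
  in \<open>x\<close>: where \<open>g x + h x * t\<close> is nonzero, \<open>g x\<close> or
  \<open>h x\<close> is, and these are conditions on \<open>x\<close> alone.\<close>

lemma poly_functions_eliminate_root:
  fixes b c :: "'a \<Rightarrow> complex"
  assumes f: "f \<in> poly_functions ({\<lambda>(x, t). g x |g. g \<in> G} \<union> {snd})"
    and bc: "b \<in> poly_functions G" "c \<in> poly_functions G"
  shows "\<exists>g\<in>poly_functions G. \<exists>h\<in>poly_functions G.
    \<forall>x t. t\<^sup>2 + b x * t + c x = 0 \<longrightarrow> f (x, t) = g x + h x * t"
  using f
proof induction
  case (const k)
  show ?case
    by (rule bexI[OF _ poly_functions.const[of k]], rule bexI[OF _ poly_functions.const[of 0]]) simp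
next
  case (gen f)
  then consider g where "g \<in> G" "f = (\<lambda>(x, t). g x)" | "f = snd" by auto
  then show ?case
  proof cases
    case 1
    show ?thesis
      by (rule bexI[OF _ poly_functions.gen[OF 1(1)]], rule bexI[OF _ poly_functions.const[of 0]])
         (simp add: 1)
  next
    case 2
    show ?thesis
      by (rule bexI[OF _ poly_functions.const[of 0]], rule bexI[OF _ poly_functions.const[of 1]])
         (simp add: 2)
  qed
next
  case (add f1 f2)
  from add.IH(1) obtain g1 h1 where 1: "g1 \<in> poly_functions G" "h1 \<in> poly_functions G"
    "\<And>x t. t\<^sup>2 + b x * t + c x = 0 \<Longrightarrow> f1 (x, t) = g1 x + h1 x * t" by blast
  from add.IH(2) obtain g2 h2 where 2: "g2 \<in> poly_functions G" "h2 \<in> poly_functions G"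
    "\<And>x t. t\<^sup>2 + b x * t + c x = 0 \<Longrightarrow> f2 (x, t) = g2 x + h2 x * t" by blast
  note * = 1(1,2) 2(1,2) 1(3) 2(3)
  show ?case
    by (intro bexI[of _ "\<lambda>x. g1 x + g2 x"] bexI[of _ "\<lambda>x. h1 x + h2 x"])
       (auto simp: * algebra_simps intro!: poly_functions_intros)
next
  case (mult f1 f2)
  from mult.IH(1) obtain g1 h1 where 1: "g1 \<in> poly_functions G" "h1 \<in> poly_functions G"
    "\<And>x t. t\<^sup>2 + b x * t + c x = 0 \<Longrightarrow> f1 (x, t) = g1 x + h1 x * t" by blast
  from mult.IH(2) obtain g2 h2 where 2: "g2 \<in> poly_functions G" "h2 \<in> poly_functions G"
    "\<And>x t. t\<^sup>2 + b x * t + c x = 0 \<Longrightarrow> f2 (x, t) = g2 x + h2 x * t" by blast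
  note * = 1(1,2) 2(1,2) 1(3) 2(3)
  have A: "(\<lambda>x. g1 x * g2 x - h1 x * h2 x * c x) \<in> poly_functions G"
    and B: "(\<lambda>x. g1 x * h2 x + h1 x * g2 x - h1 x * h2 x * b x) \<in> poly_functions G"
    by (intro poly_functions_intros * bc)+
  have "f1 (x, t) * f2 (x, t) = g1 x * g2 x - h1 x * h2 x * c x
        + (g1 x * h2 x + h1 x * g2 x - h1 x * h2 x * b x) * t" if a: "t\<^sup>2 + b x * t + c x = 0" for x t
  proof -
    have "t * t = - b x * t - c x" using a by algebra
    then show ?thesis unfolding *(5)[OF a] *(6)[OF a] by algebra
  qed
  then show ?case by (intro bexI[OF _ A] bexI[OF _ B]) auto
qed

section \<open>Pairs of vectors and two-dimensional subspaces\<close>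

text \<open>Stated for an ordered pair, so that two equal vectors are dependent, which independence
  of the set \<open>{x, y}\<close> would not express.\<close>

definition indep2 :: "complex ^ 'n \<Rightarrow> complex ^ 'n \<Rightarrow> bool" where
  "indep2 x y \<longleftrightarrow> (\<forall>a b. a *s x + b *s y = 0 \<longrightarrow> a = 0 \<and> b = 0)"

lemma span2: "vec.span {x, y} = {a *s x + b *s y |a b. True}" for x y :: "complex ^ 'n"
proof -
  have "vec.span {x, y} = {z. \<exists>k. \<exists>l. z - k *s x = l *s y}"
    unfolding vec.span_insert vec.span_singleton by auto
  also have "\<dots> = {a *s x + b *s y |a b. True}"
    by (auto simp: algebra_simps)
  finally show ?thesis .
qed

lemma indep2_nonzero: "indep2 x y \<Longrightarrow> x \<noteq> 0 \<and> y \<noteq> 0"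
proof -
  assume i: "indep2 x y"
  have "x \<noteq> 0"
  proof
    assume "x = 0" then have "1 *s x + 0 *s y = 0" by simp
    then show False using i unfolding indep2_def by (metis zero_neq_one)
  qed
  moreover have "y \<noteq> 0"
  proof
    assume "y = 0" then have "0 *s x + 1 *s y = 0" by simp
    then show False using i unfolding indep2_def by (metis zero_neq_one)
  qed
  ultimately show ?thesis ..
qed

lemma indep2_commute: "indep2 x y \<longleftrightarrow> indep2 y x"
  unfolding indep2_def by (metis add.commute)

lemma indep2_alt: "indep2 x y \<longleftrightarrow> x \<noteq> y \<and> vec.independent {x, y}"
proof
  assume i: "indep2 x y"
  have "x \<noteq> y"
  proof
    assume "x = y" then have "1 *s x + (-1) *s y = 0" by simp
    then show False using i unfolding indep2_def by (metis zero_neq_one)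
  qed
  moreover have "x \<notin> vec.span {y}"
  proof
    assume "x \<in> vec.span {y}"
    then obtain k where "x = k *s y" by (auto simp: vec.span_singleton)
    then have "1 *s x + (-k) *s y = 0" by simp
    then show False using i unfolding indep2_def by (metis zero_neq_one)
  qed
  ultimately show "x \<noteq> y \<and> vec.independent {x, y}"
    using indep2_nonzero[OF i] by (auto simp: vec.independent_insert)
next
  assume a: "x \<noteq> y \<and> vec.independent {x, y}"
  then have x: "x \<notin> vec.span {y}" and y: "y \<noteq> 0"
    using vec.independent_insert[of x "{y}"] by (auto simp: vec.dependent_zero)
  show "indep2 x y" unfolding indep2_def
  proof (intro allI impI)
    fix p q assume e: "p *s x + q *s y = 0"
    have "p = 0"
    proof (rule ccontr)
      assume p: "p \<noteq> 0"
      have "p *s x = (-q) *s y" using e by (simp add: eq_neg_iff_add_eq_0)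
      then have "inverse p *s (p *s x) = (- q / p) *s y"
        by (metis (no_types, lifting) divide_inverse mult.commute vec.scale_scale)
      then have "x = (- q / p) *s y" using p by (simp add: vec.scale_scale)
      then show False using x unfolding vec.span_singleton by blast
    qed
    with e y show "p = 0 \<and> q = 0" by simp
  qed
qed

lemma dim_span2: "indep2 x y \<Longrightarrow> vec.dim (vec.span {x, y}) = 2"
  using vec.dim_span_eq_card_independent[of "{x, y}"] by (simp add: indep2_alt)

lemma dim2_basis:
  assumes "vec.subspace E" "vec.dim E = 2"
  obtains x y where "indep2 x y" "E = vec.span {x, y}"
proof -
  obtain B where B: "B \<subseteq> E" "vec.independent B" "E \<subseteq> vec.span B" "card B = vec.dim E"
    using vec.basis_exists[of E] by metis
  then obtain x y where xy: "B = {x, y}" "x \<noteq> y" using assms(2) card_2_iff by metis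
  have "E = vec.span {x, y}"
    using B assms(1) xy vec.span_minimal by blast
  with that xy B show ?thesis by (auto simp: indep2_alt)
qed

text \<open>The minors are the Pluecker coordinates of the pair. In this form independence is an
  open condition and can be read off from \<open>wedge\<close>.\<close>

lemma indep2_minor:
  "indep2 x y \<longleftrightarrow> (\<exists>i j. x $ i * y $ j - x $ j * y $ i \<noteq> 0)" for x y :: "complex ^ 'n"
proof
  assume i: "indep2 x y"
  show "\<exists>i j. x $ i * y $ j - x $ j * y $ i \<noteq> 0"
  proof (rule ccontr)
    assume a: "\<not> ?thesis"
    obtain i where i0: "x $ i \<noteq> 0" using indep2_nonzero[OF i] by (auto simp: vec_eq_iff)
    have "(- y $ i) *s x + (x $ i) *s y = 0"
      using a by (auto simp: vec_eq_iff algebra_simps)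
    then show False using i i0 unfolding indep2_def by blast
  qed
next
  assume "\<exists>i j. x $ i * y $ j - x $ j * y $ i \<noteq> 0"
  then obtain i j where d: "x $ i * y $ j - x $ j * y $ i \<noteq> 0" by blast
  show "indep2 x y" unfolding indep2_def
  proof (intro allI impI)
    fix a b assume "a *s x + b *s y = 0"
    then have e: "a * x $ i + b * y $ i = 0" "a * x $ j + b * y $ j = 0"
      by (auto simp: vec_eq_iff)
    then have "a * (x $ i * y $ j - x $ j * y $ i) = 0" "b * (x $ i * y $ j - x $ j * y $ i) = 0"
      by algebra+
    then show "a = 0 \<and> b = 0" using d by simp
  qed
qed

lemma span2_change:
  fixes x y :: "complex ^ 'n"
  assumes "a * d - b * c \<noteq> 0"
  shows "vec.span {a *s x + b *s y, c *s x + d *s y} = vec.span {x, y}"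
    and "indep2 x y \<Longrightarrow> indep2 (a *s x + b *s y) (c *s x + d *s y)"
proof -
  let ?D = "a * d - b * c"
  have *: "k *s x + l *s y = ((k * d - l * c) / ?D) *s (a *s x + b *s y)
      + ((l * a - k * b) / ?D) *s (c *s x + d *s y)" for k l
  proof -
    have "((k * d - l * c) / ?D) * a + ((l * a - k * b) / ?D) * c = k"
      "((k * d - l * c) / ?D) * b + ((l * a - k * b) / ?D) * d = l"
    proof -
      have "(k * d - l * c) * a + (l * a - k * b) * c = k * ?D"
        "(k * d - l * c) * b + (l * a - k * b) * d = l * ?D" by algebra+
      then show "((k * d - l * c) / ?D) * a + ((l * a - k * b) / ?D) * c = k"
        "((k * d - l * c) / ?D) * b + ((l * a - k * b) / ?D) * d = l"
        using assms by (simp_all flip: add_divide_distrib)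
    qed
    moreover have "(m * a + n * c) *s x + (m * b + n * d) *s y
        = m *s (a *s x + b *s y) + n *s (c *s x + d *s y)" for m n
      by (simp add: vec_eq_iff algebra_simps)
    ultimately show ?thesis by metis
  qed
  have **: "k *s (a *s x + b *s y) + l *s (c *s x + d *s y) = (k * a + l * c) *s x + (k * b + l * d) *s y"
    for k l by (simp add: vec_eq_iff algebra_simps)
  show "vec.span {a *s x + b *s y, c *s x + d *s y} = vec.span {x, y}"
    unfolding span2 using * ** by (safe; metis)
  assume i: "indep2 x y"
  show "indep2 (a *s x + b *s y) (c *s x + d *s y)"
    unfolding indep2_def
  proof (intro allI impI)
    fix k l assume "k *s (a *s x + b *s y) + l *s (c *s x + d *s y) = 0"
    then have "(k * a + l * c) *s x + (k * b + l * d) *s y = 0" using **[of k l] by simp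
    then have e: "k * a + l * c = 0" "k * b + l * d = 0"
      using i unfolding indep2_def by blast+
    then have "k * ?D = 0" "l * ?D = 0" by algebra+
    then show "k = 0 \<and> l = 0" using assms by simp
  qed
qed

lemma indep2_span_eq:
  assumes "indep2 u v" "u \<in> vec.span {x, y}" "v \<in> vec.span {x, y}"
  shows "vec.span {u, v} = vec.span {x, y}" "indep2 x y"
proof -
  obtain a b c d where e: "u = a *s x + b *s y" "v = c *s x + d *s y"
    using assms(2,3) by (auto simp: span2)
  have "a * d - b * c \<noteq> 0"
  proof
    assume 0: "a * d - b * c = 0"
    have "d *s u + (-b) *s v = (a * d - b * c) *s x" "(-c) *s u + a *s v = (a * d - b * c) *s y"
      by (simp_all add: e vec_eq_iff algebra_simps)
    then have "d *s u + (-b) *s v = 0" "(-c) *s u + a *s v = 0" using 0 by simp_all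
    then have "d = 0 \<and> -b = 0" "-c = 0 \<and> a = 0"
      using assms(1) unfolding indep2_def by blast+
    then have "d = 0 \<and> b = 0 \<and> c = 0 \<and> a = 0" by simp
    then show False using e assms(1) indep2_nonzero[OF assms(1)] by simp
  qed
  then show s: "vec.span {u, v} = vec.span {x, y}" using span2_change(1) e by blast
  have "vec.dim (vec.span {x, y}) = 2" using dim_span2[OF assms(1)] s by simp
  then have c: "vec.dim {x, y} = 2" by simp
  show "indep2 x y"
  proof (cases "x = y")
    case True
    then have "vec.dim {x, y} \<le> 1" using vec.dim_le_card[of "{x}"] by (simp add: vec.dim_le_card')
    then show ?thesis using c by simp
  next
    case False
    then have "vec.independent {x, y}"
      using vec.card_le_dim_spanning[of "{x, y}" "vec.span {x, y}"] c
      by (simp add: vec.span_superset)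
    then show ?thesis using False by (simp add: indep2_alt)
  qed
qed

lemma norm_smult_complex: "norm (c *s x) = cmod c * norm x" for x :: "complex ^ 'n"
  unfolding norm_vec_def L2_set_def
  by (simp add: norm_mult power_mult_distrib real_sqrt_mult flip: sum_distrib_left)

text \<open>Every plane has a basis whose matrix has an identity block and entries of modulus at most 1:
  normalize at a minor of maximal modulus.\<close>

definition normalized_pairs :: "((complex ^ 'n) \<times> (complex ^ 'n)) set" where
  "normalized_pairs = (\<Union>i. \<Union>j. {(x, y). x $ i = 1 \<and> x $ j = 0 \<and> y $ i = 0 \<and> y $ j = 1 \<and>
     (\<forall>k. cmod (x $ k) \<le> 1 \<and> cmod (y $ k) \<le> 1)})"

lemma normalized_pairs_indep: "(x, y) \<in> normalized_pairs \<Longrightarrow> indep2 x y"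
proof -
  assume "(x, y) \<in> normalized_pairs"
  then obtain i j where "x $ i = 1" "x $ j = 0" "y $ i = 0" "y $ j = 1"
    unfolding normalized_pairs_def by blast
  then have "x $ i * y $ j - x $ j * y $ i \<noteq> 0" by simp
  then show ?thesis unfolding indep2_minor by blast
qed

lemma normalized_pair_exists:
  fixes x y :: "complex ^ 'n"
  assumes "indep2 x y"
  obtains u v where "(u, v) \<in> normalized_pairs" "vec.span {u, v} = vec.span {x, y}"
proof -
  define m where "m = (\<lambda>(i, j). cmod (x $ i * y $ j - x $ j * y $ i))"
  obtain ij where ij: "\<And>kl. m kl \<le> m ij"
  proof -
    have "Max (range m) \<in> range m" by (rule Max_in) auto
    then obtain ij where "m ij = Max (range m)" unfolding image_iff by metis
    then show ?thesis using Max_ge[of "range m"] that[of ij] by auto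
  qed
  obtain i j where ij': "ij = (i, j)" by fastforce
  define D where "D = x $ i * y $ j - x $ j * y $ i"
  have max: "cmod (x $ k * y $ l - x $ l * y $ k) \<le> cmod D" for k l
    using ij[of "(k, l)"] by (simp add: m_def D_def ij')
  obtain k l where "x $ k * y $ l - x $ l * y $ k \<noteq> 0" using assms by (auto simp: indep2_minor)
  then have D: "D \<noteq> 0" using max[of k l] by auto
  \<comment> \<open>The inverse of the 2x2 block with the maximal minor \<open>D\<close>, applied to
    the pair. All entries become quotients of minors by \<open>D\<close>.\<close>
  define u where "u = (y $ j / D) *s x + (- x $ j / D) *s y"
  define v where "v = (- y $ i / D) *s x + (x $ i / D) *s y"
  have det: "(y $ j / D) * (x $ i / D) - (- x $ j / D) * (- y $ i / D) \<noteq> 0"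
  proof -
    have "(y $ j / D) * (x $ i / D) - (- x $ j / D) * (- y $ i / D) = (y $ j * x $ i - x $ j * y $ i) / (D * D)"
      by (simp add: diff_divide_distrib)
    also have "y $ j * x $ i - x $ j * y $ i = D" by (simp add: D_def)
    finally show ?thesis using D by simp
  qed
  have uk: "u $ k = (x $ k * y $ j - x $ j * y $ k) / D" for k
    by (simp add: u_def diff_divide_distrib mult.commute)
  have vk: "v $ k = (x $ i * y $ k - x $ k * y $ i) / D" for k
    by (simp add: v_def diff_divide_distrib mult.commute)
  have "(u, v) \<in> normalized_pairs"
    unfolding normalized_pairs_def using D max
    by (intro UN_I[of i] UN_I[of j])
       (auto simp: uk vk norm_divide divide_le_eq D_def[symmetric])
  moreover have "vec.span {u, v} = vec.span {x, y}"
    unfolding u_def v_def by (rule span2_change(1)[OF det])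
  ultimately show ?thesis using that by blast
qed

lemma compact_normalized_pairs: "compact (normalized_pairs :: ((complex ^ 'n) \<times> (complex ^ 'n)) set)"
proof -
  have "compact {(x, y :: complex ^ 'n). x $ i = 1 \<and> x $ j = 0 \<and> y $ i = 0 \<and> y $ j = 1 \<and>
     (\<forall>k. cmod (x $ k) \<le> 1 \<and> cmod (y $ k) \<le> 1)}" (is "compact ?S") for i j :: 'n
  proof (rule compact_eq_bounded_closed[THEN iffD2], rule conjI)
    have "?S \<subseteq> cball 0 (real CARD('n)) \<times> cball 0 (real CARD('n))"
    proof
      fix p assume "p \<in> ?S"
      then obtain x y where p: "p = (x, y)" and n: "\<And>k. cmod (x $ k) \<le> 1" "\<And>k. cmod (y $ k) \<le> 1"
        by auto
      have "norm x \<le> (\<Sum>k\<in>UNIV. cmod (x $ k))" "norm y \<le> (\<Sum>k\<in>UNIV. cmod (y $ k))"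
        unfolding norm_vec_def by (rule L2_set_le_sum; simp)+
      moreover have "(\<Sum>k\<in>UNIV. cmod (x $ k)) \<le> (\<Sum>k\<in>(UNIV::'n set). 1)"
          "(\<Sum>k\<in>UNIV. cmod (y $ k)) \<le> (\<Sum>k\<in>(UNIV::'n set). 1)"
        by (intro sum_mono n)+
      ultimately show "p \<in> cball 0 (real CARD('n)) \<times> cball 0 (real CARD('n))"
        by (simp add: p)
    qed
    then show "bounded ?S"
      by (rule bounded_subset[OF bounded_Times[OF bounded_cball bounded_cball]])
    have "?S = {p. fst p $ i = 1} \<inter> {p. fst p $ j = 0} \<inter> {p. snd p $ i = 0} \<inter> {p. snd p $ j = 1} \<inter>
        (\<Inter>k. {p. cmod (fst p $ k) \<le> 1}) \<inter> (\<Inter>k. {p. cmod (snd p $ k) \<le> 1})"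
      by auto
    also have "closed \<dots>"
      by (intro closed_Int closed_INT ballI closed_Collect_eq closed_Collect_le continuous_intros)
    finally show "closed ?S" .
  qed
  then show ?thesis unfolding normalized_pairs_def by (intro compact_UN) auto
qed

text \<open>Sequential compactness of the Grassmannian of planes, expressed by bases. Normalization
  keeps the limit basis independent, because the identity block survives in the limit.\<close>

lemma normalized_pair_subsequence:
  fixes x y :: "nat \<Rightarrow> complex ^ 'n"
  assumes "\<And>n. indep2 (x n) (y n)"
  obtains r u v a b where "strict_mono (r :: nat \<Rightarrow> nat)" "u \<longlonglongrightarrow> a" "v \<longlonglongrightarrow> b" "indep2 a b"
    "\<And>n. indep2 (u n) (v n)" "\<And>n. vec.span {u n, v n} = vec.span {x (r n), y (r n)}"
proof -
  have "\<forall>n. \<exists>p. p \<in> normalized_pairs \<and> vec.span {fst p, snd p} = vec.span {x n, y n}"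
    by (metis assms fst_conv normalized_pair_exists snd_conv)
  then obtain p where p: "\<And>n. p n \<in> normalized_pairs"
      "\<And>n. vec.span {fst (p n), snd (p n)} = vec.span {x n, y n}" by metis
  obtain l r where l: "l \<in> normalized_pairs" and r: "strict_mono (r :: nat \<Rightarrow> nat)"
    and lim: "(p \<circ> r) \<longlonglongrightarrow> l"
    using compact_normalized_pairs[unfolded compact_def] p(1) by metis
  show ?thesis
  proof (rule that[OF r])
    show "(\<lambda>n. fst (p (r n))) \<longlonglongrightarrow> fst l" "(\<lambda>n. snd (p (r n))) \<longlonglongrightarrow> snd l"
      using tendsto_fst[OF lim] tendsto_snd[OF lim] by (simp_all add: o_def)
    show "indep2 (fst l) (snd l)" using l normalized_pairs_indep by (metis prod.collapse)
    show "indep2 (fst (p (r n))) (snd (p (r n)))" for n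
      using p(1)[of "r n"] normalized_pairs_indep by (metis prod.collapse)
  qed (simp add: p)
qed

section \<open>Functions of one complex variable\<close>

text \<open>The linear bound makes \<open>f\<close> bounded near each point of \<open>T\<close>, so
  Riemann's theorem removes the points one at a time.\<close>

lemma holomorphic_extend_finite:
  assumes "finite T" "f holomorphic_on (- T)" "\<And>t. t \<notin> T \<Longrightarrow> cmod (f t) \<le> C * (1 + cmod t)"
  shows "\<exists>g. g holomorphic_on UNIV \<and> (\<forall>t. t \<notin> T \<longrightarrow> g t = f t)"
proof -
  have ev: "eventually (\<lambda>z. z \<notin> T) (at a)" for a
    using islimpt_finite[OF assms(1)] by (simp add: islimpt_iff_eventually)
  have "\<exists>g. g holomorphic_on (- T') \<and> (\<forall>t. t \<notin> T \<longrightarrow> g t = f t)" if "T' \<subseteq> T" for T'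
  proof -
    have "finite (T - T')" using assms(1) by simp
    then show ?thesis using that
    proof (induction "T - T'" arbitrary: T' rule: finite_induct)
      case empty
      then have "T' = T" by auto
      then show ?case using assms(2) by blast
    next
      case (insert a U)
      have "U = T - insert a T'" using insert by auto
      moreover have "insert a T' \<subseteq> T" using insert by auto
      ultimately obtain g where g: "g holomorphic_on (- insert a T')" "\<And>t. t \<notin> T \<Longrightarrow> g t = f t"
        using insert(3) by blast
      have "a \<notin> T'" using insert by auto
      then have a: "a \<in> interior (- T')"
        using finite_subset[OF insert(5) assms(1)] by (simp add: interior_open finite_imp_closed open_Compl)
      have "eventually (\<lambda>t. cmod t \<le> cmod a + 1) (at a)"
        unfolding eventually_at
      proof (intro exI[of _ 1] conjI ballI impI)
        fix t :: complex assume "t \<noteq> a \<and> dist t a < 1"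
        then show "cmod t \<le> cmod a + 1" using norm_triangle_ineq2[of t a] by (simp add: dist_norm)
      qed simp
      then have "eventually (\<lambda>t. cmod (g t) \<le> \<bar>C\<bar> * (2 + cmod a)) (at a)"
        using ev[of a]
      proof eventually_elim
        case (elim t)
        have "cmod (g t) \<le> C * (1 + cmod t)" using g(2)[OF elim(2)] assms(3)[OF elim(2)] by simp
        also have "\<dots> \<le> \<bar>C\<bar> * (2 + cmod a)" using elim(1) by (intro mult_mono) auto
        finally show ?case .
      qed
      moreover have "- T' - {a} = - insert a T'" by auto
      ultimately obtain h where "h holomorphic_on (- T')" "\<And>z. z \<in> - T' - {a} \<Longrightarrow> h z = g z"
        using holomorphic_on_extend_bounded[of g "- T'" a] a g(1) by auto
      then show ?case using g(2) insert by (metis ComplI DiffI singletonD insert_subset insertCI subsetD \<open>insert a T' \<subseteq> T\<close>)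
    qed
  qed
  from this[of "{}"] show ?thesis by simp
qed

lemma affine_if_linear_growth:
  assumes "finite T" "f holomorphic_on (- T)" "\<And>t. t \<notin> T \<Longrightarrow> cmod (f t) \<le> C * (1 + cmod t)"
  obtains a b where "\<And>t. t \<notin> T \<Longrightarrow> f t = a + b * t"
proof -
  obtain g where g: "g holomorphic_on UNIV" "\<And>t. t \<notin> T \<Longrightarrow> g t = f t"
    using holomorphic_extend_finite[OF assms] by blast
  \<comment> \<open>Beyond radius \<open>A\<close> there are no points of \<open>T\<close>, and
    \<open>1 \<le> A\<close> turns \<open>1 + cmod z\<close> into at most \<open>2 * cmod z\<close>,
    the pure power needed for Liouville's theorem.\<close>
  define A where "A = 1 + (\<Sum>t\<in>T. cmod t)"
  have "cmod (g z) \<le> (2 * \<bar>C\<bar>) * cmod z ^ 1" if z: "A \<le> cmod z" for z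
  proof -
    have "z \<notin> T"
    proof
      assume "z \<in> T"
      then have "cmod z \<le> (\<Sum>t\<in>T. cmod t)" using assms(1) member_le_sum[of z T cmod] by simp
      then show False using z by (simp add: A_def)
    qed
    then have "cmod (g z) \<le> C * (1 + cmod z)" using g(2) assms(3) by simp
    also have "\<dots> \<le> \<bar>C\<bar> * (1 + cmod z)" by (intro mult_right_mono) auto
    also have "\<dots> \<le> \<bar>C\<bar> * (2 * cmod z)"
    proof (intro mult_left_mono)
      have "1 \<le> A" by (simp add: A_def sum_nonneg)
      then show "1 + cmod z \<le> 2 * cmod z" using z by simp
    qed simp
    finally show ?thesis by simp
  qed
  from Liouville_polynomial[OF g(1) this]
  have L: "g x = (\<Sum>k\<le>1. (deriv ^^ k) g 0 / fact k * x ^ k)" for x .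
  have "g x = g 0 + deriv g 0 * x" for x by (rule L[of x, THEN trans]) simp
  then show ?thesis using g(2) that by metis
qed

lemma constant_if_bounded:
  assumes "f holomorphic_on UNIV" "\<And>t. cmod (f t) \<le> C"
  shows "f t = f 0"
proof -
  have "bounded (range f)" using assms(2) by (auto simp: bounded_iff)
  then obtain c where "f x = c" for x using Liouville_theorem[OF assms(1)] by (auto simp: constant_on_def)
  then show ?thesis by simp
qed

text \<open>The small root of \<open>A + 2 B z + C z\<^sup>2\<close> near a point where A vanishes and B does not, in the
  form \<open>- A / (B + \<surd>(B\<^sup>2 - A C))\<close>, which has no pole where C vanishes.\<close>

lemma holomorphic_small_root:
  assumes U: "open U" "a \<in> U"
    and hol: "A holomorphic_on U" "B holomorphic_on U" "C holomorphic_on U"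
    and a: "A a = 0" "B a = 1"
  obtains V z where "open V" "a \<in> V" "V \<subseteq> U" "z holomorphic_on V" "z a = 0"
    "\<And>t. t \<in> V \<Longrightarrow> A t + 2 * B t * z t + C t * (z t)\<^sup>2 = (0 :: complex)"
proof -
  \<comment> \<open>\<open>D\<close> is 1 at \<open>a\<close>, so near \<open>a\<close> it avoids
    the branch cut of \<open>csqrt\<close>; the denominator \<open>E\<close> is 2 there.\<close>
  define D where "D t = (B t)\<^sup>2 - A t * C t" for t
  define W where "W = U \<inter> D -` (- \<real>\<^sub>\<le>\<^sub>0)"
  have Dh: "D holomorphic_on U" unfolding D_def by (intro holomorphic_intros hol)
  have W: "open W" unfolding W_def
    using continuous_on_open_vimage[OF U(1), of D] holomorphic_on_imp_continuous_on[OF Dh]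
      closed_nonpos_Reals_complex by (metis Int_commute open_Compl)
  have aW: "a \<in> W" using U a by (auto simp: W_def D_def)
  define E where "E t = B t + csqrt (D t)" for t
  have Eh: "E holomorphic_on W" unfolding E_def
    by (intro holomorphic_intros holomorphic_on_subset[OF hol(2)] holomorphic_on_subset[OF Dh])
       (auto simp: W_def)
  define V where "V = W \<inter> E -` (- {0})"
  have V: "open V" unfolding V_def
    using continuous_on_open_vimage[OF W, of E] holomorphic_on_imp_continuous_on[OF Eh]
    by (metis Int_commute open_Compl closed_singleton)
  define z where "z t = - A t / E t" for t
  show ?thesis
  proof (rule that[OF V])
    show "a \<in> V" using aW a by (auto simp: V_def E_def D_def)
    show "V \<subseteq> U" by (auto simp: V_def W_def)
    show "z holomorphic_on V" unfolding z_def
      by (intro holomorphic_intros holomorphic_on_subset[OF hol(1)] holomorphic_on_subset[OF Eh])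
         (auto simp: V_def W_def)
    show "z a = 0" by (simp add: z_def a)
    fix t assume "t \<in> V"
    then have E: "E t \<noteq> 0" by (auto simp: V_def)
    have "(E t - B t)\<^sup>2 = D t" by (simp add: E_def)
    then have e: "(E t - B t)\<^sup>2 = (B t)\<^sup>2 - A t * C t" by (simp add: D_def)
    have "z t * E t = - A t" using E by (simp add: z_def)
    then have "(A t + 2 * B t * z t + C t * (z t)\<^sup>2) * (E t)\<^sup>2 = 0" using e by algebra
    then show "A t + 2 * B t * z t + C t * (z t)\<^sup>2 = 0" using E by simp
  qed
qed

section \<open>Products in the Clifford algebra\<close>

definition bil :: "complex ^ 8 ^ 8 \<Rightarrow> complex ^ 8 \<Rightarrow> complex ^ 8 \<Rightarrow> complex" where
  "bil M \<xi> \<eta> = (\<Sum>i\<in>UNIV. \<Sum>j\<in>UNIV. M $ i $ j * \<xi> $ i * \<eta> $ j)"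

lemma bil_add_left: "bil M (\<xi> + \<xi>') \<eta> = bil M \<xi> \<eta> + bil M \<xi>' \<eta>"
  and bil_add_right: "bil M \<eta> (\<xi> + \<xi>') = bil M \<eta> \<xi> + bil M \<eta> \<xi>'"
  and bil_smult_left: "bil M (c *s \<xi>) \<eta> = c * bil M \<xi> \<eta>"
  and bil_smult_right: "bil M \<xi> (c *s \<eta>) = c * bil M \<xi> \<eta>"
  by (simp_all add: bil_def algebra_simps sum.distrib sum_distrib_left)

lemma bil_zero[simp]: "bil M 0 \<eta> = 0" "bil M \<xi> 0 = 0"
  by (simp_all add: bil_def)

lemma bil_minus[simp]: "bil M (- \<xi>) \<eta> = - bil M \<xi> \<eta>" "bil M \<xi> (- \<eta>) = - bil M \<xi> \<eta>"
  by (simp_all add: bil_def sum_negf)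

lemma bil_sum_left: "bil M (\<Sum>k\<in>K. f k) \<eta> = (\<Sum>k\<in>K. bil M (f k) \<eta>)"
  by (induction K rule: infinite_finite_induct) (simp_all add: bil_add_left)

lemma bil_sum_right: "bil M \<eta> (\<Sum>k\<in>K. f k) = (\<Sum>k\<in>K. bil M \<eta> (f k))"
  by (induction K rule: infinite_finite_induct) (simp_all add: bil_add_right)

lemma bil_commute: "transpose M = M \<Longrightarrow> bil M \<xi> \<eta> = bil M \<eta> \<xi>"
proof -
  assume a: "transpose M = M"
  have "M $ i $ j = M $ j $ i" for i j
  proof -
    have "M $ i $ j = transpose M $ j $ i" by (simp add: transpose_def)
    then show ?thesis by (simp only: a)
  qed
  then have "M $ i $ j * \<xi> $ i * \<eta> $ j = M $ j $ i * \<eta> $ j * \<xi> $ i" for i j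
    by (metis mult.assoc mult.commute)
  then show ?thesis
    unfolding bil_def by (subst (2) sum.swap, intro sum.cong refl)
qed

lemma qform_bil: "qform M \<xi> = bil M \<xi> \<xi>"
  by (simp add: qform_def bil_def)

lemma qform_add: "transpose M = M \<Longrightarrow> qform M (\<xi> + \<eta>) = qform M \<xi> + 2 * bil M \<xi> \<eta> + qform M \<eta>"
  using bil_commute[of M] by (simp add: qform_bil bil_add_left bil_add_right)

locale clifford =
  fixes M :: "complex ^ 8 ^ 8" and \<gamma> :: "complex ^ 8 \<Rightarrow> complex ^ 16 ^ 16"
  assumes sym: "transpose M = M" and spin: "spin_module M \<gamma>"
begin

definition cl :: "complex ^ 8 \<Rightarrow> complex ^ 16 \<Rightarrow> complex ^ 16" where "cl \<xi> s = \<gamma> \<xi> *v s"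

lemma cl_add: "cl (\<xi> + \<eta>) s = cl \<xi> s + cl \<eta> s"
  using spin by (simp add: cl_def spin_module_def matrix_vector_mult_add_rdistrib)

lemma cl_smult: "cl (c *s \<xi>) s = c *s cl \<xi> s"
  using spin by (simp add: cl_def spin_module_def)

lemma cl_right_add: "cl \<xi> (s + t) = cl \<xi> s + cl \<xi> t"
  by (simp add: cl_def matrix_vector_right_distrib)

lemma cl_right_smult: "cl \<xi> (c *s s) = c *s cl \<xi> s"
  by (simp add: cl_def vector_scalar_commute)

lemma cl_zero[simp]: "cl 0 s = 0" "cl \<xi> 0 = 0"
  using cl_smult[of 0 0 s] cl_right_smult[of \<xi> 0 0] by simp_all

lemma cl_right_minus: "cl \<xi> (- s) = - cl \<xi> s"
  using cl_right_smult[of \<xi> "-1" s] by simp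

lemma cl_sum: "cl (\<Sum>k\<in>K. f k) s = (\<Sum>k\<in>K. cl (f k) s)"
  by (induction K rule: infinite_finite_induct) (simp_all add: cl_add)

lemma cl_right_sum: "cl \<xi> (\<Sum>k\<in>K. f k) = (\<Sum>k\<in>K. cl \<xi> (f k))"
  by (induction K rule: infinite_finite_induct) (simp_all add: cl_right_add)

lemma cl_square: "cl \<xi> (cl \<xi> s) = qform M \<xi> *s s"
  using spin by (simp add: cl_def spin_module_def)

lemma cl_anticommute: "cl \<xi> (cl \<eta> s) + cl \<eta> (cl \<xi> s) = (2 * bil M \<xi> \<eta>) *s s"
proof -
  have "cl (\<xi> + \<eta>) (cl (\<xi> + \<eta>) s) = qform M (\<xi> + \<eta>) *s s" by (rule cl_square)
  then have "qform M \<xi> *s s + (cl \<xi> (cl \<eta> s) + cl \<eta> (cl \<xi> s)) + qform M \<eta> *s s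
      = (qform M \<xi> + 2 * bil M \<xi> \<eta> + qform M \<eta>) *s s"
    by (simp add: cl_add cl_right_add cl_square qform_add[OF sym] bil_commute[OF sym, of \<eta> \<xi>] add_ac)
  then have "(cl \<xi> (cl \<eta> s) + cl \<eta> (cl \<xi> s)) + (qform M \<xi> + qform M \<eta>) *s s
      = (2 * bil M \<xi> \<eta>) *s s + (qform M \<xi> + qform M \<eta>) *s s"
    by (simp add: vec.scale_left_distrib algebra_simps)
  then show ?thesis by (rule add_right_imp_eq)
qed

definition clprod :: "('i \<Rightarrow> complex ^ 8) \<Rightarrow> 'i list \<Rightarrow> complex ^ 16 \<Rightarrow> complex ^ 16" where
  "clprod f xs s = foldr (\<lambda>i. cl (f i)) xs s"

lemma clprod_simps[simp]:
  "clprod f [] s = s" "clprod f (x # xs) s = cl (f x) (clprod f xs s)"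
  by (simp_all add: clprod_def)

lemma clprod_append: "clprod f (xs @ ys) s = clprod f xs (clprod f ys s)"
  by (induction xs) auto

lemma clprod_minus: "clprod f xs (- s) = - clprod f xs s"
  by (induction xs) (auto simp: cl_right_minus)

lemma clprod_cong: "(\<And>x. x \<in> set xs \<Longrightarrow> f x = g x) \<Longrightarrow> clprod f xs s = clprod g xs s"
  by (induction xs) auto

lemma clprod_map: "clprod f (map h xs) s = clprod (\<lambda>i. f (h i)) xs s"
  by (induction xs) auto

text \<open>Multilinearity: there is one term for each choice of a summand in each factor. Since
  \<open>xs\<close> is distinct, the choices can be indexed by the elements of \<open>xs\<close>
  instead of positions.\<close>

lemma clprod_expand:
  fixes v :: "'j::finite \<Rightarrow> complex ^ 8"
  assumes "distinct xs"
  shows "clprod (\<lambda>i. \<Sum>j\<in>UNIV. Q i j *s v j) xs s =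
    (\<Sum>g\<in>Pi\<^sub>E (set xs) (\<lambda>_. UNIV). (\<Prod>i\<in>set xs. Q i (g i)) *s clprod (\<lambda>i. v (g i)) xs s)"
  using assms
proof (induction xs)
  case Nil
  then show ?case by simp
next
  case (Cons x xs)
  let ?P = "Pi\<^sub>E (set xs) (\<lambda>_. UNIV) :: ('a \<Rightarrow> 'j) set"
  have x: "x \<notin> set xs" using Cons by simp
  have "clprod (\<lambda>i. \<Sum>j\<in>UNIV. Q i j *s v j) (x # xs) s
      = (\<Sum>j\<in>UNIV. \<Sum>g\<in>?P. (Q x j * (\<Prod>i\<in>set xs. Q i (g i))) *s
           cl (v j) (clprod (\<lambda>i. v (g i)) xs s))"
    using Cons by (subst sum.swap) (simp add: cl_sum cl_right_sum cl_smult cl_right_smult vec.scale_sum_right mult.commute)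
  also have "\<dots> = (\<Sum>p\<in>UNIV \<times> ?P. (Q x (fst p) * (\<Prod>i\<in>set xs. Q i (snd p i))) *s
           cl (v (fst p)) (clprod (\<lambda>i. v (snd p i)) xs s))"
    by (simp add: sum.cartesian_product case_prod_unfold)
  also have "\<dots> = (\<Sum>g\<in>(\<lambda>(y, g). g(x := y)) ` (UNIV \<times> ?P).
       (\<Prod>i\<in>set (x # xs). Q i (g i)) *s clprod (\<lambda>i. v (g i)) (x # xs) s)"
    unfolding sum.reindex[OF inj_combinator[OF x, of "\<lambda>_. UNIV"]]
  proof (rule sum.cong[OF refl], goal_cases)
    case (1 p)
    have "(\<Prod>i\<in>set xs. Q i (((snd p)(x := fst p)) i)) = (\<Prod>i\<in>set xs. Q i (snd p i))"
      by (rule prod.cong) (use x in auto)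
    moreover have "clprod (\<lambda>i. v (((snd p)(x := fst p)) i)) xs s = clprod (\<lambda>i. v (snd p i)) xs s"
      by (rule clprod_cong) (use x in auto)
    ultimately show ?case using x by (simp add: case_prod_unfold)
  qed
  also have "(\<lambda>(y, g). g(x := y)) ` (UNIV \<times> ?P) = Pi\<^sub>E (set (x # xs)) (\<lambda>_. UNIV)"
    unfolding list.set PiE_insert_eq ..
  finally show ?case .
qed

lemma clprod_move:
  assumes "\<And>i. i \<in> set xs \<Longrightarrow> bil M \<xi> (v i) = 0"
  shows "cl \<xi> (clprod v xs s) = (-1) ^ length xs *s clprod v xs (cl \<xi> s)"
  using assms
proof (induction xs)
  case (Cons x xs)
  have "cl \<xi> (cl (v x) (clprod v xs s)) = - cl (v x) (cl \<xi> (clprod v xs s))"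
    using cl_anticommute[of \<xi> "v x"] Cons.prems by (simp add: eq_neg_iff_add_eq_0)
  then show ?case using Cons by (simp add: cl_right_smult flip: vec.scale_minus_left)
qed simp

text \<open>Interchanging two factors moves each of them once past the factors \<open>ms\<close> in
  between. The two signs from \<open>ms\<close> cancel, and one sign from interchanging the factors
  themselves is left.\<close>

lemma clprod_transpose:
  assumes orth: "\<And>i j. i \<noteq> j \<Longrightarrow> bil M (v i) (v j) = 0"
    and "distinct xs" "a \<in> set xs" "b \<in> set xs" "a \<noteq> b"
  shows "clprod (\<lambda>i. v (Transposition.transpose a b i)) xs s = - clprod v xs s"
proof -
  have main: "clprod (\<lambda>i. v (Transposition.transpose a b i)) (us @ a # ms @ b # ws) s = - clprod v (us @ a # ms @ b # ws) s"
    if d: "distinct (us @ a # ms @ b # ws)" for us ms ws a b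
  proof -
    let ?v = "\<lambda>i. v (Transposition.transpose a b i)"
    have e: "clprod ?v xs t = clprod v xs t" if "a \<notin> set xs" "b \<notin> set xs" for xs t
      by (rule clprod_cong) (metis that transpose_apply_other)
    have ob: "bil M (v b) (v i) = 0" and oa: "bil M (v a) (v i) = 0" if "i \<in> set ms" for i
      by (rule orth, use that d in auto)+
    have "clprod ?v (us @ a # ms @ b # ws) s
        = clprod v us (cl (v b) (clprod v ms (cl (v a) (clprod v ws s))))"
      using d by (simp add: clprod_append e)
    also have "cl (v b) (clprod v ms (cl (v a) (clprod v ws s)))
        = (-1) ^ length ms *s clprod v ms (cl (v b) (cl (v a) (clprod v ws s)))"
      by (rule clprod_move[OF ob])
    also have "cl (v b) (cl (v a) (clprod v ws s)) = - cl (v a) (cl (v b) (clprod v ws s))"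
      using cl_anticommute[of "v a" "v b"] orth[of a b] d by (simp add: eq_neg_iff_add_eq_0 add.commute)
    also have "(-1) ^ length ms *s clprod v ms (- cl (v a) (cl (v b) (clprod v ws s)))
        = - cl (v a) (clprod v ms (cl (v b) (clprod v ws s)))"
      by (simp add: clprod_minus clprod_move[OF oa])
    finally show ?thesis by (simp add: clprod_append clprod_minus)
  qed
  obtain us ys where 1: "xs = us @ a # ys" using assms(3) by (metis split_list)
  show ?thesis
  proof (cases "b \<in> set ys")
    case True
    then obtain ms ws where "ys = ms @ b # ws" by (metis split_list)
    then show ?thesis using main[of us a ms b ws] assms(2) 1 by simp
  next
    case False
    then have "b \<in> set us" using assms(4,5) 1 by auto
    then obtain vs ms where "us = vs @ b # ms" by (metis split_list)
    then show ?thesis using main[of vs b ms a ys] assms(2) 1 by (simp add: transpose_commute)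
  qed
qed

lemma clprod_permute:
  assumes orth: "\<And>i j :: 'i::finite. i \<noteq> j \<Longrightarrow> bil M (v i) (v j) = 0"
    and xs: "distinct xs" "set xs = UNIV" and p: "p permutes UNIV"
  shows "clprod (\<lambda>i. v (p i)) xs s = of_int (sign p) *s clprod v xs s"
  using p finite
proof (induction rule: permutes_induct)
  case id
  show ?case by simp
next
  case (swap a b p)
  have p': "bij p" using swap by (simp add: permutes_bij)
  have "clprod (\<lambda>i. v ((Transposition.transpose a b \<circ> p) i)) xs s = clprod (\<lambda>i. v (Transposition.transpose a b i)) (map p xs) s"
    by (simp add: clprod_map)
  also have "\<dots> = - clprod v (map p xs) s"
    by (rule clprod_transpose)
       (use orth xs p' swap in \<open>auto simp: distinct_map bij_is_inj bij_is_surj inj_on_subset[of p UNIV]\<close>)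
  also have "\<dots> = - (of_int (sign p) *s clprod v xs s)"
    using swap by (simp add: clprod_map)
  also have "\<dots> = of_int (sign (Transposition.transpose a b \<circ> p)) *s clprod v xs s"
    using swap by (simp add: sign_compose permutation_swap_id permutes_imp_permutation sign_swap_id)
  finally show ?case .
qed

text \<open>Antisymmetrization turns the base change into its determinant. After multilinear
  expansion, the sum over permutations gives each choice \<open>g\<close> the determinant of rows of
  \<open>transpose Q\<close> selected by \<open>g\<close>, which is zero unless \<open>g\<close> is
  a permutation. The remaining terms are all equal, because the determinant and the product both
  acquire the sign of \<open>g\<close>; their number cancels the factor
  \<open>1 / fact 8\<close>.\<close>

lemma volume_orthogonal:
  assumes orth: "\<And>i j. i \<noteq> j \<Longrightarrow> bil M (v i) (v j) = 0"
    and Q: "\<And>i. axis i 1 = (\<Sum>j\<in>UNIV. Q $ i $ j *s v j)"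
  shows "volume \<gamma> s = det Q *s clprod v (map of_nat [0..<8]) s"
proof -
  define L :: "8 list" where "L = map of_nat [0..<8]"
  have L: "distinct L" "set L = UNIV"
  proof -
    show d: "distinct L" by (simp add: L_def upt_rec)
    have "card (set L) = card (UNIV :: 8 set)" using distinct_card[OF d] by (simp add: L_def)
    then show "set L = UNIV" by (metis card_subset_eq finite subset_UNIV)
  qed
  let ?S = "{p. p permutes (UNIV :: 8 set)}"
  have "(\<Sum>p\<in>?S. of_int (sign p) *s foldr (\<lambda>i t. \<gamma> (axis (p (of_nat i)) 1) *v t) [0..<8] s)
      = (\<Sum>p\<in>?S. of_int (sign p) *s clprod (\<lambda>i. \<Sum>j\<in>UNIV. Q $ p i $ j *s v j) L s)"
  proof -
    have "cl \<xi> = (*v) (\<gamma> \<xi>)" for \<xi> by (rule ext) (simp add: cl_def)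
    then show ?thesis by (simp add: L_def clprod_def foldr_map o_def flip: Q)
  qed
  also have "\<dots> = (\<Sum>p\<in>?S. \<Sum>g\<in>UNIV. (of_int (sign p) * (\<Prod>i\<in>UNIV. Q $ p i $ g i)) *s clprod (\<lambda>i. v (g i)) L s)"
    unfolding clprod_expand[OF L(1)] L(2) by (simp add: vec.scale_sum_right)
  also have "\<dots> = (\<Sum>g\<in>UNIV. \<Sum>p\<in>?S. (of_int (sign p) * (\<Prod>i\<in>UNIV. Q $ p i $ g i)) *s clprod (\<lambda>i. v (g i)) L s)"
    by (rule sum.swap)
  also have "\<dots> = (\<Sum>g\<in>UNIV. (\<Sum>p\<in>?S. of_int (sign p) * (\<Prod>i\<in>UNIV. Q $ p i $ g i)) *s clprod (\<lambda>i. v (g i)) L s)"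
    by (simp add: vec.scale_sum_left)
  also have "\<dots> = (\<Sum>g\<in>UNIV. det (\<chi> i. transpose Q $ g i) *s clprod (\<lambda>i. v (g i)) L s)"
    unfolding det_def transpose_def vec_lambda_beta ..
  also have "\<dots> = (\<Sum>g\<in>?S. det (\<chi> i. transpose Q $ g i) *s clprod (\<lambda>i. v (g i)) L s)"
  proof (rule sum.mono_neutral_right)
    show "\<forall>g\<in>UNIV - ?S. det (\<chi> i. transpose Q $ g i) *s clprod (\<lambda>i. v (g i)) L s = 0"
    proof
      fix g :: "8 \<Rightarrow> 8" assume "g \<in> UNIV - ?S"
      have "\<not> inj g"
      proof
        assume i: "inj g"
        then have "bij_betw g UNIV UNIV" using finite_UNIV_inj_surj[of g] by (simp add: bij_betw_def)
        then have "g permutes UNIV" by (rule bij_imp_permutes) simp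
        then show False using \<open>g \<in> UNIV - ?S\<close> by simp
      qed
      then obtain i j where "i \<noteq> j" "g i = g j" by (auto simp: inj_def)
      then have "det (\<chi> i. transpose Q $ g i) = 0"
        by (intro det_identical_rows[of i j]) (auto simp: row_def)
      then show "det (\<chi> i. transpose Q $ g i) *s clprod (\<lambda>i. v (g i)) L s = 0" by simp
    qed
  qed auto
  also have "\<dots> = (\<Sum>g\<in>?S. det Q *s clprod v L s)"
  proof (rule sum.cong[OF refl])
    fix g :: "8 \<Rightarrow> 8" assume "g \<in> ?S"
    then have g: "g permutes UNIV" by simp
    have "(of_int (sign g) :: complex) * of_int (sign g) = 1"
      by (metis of_int_1 of_int_mult sign_idempotent)
    then have "(of_int (sign g) * det Q * of_int (sign g) :: complex) = det Q"
      by (metis mult.commute mult.left_commute mult_1)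
    moreover have "clprod (\<lambda>i. v (g i)) L s = of_int (sign g) *s clprod v L s"
      by (rule clprod_permute[OF _ L g]) (rule orth)
    ultimately show "det (\<chi> i. transpose Q $ g i) *s clprod (\<lambda>i. v (g i)) L s = det Q *s clprod v L s"
      unfolding det_permute_rows[OF g] by (simp add: det_transpose)
  qed
  also have "\<dots> = (fact 8 * det Q) *s clprod v L s"
  proof -
    have "(of_nat n :: complex ^ 16) * x = of_nat n *s x" for n x
      by (induction n) (simp_all add: distrib_right vec.scale_left_distrib)
    from this[of "fact 8"] show ?thesis by (simp add: card_permutations)
  qed
  finally show ?thesis unfolding volume_def L_def[symmetric] by simp
qed

end

section \<open>The spin module in coordinates\<close>

text \<open>Elements of the exterior square of a 4-dimensional space, with coordinates
  12, 13, 14, 34, 42, 23, act as antisymmetric matrices.\<close>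

definition skew :: "complex ^ 6 \<Rightarrow> complex ^ 4 \<Rightarrow> complex ^ 4" where
  "skew z y = (\<chi> i. if i = 1 then z$1 * y$2 + z$2 * y$3 + z$3 * y$4
     else if i = 2 then - z$1 * y$1 + z$6 * y$3 - z$5 * y$4
     else if i = 3 then - z$2 * y$1 - z$6 * y$2 + z$4 * y$4
     else - z$3 * y$1 + z$5 * y$2 - z$4 * y$3)"

lemma skew_nth[simp]:
  "skew z y $ 1 = z$1 * y$2 + z$2 * y$3 + z$3 * y$4"
  "skew z y $ 2 = - z$1 * y$1 + z$6 * y$3 - z$5 * y$4"
  "skew z y $ 3 = - z$2 * y$1 - z$6 * y$2 + z$4 * y$4"
  "skew z y $ 4 = - z$3 * y$1 + z$5 * y$2 - z$4 * y$3"
  by (simp_all add: skew_def)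

definition vec6 :: "complex \<Rightarrow> complex \<Rightarrow> complex \<Rightarrow> complex \<Rightarrow> complex \<Rightarrow> complex \<Rightarrow> complex ^ 6" where
  "vec6 a b c d e f = (\<chi> i. if i = 1 then a else if i = 2 then b else if i = 3 then c
     else if i = 4 then d else if i = 5 then e else f)"

lemma vec6_nth[simp]:
  "vec6 a b c d e f $ 1 = a" "vec6 a b c d e f $ 2 = b" "vec6 a b c d e f $ 3 = c"
  "vec6 a b c d e f $ 4 = d" "vec6 a b c d e f $ 5 = e" "vec6 a b c d e f $ 6 = f"
  by (simp_all add: vec6_def)

definition vec4 :: "complex \<Rightarrow> complex \<Rightarrow> complex \<Rightarrow> complex \<Rightarrow> complex ^ 4" where
  "vec4 a b c d = (\<chi> i. if i = 1 then a else if i = 2 then b else if i = 3 then c else d)"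

lemma vec4_nth[simp]:
  "vec4 a b c d $ 1 = a" "vec4 a b c d $ 2 = b" "vec4 a b c d $ 3 = c" "vec4 a b c d $ 4 = d"
  by (simp_all add: vec4_def)

text \<open>The Hodge star: in the order 12, 13, 14, 34, 42, 23 complementary index pairs are three
  places apart, so the star exchanges the two halves and the Pfaffian \<open>pf\<close> has no
  signs.\<close>

definition dual6 :: "complex ^ 6 \<Rightarrow> complex ^ 6" where
  "dual6 z = vec6 (z$4) (z$5) (z$6) (z$1) (z$2) (z$3)"

definition pf :: "complex ^ 6 \<Rightarrow> complex" where
  "pf z = z$1 * z$4 + z$2 * z$5 + z$3 * z$6"

lemma exhaust_6: fixes x :: 6
  shows "x = 1 \<or> x = 2 \<or> x = 3 \<or> x = 4 \<or> x = 5 \<or> x = 6"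
proof (induct x)
  case (of_int z)
  then have "0 \<le> z" and "z < 6" by simp_all
  then have "z = 0 \<or> z = 1 \<or> z = 2 \<or> z = 3 \<or> z = 4 \<or> z = 5" by arith
  then show ?case by auto
qed

lemma exhaust_8: fixes x :: 8
  shows "x = 0 \<or> x = 1 \<or> x = 2 \<or> x = 3 \<or> x = 4 \<or> x = 5 \<or> x = 6 \<or> x = 7"
proof (induct x)
  case (of_int z)
  then have "0 \<le> z" and "z < 8" by simp_all
  then have "z = 0 \<or> z = 1 \<or> z = 2 \<or> z = 3 \<or> z = 4 \<or> z = 5 \<or> z = 6 \<or> z = 7" by arith
  then show ?case by auto
qed

lemma exhaust_16: fixes x :: 16
  shows "x = 1 \<or> x = 2 \<or> x = 3 \<or> x = 4 \<or> x = 5 \<or> x = 6 \<or> x = 7 \<or> x = 8 \<or>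
    x = 9 \<or> x = 10 \<or> x = 11 \<or> x = 12 \<or> x = 13 \<or> x = 14 \<or> x = 15 \<or> x = 16"
proof (induct x)
  case (of_int z)
  then have "0 \<le> z" and "z < 16" by simp_all
  then have "z = 0 \<or> z = 1 \<or> z = 2 \<or> z = 3 \<or> z = 4 \<or> z = 5 \<or> z = 6 \<or> z = 7 \<or>
    z = 8 \<or> z = 9 \<or> z = 10 \<or> z = 11 \<or> z = 12 \<or> z = 13 \<or> z = 14 \<or> z = 15" by arith
  then show ?case by auto
qed

lemma forall_6: "(\<forall>i::6. P i) \<longleftrightarrow> P 1 \<and> P 2 \<and> P 3 \<and> P 4 \<and> P 5 \<and> P 6"
  by (metis exhaust_6)

lemma forall_8: "(\<forall>i::8. P i) \<longleftrightarrow> P 0 \<and> P 1 \<and> P 2 \<and> P 3 \<and> P 4 \<and> P 5 \<and> P 6 \<and> P 7"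
  by (metis exhaust_8)

lemma UNIV_8: "UNIV = {0, 1, 2, 3, 4, 5, 6, 7 :: 8}"
  using exhaust_8 by blast

lemma sum_8: "sum f (UNIV :: 8 set) = f 0 + f 1 + f 2 + f 3 + f 4 + f 5 + f 6 + f 7"
  unfolding UNIV_8 by (simp add: ac_simps)

section \<open>Creation and annihilation operators on a 16-dimensional space\<close>

locale fock =
  fixes A B :: "4 \<Rightarrow> complex ^ 16 \<Rightarrow> complex ^ 16"
  assumes A_add: "A i (u + v) = A i u + A i v" and A_smult: "A i (c *s u) = c *s A i u"
    and B_add: "B i (u + v) = B i u + B i v" and B_smult: "B i (c *s u) = c *s B i u"
    and AA: "A i (A j u) = - A j (A i u)" and BB: "B i (B j u) = - B j (B i u)"
    and AB: "i \<noteq> j \<Longrightarrow> B i (A j u) = - A j (B i u)"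
    and ABi: "B i (A i u) = u - A i (B i u)"
begin

lemma zero[simp]: "A i 0 = 0" "B i 0 = 0"
  using A_smult[of i 0 0] B_smult[of i 0 0] by simp_all

lemma minus: "A i (- u) = - A i u" "B i (- u) = - B i u"
  using A_smult[of i "-1" u] B_smult[of i "-1" u] by simp_all

lemma diff: "A i (u - v) = A i u - A i v" "B i (u - v) = B i u - B i v"
  using A_add[of i u "-v"] B_add[of i u "-v"] by (simp_all add: minus)

lemma square[simp]: "A i (A i u) = 0" "B i (B i u) = 0"
  using AA[of i i u] BB[of i i u] by (simp_all add: eq_neg_iff_add_eq_0 vec_eq_iff)

text \<open>If a vector killed by some of the \<open>B\<close> is not killed by the next one, apply
  that one to it: it squares to zero and anticommutes with the others.\<close>

lemma vacuum_exists: "\<exists>Om. Om \<noteq> 0 \<and> (\<forall>i. B i Om = 0)"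
proof -
  have step: "\<exists>x. x \<noteq> 0 \<and> (\<forall>i\<in>insert j I. B i x = 0)" if "x \<noteq> 0" "\<forall>i\<in>I. B i x = 0" for j I x
  proof (cases "B j x = 0")
    case True
    then show ?thesis using that by blast
  next
    case False
    then show ?thesis using that BB[of _ j x] by (intro exI[of _ "B j x"]) (auto simp: BB[of _ j x])
  qed
  obtain x :: "complex ^ 16" where "x \<noteq> 0" using zero_neq_one by blast
  have "\<exists>x. x \<noteq> 0 \<and> (\<forall>i\<in>I. B i x = 0)" if "finite I" for I
    using that
  proof (induction I)
    case empty
    then show ?case using \<open>x \<noteq> 0\<close> by auto
  next
    case (insert j I)
    then show ?case using step by metis
  qed
  from this[of UNIV] show ?thesis by auto
qed

end

locale fock_vacuum = fock +
  fixes Om :: "complex ^ 16"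
  assumes Om: "Om \<noteq> 0" "B i Om = 0"
begin

text \<open>The even part of the exterior algebra. The sign at \<open>z$5\<close> is there because
  this coordinate belongs to the index pair 42, not 24.\<close>

definition ev :: "complex \<Rightarrow> complex ^ 6 \<Rightarrow> complex \<Rightarrow> complex ^ 16" where
  "ev s z t = s *s Om + (z$1 *s A 1 (A 2 Om) + z$2 *s A 1 (A 3 Om) + z$3 *s A 1 (A 4 Om)
     + z$4 *s A 3 (A 4 Om) + (- z$5) *s A 2 (A 4 Om) + z$6 *s A 2 (A 3 Om)) + t *s A 1 (A 2 (A 3 (A 4 Om)))"

text \<open>The cubic terms with their signs are the results of applying \<open>B 1\<close>, ...,
  \<open>B 4\<close> to the top vector \<open>A 1 (A 2 (A 3 (A 4 Om)))\<close>.\<close>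

definition od :: "complex ^ 4 \<Rightarrow> complex ^ 4 \<Rightarrow> complex ^ 16" where
  "od c d = (c$1 *s A 1 Om + c$2 *s A 2 Om + c$3 *s A 3 Om + c$4 *s A 4 Om) +
     (d$1 *s A 2 (A 3 (A 4 Om)) - d$2 *s A 1 (A 3 (A 4 Om)) + d$3 *s A 1 (A 2 (A 4 Om))
      - d$4 *s A 1 (A 2 (A 3 Om)))"

definition act :: "complex ^ 4 \<Rightarrow> complex ^ 4 \<Rightarrow> complex ^ 16 \<Rightarrow> complex ^ 16" where
  "act x w u = (\<Sum>i\<in>UNIV. x$i *s A i u + w$i *s B i u)"

lemma order:
  "A 2 (A 1 u) = - A 1 (A 2 u)" "A 3 (A 1 u) = - A 1 (A 3 u)" "A 4 (A 1 u) = - A 1 (A 4 u)"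
  "A 3 (A 2 u) = - A 2 (A 3 u)" "A 4 (A 2 u) = - A 2 (A 4 u)" "A 4 (A 3 u) = - A 3 (A 4 u)"
  by (rule AA)+

lemmas normal_order = order AB ABi Om(2) A_add A_smult B_add B_smult minus diff

lemma act_ev: "act x w (ev s z t) = od (s *s x - skew z w) (t *s w + skew (dual6 z) x)"
  unfolding act_def sum_4 ev_def od_def
  by (simp add: normal_order dual6_def vec.scale_right_distrib vec.scale_right_diff_distrib vec.scale_scale)
     (simp add: vec_eq_iff algebra_simps)

lemma independent:
  assumes "ev s z t + od c d = 0"
  shows "s = 0" "z = 0" "t = 0" "c = 0" "d = 0"
proof -
  note u = assms[unfolded ev_def od_def]
  \<comment> \<open>Each word annihilates all but one of the sixteen basis vectors and sends that
    one to a multiple of \<open>Om\<close>: \<open>B i\<close> followed after \<open>A i\<close>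
    projects to the states without particle i, and \<open>B i\<close> alone selects the states with
    it.\<close>
  have e: "B 1 (A 1 (B 2 (A 2 (B 3 (A 3 (B 4 (A 4 v))))))) = 0"
     "B 2 (B 1 (B 3 (A 3 (B 4 (A 4 v))))) = 0" "B 3 (B 1 (B 2 (A 2 (B 4 (A 4 v))))) = 0"
     "B 4 (B 1 (B 2 (A 2 (B 3 (A 3 v))))) = 0" "B 4 (B 3 (B 1 (A 1 (B 2 (A 2 v))))) = 0"
     "B 4 (B 2 (B 1 (A 1 (B 3 (A 3 v))))) = 0" "B 3 (B 2 (B 1 (A 1 (B 4 (A 4 v))))) = 0"
     "B 4 (B 3 (B 2 (B 1 v))) = 0"
     "B 1 (B 2 (A 2 (B 3 (A 3 (B 4 (A 4 v)))))) = 0" "B 2 (B 1 (A 1 (B 3 (A 3 (B 4 (A 4 v)))))) = 0"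
     "B 3 (B 1 (A 1 (B 2 (A 2 (B 4 (A 4 v)))))) = 0" "B 4 (B 1 (A 1 (B 2 (A 2 (B 3 (A 3 v)))))) = 0"
     "B 4 (B 3 (B 2 (B 1 (A 1 v)))) = 0" "B 4 (B 3 (B 1 (B 2 (A 2 v)))) = 0"
     "B 4 (B 2 (B 1 (B 3 (A 3 v)))) = 0" "B 3 (B 2 (B 1 (B 4 (A 4 v)))) = 0"
     if "v = 0" for v by (simp_all add: that)
  note E = e[OF u]
  show "s = 0" using E(1) by (simp add: normal_order Om(1))
  show "t = 0" using E(8) by (simp add: normal_order Om(1))
  show "z = 0" using E(2-7) by (simp add: vec_eq_iff[where 'b = 6] forall_6 normal_order Om(1))
  show "c = 0" using E(9-12) by (simp add: vec_eq_iff[where 'b = 4] forall_4 normal_order Om(1))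
  show "d = 0" using E(13-16) by (simp add: vec_eq_iff[where 'b = 4] forall_4 normal_order Om(1))
qed

lemma ev_linear: "ev (s + s') (z + z') (t + t') = ev s z t + ev s' z' t'"
    "ev (c * s) (c *s z) (c * t) = c *s ev s z t"
  unfolding ev_def by (simp_all add: vec_eq_iff algebra_simps)

lemma od_linear: "od (c + c') (d + d') = od c d + od c' d'" "od (k *s c) (k *s d) = k *s od c d"
  unfolding od_def by (simp_all add: vec_eq_iff algebra_simps)

lemma od_eq_0: "od c d = 0 \<longleftrightarrow> c = 0 \<and> d = 0"
  using independent(4,5)[of 0 0 0 c d] by (auto simp: ev_def od_def)

lemma ev_eq_0: "ev s z t = 0 \<longleftrightarrow> s = 0 \<and> z = 0 \<and> t = 0"
  using independent(1-3)[of s z t 0 0] by (auto simp: ev_def od_def)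

text \<open>Sixteen independent vectors in a space of dimension 16.\<close>

lemma ev_od_surj: "\<exists>s z t c d. u = ev s z t + od c d"
proof -
  define T where "T v = ev (v$1) (vec6 (v$2) (v$3) (v$4) (v$5) (v$6) (v$7)) (v$8)
    + od (vec4 (v$9) (v$10) (v$11) (v$12)) (vec4 (v$13) (v$14) (v$15) (v$16))" for v :: "complex ^ 16"
  have add: "T (x + y) = T x + T y" for x y
  proof -
    have "vec6 (a + a') (b + b') (c + c') (d + d') (e + e') (f + f')
        = vec6 a b c d e f + vec6 a' b' c' d' e' f'" for a a' b b' c c' d d' e e' f f'
      by (simp add: vec_eq_iff forall_6)
    moreover have "vec4 (a + a') (b + b') (c + c') (d + d') = vec4 a b c d + vec4 a' b' c' d'" for a a' b b' c c' d d'
      by (simp add: vec_eq_iff forall_4)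
    ultimately show ?thesis by (simp add: T_def ev_linear od_linear)
  qed
  have smult: "T (k *s x) = k *s T x" for k x
  proof -
    have "vec6 (k * a) (k * b) (k * c) (k * d) (k * e) (k * f) = k *s vec6 a b c d e f" for a b c d e f
      by (simp add: vec_eq_iff forall_6)
    moreover have "vec4 (k * a) (k * b) (k * c) (k * d) = k *s vec4 a b c d" for a b c d
      by (simp add: vec_eq_iff forall_4)
    ultimately show ?thesis by (simp add: T_def ev_linear od_linear vec.scale_right_distrib)
  qed
  have lin: "Vector_Spaces.linear (*s) (*s) T"
    unfolding Vector_Spaces.linear_iff using add smult vec.vector_space_axioms by auto
  have "inj T"
  proof (rule injI)
    fix x y assume "T x = T y"
    then have "T (x + (-1) *s y) = 0" unfolding add smult by simp
    then have "T (x - y) = 0" by simp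
    moreover define d where "d = x - y"
    ultimately have 0: "T d = 0" by simp
    note ind = independent[OF 0[unfolded T_def]]
    have "d $ 1 = 0" "d $ 8 = 0" by (rule ind)+
    moreover have "d $ 2 = 0" "d $ 3 = 0" "d $ 4 = 0" "d $ 5 = 0" "d $ 6 = 0" "d $ 7 = 0"
      using arg_cong[OF ind(2), of "\<lambda>v. v $ 1"] arg_cong[OF ind(2), of "\<lambda>v. v $ 2"]
        arg_cong[OF ind(2), of "\<lambda>v. v $ 3"] arg_cong[OF ind(2), of "\<lambda>v. v $ 4"]
        arg_cong[OF ind(2), of "\<lambda>v. v $ 5"] arg_cong[OF ind(2), of "\<lambda>v. v $ 6"] by simp_all
    moreover have "d $ 9 = 0" "d $ 10 = 0" "d $ 11 = 0" "d $ 12 = 0"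
      using arg_cong[OF ind(4), of "\<lambda>v. v $ 1"] arg_cong[OF ind(4), of "\<lambda>v. v $ 2"]
        arg_cong[OF ind(4), of "\<lambda>v. v $ 3"] arg_cong[OF ind(4), of "\<lambda>v. v $ 4"] by simp_all
    moreover have "d $ 13 = 0" "d $ 14 = 0" "d $ 15 = 0" "d $ 16 = 0"
      using arg_cong[OF ind(5), of "\<lambda>v. v $ 1"] arg_cong[OF ind(5), of "\<lambda>v. v $ 2"]
        arg_cong[OF ind(5), of "\<lambda>v. v $ 3"] arg_cong[OF ind(5), of "\<lambda>v. v $ 4"] by simp_all
    ultimately have "d $ i = 0" for i
      using exhaust_16[of i] by (elim disjE) simp_all
    then have "d = 0" by (simp add: vec_eq_iff)
    then show "x = y" by (simp add: d_def)
  qed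
  then obtain v where "u = T v" using vec.linear_inj_imp_surj[OF lin] by (metis surjD)
  then show ?thesis unfolding T_def by blast
qed

text \<open>Each factor is 1 on states which contain the particle and -1 on the others. As there are
  four factors, the product is the parity of the number of particles.\<close>

definition chir :: "complex ^ 16 \<Rightarrow> complex ^ 16" where
  "chir u = (let N = \<lambda>i u. A i (B i u) - B i (A i u) in N 1 (N 2 (N 3 (N 4 u))))"

lemma chir_add: "chir (u + v) = chir u + chir v"
  by (simp add: chir_def Let_def A_add B_add diff)

lemma chir_ev: "chir (ev s z t) = ev s z t"
  unfolding chir_def Let_def ev_def
  by (simp add: normal_order)

lemma chir_od: "chir (od c d) = - od c d"
  unfolding chir_def Let_def od_def
  by (simp add: normal_order)

lemma chir_fixed: "chir u = u \<longleftrightarrow> (\<exists>s z t. u = ev s z t)"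
proof
  assume "chir u = u"
  obtain s z t c d where u: "u = ev s z t + od c d" using ev_od_surj by blast
  have "ev s z t - od c d = ev s z t + od c d"
    using \<open>chir u = u\<close> by (simp add: u chir_add chir_ev chir_od)
  then have "od c d = 0" by (simp add: vec_eq_iff)
  then show "\<exists>s z t. u = ev s z t" using u by auto
qed (auto simp: chir_ev)

end

text \<open>For an orthonormal family the factor \<open>1/2\<close> makes the bilinear form of
  \<open>hypb v j\<close> and \<open>hypa v j\<close> equal to 1/2. Their Clifford anticommutator is
  then 1, and the quadratic form of \<open>kap v x w\<close> is the sum of the products of
  coordinates.\<close>

definition hypa :: "(8 \<Rightarrow> complex ^ 8) \<Rightarrow> 4 \<Rightarrow> complex ^ 8" where
  "hypa v j = (1/2) *s (if j = 1 then v 0 + \<i> *s v 1 else if j = 2 then v 2 + \<i> *s v 3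
     else if j = 3 then v 4 + \<i> *s v 5 else v 6 + \<i> *s v 7)"

definition hypb :: "(8 \<Rightarrow> complex ^ 8) \<Rightarrow> 4 \<Rightarrow> complex ^ 8" where
  "hypb v j = (1/2) *s (if j = 1 then v 0 - \<i> *s v 1 else if j = 2 then v 2 - \<i> *s v 3
     else if j = 3 then v 4 - \<i> *s v 5 else v 6 - \<i> *s v 7)"

definition kap :: "(8 \<Rightarrow> complex ^ 8) \<Rightarrow> complex ^ 4 \<Rightarrow> complex ^ 4 \<Rightarrow> complex ^ 8" where
  "kap v x w = (\<Sum>j\<in>UNIV. x$j *s hypa v j + w$j *s hypb v j)"

text \<open>The coordinates are kept abstract because the same properties hold again after a
  relabelling of the hyperbolic basis. In this way whatever is proved for the chart with nonzero
  first coordinate is available for all charts.\<close>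

locale spin_model =
  fixes \<gamma> :: "complex ^ 8 \<Rightarrow> complex ^ 16 ^ 16" and y0 :: complex
    and kp :: "complex ^ 4 \<Rightarrow> complex ^ 4 \<Rightarrow> complex ^ 8"
    and io :: "complex \<Rightarrow> complex ^ 6 \<Rightarrow> complex \<Rightarrow> complex ^ 16"
  assumes kp_add: "kp (x + x') (w + w') = kp x w + kp x' w'"
    and kp_smult: "kp (c *s x) (c *s w) = c *s kp x w"
    and kp_eq_0: "kp x w = 0 \<longleftrightarrow> x = 0 \<and> w = 0"
    and kp_surj: "\<exists>x w. \<xi> = kp x w"
    and io_add: "io (s + s') (z + z') (t + t') = io s z t + io s' z' t'"
    and io_smult: "io (c * s) (c *s z) (c * t) = c *s io s z t"
    and io_eq_0: "io s z t = 0 \<longleftrightarrow> s = 0 \<and> z = 0 \<and> t = 0"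
    and io_range: "u \<in> half_spin \<gamma> y0 \<longleftrightarrow> (\<exists>s z t. u = io s z t)"
    and rel: "\<gamma> (kp x w) *v io s z t = 0 \<longleftrightarrow> s *s x = skew z w \<and> t *s w = - skew (dual6 z) x"

text \<open>The two vectors of a pair multiply to \<open>\<i>\<close> times the operator
  \<open>A j B j - B j A j\<close>, and the fourth power of \<open>\<i>\<close> is 1, so the ordered
  product of the basis is \<open>chir\<close>. The hypothesis on \<open>y0\<close> makes the base
  change determinant \<open>det Q\<close> equal to \<open>y0\<close>. Hence the eigenspace of
  \<open>volume\<close> for \<open>y0\<close> is the even part.\<close>

lemma (in clifford) spin_model_exists:
  assumes orth: "\<And>i j. bil M (v i) (v j) = (if i = j then 1 else 0)"
    and y0: "y0 * det (\<chi> i. v i) = 1"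
  shows "\<exists>io. spin_model \<gamma> y0 (kap v) io"
proof -
  define A where "A j u = cl (hypa v j) u" for j u
  define B where "B j u = cl (hypb v j) u" for j u
  note bs = bil_add_left bil_add_right bil_smult_left bil_smult_right orth
  have bil_diff: "bil M (x - x') z = bil M x z - bil M x' z" "bil M z (x - x') = bil M z x - bil M z x'" for x x' z
    using bil_add_left[of M x "- x'" z] bil_add_right[of M z x "- x'"] by simp_all
  have aa: "bil M (hypa v i) (hypa v j) = 0" and bb: "bil M (hypb v i) (hypb v j) = 0"
    and ab: "bil M (hypb v i) (hypa v j) = (if i = j then 1/2 else 0)" for i j
    unfolding hypa_def hypb_def using exhaust_4[of i] exhaust_4[of j]
    by (elim disjE; simp add: bs bil_diff)+
  interpret fock A B
  proof
    fix i j :: 4 and u w :: "complex ^ 16" and c :: complex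
    show "A i (u + w) = A i u + A i w" "A i (c *s u) = c *s A i u"
      "B i (u + w) = B i u + B i w" "B i (c *s u) = c *s B i u"
      by (simp_all add: A_def B_def cl_right_add cl_right_smult)
    show "A i (A j u) = - A j (A i u)" using cl_anticommute[of "hypa v i" "hypa v j" u]
      by (simp add: A_def aa eq_neg_iff_add_eq_0)
    show "B i (B j u) = - B j (B i u)" using cl_anticommute[of "hypb v i" "hypb v j" u]
      by (simp add: B_def bb eq_neg_iff_add_eq_0)
    show "B i (A j u) = - A j (B i u)" if "i \<noteq> j"
      using cl_anticommute[of "hypb v i" "hypa v j" u] that
      by (simp add: A_def B_def ab eq_neg_iff_add_eq_0)
    show "B i (A i u) = u - A i (B i u)"
      using cl_anticommute[of "hypb v i" "hypa v i" u]
      by (simp add: A_def B_def ab algebra_simps)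
  qed
  obtain Om where "Om \<noteq> 0" "\<And>i. B i Om = 0" using vacuum_exists by blast
  then interpret fock_vacuum A B Om by unfold_locales
  have act: "cl (kap v x w) u = act x w u" for x w u
    by (simp add: kap_def act_def cl_sum cl_add cl_smult A_def B_def)
  have v: "v 0 = hypa v 1 + hypb v 1" "v 1 = (- \<i>) *s hypa v 1 + \<i> *s hypb v 1"
    "v 2 = hypa v 2 + hypb v 2" "v 3 = (- \<i>) *s hypa v 2 + \<i> *s hypb v 2"
    "v 4 = hypa v 3 + hypb v 3" "v 5 = (- \<i>) *s hypa v 3 + \<i> *s hypb v 3"
    "v 6 = hypa v 4 + hypb v 4" "v 7 = (- \<i>) *s hypa v 4 + \<i> *s hypb v 4"
    by (simp_all add: hypa_def hypb_def vec_eq_iff field_simps)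
  have pair: "cl (hypa v j + hypb v j) (cl ((- \<i>) *s hypa v j + \<i> *s hypb v j) u)
      = \<i> *s (A j (B j u) - B j (A j u))" for j u
    unfolding cl_add cl_smult A_def[symmetric] B_def[symmetric] A_add B_add A_smult B_smult square
    by (simp add: vec_eq_iff algebra_simps)
  have L: "map of_nat [0..<8] = [0, 1, 2, 3, 4, 5, 6, 7 :: 8]" by (simp add: upt_rec)
  define N where "N j u = A j (B j u) - B j (A j u)" for j u
  have Ns: "N j (c *s u) = c *s N j u" for j c u
    by (simp add: N_def A_smult B_smult vec.scale_right_diff_distrib)
  have prod: "clprod v (map of_nat [0..<8]) u = chir u" for u
  proof -
    have "clprod v (map of_nat [0..<8]) u = \<i> *s N 1 (\<i> *s N 2 (\<i> *s N 3 (\<i> *s N 4 u)))"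
      unfolding L clprod_simps unfolding v pair N_def[symmetric] ..
    also have "\<dots> = (\<i> * \<i> * \<i> * \<i>) *s N 1 (N 2 (N 3 (N 4 u)))"
      by (simp only: Ns vec.scale_scale mult.assoc)
    also have "\<dots> = chir u" by (simp add: chir_def N_def Let_def)
    finally show ?thesis .
  qed
  define V where "V = (\<chi> i. v i)"
  have dV: "det V \<noteq> 0" using y0 by (auto simp: V_def)
  then obtain Q where Q: "Q ** V = mat 1" "V ** Q = mat 1"
    using invertible_det_nz[of V] by (auto simp: invertible_def)
  have "axis i 1 = (\<Sum>j\<in>UNIV. Q $ i $ j *s v j)" for i
  proof -
    have "(Q ** V) $ i $ k = (\<Sum>j\<in>UNIV. Q $ i $ j *s v j) $ k" for k
      by (simp add: matrix_matrix_mult_def V_def sum_component)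
    moreover have "(axis i 1 :: complex ^ 8) $ k = (Q ** V) $ i $ k" for k
      by (simp add: Q mat_def axis_def)
    ultimately show ?thesis unfolding vec_eq_iff by metis
  qed
  then have vol: "volume \<gamma> s = det Q *s chir s" for s
    using volume_orthogonal[of v Q s] orth by (simp add: prod)
  have "det Q * det V = 1" using Q(1) by (metis det_I det_mul)
  then have "det Q = y0" using y0 dV unfolding V_def[symmetric] by (metis mult_cancel_right)
  then have hs: "u \<in> half_spin \<gamma> y0 \<longleftrightarrow> chir u = u" for u
    using vol[of u] y0 by (auto simp: half_spin_def)
  show ?thesis
  proof (intro exI[of _ ev] spin_model.intro)
    fix x x' w w' :: "complex ^ 4" and c
    show "kap v (x + x') (w + w') = kap v x w + kap v x' w'"
      "kap v (c *s x) (c *s w) = c *s kap v x w"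
      by (simp_all add: kap_def vec.scale_left_distrib sum.distrib vec.scale_sum_right vec.scale_right_distrib)
    show "kap v x w = 0 \<longleftrightarrow> x = 0 \<and> w = 0"
    proof
      assume k: "kap v x w = 0"
      have "bil M (hypb v i) (kap v x w) = x $ i / 2" "bil M (kap v x w) (hypa v i) = w $ i / 2" for i
        using exhaust_4[of i]
        by (auto simp: kap_def sum_4 bs aa bb ab)
      then show "x = 0 \<and> w = 0" by (simp add: k vec_eq_iff)
    qed (simp add: kap_def)
  next
    fix \<xi> :: "complex ^ 8"
    have "\<xi> = (\<Sum>j\<in>UNIV. (\<xi> v* Q) $ j *s v j)"
    proof -
      have "\<xi> = (\<xi> v* Q) v* V" by (simp add: vector_matrix_mul_assoc Q)
      also have "\<dots> = (\<Sum>j\<in>UNIV. (\<xi> v* Q) $ j *s v j)"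
        by (simp add: vec_eq_iff vector_matrix_mult_def V_def sum_component mult.commute)
      finally show ?thesis .
    qed
    then obtain c where c: "\<xi> = (\<Sum>j\<in>UNIV. c j *s v j)" by blast
    have "\<xi> = kap v (vec4 (c 0 - \<i> * c 1) (c 2 - \<i> * c 3) (c 4 - \<i> * c 5) (c 6 - \<i> * c 7))
       (vec4 (c 0 + \<i> * c 1) (c 2 + \<i> * c 3) (c 4 + \<i> * c 5) (c 6 + \<i> * c 7))"
      unfolding c kap_def sum_4 sum_8 vec4_nth hypa_def hypb_def
      by (simp add: vec_eq_iff field_simps)
    then show "\<exists>x w. \<xi> = kap v x w" by blast
  next
    fix x w :: "complex ^ 4" and z :: "complex ^ 6" and s t :: complex
    have "\<gamma> (kap v x w) *v ev s z t = od (s *s x - skew z w) (t *s w + skew (dual6 z) x)"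
      using act[of x w "ev s z t"] by (simp add: act_ev cl_def)
    then show "\<gamma> (kap v x w) *v ev s z t = 0 \<longleftrightarrow> s *s x = skew z w \<and> t *s w = - skew (dual6 z) x"
      by (simp add: od_eq_0 eq_neg_iff_add_eq_0)
  qed (simp_all add: ev_linear ev_eq_0 hs chir_fixed)
qed

section \<open>Sections of the spinor bundle\<close>

lemma wedge_eq_0: "wedge \<xi> \<eta> = 0 \<longleftrightarrow> \<not> indep2 \<xi> \<eta>"
  unfolding indep2_minor by (auto simp: wedge_def vec_eq_iff)

lemma half_spin_subspaceI:
  assumes "\<And>u v. u \<in> H \<Longrightarrow> v \<in> H \<Longrightarrow> u + v \<in> H" "\<And>c u. u \<in> H \<Longrightarrow> c *s u \<in> H" "0 \<in> H"
  shows "closed (H :: (complex ^ 'n) set)"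
proof (rule closed_subspace)
  have "c *\<^sub>R x = complex_of_real c *s x" for c and x :: "complex ^ 'n"
    unfolding vec_eq_iff vector_scaleR_component vector_smult_component scaleR_conv_of_real[where 'a = complex] by simp
  then show "subspace H" unfolding subspace_def using assms by auto
qed

text \<open>Both forms are sums of four binary forms in the pairs \<open>x$i\<close>,
  \<open>w$i\<close>. The first one is hyperbolic; eigenvalues m and m' of the second on such a pair
  give (m - m')/4 for \<open>p$i\<close> and (m + m')/4 for \<open>r$i\<close>.\<close>

locale pencil_model = clifford M \<gamma> + spin_model \<gamma> y0 kp io
  for M :: "complex ^ 8 ^ 8" and \<gamma> :: "complex ^ 8 \<Rightarrow> complex ^ 16 ^ 16" and y0 :: complex
    and kp :: "complex ^ 4 \<Rightarrow> complex ^ 4 \<Rightarrow> complex ^ 8"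
    and io :: "complex \<Rightarrow> complex ^ 6 \<Rightarrow> complex \<Rightarrow> complex ^ 16" +
  fixes M' :: "complex ^ 8 ^ 8" and p r :: "complex ^ 4"
  assumes sym': "transpose M' = M'"
    and q_kp: "qform M (kp x w) = (\<Sum>i\<in>UNIV. x$i * w$i)"
    and q'_kp: "qform M' (kp x w) = (\<Sum>i\<in>UNIV. p$i * ((x$i)\<^sup>2 + (w$i)\<^sup>2) + 2 * r$i * x$i * w$i)"
    and p_nz: "p$i \<noteq> 0" and r_inj: "i \<noteq> j \<Longrightarrow> r$i \<noteq> r$j"
begin

definition "X = Gr_quadric M \<inter> Gr_quadric M'"

lemma kp_0: "kp 0 0 = 0" by (simp add: kp_eq_0)

lemma kp_nth: "kp x w $ k = (\<Sum>i\<in>UNIV. x$i * kp (axis i 1) 0 $ k + w$i * kp 0 (axis i 1) $ k)"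
proof -
  have *: "kp (\<Sum>i\<in>I. f i) (\<Sum>i\<in>I. g i) = (\<Sum>i\<in>I. kp (f i) (g i))" for f g and I :: "4 set"
    by (induction I rule: infinite_finite_induct) (simp_all add: kp_add kp_0)
  have a: "(\<Sum>i\<in>UNIV. x$i *s axis i 1) = x" for x :: "complex ^ 4"
    by (rule basis_expansion)
  have "kp x w = kp (\<Sum>i\<in>UNIV. x$i *s axis i 1) 0 + kp 0 (\<Sum>i\<in>UNIV. w$i *s axis i 1)"
    using kp_add[of x 0 0 w] by (simp add: a)
  also have "\<dots> = (\<Sum>i\<in>UNIV. x$i *s kp (axis i 1) 0 + w$i *s kp 0 (axis i 1))"
    using *[of "\<lambda>i. x$i *s axis i 1" UNIV "\<lambda>i. 0"] *[of "\<lambda>i. 0" UNIV "\<lambda>i. w$i *s axis i 1"]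
      kp_smult[of _ _ 0] kp_smult[of _ 0]
    by (simp add: sum.distrib)
  finally show ?thesis by (simp add: sum_component)
qed

lemma io_0: "io 0 0 0 = 0" by (simp add: io_eq_0)

lemma io_nth: "io s z t $ k = s * io 1 0 0 $ k + (\<Sum>i\<in>UNIV. z$i * io 0 (axis i 1) 0 $ k) + t * io 0 0 1 $ k"
proof -
  have *: "io 0 (\<Sum>i\<in>I. f i) 0 = (\<Sum>i\<in>I. io 0 (f i) 0)" for f and I :: "6 set"
  proof (induction I rule: infinite_finite_induct)
    case (insert i I)
    then show ?case using io_add[of 0 0 "f i" "sum f I" 0 0] by simp
  qed (simp_all add: io_0)
  have sm: "io s 0 0 = s *s io 1 0 0" "io 0 0 t = t *s io 0 0 1" "io 0 (c *s z') 0 = c *s io 0 z' 0" for c z'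
    using io_smult[of s 1 0 0] io_smult[of t 0 0 1] io_smult[of c 0 z' 0] by simp_all
  have "io s z t = io s 0 0 + io 0 (\<Sum>i\<in>UNIV. z$i *s axis i 1) 0 + io 0 0 t"
    using io_add[of s 0 0 z 0 0] io_add[of s 0 z 0 0 t] by (simp add: basis_expansion)
  also have "io 0 (\<Sum>i\<in>UNIV. z$i *s axis i 1) 0 = (\<Sum>i\<in>UNIV. z$i *s io 0 (axis i 1) 0)"
    unfolding * sm ..
  finally show ?thesis by (simp add: sm sum_component)
qed

lemma closed_half_spin: "closed (half_spin \<gamma> y0)"
proof (rule half_spin_subspaceI)
  show "u + v \<in> half_spin \<gamma> y0" if "u \<in> half_spin \<gamma> y0" "v \<in> half_spin \<gamma> y0" for u v
    using that unfolding io_range by (metis io_add)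
  show "c *s u \<in> half_spin \<gamma> y0" if "u \<in> half_spin \<gamma> y0" for c u
    using that unfolding io_range by (metis io_smult)
  show "0 \<in> half_spin \<gamma> y0" unfolding io_range by (metis io_0)
qed

lemma spinor_sub_iff: "u \<in> spinor_sub \<gamma> y0 E \<longleftrightarrow> u \<in> half_spin \<gamma> y0 \<and> (\<forall>\<xi>\<in>E. cl \<xi> u = 0)"
  by (auto simp: spinor_sub_def cl_def)

lemma spinor_sub_span: "u \<in> spinor_sub \<gamma> y0 (vec.span {\<xi>, \<eta>}) \<longleftrightarrow>
    u \<in> half_spin \<gamma> y0 \<and> cl \<xi> u = 0 \<and> cl \<eta> u = 0"
proof -
  have "\<xi> \<in> vec.span {\<xi>, \<eta>}" "\<eta> \<in> vec.span {\<xi>, \<eta>}" by (auto intro: vec.span_base)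
  then show ?thesis unfolding spinor_sub_iff by (auto simp: span2 cl_add cl_smult)
qed

lemma X_span: "indep2 \<xi> \<eta> \<Longrightarrow> vec.span {\<xi>, \<eta>} \<in> X \<longleftrightarrow>
    qform M \<xi> = 0 \<and> bil M \<xi> \<eta> = 0 \<and> qform M \<eta> = 0 \<and> qform M' \<xi> = 0 \<and> bil M' \<xi> \<eta> = 0 \<and> qform M' \<eta> = 0"
proof -
  assume i: "indep2 \<xi> \<eta>"
  have *: "(\<forall>\<zeta>\<in>vec.span {\<xi>, \<eta>}. qform N \<zeta> = 0) \<longleftrightarrow> qform N \<xi> = 0 \<and> bil N \<xi> \<eta> = 0 \<and> qform N \<eta> = 0"
    if N: "transpose N = N" for N
  proof
    assume a: "\<forall>\<zeta>\<in>vec.span {\<xi>, \<eta>}. qform N \<zeta> = 0"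
    have "\<xi> \<in> vec.span {\<xi>, \<eta>}" "\<eta> \<in> vec.span {\<xi>, \<eta>}" "\<xi> + \<eta> \<in> vec.span {\<xi>, \<eta>}"
      by (auto intro: vec.span_base vec.span_add)
    then show "qform N \<xi> = 0 \<and> bil N \<xi> \<eta> = 0 \<and> qform N \<eta> = 0"
      using a qform_add[OF N, of \<xi> \<eta>] by simp
  next
    assume "qform N \<xi> = 0 \<and> bil N \<xi> \<eta> = 0 \<and> qform N \<eta> = 0"
    then show "\<forall>\<zeta>\<in>vec.span {\<xi>, \<eta>}. qform N \<zeta> = 0"
      using bil_commute[OF N, of \<eta> \<xi>]
      by (auto simp: span2 qform_bil bil_add_left bil_add_right bil_smult_left bil_smult_right)
  qed
  have "vec.span {\<xi>, \<eta>} \<in> Gr" using dim_span2[OF i] vec.subspace_span[of "{\<xi>, \<eta>}"] by (simp add: Gr_def)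
  then show ?thesis unfolding X_def Gr_quadric_def using *[OF sym] *[OF sym'] by auto
qed

lemma X_basis:
  assumes "E \<in> X" obtains \<xi> \<eta> where "indep2 \<xi> \<eta>" "E = vec.span {\<xi>, \<eta>}"
  using assms dim2_basis[of E] by (auto simp: X_def Gr_quadric_def Gr_def)

text \<open>The data at which a section can be evaluated. A basis is carried along instead of its
  plane so that limits and holomorphic dependence on parameters make sense.\<close>

definition adm :: "complex ^ 8 \<Rightarrow> complex ^ 8 \<Rightarrow> complex ^ 16 \<Rightarrow> bool" where
  "adm \<xi> \<eta> u \<longleftrightarrow> indep2 \<xi> \<eta> \<and> vec.span {\<xi>, \<eta>} \<in> X \<and> u \<in> spinor_sub \<gamma> y0 (vec.span {\<xi>, \<eta>})"

lemma cl_tendsto: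
  assumes "(f \<longlongrightarrow> \<xi>) F" "(g \<longlongrightarrow> u) F" shows "((\<lambda>x. cl (f x) (g x)) \<longlongrightarrow> cl \<xi> u) F"
proof -
  have e: "cl \<xi> u = (\<Sum>i\<in>UNIV. \<xi>$i *s (\<gamma> (axis i 1) *v u))" for \<xi> u
  proof -
    have "cl (\<Sum>i\<in>UNIV. \<xi>$i *s axis i 1) u = (\<Sum>i\<in>UNIV. \<xi>$i *s cl (axis i 1) u)"
      by (simp only: cl_sum cl_smult)
    then show ?thesis by (simp add: basis_expansion cl_def)
  qed
  show ?thesis unfolding e
    by (intro vec_tendstoI)
       (auto simp: sum_component matrix_vector_mult_def intro!: tendsto_intros assms)
qed

lemma qform_tendsto: "(f \<longlongrightarrow> \<xi>) F \<Longrightarrow> ((\<lambda>x. qform N (f x)) \<longlongrightarrow> qform N \<xi>) F"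
  unfolding qform_def by (intro tendsto_intros)

lemma bil_tendsto: "(f \<longlongrightarrow> \<xi>) F \<Longrightarrow> (g \<longlongrightarrow> \<eta>) F \<Longrightarrow> ((\<lambda>x. bil N (f x) (g x)) \<longlongrightarrow> bil N \<xi> \<eta>) F"
  unfolding bil_def by (intro tendsto_intros)

lemma adm_limit:
  assumes "\<And>n. adm (f n) (g n) (h n)" and lim: "f \<longlonglongrightarrow> \<xi>" "g \<longlonglongrightarrow> \<eta>" "h \<longlonglongrightarrow> u" and i: "indep2 \<xi> \<eta>"
  shows "adm \<xi> \<eta> u"
proof -
  have u: "u \<in> half_spin \<gamma> y0"
    using closed_sequentially[OF closed_half_spin _ lim(3)] assms(1) by (auto simp: adm_def spinor_sub_iff)
  have c: "cl (f n) (h n) = 0" "cl (g n) (h n) = 0" for n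
    using assms(1)[of n] by (auto simp: adm_def spinor_sub_span)
  have "cl \<xi> u = 0" "cl \<eta> u = 0"
    using cl_tendsto[OF lim(1,3)] cl_tendsto[OF lim(2,3)] by (simp_all add: c LIMSEQ_const_iff)
  moreover have q: "qform M (f n) = 0 \<and> bil M (f n) (g n) = 0 \<and> qform M (g n) = 0 \<and>
      qform M' (f n) = 0 \<and> bil M' (f n) (g n) = 0 \<and> qform M' (g n) = 0" for n
    using assms(1)[of n] X_span by (auto simp: adm_def)
  have "qform M \<xi> = 0 \<and> bil M \<xi> \<eta> = 0 \<and> qform M \<eta> = 0 \<and> qform M' \<xi> = 0 \<and> bil M' \<xi> \<eta> = 0 \<and> qform M' \<eta> = 0"
    using qform_tendsto[OF lim(1), of M] qform_tendsto[OF lim(1), of M'] qform_tendsto[OF lim(2), of M]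
      qform_tendsto[OF lim(2), of M'] bil_tendsto[OF lim(1,2), of M] bil_tendsto[OF lim(1,2), of M']
    by (simp add: q LIMSEQ_const_iff)
  ultimately show ?thesis using u i X_span[OF i] by (auto simp: adm_def spinor_sub_span)
qed

end

section \<open>Continuity, holomorphy and boundedness of the values of a section\<close>

locale spin_section = pencil_model +
  fixes \<sigma> :: "(complex ^ 8) set \<Rightarrow> complex ^ 16 \<Rightarrow> complex"
  assumes sec: "\<sigma> \<in> spinor_sections \<gamma> y0 X"
begin

definition val :: "complex ^ 8 \<Rightarrow> complex ^ 8 \<Rightarrow> complex ^ 16 \<Rightarrow> complex" where
  "val \<xi> \<eta> u = \<sigma> (vec.span {\<xi>, \<eta>}) u"

lemma local_form:
  assumes "indep2 \<xi>0 \<eta>0" "vec.span {\<xi>0, \<eta>0} \<in> X"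
  obtains N g where
    "\<And>j. (\<lambda>w. N w $ j) \<in> poly_functions (range (\<lambda>i v. v $ i))"
    "g \<in> poly_functions (range (\<lambda>i v. v $ i))" "g (wedge \<xi>0 \<eta>0) \<noteq> 0"
    "\<And>\<xi> \<eta> u. adm \<xi> \<eta> u \<Longrightarrow> g (wedge \<xi> \<eta>) \<noteq> 0 \<Longrightarrow>
      val \<xi> \<eta> u = (\<Sum>j\<in>UNIV. N (wedge \<xi> \<eta>) $ j * u $ j) / g (wedge \<xi> \<eta>)"
proof -
  have w: "wedge \<xi> \<eta> \<in> plucker (vec.span {\<xi>, \<eta>})" for \<xi> \<eta>
    unfolding plucker_def by (rule vec.span_base) (blast intro: vec.span_base)
  obtain d N g where *: "\<forall>j. hom_poly d (\<lambda>w. N w $ j)" "hom_poly d g"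
     "\<forall>w\<in>plucker (vec.span {\<xi>0, \<eta>0}). w \<noteq> 0 \<longrightarrow> g w \<noteq> 0"
     "\<forall>E'\<in>X. \<forall>w\<in>plucker E'. w \<noteq> 0 \<and> g w \<noteq> 0 \<longrightarrow>
               (\<forall>s\<in>spinor_sub \<gamma> y0 E'. \<sigma> E' s = (\<Sum>j\<in>UNIV. N w $ j * s $ j) / g w)"
    using sec assms(2) unfolding spinor_sections_def by blast
  show ?thesis
  proof (rule that[of N g])
    show "g (wedge \<xi>0 \<eta>0) \<noteq> 0" using *(3) w assms(1) wedge_eq_0 by blast
    fix \<xi> \<eta> u assume a: "adm \<xi> \<eta> u" "g (wedge \<xi> \<eta>) \<noteq> 0"
    then show "val \<xi> \<eta> u = (\<Sum>j\<in>UNIV. N (wedge \<xi> \<eta>) $ j * u $ j) / g (wedge \<xi> \<eta>)"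
      using *(4) w[of \<xi> \<eta>] wedge_eq_0[of \<xi> \<eta>] unfolding adm_def val_def by blast
  qed (use *(1,2) in \<open>auto simp: hom_poly_def\<close>)
qed

lemma val_linear:
  assumes "adm \<xi> \<eta> u" "adm \<xi> \<eta> u'"
  shows "val \<xi> \<eta> (u + u') = val \<xi> \<eta> u + val \<xi> \<eta> u'" "val \<xi> \<eta> (c *s u) = c * val \<xi> \<eta> u"
proof -
  have i: "indep2 \<xi> \<eta>" "vec.span {\<xi>, \<eta>} \<in> X" using assms by (auto simp: adm_def)
  obtain N g where *: "g (wedge \<xi> \<eta>) \<noteq> 0"
    "\<And>\<xi> \<eta> u. adm \<xi> \<eta> u \<Longrightarrow> g (wedge \<xi> \<eta>) \<noteq> 0 \<Longrightarrow>
      val \<xi> \<eta> u = (\<Sum>j\<in>UNIV. N (wedge \<xi> \<eta>) $ j * u $ j) / g (wedge \<xi> \<eta>)"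
    using local_form[OF i] by metis
  have "adm \<xi> \<eta> (u + u')" "adm \<xi> \<eta> (c *s u)"
    using assms unfolding adm_def spinor_sub_span io_range
    by (auto simp: cl_right_add cl_right_smult) (metis io_add, metis io_smult)
  then show "val \<xi> \<eta> (u + u') = val \<xi> \<eta> u + val \<xi> \<eta> u'" "val \<xi> \<eta> (c *s u) = c * val \<xi> \<eta> u"
    using * assms by (simp_all add: sum.distrib algebra_simps sum_distrib_left add_divide_distrib)
qed

lemma wedge_nth: "wedge \<xi> \<eta> $ i = \<xi> $ fst i * \<eta> $ snd i - \<xi> $ snd i * \<eta> $ fst i"
  by (simp add: wedge_def)

lemma val_tendsto:
  assumes ev: "eventually (\<lambda>x. adm (f x) (g x) (h x)) F"
    and lim: "(f \<longlongrightarrow> \<xi>) F" "(g \<longlongrightarrow> \<eta>) F" "(h \<longlongrightarrow> u) F" and adm: "adm \<xi> \<eta> u"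
  shows "((\<lambda>x. val (f x) (g x) (h x)) \<longlongrightarrow> val \<xi> \<eta> u) F"
proof -
  have i: "indep2 \<xi> \<eta>" "vec.span {\<xi>, \<eta>} \<in> X" using adm by (auto simp: adm_def)
  obtain N k where *: "\<And>j. (\<lambda>w. N w $ j) \<in> poly_functions (range (\<lambda>i v. v $ i))"
    "k \<in> poly_functions (range (\<lambda>i v. v $ i))" "k (wedge \<xi> \<eta>) \<noteq> 0"
    "\<And>\<xi> \<eta> u. adm \<xi> \<eta> u \<Longrightarrow> k (wedge \<xi> \<eta>) \<noteq> 0 \<Longrightarrow>
      val \<xi> \<eta> u = (\<Sum>j\<in>UNIV. N (wedge \<xi> \<eta>) $ j * u $ j) / k (wedge \<xi> \<eta>)"
    by (rule local_form[OF i]) (rule that)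
  have w: "((\<lambda>x. wedge (f x) (g x) $ i) \<longlongrightarrow> wedge \<xi> \<eta> $ i) F" for i
    unfolding wedge_nth by (intro tendsto_intros lim)
  have kl: "((\<lambda>x. k (wedge (f x) (g x))) \<longlongrightarrow> k (wedge \<xi> \<eta>)) F"
    by (rule poly_functions_tendsto[OF *(2)]) (use w in auto)
  have Nl: "((\<lambda>x. N (wedge (f x) (g x)) $ j) \<longlongrightarrow> N (wedge \<xi> \<eta>) $ j) F" for j
    by (rule poly_functions_tendsto[OF *(1)]) (use w in auto)
  have "((\<lambda>x. (\<Sum>j\<in>UNIV. N (wedge (f x) (g x)) $ j * h x $ j) / k (wedge (f x) (g x)))
      \<longlongrightarrow> (\<Sum>j\<in>UNIV. N (wedge \<xi> \<eta>) $ j * u $ j) / k (wedge \<xi> \<eta>)) F"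
    by (intro tendsto_intros Nl kl lim *(3))
  moreover have "eventually (\<lambda>x. k (wedge (f x) (g x)) \<noteq> 0) F"
    using tendsto_imp_eventually_ne[OF kl *(3)] .
  then have "eventually (\<lambda>x. (\<Sum>j\<in>UNIV. N (wedge (f x) (g x)) $ j * h x $ j) / k (wedge (f x) (g x))
      = val (f x) (g x) (h x)) F"
    using ev by eventually_elim (simp add: *(4))
  ultimately show ?thesis using *(4)[OF adm *(3)] by (simp add: tendsto_cong)
qed

lemma val_holomorphic:
  assumes U: "open U" and adm: "\<And>t. t \<in> U \<Longrightarrow> adm (f t) (g t) (h t)"
    and hol: "\<And>i. (\<lambda>t. f t $ i) holomorphic_on U" "\<And>i. (\<lambda>t. g t $ i) holomorphic_on U"
      "\<And>i. (\<lambda>t. h t $ i) holomorphic_on U"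
  shows "(\<lambda>t. val (f t) (g t) (h t)) holomorphic_on U"
proof -
  have "(\<lambda>t. val (f t) (g t) (h t)) field_differentiable at t0" if t0: "t0 \<in> U" for t0
  proof -
    have i: "indep2 (f t0) (g t0)" "vec.span {f t0, g t0} \<in> X" using adm[OF t0] by (auto simp: adm_def)
    obtain N k where *: "\<And>j. (\<lambda>w. N w $ j) \<in> poly_functions (range (\<lambda>i v. v $ i))"
      "k \<in> poly_functions (range (\<lambda>i v. v $ i))" "k (wedge (f t0) (g t0)) \<noteq> 0"
      "\<And>\<xi> \<eta> u. adm \<xi> \<eta> u \<Longrightarrow> k (wedge \<xi> \<eta>) \<noteq> 0 \<Longrightarrow>
        val \<xi> \<eta> u = (\<Sum>j\<in>UNIV. N (wedge \<xi> \<eta>) $ j * u $ j) / k (wedge \<xi> \<eta>)"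
      by (rule local_form[OF i]) (rule that)
    have w: "(\<lambda>x. wedge (f x) (g x) $ i) holomorphic_on U" for i
      unfolding wedge_nth by (intro holomorphic_intros hol)
    have kh: "(\<lambda>x. k (wedge (f x) (g x))) holomorphic_on U"
      by (rule poly_functions_holomorphic[OF *(2)]) (use w in auto)
    have Nh: "(\<lambda>x. N (wedge (f x) (g x)) $ j) holomorphic_on U" for j
      by (rule poly_functions_holomorphic[OF *(1)]) (use w in auto)
    \<comment> \<open>The quotient is available only off the zeros of its denominator;
      differentiability is local, so this neighbourhood of \<open>t0\<close> is enough.\<close>
    define V where "V = U \<inter> (\<lambda>x. k (wedge (f x) (g x))) -` (- {0})"
    have V: "open V" unfolding V_def
      using continuous_on_open_vimage[OF U] holomorphic_on_imp_continuous_on[OF kh]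
      by (metis Int_commute open_Compl closed_singleton)
    have VU: "V \<subseteq> U" by (auto simp: V_def)
    have "(\<lambda>x. (\<Sum>j\<in>UNIV. N (wedge (f x) (g x)) $ j * h x $ j) / k (wedge (f x) (g x))) holomorphic_on V"
      by (intro holomorphic_intros holomorphic_on_subset[OF Nh VU] holomorphic_on_subset[OF kh VU]
          holomorphic_on_subset[OF hol(3) VU]) (auto simp: V_def)
    then have "(\<lambda>t. val (f t) (g t) (h t)) holomorphic_on V"
      by (rule holomorphic_transform) (auto simp: V_def *(4) adm)
    then show ?thesis
      using V t0 *(3) by (intro holomorphic_on_imp_differentiable_at[of _ V]) (auto simp: V_def)
  qed
  then show ?thesis using U by (simp add: holomorphic_on_open field_differentiable_def)
qed

lemma val_zero: "adm \<xi> \<eta> u \<Longrightarrow> val \<xi> \<eta> 0 = 0"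
  using val_linear(2)[of \<xi> \<eta> u u 0] by simp

lemma val_span:
  assumes "vec.span {\<xi>, \<eta>} = vec.span {\<xi>', \<eta>'}" shows "val \<xi> \<eta> u = val \<xi>' \<eta>' u"
  using assms by (simp add: val_def)

text \<open>Compactness. From a sequence violating every bound, unit spinors and normalized bases
  extract a convergent subsequence; its limit is admissible, and by continuity the values converge
  there, so they are bounded.\<close>

lemma val_bound: obtains C where "C \<ge> 0" "\<And>\<xi> \<eta> u. adm \<xi> \<eta> u \<Longrightarrow> cmod (val \<xi> \<eta> u) \<le> C * norm u"
proof -
  have "\<exists>C. \<forall>\<xi> \<eta> u. adm \<xi> \<eta> u \<longrightarrow> cmod (val \<xi> \<eta> u) \<le> C * norm u"
  proof (rule ccontr)
    assume "\<not> ?thesis"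
    then have "\<forall>n::nat. \<exists>\<xi> \<eta> u. adm \<xi> \<eta> u \<and> cmod (val \<xi> \<eta> u) > real n * norm u"
      by (meson not_le)
    then obtain f g h where a: "\<And>n. adm (f n) (g n) (h n)"
      "\<And>n. cmod (val (f n) (g n) (h n)) > real n * norm (h n)" by metis
    have hn: "h n \<noteq> 0" for n using a[of n] val_zero[OF a(1)[of n]] by auto
    define k where "k n = complex_of_real (inverse (norm (h n))) *s h n" for n
    have kn: "norm (k n) = 1" for n using hn[of n] by (simp add: k_def norm_smult_complex norm_inverse)
    have ka: "adm (f n) (g n) (k n)" for n
      using a(1)[of n] unfolding adm_def spinor_sub_span io_range k_def
      by (auto simp: cl_right_smult) (metis io_smult)
    have kv: "cmod (val (f n) (g n) (k n)) \<ge> real n" for n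
    proof -
      have "cmod (val (f n) (g n) (k n)) = inverse (norm (h n)) * cmod (val (f n) (g n) (h n))"
        unfolding k_def val_linear(2)[OF a(1) a(1)] by (simp add: norm_mult norm_inverse)
      also have "\<dots> \<ge> inverse (norm (h n)) * (real n * norm (h n))"
        by (intro mult_left_mono) (use a(2)[of n] in auto)
      moreover have "inverse (norm (h n)) * (real n * norm (h n)) = real n" using hn[of n] by simp
      ultimately show ?thesis by simp
    qed
    have "k n \<in> sphere 0 1" for n by (simp add: kn)
    then obtain l r where l: "strict_mono (r :: nat \<Rightarrow> nat)" "(k \<circ> r) \<longlonglongrightarrow> l"
      using compact_sphere[of "0 :: complex ^ 16" 1] unfolding compact_def by metis
    have "indep2 (f (r n)) (g (r n))" for n using ka[of "r n"] by (simp add: adm_def)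
    then obtain r' u v a' b where *: "strict_mono (r' :: nat \<Rightarrow> nat)" "u \<longlonglongrightarrow> a'" "v \<longlonglongrightarrow> b" "indep2 a' b"
      "\<And>n. indep2 (u n) (v n)" "\<And>n. vec.span {u n, v n} = vec.span {f (r (r' n)), g (r (r' n))}"
      using normalized_pair_subsequence[of "\<lambda>n. f (r n)" "\<lambda>n. g (r n)"] by metis
    have lim: "(\<lambda>n. k (r (r' n))) \<longlonglongrightarrow> l" using LIMSEQ_subseq_LIMSEQ[OF l(2) *(1)] by (simp add: o_def)
    have ad: "adm (u n) (v n) (k (r (r' n)))" for n
      using ka[of "r (r' n)"] *(5)[of n] *(6)[of n] by (simp add: adm_def)
    have "adm a' b l" by (rule adm_limit[OF ad *(2,3) lim *(4)])
    then have "(\<lambda>n. val (u n) (v n) (k (r (r' n)))) \<longlonglongrightarrow> val a' b l"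
      by (intro val_tendsto *(2,3) lim) (use ad in auto)
    then have "Bseq (\<lambda>n. val (u n) (v n) (k (r (r' n))))"
      using convergentI convergent_imp_Bseq by blast
    then obtain K where K: "\<And>n. cmod (val (u n) (v n) (k (r (r' n)))) \<le> K" by (auto simp: Bseq_def)
    have "real n \<le> K" for n
    proof -
      \<comment> \<open>The lower bound \<open>kv\<close> is in terms of the original index, which
        dominates the index in the subsequence.\<close>
      have "n \<le> r (r' n)" using seq_suble[OF l(1), of "r' n"] seq_suble[OF *(1), of n] by linarith
      then have "real n \<le> real (r (r' n))" by simp
      also have "\<dots> \<le> cmod (val (f (r (r' n))) (g (r (r' n))) (k (r (r' n))))" by (rule kv)
      also have "\<dots> \<le> K" using K[of n] val_span[OF *(6)[of n]] by simp
      finally show ?thesis .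
    qed
    then show False using reals_Archimedean2[of K] by (metis not_le)
  qed
  then obtain C where C: "\<And>\<xi> \<eta> u. adm \<xi> \<eta> u \<Longrightarrow> cmod (val \<xi> \<eta> u) \<le> C * norm u" by blast
  have "C * norm u \<le> \<bar>C\<bar> * norm u" for u :: "complex ^ 16" by (intro mult_right_mono) auto
  then show ?thesis using that[of "\<bar>C\<bar>"] C by (meson abs_ge_zero order_trans)
qed

end

section \<open>Linear algebra in dimension four\<close>

definition indep3 :: "complex ^ 'n \<Rightarrow> complex ^ 'n \<Rightarrow> complex ^ 'n \<Rightarrow> bool" where
  "indep3 a b c \<longleftrightarrow> (\<forall>\<alpha> \<beta> \<gamma>. \<alpha> *s a + \<beta> *s b + \<gamma> *s c = 0 \<longrightarrow> \<alpha> = 0 \<and> \<beta> = 0 \<and> \<gamma> = 0)"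

definition indep4 :: "complex ^ 'n \<Rightarrow> complex ^ 'n \<Rightarrow> complex ^ 'n \<Rightarrow> complex ^ 'n \<Rightarrow> bool" where
  "indep4 a b c d \<longleftrightarrow> (\<forall>\<alpha> \<beta> \<gamma> \<delta>. \<alpha> *s a + \<beta> *s b + \<gamma> *s c + \<delta> *s d = 0 \<longrightarrow>
     \<alpha> = 0 \<and> \<beta> = 0 \<and> \<gamma> = 0 \<and> \<delta> = 0)"

lemma indep2D: "indep2 a b \<Longrightarrow> \<alpha> *s a + \<beta> *s b = 0 \<Longrightarrow> \<alpha> = 0 \<and> \<beta> = 0"
  unfolding indep2_def by blast

lemma indep3D: "indep3 a b c \<Longrightarrow> \<alpha> *s a + \<beta> *s b + \<gamma> *s c = 0 \<Longrightarrow> \<alpha> = 0 \<and> \<beta> = 0 \<and> \<gamma> = 0"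
  unfolding indep3_def by blast

lemma indep4D: "indep4 a b c d \<Longrightarrow> \<alpha> *s a + \<beta> *s b + \<gamma> *s c + \<delta> *s d = 0 \<Longrightarrow>
    \<alpha> = 0 \<and> \<beta> = 0 \<and> \<gamma> = 0 \<and> \<delta> = 0"
  unfolding indep4_def by blast

lemma indep4_indep3: "indep4 a b c d \<Longrightarrow> indep3 a b c"
  unfolding indep3_def using indep4D[of a b c d _ _ _ 0] by simp

lemma indep4_spans:
  fixes a b c d y :: "complex ^ 4"
  assumes "indep4 a b c d"
  shows "\<exists>\<alpha> \<beta> \<gamma> \<delta>. y = \<alpha> *s a + \<beta> *s b + \<gamma> *s c + \<delta> *s d"
proof -
  define T where "T x = x$1 *s a + x$2 *s b + x$3 *s c + x$4 *s d" for x :: "complex ^ 4"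
  have T: "T (x + y) = T x + T y" "T (k *s x) = k *s T x" for x y k
    unfolding T_def by (simp_all add: vec_eq_iff algebra_simps)
  then have lin: "Vector_Spaces.linear (*s) (*s) T"
    unfolding Vector_Spaces.linear_iff using vec.vector_space_axioms by auto
  have "inj T"
  proof (rule injI)
    fix x y assume "T x = T y"
    then have "T (x + (-1) *s y) = 0" unfolding T by simp
    then have "x + (-1) *s y = 0"
      using indep4D[OF assms] unfolding T_def vec_eq_iff[of "x + (-1) *s y"] forall_4 zero_index by blast
    then show "x = y" by simp
  qed
  then obtain x where "y = T x" using vec.linear_inj_imp_surj[OF lin] by (metis surjD)
  then show ?thesis unfolding T_def by blast
qed

lemma indep3_extend:
  fixes a b c :: "complex ^ 4"
  assumes "indep3 a b c" obtains d where "indep4 a b c d"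
proof -
  have "\<exists>d. d \<notin> vec.span {a, b, c}"
  proof (rule ccontr)
    assume "\<not> ?thesis"
    then have "(UNIV :: (complex ^ 4) set) \<subseteq> vec.span {a, b, c}" by auto
    then have "vec.dim (UNIV :: (complex ^ 4) set) \<le> card {a, b, c}" by (rule vec.dim_le_card) simp
    moreover have "card {a, b, c} \<le> 3" by (simp add: card_insert_if)
    ultimately show False by (simp add: vec_dim_card card_cart_basis)
  qed
  then obtain d where d: "d \<notin> vec.span {a, b, c}" by blast
  have "indep4 a b c d" unfolding indep4_def
  proof (intro allI impI)
    fix \<alpha> \<beta> \<gamma> \<delta> assume e: "\<alpha> *s a + \<beta> *s b + \<gamma> *s c + \<delta> *s d = 0"
    have "\<delta> = 0"
    proof (rule ccontr)
      assume n: "\<delta> \<noteq> 0"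
      have "\<delta> *s d = - (\<alpha> *s a + \<beta> *s b + \<gamma> *s c)" using e by (simp only: add_eq_0_iff)
      moreover have "\<dots> \<in> vec.span {a, b, c}"
        by (intro vec.span_neg vec.span_add vec.span_scale vec.span_base) auto
      ultimately have "inverse \<delta> *s (\<delta> *s d) \<in> vec.span {a, b, c}" by (metis vec.span_scale)
      then show False using d n by (simp add: vec.scale_scale)
    qed
    then show "\<alpha> = 0 \<and> \<beta> = 0 \<and> \<gamma> = 0 \<and> \<delta> = 0" using indep3D[OF assms, of \<alpha> \<beta> \<gamma>] e by simp
  qed
  then show ?thesis by (rule that)
qed

lemma indep2_extend:
  fixes a b :: "complex ^ 4"
  assumes "indep2 a b" obtains c where "indep3 a b c"
proof -
  have "\<exists>d. d \<notin> vec.span {a, b}"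
  proof (rule ccontr)
    assume "\<not> ?thesis"
    then have "vec.span {a, b} = (UNIV :: (complex ^ 4) set)" by auto
    then show False using dim_span2[OF assms] by (simp add: vec_dim_card card_cart_basis)
  qed
  then obtain d where d: "d \<notin> vec.span {a, b}" by blast
  have "indep3 a b d" unfolding indep3_def
  proof (intro allI impI)
    fix \<alpha> \<beta> \<delta> assume e: "\<alpha> *s a + \<beta> *s b + \<delta> *s d = 0"
    have "\<delta> = 0"
    proof (rule ccontr)
      assume n: "\<delta> \<noteq> 0"
      have "\<delta> *s d = - (\<alpha> *s a + \<beta> *s b)" using e by (simp only: add_eq_0_iff)
      moreover have "\<dots> \<in> vec.span {a, b}"
        by (intro vec.span_neg vec.span_add vec.span_scale vec.span_base) auto
      ultimately have "inverse \<delta> *s (\<delta> *s d) \<in> vec.span {a, b}" by (metis vec.span_scale)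
      then show False using d n by (simp add: vec.scale_scale)
    qed
    then show "\<alpha> = 0 \<and> \<beta> = 0 \<and> \<delta> = 0" using indep2D[OF assms, of \<alpha> \<beta>] e by simp
  qed
  then show ?thesis by (rule that)
qed

lemma singular2:
  fixes A :: complex
  assumes "A * D - B * C = 0"
  shows "\<exists>x y. (x \<noteq> 0 \<or> y \<noteq> 0) \<and> x * A + y * C = 0 \<and> x * B + y * D = 0"
proof -
  consider "C = 0" "D = 0" | "C \<noteq> 0" | "D \<noteq> 0" by blast
  then show ?thesis
  proof cases
    case 1
    then show ?thesis by (intro exI[of _ 0] exI[of _ 1]) simp
  next
    case 2
    then show ?thesis using assms by (intro exI[of _ C] exI[of _ "-A"]) (auto simp: algebra_simps)
  next
    case 3
    then show ?thesis using assms by (intro exI[of _ D] exI[of _ "-B"]) (auto simp: algebra_simps)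
  qed
qed

lemma complete2:
  assumes "indep2 a b" "\<alpha> \<noteq> 0 \<or> \<beta> \<noteq> 0"
  obtains u \<gamma> \<delta> where "u = \<gamma> *s a + \<delta> *s b" "vec.span {\<alpha> *s a + \<beta> *s b, u} = vec.span {a, b}"
    "indep2 (\<alpha> *s a + \<beta> *s b) u"
proof (cases "\<alpha> = 0")
  case True
  then have d: "\<alpha> * 0 - \<beta> * 1 \<noteq> 0" using assms(2) by simp
  show ?thesis by (rule that[of "1 *s a + 0 *s b" 1 0, OF refl span2_change(1)[OF d] span2_change(2)[OF d assms(1)]])
next
  case False
  then have d: "\<alpha> * 1 - \<beta> * 0 \<noteq> 0" by simp
  show ?thesis by (rule that[of "0 *s a + 1 *s b" 0 1, OF refl span2_change(1)[OF d] span2_change(2)[OF d assms(1)]])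
qed

lemma quadratic_root:
  fixes A B C :: complex
  shows "\<exists>x y. (x \<noteq> 0 \<or> y \<noteq> 0) \<and> A * x\<^sup>2 + 2 * B * x * y + C * y\<^sup>2 = 0"
proof (cases "A = 0")
  case True
  then show ?thesis by (intro exI[of _ 1] exI[of _ 0]) simp
next
  case False
  have "(csqrt (B\<^sup>2 - A * C))\<^sup>2 = B\<^sup>2 - A * C" by simp
  then have "A * (csqrt (B\<^sup>2 - A * C) - B)\<^sup>2 + 2 * B * (csqrt (B\<^sup>2 - A * C) - B) * A + C * A\<^sup>2 = 0"
    by algebra
  then show ?thesis using False by (intro exI[of _ "csqrt (B\<^sup>2 - A * C) - B"] exI[of _ A]) simp
qed

section \<open>The affine chart of pure spinors\<close>

lemma poly_functions_closed_holomorphic: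
  "f \<in> poly_functions {g. g holomorphic_on U} \<Longrightarrow> f holomorphic_on U"
  by (induction rule: poly_functions.induct) (auto intro: holomorphic_intros)

context pencil_model
begin

text \<open>The affine chart \<open>z \<mapsto> pure z\<close> of the quadric of pure spinors: \<open>ch z\<close> parametrizes the totally isotropic
  4-space which annihilates \<open>pure z\<close>, and \<open>kf z\<close> is the restriction of the second form of the pencil to it.\<close>

definition ch :: "complex ^ 6 \<Rightarrow> complex ^ 4 \<Rightarrow> complex ^ 8" where "ch z y = kp (skew z y) y"

definition kf :: "complex ^ 6 \<Rightarrow> complex ^ 4 \<Rightarrow> complex ^ 4 \<Rightarrow> complex" where
  "kf z a b = bil M' (ch z a) (ch z b)"

definition pure :: "complex ^ 6 \<Rightarrow> complex ^ 16" where "pure z = io 1 z (pf z)"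

definition iso :: "complex ^ 6 \<Rightarrow> complex ^ 4 \<Rightarrow> complex ^ 4 \<Rightarrow> bool" where
  "iso z a b \<longleftrightarrow> indep2 a b \<and> kf z a a = 0 \<and> kf z a b = 0 \<and> kf z b b = 0"

lemma skew_linear: "skew z (a + b) = skew z a + skew z b" "skew z (c *s a) = c *s skew z a"
    "skew (z + z') a = skew z a + skew z' a" "skew (c *s z) a = c *s skew z a" "skew z 0 = 0" "skew 0 a = 0"
  by (simp_all add: vec_eq_iff forall_4 algebra_simps)

lemma ch_add: "ch z (a + b) = ch z a + ch z b" and ch_smult: "ch z (c *s a) = c *s ch z a"
  by (simp_all add: ch_def skew_linear kp_add kp_smult)

lemma ch_eq_0: "ch z a = 0 \<longleftrightarrow> a = 0"
  by (auto simp: ch_def kp_eq_0 skew_linear)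

lemma indep2_ch: "indep2 (ch z a) (ch z b) \<longleftrightarrow> indep2 a b"
  unfolding indep2_def by (simp add: ch_eq_0 flip: ch_add ch_smult)

lemma kf_add: "kf z (a + b) c = kf z a c + kf z b c" "kf z c (a + b) = kf z c a + kf z c b"
  and kf_smult: "kf z (k *s a) c = k * kf z a c" "kf z c (k *s a) = k * kf z c a"
  and kf_0: "kf z 0 c = 0" "kf z c 0 = 0"
  by (simp_all add: kf_def ch_add ch_smult bil_add_left bil_add_right bil_smult_left bil_smult_right ch_eq_0[THEN iffD2])

lemma kf_commute: "kf z a b = kf z b a"
  unfolding kf_def by (rule bil_commute[OF sym'])

lemma kf_minus: "kf z (- a) b = - kf z a b" "kf z b (- a) = - kf z b a"
  using kf_smult(1)[of z "-1" a b] kf_smult(2)[of z b "-1" a] by simp_all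

lemma kf_diff: "kf z (a - b) c = kf z a c - kf z b c" "kf z c (a - b) = kf z c a - kf z c b"
  using kf_add(1)[of z a "- b" c] kf_add(2)[of z c a "- b"] by (simp_all add: kf_minus)

lemmas kf_simps = kf_add kf_smult kf_0 kf_minus kf_diff

lemma skew_poly:
  assumes "\<And>i. (\<lambda>x. Z x $ i) \<in> poly_functions G" "\<And>i. (\<lambda>x. a x $ i) \<in> poly_functions G"
  shows "(\<lambda>x. skew (Z x) (a x) $ i) \<in> poly_functions G"
proof -
  have "(\<lambda>x. skew (Z x) (a x) $ 1) \<in> poly_functions G" "(\<lambda>x. skew (Z x) (a x) $ 2) \<in> poly_functions G"
    "(\<lambda>x. skew (Z x) (a x) $ 3) \<in> poly_functions G" "(\<lambda>x. skew (Z x) (a x) $ 4) \<in> poly_functions G"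
    unfolding skew_nth by (intro poly_functions_intros assms)+
  then show ?thesis using exhaust_4[of i] by metis
qed

lemma kp_poly:
  assumes "\<And>i. (\<lambda>x. a x $ i) \<in> poly_functions G" "\<And>i. (\<lambda>x. b x $ i) \<in> poly_functions G"
  shows "(\<lambda>x. kp (a x) (b x) $ k) \<in> poly_functions G"
  by (subst kp_nth) (intro poly_functions_intros assms)

lemma ch_poly:
  assumes "\<And>i. (\<lambda>x. Z x $ i) \<in> poly_functions G" "\<And>i. (\<lambda>x. a x $ i) \<in> poly_functions G"
  shows "(\<lambda>x. ch (Z x) (a x) $ k) \<in> poly_functions G"
  unfolding ch_def by (intro kp_poly skew_poly assms)

lemma bil_poly:
  assumes "\<And>i. (\<lambda>x. a x $ i) \<in> poly_functions G" "\<And>i. (\<lambda>x. b x $ i) \<in> poly_functions G"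
  shows "(\<lambda>x. bil N (a x) (b x)) \<in> poly_functions G"
  unfolding bil_def by (intro poly_functions_intros assms)

lemma kf_poly:
  assumes "\<And>i. (\<lambda>x. Z x $ i) \<in> poly_functions G" "\<And>i. (\<lambda>x. a x $ i) \<in> poly_functions G"
    "\<And>i. (\<lambda>x. b x $ i) \<in> poly_functions G"
  shows "(\<lambda>x. kf (Z x) (a x) (b x)) \<in> poly_functions G"
  unfolding kf_def by (intro bil_poly ch_poly assms)

lemma kf_holomorphic:
  assumes "\<And>i. (\<lambda>x. Z x $ i) holomorphic_on U" "\<And>i. (\<lambda>x. a x $ i) holomorphic_on U"
    "\<And>i. (\<lambda>x. b x $ i) holomorphic_on U"
  shows "(\<lambda>x. kf (Z x) (a x) (b x)) holomorphic_on U"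
  by (rule poly_functions_closed_holomorphic, rule kf_poly; rule poly_functions.gen) (simp_all add: assms)

lemma skew_tendsto:
  assumes "(Z \<longlongrightarrow> z) F" "(a \<longlongrightarrow> a0) F" shows "((\<lambda>x. skew (Z x) (a x)) \<longlongrightarrow> skew z a0) F"
proof (rule vec_tendstoI)
  fix i
  have "((\<lambda>x. skew (Z x) (a x) $ 1) \<longlongrightarrow> skew z a0 $ 1) F" "((\<lambda>x. skew (Z x) (a x) $ 2) \<longlongrightarrow> skew z a0 $ 2) F"
    "((\<lambda>x. skew (Z x) (a x) $ 3) \<longlongrightarrow> skew z a0 $ 3) F" "((\<lambda>x. skew (Z x) (a x) $ 4) \<longlongrightarrow> skew z a0 $ 4) F"
    unfolding skew_nth by (intro tendsto_intros assms)+
  then show "((\<lambda>x. skew (Z x) (a x) $ i) \<longlongrightarrow> skew z a0 $ i) F"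
    using exhaust_4[of i] by (elim disjE) (simp_all only:)
qed

lemma ch_tendsto:
  assumes "(Z \<longlongrightarrow> z) F" "(a \<longlongrightarrow> a0) F" shows "((\<lambda>x. ch (Z x) (a x)) \<longlongrightarrow> ch z a0) F"
  unfolding ch_def
  by (rule vec_tendstoI, subst (1 2) kp_nth) (intro tendsto_intros assms skew_tendsto)

lemma kf_tendsto:
  assumes "(Z \<longlongrightarrow> z) F" "(a \<longlongrightarrow> a0) F" "(b \<longlongrightarrow> b0) F"
  shows "((\<lambda>x. kf (Z x) (a x) (b x)) \<longlongrightarrow> kf z a0 b0) F"
  unfolding kf_def by (intro bil_tendsto ch_tendsto assms)

lemma pure_tendsto: "(Z \<longlongrightarrow> z) F \<Longrightarrow> ((\<lambda>x. pure (Z x)) \<longlongrightarrow> pure z) F"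
  unfolding pure_def pf_def by (rule vec_tendstoI, subst (1 2) io_nth) (intro tendsto_intros)

lemma pure_holomorphic:
  "(\<And>i. (\<lambda>x. Z x $ i) holomorphic_on U) \<Longrightarrow> (\<lambda>x. pure (Z x) $ k) holomorphic_on U"
  unfolding pure_def pf_def by (subst io_nth) (intro holomorphic_intros)

lemma skew_dual: "skew (dual6 z) (skew z y) = - pf z *s y"
  by (simp add: vec_eq_iff forall_4 dual6_def pf_def algebra_simps)

lemma cl_ch_pure: "cl (ch z y) (pure z) = 0"
  unfolding cl_def ch_def pure_def rel by (simp add: skew_dual)

lemma qform_ch: "qform M (ch z y) = 0"
  unfolding ch_def q_kp sum_4 by (simp add: algebra_simps)

lemma bil_ch: "bil M (ch z y) (ch z y') = 0"
  using qform_ch[of z "y + y'"] qform_ch[of z y] qform_ch[of z y'] qform_add[OF sym, of "ch z y" "ch z y'"]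
  by (simp add: ch_add)

lemma adm_ch: "iso z a b \<Longrightarrow> adm (ch z a) (ch z b) (pure z)"
  unfolding iso_def adm_def
  using X_span[of "ch z a" "ch z b"]
  by (auto simp: indep2_ch qform_ch bil_ch qform_bil[of M'] kf_def spinor_sub_span cl_ch_pure io_range)
     (auto simp: pure_def)

lemma iso_span:
  assumes "iso z a b" "indep2 c d" "vec.span {c, d} = vec.span {a, b}"
  shows "iso z c d"
proof -
  have "c \<in> vec.span {a, b}" "d \<in> vec.span {a, b}" using assms(3) by (auto intro: vec.span_base)
  then obtain \<alpha> \<beta> \<gamma> \<delta> where "c = \<alpha> *s a + \<beta> *s b" "d = \<gamma> *s a + \<delta> *s b" by (auto simp: span2)
  then show ?thesis using assms(1,2) by (simp add: iso_def kf_simps kf_commute[of z b a])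
qed

definition Dt :: "complex ^ 6 \<Rightarrow> complex" where
  "Dt z = det (\<chi> i j. kf z (axis i 1) (axis j 1))"

lemma kf_sum: "kf z (\<Sum>i\<in>I. f i) b = (\<Sum>i\<in>I. kf z (f i) b)" "kf z b (\<Sum>i\<in>I. f i) = (\<Sum>i\<in>I. kf z b (f i))"
  by (induction I rule: infinite_finite_induct) (simp_all add: kf_simps)

lemma kf_matrix: "kf z a b = (\<Sum>i\<in>UNIV. a $ i * ((\<chi> i j. kf z (axis i 1) (axis j 1)) *v b) $ i)"
proof -
  have "kf z (\<Sum>i\<in>UNIV. a$i *s axis i 1) (\<Sum>i\<in>UNIV. b$i *s axis i 1)
      = (\<Sum>i\<in>UNIV. a $ i * ((\<chi> i j. kf z (axis i 1) (axis j 1)) *v b) $ i)"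
    unfolding kf_sum(1) kf_smult(1)
    by (simp add: kf_sum(2) kf_smult(2) matrix_vector_mult_def sum_distrib_left mult_ac)
  then show ?thesis by (simp add: basis_expansion)
qed

lemma kf_radical: "Dt z = 0 \<Longrightarrow> \<exists>n. n \<noteq> 0 \<and> (\<forall>w. kf z n w = 0)"
proof -
  assume "Dt z = 0"
  then obtain n where n: "n \<noteq> 0" "(\<chi> i j. kf z (axis i 1) (axis j 1)) *v n = 0"
    using singular_kernel unfolding Dt_def by blast
  then have "kf z w n = 0" for w by (simp add: kf_matrix[of z w n])
  then show ?thesis using n by (metis kf_commute)
qed

lemma kf_surj: "Dt z \<noteq> 0 \<Longrightarrow> \<exists>v. \<forall>a. kf z a v = (\<Sum>i\<in>UNIV. a $ i * c $ i)"
proof -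
  assume "Dt z \<noteq> 0"
  then obtain B where B: "(\<chi> i j. kf z (axis i 1) (axis j 1)) ** B = mat 1"
    using invertible_det_nz unfolding Dt_def invertible_def by blast
  then have "(\<chi> i j. kf z (axis i 1) (axis j 1)) *v (B *v c) = c"
    by (simp add: matrix_vector_mul_assoc)
  then show ?thesis by (intro exI[of _ "B *v c"]) (simp add: kf_matrix[of z _ "B *v c"])
qed

lemma kf_nondegenerate:
  assumes "Dt z \<noteq> 0" "\<And>w. kf z n w = 0" shows "n = 0"
proof -
  have "n $ i = 0" for i
  proof -
    obtain v where "\<forall>a. kf z a v = (\<Sum>j\<in>UNIV. a $ j * (axis i 1 :: complex ^ 4) $ j)"
      using kf_surj[OF assms(1)] by blast
    then have "kf z n v = (\<Sum>j\<in>UNIV. n $ j * (if j = i then 1 else 0))" by (simp add: axis_def eq_commute)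
    then show ?thesis using assms(2)[of v] by (simp add: if_distrib sum.delta cong: if_cong)
  qed
  then show ?thesis by (simp add: vec_eq_iff)
qed

lemma Dt_poly:
  assumes "\<And>i. (\<lambda>x. Z x $ i) \<in> poly_functions G" shows "(\<lambda>x. Dt (Z x)) \<in> poly_functions G"
  unfolding Dt_def
  by (intro poly_functions_det) (simp, intro kf_poly assms poly_functions.const)

lemma Dt_line_finite:
  assumes "Dt (z + t0 *s \<theta>) \<noteq> 0" shows "finite {t. Dt (z + t *s \<theta>) = 0}"
proof (rule poly_functions_finite_zeros[of "\<lambda>t. Dt (z + t *s \<theta>)"])
  show "(\<lambda>t. Dt (z + t *s \<theta>)) \<in> poly_functions {\<lambda>t. t}"
    by (intro Dt_poly) (simp, intro poly_functions_intros poly_functions.gen, simp)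
qed (rule assms)

text \<open>\<open><e, v>\<close> is the second isotropic plane through \<open>e\<close>, and
  \<open>w\<close> pairs with \<open>e\<close>. The values 1 are what allows the frame to be
  deformed: they are the nonvanishing linear coefficients of quadratic equations.\<close>

lemma hyperbolic_frame:
  assumes D: "Dt z \<noteq> 0" and i: "iso z e u"
  obtains v w where "kf z e v = 0" "kf z v v = 0" "kf z u v = 1" "kf z e w = 1"
proof -
  have ind: "indep2 e u" using i by (simp add: iso_def)
  then obtain i' j' where m: "e $ i' * u $ j' - e $ j' * u $ i' \<noteq> 0" by (auto simp: indep2_minor)
  define m where "m = e $ i' * u $ j' - e $ j' * u $ i'"
  have ij: "i' \<noteq> j'" using m by auto
  \<comment> \<open>A linear form supported on the two coordinates of a nonzero minor, with value 0
    at \<open>e\<close> and 1 at \<open>u\<close>.\<close>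
  define c where "c = (\<chi> k. if k = i' then - e $ j' / m else if k = j' then e $ i' / m else 0)"
  have sum: "(\<Sum>k\<in>UNIV. a $ k * c $ k) = (a $ j' * e $ i' - a $ i' * e $ j') / m" for a
  proof -
    have "(\<Sum>k\<in>UNIV. a $ k * c $ k) = (\<Sum>k\<in>{i', j'}. a $ k * c $ k)"
      by (rule sum.mono_neutral_right) (auto simp: c_def)
    then show ?thesis using ij by (simp add: c_def diff_divide_distrib)
  qed
  obtain v0 where v0: "\<And>a. kf z a v0 = (\<Sum>k\<in>UNIV. a $ k * c $ k)" using kf_surj[OF D] by blast
  have 1: "kf z e v0 = 0" "kf z u v0 = 1"
    unfolding v0 sum using m by (simp_all add: m_def mult.commute)
  obtain k where k: "e $ k \<noteq> 0" using indep2_nonzero[OF ind] by (auto simp: vec_eq_iff)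
  obtain w where w: "\<And>a. kf z a w = (\<Sum>l\<in>UNIV. a $ l * (axis k (1 / e $ k) :: complex ^ 4) $ l)"
    using kf_surj[OF D] by blast
  show ?thesis
  \<comment> \<open>Subtracting this multiple of the isotropic vector \<open>u\<close> makes
    \<open>v0\<close> isotropic and leaves its pairings with \<open>e\<close> and \<open>u\<close>
    unchanged.\<close>
  proof (rule that[of "v0 + (- (kf z v0 v0 / 2)) *s u" w])
    show "kf z e (v0 + (- (kf z v0 v0 / 2)) *s u) = 0" "kf z u (v0 + (- (kf z v0 v0 / 2)) *s u) = 1"
      "kf z (v0 + (- (kf z v0 v0 / 2)) *s u) (v0 + (- (kf z v0 v0 / 2)) *s u) = 0"
      using i 1 kf_commute[of z v0 u] by (simp_all add: kf_simps iso_def)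
    show "kf z e w = 1" unfolding w using k by (simp add: axis_def if_distrib sum.delta cong: if_cong)
  qed
qed

lemma isotropic_vector:
  assumes "indep2 a b" obtains \<alpha> \<beta> where "\<alpha> \<noteq> 0 \<or> \<beta> \<noteq> 0" "kf z (\<alpha> *s a + \<beta> *s b) (\<alpha> *s a + \<beta> *s b) = 0"
proof -
  obtain x y where "x \<noteq> 0 \<or> y \<noteq> 0" "kf z a a * x\<^sup>2 + 2 * kf z a b * x * y + kf z b b * y\<^sup>2 = 0"
    using quadratic_root by blast
  then show ?thesis
    by (intro that[of x y]) (simp_all add: kf_simps kf_commute[of z b a] power2_eq_square algebra_simps)
qed

text \<open>Every plane contains an isotropic vector. Take one, \<open>e\<close>; its orthogonal
  complement has dimension at least 3 and contains a plane which avoids \<open>e\<close>, and in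
  this plane there is another isotropic vector.\<close>

lemma iso_exists: "\<exists>a b. iso z a b"
proof -
  have "indep2 (axis 1 1) (axis 2 1 :: complex ^ 4)"
    unfolding indep2_def by (auto simp: vec_eq_iff forall_4 axis_def)
  then obtain \<alpha> \<beta> where ab: "\<alpha> \<noteq> 0 \<or> \<beta> \<noteq> 0"
    "kf z (\<alpha> *s axis 1 1 + \<beta> *s axis 2 1) (\<alpha> *s axis 1 1 + \<beta> *s axis 2 1) = 0"
    using isotropic_vector by blast
  define e :: "complex ^ 4" where "e = \<alpha> *s axis 1 1 + \<beta> *s axis 2 1"
  obtain f where "indep2 e f" using complete2[OF \<open>indep2 (axis 1 1) (axis 2 1)\<close> ab(1)] unfolding e_def by metis
  then obtain g where "indep3 e f g" by (rule indep2_extend)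
  then obtain h where i4: "indep4 e f g h" by (rule indep3_extend)
  define c1 c2 c3 where "c1 = kf z e f" and "c2 = kf z e g" and "c3 = kf z e h"
  have "\<exists>x y. indep3 e x y \<and> kf z e x = 0 \<and> kf z e y = 0"
  proof -
    \<comment> \<open>Two combinations of \<open>f\<close>, \<open>g\<close>, \<open>h\<close>
      orthogonal to \<open>e\<close>; the pivot is the first nonzero one among the pairings
      \<open>c1\<close>, \<open>c2\<close>.\<close>
    consider "c1 = 0" "c2 = 0" | "c1 \<noteq> 0" | "c1 = 0" "c2 \<noteq> 0" by blast
    then show ?thesis
    proof cases
      case 1
      then show ?thesis using indep4_indep3[OF i4] by (auto simp: c1_def c2_def)
    next
      case 2
      have "indep3 e (c2 *s f + (- c1) *s g) (c3 *s f + (- c1) *s h)" unfolding indep3_def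
      proof (intro allI impI)
        fix k l m assume "k *s e + l *s (c2 *s f + (- c1) *s g) + m *s (c3 *s f + (- c1) *s h) = 0"
        then have "k *s e + (l * c2 + m * c3) *s f + (- (l * c1)) *s g + (- (m * c1)) *s h = 0"
          by (simp add: vec_eq_iff algebra_simps)
        from indep4D[OF i4 this] show "k = 0 \<and> l = 0 \<and> m = 0" using 2 by simp
      qed
      then show ?thesis by (intro exI conjI) (auto simp: kf_simps c1_def c2_def c3_def)
    next
      case 3
      have "indep3 e f (c3 *s g + (- c2) *s h)" unfolding indep3_def
      proof (intro allI impI)
        fix k l m assume "k *s e + l *s f + m *s (c3 *s g + (- c2) *s h) = 0"
        then have "k *s e + l *s f + (m * c3) *s g + (- (m * c2)) *s h = 0"
          by (simp add: vec_eq_iff algebra_simps)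
        from indep4D[OF i4 this] show "k = 0 \<and> l = 0 \<and> m = 0" using 3 by simp
      qed
      then show ?thesis using 3
        by (intro exI[of _ f] exI[of _ "c3 *s g + (- c2) *s h"] conjI) (auto simp: kf_simps c1_def c2_def c3_def)
    qed
  qed
  then obtain x y where xy: "indep3 e x y" "kf z e x = 0" "kf z e y = 0" by blast
  have "indep2 x y" unfolding indep2_def using indep3D[OF xy(1), of 0] by simp
  then obtain \<gamma> \<delta> where g: "\<gamma> \<noteq> 0 \<or> \<delta> \<noteq> 0" "kf z (\<gamma> *s x + \<delta> *s y) (\<gamma> *s x + \<delta> *s y) = 0"
    by (rule isotropic_vector)
  have "indep2 e (\<gamma> *s x + \<delta> *s y)" unfolding indep2_def
  proof (intro allI impI)
    fix k l assume "k *s e + l *s (\<gamma> *s x + \<delta> *s y) = 0"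
    then have "k *s e + (l * \<gamma>) *s x + (l * \<delta>) *s y = 0" by (simp add: vec_eq_iff algebra_simps)
    from indep3D[OF xy(1) this] show "k = 0 \<and> l = 0" using g by auto
  qed
  then have "iso z e (\<gamma> *s x + \<delta> *s y)"
    using ab(2) g(2) xy by (simp add: iso_def e_def[symmetric]) (simp add: kf_simps)
  then show ?thesis by blast
qed

end

section \<open>Lines on quadric surfaces and their holomorphic deformation\<close>

lemma open_nonzero:
  assumes "open U" "f holomorphic_on U" shows "open {t \<in> U. f t \<noteq> (0 :: complex)}"
proof -
  have "{t \<in> U. f t \<noteq> 0} = U \<inter> f -` (- {0})" by auto
  then show ?thesis
    using continuous_on_open_vimage[OF assms(1)] holomorphic_on_imp_continuous_on[OF assms(2)]
    by (metis Int_commute open_Compl closed_singleton)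
qed

lemma sequence_avoiding_finite:
  assumes "finite T" obtains x :: "nat \<Rightarrow> complex" where "\<And>n. x n \<notin> T" "x \<longlonglongrightarrow> t"
proof -
  have "eventually (\<lambda>y. y \<notin> T) (at t)"
    using islimpt_finite[OF assms] by (simp add: islimpt_iff_eventually)
  then have "t islimpt (- T)"
    unfolding islimpt_iff_eventually
  proof (rule contrapos_pn)
    assume "eventually (\<lambda>y. y \<notin> - T) (at t)"
    then show "\<not> eventually (\<lambda>y. y \<notin> T) (at t)"
      using eventually_conj[of "\<lambda>y. y \<notin> T" "at t" "\<lambda>y. y \<notin> - T"] by (auto simp: eventually_False)
  qed
  then obtain x where "\<And>n. x n \<in> - T - {t}" "x \<longlonglongrightarrow> t" unfolding islimpt_sequential by blast
  then show ?thesis using that by blast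
qed

text \<open>The Hodge dual of the bivector of \<open>a\<close> and \<open>b\<close>. Moving
  \<open>z\<close> in this direction fixes \<open>ch z a\<close> and \<open>ch z b\<close>, so it
  runs through the isotropic 4-spaces which contain a given plane.\<close>

definition kill :: "complex ^ 4 \<Rightarrow> complex ^ 4 \<Rightarrow> complex ^ 6" where
  "kill a b = vec6 (a$3 * b$4 - a$4 * b$3) (a$4 * b$2 - a$2 * b$4) (a$2 * b$3 - a$3 * b$2)
     (a$1 * b$2 - a$2 * b$1) (a$1 * b$3 - a$3 * b$1) (a$1 * b$4 - a$4 * b$1)"

lemma kill: "skew (kill a b) a = 0" "skew (kill a b) b = 0" "pf (kill a b) = 0"
  by (simp_all add: vec_eq_iff forall_4 kill_def pf_def algebra_simps)

context pencil_model
begin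

lemma ch_line: "ch (z + t *s \<theta>) y = ch z y + t *s kp (skew \<theta> y) 0"
  using kp_add[of "skew z y" "t *s skew \<theta> y" y 0] kp_smult[of t "skew \<theta> y" 0]
  by (simp add: ch_def skew_linear)

text \<open>A nontrivial relation between the four vectors exhibits a vector common to both planes.
  Equal planes fall under the second alternative.\<close>

lemma iso_pair_cases:
  assumes "iso z a b" "iso z c d"
  obtains "indep4 a b c d"
  | e u v where "iso z e u" "vec.span {e, u} = vec.span {a, b}" "iso z e v" "vec.span {e, v} = vec.span {c, d}"
proof (cases "indep4 a b c d")
  case False
  have ab: "indep2 a b" and cd: "indep2 c d" using assms by (auto simp: iso_def)
  obtain \<alpha> \<beta> \<gamma> \<delta> where n: "\<not> (\<alpha> = 0 \<and> \<beta> = 0 \<and> \<gamma> = 0 \<and> \<delta> = 0)"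
    and e: "\<alpha> *s a + \<beta> *s b + \<gamma> *s c + \<delta> *s d = 0"
    using False unfolding indep4_def by blast
  define e' where "e' = \<alpha> *s a + \<beta> *s b"
  have e'': "e' = (- \<gamma>) *s c + (- \<delta>) *s d"
  proof -
    have "e' + (\<gamma> *s c + \<delta> *s d) = 0" using e by (simp add: e'_def add.assoc)
    then show ?thesis by (simp add: eq_neg_iff_add_eq_0 algebra_simps)
  qed
  have "\<not> (\<alpha> = 0 \<and> \<beta> = 0)"
  proof
    assume "\<alpha> = 0 \<and> \<beta> = 0"
    then show False using n e indep2D[OF cd, of \<gamma> \<delta>] by simp
  qed
  then obtain u where u: "vec.span {e', u} = vec.span {a, b}" "indep2 e' u"
    using complete2[OF ab, of \<alpha> \<beta>] unfolding e'_def by metis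
  have "\<not> (\<gamma> = 0 \<and> \<delta> = 0)"
  proof
    assume "\<gamma> = 0 \<and> \<delta> = 0"
    then show False using n e indep2D[OF ab, of \<alpha> \<beta>] by simp
  qed
  then have "- \<gamma> \<noteq> 0 \<or> - \<delta> \<noteq> 0" by auto
  then obtain v where v: "vec.span {e', v} = vec.span {c, d}" "indep2 e' v"
    using complete2[OF cd] unfolding e'' by metis
  show ?thesis
    by (rule that(2)[OF iso_span[OF assms(1) u(2,1)] u(1) iso_span[OF assms(2) v(2,1)] v(1)])
qed (rule that(1))

text \<open>Each vector of the frame is corrected by a holomorphic small root: \<open>e\<close>
  along \<open>w\<close>, and then, in the orthogonal complement of the new \<open>e'\<close>,
  \<open>u\<close> and \<open>v\<close> along each other. The pairings which are 1 at
  \<open>t0\<close> are the linear coefficients of the three quadratic equations.\<close>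

lemma frame_extend:
  assumes U: "open U" "t0 \<in> U" and Z: "\<And>i. (\<lambda>t. Z t $ i) holomorphic_on U"
    and i: "iso (Z t0) e u" and v: "kf (Z t0) e v = 0" "kf (Z t0) v v = 0" "kf (Z t0) u v = 1"
    and w: "kf (Z t0) e w = 1"
  obtains V e' u' v' where "open V" "t0 \<in> V" "V \<subseteq> U"
    "\<And>i. (\<lambda>t. e' t $ i) holomorphic_on V" "\<And>i. (\<lambda>t. u' t $ i) holomorphic_on V" "\<And>i. (\<lambda>t. v' t $ i) holomorphic_on V"
    "e' t0 = e" "u' t0 = u" "v' t0 = v"
    "\<And>t. t \<in> V \<Longrightarrow> iso (Z t) (e' t) (u' t)" "\<And>t. t \<in> V \<Longrightarrow> iso (Z t) (e' t) (v' t)"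
    "\<And>t. t \<in> V \<Longrightarrow> kf (Z t) (u' t) (v' t) \<noteq> 0"
proof -
  have kfh: "(\<lambda>t. kf (Z t) (a t) (b t)) holomorphic_on V"
    if "V \<subseteq> U" "\<And>i. (\<lambda>t. a t $ i) holomorphic_on V" "\<And>i. (\<lambda>t. b t $ i) holomorphic_on V" for a b V
    by (rule kf_holomorphic[OF holomorphic_on_subset[OF Z that(1)] that(2,3)])
  have e0: "kf (Z t0) e e = 0" "kf (Z t0) e u = 0" "kf (Z t0) u u = 0" using i by (auto simp: iso_def)
  obtain V1 z1 where V1: "open V1" "t0 \<in> V1" "V1 \<subseteq> U" "z1 holomorphic_on V1" "z1 t0 = 0"
    "\<And>t. t \<in> V1 \<Longrightarrow> kf (Z t) e e + 2 * kf (Z t) e w * z1 t + kf (Z t) w w * (z1 t)\<^sup>2 = 0"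
  proof (rule holomorphic_small_root[OF U, of "\<lambda>t. kf (Z t) e e" "\<lambda>t. kf (Z t) e w" "\<lambda>t. kf (Z t) w w"])
  qed (auto intro!: kfh holomorphic_intros simp: e0 w)
  define e' where "e' t = e + z1 t *s w" for t
  have e'h: "(\<lambda>t. e' t $ i) holomorphic_on V1" for i
    unfolding e'_def by (simp, intro holomorphic_intros V1)
  have e't: "e' t0 = e" by (simp add: e'_def V1)
  have e'e': "kf (Z t) (e' t) (e' t) = 0" if "t \<in> V1" for t
    using V1(6)[OF that] kf_commute[of "Z t" w e]
    by (simp add: e'_def kf_simps power2_eq_square algebra_simps)
  define be where "be t = kf (Z t) (e' t) w" for t
  have beh: "be holomorphic_on V1" unfolding be_def
    by (intro kfh V1 e'h holomorphic_intros)
  define V2 where "V2 = {t \<in> V1. be t \<noteq> 0}"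
  have V2: "open V2" "t0 \<in> V2" "V2 \<subseteq> V1" "V2 \<subseteq> U"
    unfolding V2_def using open_nonzero[OF V1(1) beh] V1 by (auto simp: be_def e't w)
  \<comment> \<open>Projection to the orthogonal complement of \<open>e' t\<close>. Again along
    \<open>w\<close>, whose pairing with \<open>e' t\<close> stays nonzero on
    \<open>V2\<close>.\<close>
  define u1 where "u1 t = u + (- kf (Z t) (e' t) u / be t) *s w" for t
  define v1 where "v1 t = v + (- kf (Z t) (e' t) v / be t) *s w" for t
  have e'h2: "(\<lambda>t. e' t $ i) holomorphic_on V2" for i using e'h holomorphic_on_subset V2 by blast
  have be2: "be holomorphic_on V2" using beh holomorphic_on_subset V2 by blast
  have be0: "be t \<noteq> 0" if "t \<in> V2" for t using that by (simp add: V2_def)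
  have u1h: "(\<lambda>t. u1 t $ i) holomorphic_on V2" and v1h: "(\<lambda>t. v1 t $ i) holomorphic_on V2" for i
    unfolding u1_def v1_def
    by (simp_all, (intro holomorphic_intros kfh V2 e'h2 be2 be0; assumption)+)
  have u1t: "u1 t0 = u" and v1t: "v1 t0 = v" by (simp_all add: u1_def v1_def e't e0 v)
  have eu1: "kf (Z t) (e' t) (u1 t) = 0" and ev1: "kf (Z t) (e' t) (v1 t) = 0" if "t \<in> V2" for t
    using be0[OF that] by (simp_all add: u1_def v1_def kf_simps flip: be_def)
  \<comment> \<open>All combinations of \<open>u1\<close> and \<open>v1\<close> are orthogonal to
    \<open>e'\<close>, so only isotropy is left to be restored.\<close>
  obtain V3 z2 where V3: "open V3" "t0 \<in> V3" "V3 \<subseteq> V2" "z2 holomorphic_on V3" "z2 t0 = 0"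
    "\<And>t. t \<in> V3 \<Longrightarrow> kf (Z t) (u1 t) (u1 t) + 2 * kf (Z t) (u1 t) (v1 t) * z2 t + kf (Z t) (v1 t) (v1 t) * (z2 t)\<^sup>2 = 0"
  proof (rule holomorphic_small_root[OF V2(1,2), of "\<lambda>t. kf (Z t) (u1 t) (u1 t)"
      "\<lambda>t. kf (Z t) (u1 t) (v1 t)" "\<lambda>t. kf (Z t) (v1 t) (v1 t)"])
  qed (auto intro!: kfh u1h v1h V2 simp: e0 v u1t v1t)
  obtain V4 z3 where V4: "open V4" "t0 \<in> V4" "V4 \<subseteq> V3" "z3 holomorphic_on V4" "z3 t0 = 0"
    "\<And>t. t \<in> V4 \<Longrightarrow> kf (Z t) (v1 t) (v1 t) + 2 * kf (Z t) (u1 t) (v1 t) * z3 t + kf (Z t) (u1 t) (u1 t) * (z3 t)\<^sup>2 = 0"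
  proof (rule holomorphic_small_root[OF V3(1,2), of "\<lambda>t. kf (Z t) (v1 t) (v1 t)"
      "\<lambda>t. kf (Z t) (u1 t) (v1 t)" "\<lambda>t. kf (Z t) (u1 t) (u1 t)"])
  qed (use V3 V2 in \<open>auto intro!: kfh holomorphic_on_subset[OF u1h] holomorphic_on_subset[OF v1h] simp: e0 v u1t v1t\<close>)
  have V4': "V4 \<subseteq> V2" "V4 \<subseteq> U" "V4 \<subseteq> V1" using V4 V3 V2 by auto
  define u' where "u' t = u1 t + z2 t *s v1 t" for t
  define v' where "v' t = v1 t + z3 t *s u1 t" for t
  have h4: "(\<lambda>t. e' t $ i) holomorphic_on V4" "(\<lambda>t. u1 t $ i) holomorphic_on V4" "(\<lambda>t. v1 t $ i) holomorphic_on V4"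
    "z2 holomorphic_on V4" for i
    using e'h2 u1h v1h V3(4) V4' V4(3) holomorphic_on_subset by blast+
  have u'h: "(\<lambda>t. u' t $ i) holomorphic_on V4" and v'h: "(\<lambda>t. v' t $ i) holomorphic_on V4" for i
    unfolding u'_def v'_def by (simp_all, (intro holomorphic_intros h4 V4)+)
  define V where "V = {t \<in> V4. kf (Z t) (u' t) (v' t) \<noteq> 0}"
  have "open V" unfolding V_def by (rule open_nonzero[OF V4(1) kfh[OF V4'(2) u'h v'h]])
  show ?thesis
  proof (rule that[of V e' u' v'])
    show "open V" by fact
    show u't: "u' t0 = u" and v't: "v' t0 = v" by (simp_all add: u'_def v'_def V3 V4 u1t v1t)
    show "t0 \<in> V" by (simp add: V_def V4 u't v't v)
    show "V \<subseteq> U" using V4' by (auto simp: V_def)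
    show "(\<lambda>t. e' t $ i) holomorphic_on V" "(\<lambda>t. u' t $ i) holomorphic_on V" "(\<lambda>t. v' t $ i) holomorphic_on V" for i
      using h4(1) u'h v'h by (auto simp: V_def intro: holomorphic_on_subset)
    show "e' t0 = e" by (rule e't)
    fix t assume t: "t \<in> V"
    then have tt: "t \<in> V1" "t \<in> V2" "t \<in> V3" "t \<in> V4" using V4' V4 by (auto simp: V_def)
    show n: "kf (Z t) (u' t) (v' t) \<noteq> 0" using t by (simp add: V_def)
    have z: "kf (Z t) (u' t) (u' t) = 0" "kf (Z t) (v' t) (v' t) = 0"
      "kf (Z t) (e' t) (u' t) = 0" "kf (Z t) (e' t) (v' t) = 0"
      using V3(6)[OF tt(3)] V4(6)[OF tt(4)] eu1[OF tt(2)] ev1[OF tt(2)] kf_commute[of "Z t" "v1 t" "u1 t"]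
      by (simp_all add: u'_def v'_def kf_simps power2_eq_square algebra_simps)
    have e'n: "e' t \<noteq> 0" using be0[OF tt(2)] by (auto simp: be_def kf_simps)
    have "indep2 (e' t) (u' t)" unfolding indep2_def
    proof (intro allI impI)
      fix l m assume a: "l *s e' t + m *s u' t = 0"
      then have "kf (Z t) (l *s e' t + m *s u' t) (v' t) = 0" by (simp add: kf_simps)
      then have "m = 0" using n z by (simp add: kf_simps)
      then show "l = 0 \<and> m = 0" using a e'n by simp
    qed
    then show "iso (Z t) (e' t) (u' t)" using z e'e'[OF tt(1)] by (simp add: iso_def)
    have "indep2 (e' t) (v' t)" unfolding indep2_def
    proof (intro allI impI)
      fix l m assume a: "l *s e' t + m *s v' t = 0"
      then have "kf (Z t) (l *s e' t + m *s v' t) (u' t) = 0" by (simp add: kf_simps)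
      then have "m = 0" using n z kf_commute[of "Z t" "v' t" "u' t"] by (simp add: kf_simps)
      then show "l = 0 \<and> m = 0" using a e'n by simp
    qed
    then show "iso (Z t) (e' t) (v' t)" using z e'e'[OF tt(1)] by (simp add: iso_def)
  qed
qed

end

section \<open>Values of a section on the lines of a quadric surface\<close>

context spin_section
begin

definition phi :: "complex ^ 6 \<Rightarrow> complex ^ 4 \<Rightarrow> complex ^ 4 \<Rightarrow> complex" where
  "phi z a b = val (ch z a) (ch z b) (pure z)"

lemma phi_span:
  assumes "indep2 a b" "indep2 c d" "vec.span {c, d} = vec.span {a, b}"
  shows "phi z c d = phi z a b"
proof -
  have m: "ch z x \<in> vec.span {ch z a, ch z b}" if xs: "x \<in> vec.span {a, b}" for x
  proof -
    obtain k l where "x = k *s a + l *s b" using xs by (auto simp: span2)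
    then have "ch z x = k *s ch z a + l *s ch z b" by (simp add: ch_add ch_smult)
    then show ?thesis unfolding span2 by blast
  qed
  have cd: "c \<in> vec.span {a, b}" "d \<in> vec.span {a, b}" using assms(3) by (auto intro: vec.span_base)
  have "vec.span {ch z c, ch z d} = vec.span {ch z a, ch z b}"
    by (rule indep2_span_eq(1)[OF assms(2)[folded indep2_ch[of z]] m[OF cd(1)] m[OF cd(2)]])
  then show ?thesis unfolding phi_def by (rule val_span)
qed

lemma phi_span': "iso z a b \<Longrightarrow> iso z c d \<Longrightarrow> vec.span {c, d} = vec.span {a, b} \<Longrightarrow> phi z c d = phi z a b"
  by (rule phi_span) (auto simp: iso_def)

lemma phi_holomorphic:
  assumes "open U" "\<And>t. t \<in> U \<Longrightarrow> iso (Z t) (a t) (b t)"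
    "\<And>i. (\<lambda>x. Z x $ i) holomorphic_on U" "\<And>i. (\<lambda>x. a x $ i) holomorphic_on U"
    "\<And>i. (\<lambda>x. b x $ i) holomorphic_on U"
  shows "(\<lambda>t. phi (Z t) (a t) (b t)) holomorphic_on U"
  unfolding phi_def
proof (rule val_holomorphic[OF assms(1)])
  show "(\<lambda>t. ch (Z t) (a t) $ i) holomorphic_on U" "(\<lambda>t. ch (Z t) (b t) $ i) holomorphic_on U" for i
    by (rule poly_functions_closed_holomorphic, rule ch_poly; rule poly_functions.gen; simp add: assms)+
qed (auto intro: adm_ch pure_holomorphic assms)

lemma phi_tendsto:
  assumes "eventually (\<lambda>x. iso (Z x) (a x) (b x)) F" "(Z \<longlongrightarrow> z) F" "(a \<longlongrightarrow> a0) F" "(b \<longlongrightarrow> b0) F" "iso z a0 b0"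
  shows "((\<lambda>x. phi (Z x) (a x) (b x)) \<longlongrightarrow> phi z a0 b0) F"
  unfolding phi_def
  by (intro val_tendsto ch_tendsto pure_tendsto assms adm_ch)
     (use assms(1) in \<open>auto elim: eventually_mono simp: adm_ch\<close>)

lemma phi_bound: obtains C where "C \<ge> 0" "\<And>z a b. iso z a b \<Longrightarrow> cmod (phi z a b) \<le> C * norm (pure z)"
  using val_bound adm_ch unfolding phi_def by metis

text \<open>As \<open>z\<close> is fixed, the values along an entire family are bounded by a
  multiple of the norm of a single spinor, and Liouville's theorem applies.\<close>

lemma phi_path:
  assumes "\<And>t. iso z (a t) (b t)" "\<And>i. (\<lambda>x. a x $ i) holomorphic_on UNIV" "\<And>i. (\<lambda>x. b x $ i) holomorphic_on UNIV"
  shows "phi z (a t) (b t) = phi z (a 0) (b 0)"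
proof -
  obtain C where "\<And>z a b. iso z a b \<Longrightarrow> cmod (phi z a b) \<le> C * norm (pure z)" using phi_bound by metis
  then show ?thesis
    using constant_if_bounded[of "\<lambda>t. phi z (a t) (b t)" "C * norm (pure z)" t]
      phi_holomorphic[of UNIV "\<lambda>_. z" a b] assms by simp
qed

text \<open>If the three vectors are independent, they span an isotropic 3-space, and the planes
  through \<open>e\<close> in it form a pencil which joins the two given ones. Otherwise the two
  planes coincide.\<close>

lemma phi_concurrent:
  assumes "iso z e u" "iso z e v" "kf z u v = 0" shows "phi z e u = phi z e v"
proof (cases "indep3 e u v")
  case True
  have "phi z e ((1 - t) *s u + t *s v) = phi z e ((1 - 0) *s u + 0 *s v)" for t
  proof (rule phi_path)
    fix t
    have "indep2 e ((1 - t) *s u + t *s v)" unfolding indep2_def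
    proof (intro allI impI)
      fix l m assume "l *s e + m *s ((1 - t) *s u + t *s v) = 0"
      then have "l *s e + (m * (1 - t)) *s u + (m * t) *s v = 0" by (simp add: vec_eq_iff algebra_simps)
      from indep3D[OF True this] show "l = 0 \<and> m = 0" by auto
    qed
    then show "iso z e ((1 - t) *s u + t *s v)"
      using assms kf_commute[of z v u] by (simp add: iso_def kf_simps)
  qed (auto intro!: holomorphic_intros)
  from this[of 1] show ?thesis by simp
next
  case False
  then obtain \<alpha> \<beta> \<gamma> where n: "\<not> (\<alpha> = 0 \<and> \<beta> = 0 \<and> \<gamma> = 0)" and e: "\<alpha> *s e + \<beta> *s u + \<gamma> *s v = 0"
    unfolding indep3_def by blast
  have eu: "indep2 e u" and ev: "indep2 e v" using assms by (auto simp: iso_def)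
  have "\<gamma> \<noteq> 0" using n e indep2D[OF eu, of \<alpha> \<beta>] by auto
  moreover have "\<gamma> *s v = (- \<alpha>) *s e + (- \<beta>) *s u"
    using e by (simp add: eq_neg_iff_add_eq_0 vec_eq_iff algebra_simps)
  ultimately have "v = (- \<alpha> / \<gamma>) *s e + (- \<beta> / \<gamma>) *s u"
    by (simp add: vec_eq_iff field_simps)
  then have "v \<in> vec.span {e, u}" unfolding span2 by blast
  then have "vec.span {e, v} = vec.span {e, u}"
    by (intro indep2_span_eq(1) ev) (auto intro: vec.span_base)
  then show ?thesis using phi_span'[OF assms(1,2)] by simp
qed

text \<open>Skew lines belong to the same ruling. If the pairing between the two planes is
  nondegenerate, an entire family of isotropic planes joins them. If not, \<open>e\<close> and
  \<open>f\<close> in the kernels of the pairing span a third isotropic plane, which is concurrent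
  with both.\<close>

lemma phi_disjoint:
  assumes i4: "indep4 a b c d" and ab: "iso z a b" and cd: "iso z c d"
  shows "phi z a b = phi z c d"
proof -
  have iab: "indep2 a b" "kf z a a = 0" "kf z a b = 0" "kf z b b = 0" "kf z b a = 0"
    and icd: "indep2 c d" "kf z c c = 0" "kf z c d = 0" "kf z d d = 0" "kf z d c = 0"
    using ab cd kf_commute[of z a b] kf_commute[of z c d] by (auto simp: iso_def)
  define \<Delta> where "\<Delta> = kf z a c * kf z b d - kf z a d * kf z b c"
  show ?thesis
  proof (cases "\<Delta> = 0")
    case False
    \<comment> \<open>\<open>v1\<close> and \<open>v2\<close> are \<open>\<Delta>\<close> times the
      basis of \<open><c, d>\<close> dual to \<open>a\<close>, \<open>b\<close>. The map sending
      \<open>a\<close> to \<open>v2\<close> and \<open>b\<close> to \<open>- v1\<close> is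
      alternating for the pairing, which is why the interpolated planes stay isotropic.\<close>
    define v1 where "v1 = kf z b d *s c + (- kf z b c) *s d"
    define v2 where "v2 = (- kf z a d) *s c + kf z a c *s d"
    have kv: "kf z a v1 = \<Delta>" "kf z b v1 = 0" "kf z a v2 = 0" "kf z b v2 = \<Delta>"
      "kf z v1 v1 = 0" "kf z v2 v2 = 0" "kf z v1 v2 = 0"
      by (simp_all add: v1_def v2_def \<Delta>_def kf_simps icd algebra_simps)
    have "phi z ((1 - t) *s a + t *s v2) ((1 - t) *s b + (- t) *s v1)
        = phi z ((1 - 0) *s a + 0 *s v2) ((1 - 0) *s b + (- 0) *s v1)" for t
    proof (rule phi_path)
      fix t
      have "indep2 ((1 - t) *s a + t *s v2) ((1 - t) *s b + (- t) *s v1)" unfolding indep2_def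
      proof (intro allI impI)
        fix l m assume "l *s ((1 - t) *s a + t *s v2) + m *s ((1 - t) *s b + (- t) *s v1) = 0"
        then have "(l * (1 - t)) *s a + (m * (1 - t)) *s b + (t * (- l * kf z a d - m * kf z b d)) *s c
            + (t * (l * kf z a c + m * kf z b c)) *s d = 0"
          by (simp add: vec_eq_iff v1_def v2_def algebra_simps)
        from indep4D[OF i4 this] have *: "l * (1 - t) = 0" "m * (1 - t) = 0"
          "t * (- l * kf z a d - m * kf z b d) = 0" "t * (l * kf z a c + m * kf z b c) = 0" by auto
        show "l = 0 \<and> m = 0"
        proof (cases "t = 1")
          case True
          then have "- l * kf z a d - m * kf z b d = 0" "l * kf z a c + m * kf z b c = 0" using * by auto
          then have "l * \<Delta> = 0" "m * \<Delta> = 0" unfolding \<Delta>_def by algebra+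
          then show ?thesis using False by simp
        qed (use * in auto)
      qed
      then show "iso z ((1 - t) *s a + t *s v2) ((1 - t) *s b + (- t) *s v1)"
        using kf_commute[of z v2 a] kf_commute[of z v2 b] kf_commute[of z v1 a] kf_commute[of z v1 b] kf_commute[of z v2 v1]
        by (simp add: iso_def kf_simps kv iab) (simp add: algebra_simps)
    qed (auto intro!: holomorphic_intros)
    from this[of 1] have 1: "phi z v2 ((- 1) *s v1) = phi z a b" by simp
    have eq: "(- kf z a d) *s c + kf z a c *s d = v2" "(- kf z b d) *s c + kf z b c *s d = (- 1) *s v1"
      by (simp_all add: v1_def v2_def vec_eq_iff)
    have "(- kf z a d) * kf z b c - kf z a c * (- kf z b d) \<noteq> 0" using False by (simp add: \<Delta>_def algebra_simps)
    from span2_change[OF this, of c d] have "vec.span {v2, (- 1) *s v1} = vec.span {c, d}" "indep2 v2 ((- 1) *s v1)"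
      unfolding eq using icd(1) by auto
    then show ?thesis using 1 phi_span[OF icd(1)] by simp
  next
    case True
    then obtain x y where xy: "x \<noteq> 0 \<or> y \<noteq> 0" "x * kf z a c + y * kf z b c = 0" "x * kf z a d + y * kf z b d = 0"
      using singular2[of "kf z a c" "kf z b d" "kf z a d" "kf z b c"] by (auto simp: \<Delta>_def)
    have "kf z a c * kf z b d - kf z b c * kf z a d = 0" using True by (simp add: \<Delta>_def algebra_simps)
    then obtain x' y' where xy': "x' \<noteq> 0 \<or> y' \<noteq> 0" "x' * kf z a c + y' * kf z a d = 0" "x' * kf z b c + y' * kf z b d = 0"
      using singular2[of "kf z a c" "kf z b d" "kf z b c" "kf z a d"] by (auto simp: \<Delta>_def)
    \<comment> \<open>\<open>e\<close> is orthogonal to \<open><c, d>\<close>, and \<open>f\<close>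
      is orthogonal to \<open><a, b>\<close>.\<close>
    define e f where "e = x *s a + y *s b" and "f = x' *s c + y' *s d"
    obtain u \<gamma> \<delta> where u: "u = \<gamma> *s a + \<delta> *s b" "vec.span {e, u} = vec.span {a, b}" "indep2 e u"
      using complete2[OF iab(1) xy(1)] unfolding e_def by metis
    obtain v \<gamma>' \<delta>' where v: "v = \<gamma>' *s c + \<delta>' *s d" "vec.span {f, v} = vec.span {c, d}" "indep2 f v"
      using complete2[OF icd(1) xy'(1)] unfolding f_def by metis
    have kc: "kf z c a = kf z a c" "kf z c b = kf z b c" "kf z d a = kf z a d" "kf z d b = kf z b d"
      by (rule kf_commute)+
    have 0: "kf z e c = 0" "kf z e d = 0" "kf z a f = 0" "kf z b f = 0"
      using xy xy' by (simp_all add: e_def f_def kf_simps)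
    have "indep2 e f" unfolding indep2_def
    proof (intro allI impI)
      fix l m assume "l *s e + m *s f = 0"
      then have "(l * x) *s a + (l * y) *s b + (m * x') *s c + (m * y') *s d = 0"
        by (simp add: e_def f_def vec_eq_iff algebra_simps)
      from indep4D[OF i4 this] show "l = 0 \<and> m = 0" using xy(1) xy'(1) by auto
    qed
    moreover have "kf z e e = 0" "kf z f f = 0" by (simp_all add: e_def f_def kf_simps iab icd)
    moreover have "kf z e f = 0" using 0 by (simp add: f_def kf_simps)
    ultimately have ef: "iso z e f" and fe: "iso z f e"
      using kf_commute[of z f e] indep2_commute[of e f] by (auto simp: iso_def)
    have eu: "iso z e u" and fv: "iso z f v" using iso_span[OF ab u(3,2)] iso_span[OF cd v(3,2)] by auto
    have "phi z a b = phi z e u" using phi_span'[OF ab eu u(2)] by simp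
    also have "\<dots> = phi z e f" by (rule phi_concurrent[OF eu ef]) (simp add: u(1) kf_simps 0)
    also have "\<dots> = phi z f e" using phi_span'[OF fe ef] by (simp add: insert_commute)
    also have "\<dots> = phi z f v" by (rule phi_concurrent[OF fe fv]) (simp add: v(1) kf_simps 0)
    also have "\<dots> = phi z c d" using phi_span'[OF cd fv v(2)] by simp
    finally show ?thesis .
  qed
qed

definition unambiguous :: "complex ^ 6 \<Rightarrow> bool" where
  "unambiguous z \<longleftrightarrow> (\<forall>a b c d. iso z a b \<longrightarrow> iso z c d \<longrightarrow> phi z a b = phi z c d)"

text \<open>On a singular quadric surface there is only one family of lines.\<close>

lemma unambiguous_degenerate:
  assumes "Dt z = 0" shows "unambiguous z"
proof -
  obtain n where n: "n \<noteq> 0" "\<And>w. kf z n w = 0" using kf_radical[OF assms] by blast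
  have "phi z a b = phi z c d" if ab: "iso z a b" and cd: "iso z c d" for a b c d
    using ab cd
  proof (rule iso_pair_cases)
    assume "indep4 a b c d"
    then show ?thesis using ab cd by (rule phi_disjoint)
  next
    fix e u v assume eu: "iso z e u" "vec.span {e, u} = vec.span {a, b}"
      and ev: "iso z e v" "vec.span {e, v} = vec.span {c, d}"
    have "phi z e u = phi z e v"
    proof (cases "kf z u v = 0 \<or> \<not> indep3 e u v")
      case True
      then show ?thesis
      proof
        assume "kf z u v = 0"
        then show ?thesis by (rule phi_concurrent[OF eu(1) ev(1)])
      next
        assume "\<not> indep3 e u v"
        then obtain \<alpha> \<beta> \<gamma> where m: "\<not> (\<alpha> = 0 \<and> \<beta> = 0 \<and> \<gamma> = 0)" and e: "\<alpha> *s e + \<beta> *s u + \<gamma> *s v = 0"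
          unfolding indep3_def by blast
        have k: "kf z e v = 0" "kf z v v = 0" "kf z e u = 0" "kf z u u = 0" using eu ev by (auto simp: iso_def)
        have "kf z (\<alpha> *s e + \<beta> *s u + \<gamma> *s v) v = 0" using e by (simp add: kf_simps)
        then have "\<beta> * kf z u v = 0" using k by (simp add: kf_simps)
        moreover have "\<beta> \<noteq> 0"
        proof
          assume "\<beta> = 0"
          then show False using m e indep2D[of e v \<alpha> \<gamma>] ev(1) by (auto simp: iso_def)
        qed
        ultimately show ?thesis using phi_concurrent[OF eu(1) ev(1)] by simp
      qed
    next
      case False
      then have i3: "indep3 e u v" and k: "kf z u v \<noteq> 0" by auto
      obtain w0 where w0: "indep4 e u v w0" using indep3_extend[OF i3] .
      \<comment> \<open>The projection of \<open>w0\<close> to the orthogonal complement of the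
        hyperbolic pair \<open>u\<close>, \<open>v\<close>.\<close>
      define w where "w = w0 + (- kf z w0 v / kf z u v) *s u + (- kf z w0 u / kf z u v) *s v"
      have z: "kf z e e = 0" "kf z e u = 0" "kf z e v = 0" "kf z u u = 0" "kf z v v = 0"
        "kf z u e = 0" "kf z v e = 0" "kf z v u = kf z u v"
        using eu(1) ev(1) kf_commute[of z] by (auto simp: iso_def)
      have w: "kf z w u = 0" "kf z w v = 0" "kf z u w = 0" "kf z v w = 0"
        using k by (simp_all add: w_def kf_simps z kf_commute[of z u w0] kf_commute[of z v w0])
      have iw: "l = 0 \<and> m1 = 0 \<and> m2 = 0 \<and> m3 = 0" if "l *s e + m1 *s u + m2 *s v + m3 *s w = 0" for l m1 m2 m3
      proof -
        have "l *s e + (m1 + m3 * (- kf z w0 v / kf z u v)) *s u + (m2 + m3 * (- kf z w0 u / kf z u v)) *s v + m3 *s w0 = 0"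
          using that by (simp add: w_def vec_eq_iff algebra_simps)
        from indep4D[OF w0 this] show ?thesis by auto
      qed
      have i4: "indep4 e u v w" unfolding indep4_def using iw by blast
      \<comment> \<open>Otherwise \<open><e, w>\<close> and \<open><u, v>\<close> would be
        orthogonal nondegenerate planes, which excludes the vector \<open>n\<close> of the
        radical.\<close>
      have ew: "kf z e w = 0"
      proof (rule ccontr)
        assume ew: "kf z e w \<noteq> 0"
        obtain \<alpha> \<beta> \<gamma> \<delta> where nn: "n = \<alpha> *s e + \<beta> *s u + \<gamma> *s v + \<delta> *s w"
          using indep4_spans[OF i4] by blast
        have "kf z n e = \<delta> * kf z w e" "kf z n u = \<gamma> * kf z u v" "kf z n v = \<beta> * kf z u v"
          by (simp_all add: nn kf_simps z w)
        then have "\<delta> = 0" "\<gamma> = 0" "\<beta> = 0" using n(2) ew k kf_commute[of z w e] by auto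
        moreover from this have "kf z n w = \<alpha> * kf z e w" by (simp add: nn kf_simps)
        ultimately show False using n ew nn by auto
      qed
      show ?thesis
      proof (cases "kf z w w = 0")
        case True
        have "indep2 e w" unfolding indep2_def using iw[of _ 0 0] by auto
        then have "iso z e w" using True ew z by (simp add: iso_def)
        then show ?thesis using phi_concurrent[OF eu(1), of w] phi_concurrent[OF _ ev(1), of w] w by simp
      next
        case False
        \<comment> \<open>The surface is now the cone with vertex \<open>e\<close> over a smooth
          conic in \<open><u, v, w>\<close>. The path follows the conic from \<open>u\<close> to the
          multiple \<open>\<kappa> *s v\<close>; this constant makes the path isotropic.\<close>
        define \<kappa> where "\<kappa> = - kf z w w / (2 * kf z u v)"
        have \<kappa>: "\<kappa> \<noteq> 0" "2 * \<kappa> * kf z u v = - kf z w w" using False k by (simp_all add: \<kappa>_def)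
        have "phi z e ((1 - t)\<^sup>2 *s u + (t * (1 - t)) *s w + (t\<^sup>2 * \<kappa>) *s v)
          = phi z e ((1 - 0)\<^sup>2 *s u + (0 * (1 - 0)) *s w + (0\<^sup>2 * \<kappa>) *s v)" for t
        proof (rule phi_path)
          fix t
          have "indep2 e ((1 - t)\<^sup>2 *s u + (t * (1 - t)) *s w + (t\<^sup>2 * \<kappa>) *s v)" unfolding indep2_def
          proof (intro allI impI)
            fix l m assume "l *s e + m *s ((1 - t)\<^sup>2 *s u + (t * (1 - t)) *s w + (t\<^sup>2 * \<kappa>) *s v) = 0"
            then have "l *s e + (m * (1 - t)\<^sup>2) *s u + (m * (t\<^sup>2 * \<kappa>)) *s v + (m * (t * (1 - t))) *s w = 0"
              by (simp add: vec_eq_iff algebra_simps)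
            from iw[OF this] show "l = 0 \<and> m = 0" using \<kappa> by auto
          qed
          moreover have "kf z ((1 - t)\<^sup>2 *s u + (t * (1 - t)) *s w + (t\<^sup>2 * \<kappa>) *s v)
             ((1 - t)\<^sup>2 *s u + (t * (1 - t)) *s w + (t\<^sup>2 * \<kappa>) *s v)
             = (1 - t)\<^sup>2 * t\<^sup>2 * (2 * \<kappa> * kf z u v) + (t * (1 - t))\<^sup>2 * kf z w w"
            by (simp add: kf_simps z w power2_eq_square algebra_simps)
          then have "kf z ((1 - t)\<^sup>2 *s u + (t * (1 - t)) *s w + (t\<^sup>2 * \<kappa>) *s v)
             ((1 - t)\<^sup>2 *s u + (t * (1 - t)) *s w + (t\<^sup>2 * \<kappa>) *s v) = 0"
            unfolding \<kappa>(2) by (simp add: power2_eq_square algebra_simps)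
          ultimately show "iso z e ((1 - t)\<^sup>2 *s u + (t * (1 - t)) *s w + (t\<^sup>2 * \<kappa>) *s v)"
            by (simp add: iso_def) (simp add: kf_simps z w ew)
        qed (auto intro!: holomorphic_intros)
        from this[of 1] have 1: "phi z e (\<kappa> *s v) = phi z e u" by simp
        have "1 * \<kappa> - 0 * 0 \<noteq> 0" using \<kappa> by simp
        from span2_change[OF this, of e v] have "vec.span {e, \<kappa> *s v} = vec.span {e, v}" "indep2 e (\<kappa> *s v)"
          using ev(1) by (auto simp: iso_def)
        then show ?thesis using 1 phi_span[of e v e "\<kappa> *s v" z] ev(1) by (simp add: iso_def)
      qed
    qed
    then show ?thesis using phi_span'[OF ab eu] phi_span'[OF cd ev] by simp
  qed
  then show ?thesis unfolding unambiguous_def by blast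
qed

text \<open>A smooth quadric surface has two families of lines, and two lines which meet are in
  different families.\<close>

lemma unambiguous_meet:
  assumes D: "Dt z \<noteq> 0" and eu: "iso z e u" and ev: "iso z e v" and k: "kf z u v \<noteq> 0"
    and eq: "phi z e u = phi z e v"
  shows "unambiguous z"
proof -
  have z: "kf z e e = 0" "kf z e u = 0" "kf z e v = 0" "kf z u u = 0" "kf z v v = 0"
    "kf z u e = 0" "kf z v e = 0" "kf z v u = kf z u v"
    using eu ev kf_commute[of z] by (auto simp: iso_def)
  have ieu: "indep2 e u" and iev: "indep2 e v" using eu ev by (auto simp: iso_def)
  have i3: "indep3 e u v" unfolding indep3_def
  proof (intro allI impI)
    fix l m1 m2 assume e: "l *s e + m1 *s u + m2 *s v = 0"
    have "kf z (l *s e + m1 *s u + m2 *s v) u = 0" "kf z (l *s e + m1 *s u + m2 *s v) v = 0"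
      unfolding e by (simp_all add: kf_simps)
    then have "m2 = 0" "m1 = 0" using k by (simp_all add: kf_simps z)
    then show "l = 0 \<and> m1 = 0 \<and> m2 = 0" using e indep2_nonzero[OF ieu] by simp
  qed
  obtain w where i4: "indep4 e u v w" using indep3_extend[OF i3] .
  have ew: "kf z e w \<noteq> 0"
  proof
    assume "kf z e w = 0"
    then have "kf z e y = 0" for y
      using indep4_spans[OF i4, of y] by (auto simp: kf_simps z)
    then show False using kf_nondegenerate[OF D] indep2_nonzero[OF ieu] by blast
  qed
  have "phi z a b = phi z e u" if ab: "iso z a b" for a b
  proof -
    \<comment> \<open>The isotropic vectors orthogonal to \<open>e\<close> lie in
      \<open><e, u>\<close> or in \<open><e, v>\<close>, so these are the only lines of the surface
      through \<open>e\<close>.\<close>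
    have main: "phi z a b = phi z e u" if "e \<in> vec.span {a, b}"
    proof -
      obtain \<alpha> \<beta> where e: "e = \<alpha> *s a + \<beta> *s b" using \<open>e \<in> _\<close> by (auto simp: span2)
      then have "\<alpha> \<noteq> 0 \<or> \<beta> \<noteq> 0" using indep2_nonzero[OF ieu] by auto
      then obtain y where y: "vec.span {e, y} = vec.span {a, b}" "indep2 e y"
        using complete2[of a b \<alpha> \<beta>] ab unfolding e iso_def by metis
      have ey: "iso z e y" by (rule iso_span[OF ab y(2,1)])
      obtain l1 l2 l3 l4 where yy: "y = l1 *s e + l2 *s u + l3 *s v + l4 *s w" using indep4_spans[OF i4] by blast
      have "kf z e y = l4 * kf z e w" by (simp add: yy kf_simps z)
      then have l4: "l4 = 0" using ey ew by (simp add: iso_def)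
      have "kf z y y = 2 * l2 * l3 * kf z u v" by (simp add: yy l4 kf_simps z algebra_simps)
      then have "l2 = 0 \<or> l3 = 0" using ey k by (simp add: iso_def)
      then have "phi z e y = phi z e u"
      proof
        assume "l2 = 0"
        then have "y = l1 *s e + l3 *s v" by (simp add: yy l4)
        then have "y \<in> vec.span {e, v}" unfolding span2 by blast
        then have "vec.span {e, y} = vec.span {e, v}"
          by (intro indep2_span_eq(1) y(2)) (auto intro: vec.span_base)
        then show ?thesis using phi_span'[OF ev ey] eq by simp
      next
        assume "l3 = 0"
        then have "y = l1 *s e + l2 *s u" by (simp add: yy l4)
        then have "y \<in> vec.span {e, u}" unfolding span2 by blast
        then have "vec.span {e, y} = vec.span {e, u}"
          by (intro indep2_span_eq(1) y(2)) (auto intro: vec.span_base)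
        then show ?thesis using phi_span'[OF eu ey] by simp
      qed
      then show ?thesis using phi_span'[OF ab ey y(1)] by simp
    qed
    from ab eu show ?thesis
    proof (rule iso_pair_cases)
      assume "indep4 a b e u"
      then show ?thesis by (rule phi_disjoint[OF _ ab eu])
    next
      fix x1 y1 y2
      assume 1: "iso z x1 y1" "vec.span {x1, y1} = vec.span {a, b}" "iso z x1 y2" "vec.span {x1, y2} = vec.span {e, u}"
      from ab ev show ?thesis
      proof (rule iso_pair_cases)
        assume "indep4 a b e v"
        then show ?thesis using phi_disjoint[OF _ ab ev] eq by simp
      next
        fix x2 y3 y4
        assume 2: "iso z x2 y3" "vec.span {x2, y3} = vec.span {a, b}" "iso z x2 y4" "vec.span {x2, y4} = vec.span {e, v}"
        have x: "x1 \<in> vec.span {a, b}" "x2 \<in> vec.span {a, b}" "x1 \<in> vec.span {e, u}" "x2 \<in> vec.span {e, v}"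
          using vec.span_base[of x1 "{x1, y1}"] vec.span_base[of x2 "{x2, y3}"]
            vec.span_base[of x1 "{x1, y2}"] vec.span_base[of x2 "{x2, y4}"]
          unfolding 1(2,4) 2(2,4) by simp_all
        then obtain \<alpha> \<beta> \<alpha>' \<beta>' where xx: "x1 = \<alpha> *s e + \<beta> *s u" "x2 = \<alpha>' *s e + \<beta>' *s v"
          by (auto simp: span2)
        have nz: "x1 \<noteq> 0" "x2 \<noteq> 0" using 1(1) 2(1) indep2_nonzero by (auto simp: iso_def)
        obtain l m l' m' where "x1 = l *s a + m *s b" "x2 = l' *s a + m' *s b" using x by (auto simp: span2)
        \<comment> \<open>A line which meets both \<open><e, u>\<close> and \<open><e, v>\<close>:
          its meeting points are orthogonal to each other, which forces one of them to be the point
          of \<open>e\<close>.\<close>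
        then have "kf z x1 x2 = 0" using ab kf_commute[of z b a] by (simp add: kf_simps iso_def)
        then have "\<beta> * \<beta>' = 0" using k by (auto simp: xx kf_simps z)
        then have "\<exists>x\<in>vec.span {a, b}. \<exists>c. c \<noteq> 0 \<and> x = c *s e"
        proof -
          have "\<beta> = 0 \<or> \<beta>' = 0" using \<open>\<beta> * \<beta>' = 0\<close> by simp
          then show ?thesis
          proof
            assume "\<beta> = 0"
            then show ?thesis using x(1) xx(1) nz(1) by (intro bexI[OF _ x(1)] exI[of _ \<alpha>]) auto
          next
            assume "\<beta>' = 0"
            then show ?thesis using x(2) xx(2) nz(2) by (intro bexI[OF _ x(2)] exI[of _ \<alpha>']) auto
          qed
        qed
        then obtain c where "c \<noteq> 0" "c *s e \<in> vec.span {a, b}" by auto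
        then have "inverse c *s (c *s e) \<in> vec.span {a, b}" by (metis vec.span_scale)
        then have "e \<in> vec.span {a, b}" using \<open>c \<noteq> 0\<close> by (simp add: vec.scale_scale)
        then show ?thesis by (rule main)
      qed
    qed
  qed
  then show ?thesis unfolding unambiguous_def by metis
qed

end

context pencil_model
begin

text \<open>\<open>pf\<close> is quadratic, and its coefficient of the square of \<open>t\<close> is
  \<open>pf \<theta>\<close>. In null directions the pure spinors thus move on an affine line, so
  their norm, and with it every value of a section, grows at most linearly.\<close>

lemma pf_line: "pf \<theta> = 0 \<Longrightarrow> pure (z + t *s \<theta>) = pure z + t *s (pure (z + \<theta>) - pure z)"
proof -
  assume "pf \<theta> = 0"
  then have "pf (z + t *s \<theta>) = pf z + t * (pf (z + \<theta>) - pf z)"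
    by (simp add: pf_def algebra_simps) (simp flip: distrib_left)
  then have "io 1 (z + t *s \<theta>) (pf (z + t *s \<theta>)) = pure z + t *s io 0 \<theta> (pf (z + \<theta>) - pf z)"
    unfolding pure_def using io_add[of 1 0 z "t *s \<theta>" "pf z" "t * (pf (z + \<theta>) - pf z)"]
      io_smult[of t 0 \<theta> "pf (z + \<theta>) - pf z"] by simp
  moreover have "pure (z + \<theta>) = pure z + io 0 \<theta> (pf (z + \<theta>) - pf z)"
    unfolding pure_def using io_add[of 1 0 z \<theta> "pf z" "pf (z + \<theta>) - pf z"] by simp
  ultimately show ?thesis by (simp add: pure_def)
qed

lemma pure_line_bound:
  assumes "pf \<theta> = 0" obtains K where "K \<ge> 0" "\<And>t. norm (pure (z + t *s \<theta>)) \<le> K * (1 + cmod t)"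
proof (rule that[of "norm (pure z) + norm (pure (z + \<theta>) - pure z)"])
  fix t
  have "norm (pure (z + t *s \<theta>)) \<le> norm (pure z) + cmod t * norm (pure (z + \<theta>) - pure z)"
    unfolding pf_line[OF assms] using norm_triangle_ineq[of "pure z" "t *s (pure (z + \<theta>) - pure z)"]
    by (simp only: norm_smult_complex)
  also have "\<dots> \<le> (norm (pure z) + norm (pure (z + \<theta>) - pure z)) * (1 + cmod t)"
    by (simp add: algebra_simps)
  finally show "norm (pure (z + t *s \<theta>)) \<le> (norm (pure z) + norm (pure (z + \<theta>) - pure z)) * (1 + cmod t)" .
qed simp

end

context spin_section
begin

lemma phi_limit:
  assumes Z: "Z \<longlonglongrightarrow> z" and i: "\<And>n. iso (Z n) (a n) (b n)"
  obtains R a' b' where "strict_mono (R :: nat \<Rightarrow> nat)" "iso z a' b'"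
    "(\<lambda>n. phi (Z (R n)) (a (R n)) (b (R n))) \<longlonglongrightarrow> phi z a' b'"
proof -
  have "indep2 (a n) (b n)" for n using i[of n] by (simp add: iso_def)
  then obtain r u v a' b' where *: "strict_mono (r :: nat \<Rightarrow> nat)" "u \<longlonglongrightarrow> a'" "v \<longlonglongrightarrow> b'" "indep2 a' b'"
      "\<And>n. indep2 (u n) (v n)" "\<And>n. vec.span {u n, v n} = vec.span {a (r n), b (r n)}"
    using normalized_pair_subsequence[of a b] by metis
  have Zr: "(\<lambda>n. Z (r n)) \<longlonglongrightarrow> z" using LIMSEQ_subseq_LIMSEQ[OF Z *(1)] by (simp add: o_def)
  have iu: "iso (Z (r n)) (u n) (v n)" for n by (rule iso_span[OF i *(5,6)])
  then have k: "kf (Z (r n)) (u n) (u n) = 0" "kf (Z (r n)) (u n) (v n) = 0" "kf (Z (r n)) (v n) (v n) = 0" for n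
    by (auto simp: iso_def)
  have i': "iso z a' b'"
    using kf_tendsto[OF Zr *(2,2)] kf_tendsto[OF Zr *(2,3)] kf_tendsto[OF Zr *(3,3)] *(4)
    by (simp add: iso_def k LIMSEQ_const_iff)
  have "(\<lambda>n. phi (Z (r n)) (u n) (v n)) \<longlonglongrightarrow> phi z a' b'"
    by (intro phi_tendsto Zr * i') (use iu in auto)
  moreover have "phi (Z (r n)) (u n) (v n) = phi (Z (r n)) (a (r n)) (b (r n))" for n
    by (rule phi_span'[OF i iu *(6)])
  ultimately show ?thesis using that[OF *(1) i'] by simp
qed

text \<open>Isotropic planes converge only along subsequences, and the limits may lie in different
  rulings. As all planes over \<open>z\<close> have the same value, every subsequence has a further
  one with this limit.\<close>

lemma phi_limit_unambiguous:
  assumes Z: "Z \<longlonglongrightarrow> z" and i: "\<And>n. iso (Z n) (a n) (b n)" and un: "unambiguous z" and i0: "iso z a0 b0"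
  shows "(\<lambda>n. phi (Z n) (a n) (b n)) \<longlonglongrightarrow> phi z a0 b0"
proof (rule ccontr)
  assume "\<not> ?thesis"
  then obtain e where e: "e > 0" "\<not> eventually (\<lambda>n. dist (phi (Z n) (a n) (b n)) (phi z a0 b0) < e) sequentially"
    unfolding tendsto_iff by blast
  then obtain r :: "nat \<Rightarrow> nat" where r: "strict_mono r" "\<And>n. \<not> dist (phi (Z (r n)) (a (r n)) (b (r n))) (phi z a0 b0) < e"
    using not_eventually_sequentiallyD[OF e(2)] by blast
  have Zr: "(\<lambda>n. Z (r n)) \<longlonglongrightarrow> z" using LIMSEQ_subseq_LIMSEQ[OF Z r(1)] by (simp add: o_def)
  obtain r' a' b' where r': "strict_mono (r' :: nat \<Rightarrow> nat)" "iso z a' b'"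
    "(\<lambda>n. phi (Z (r (r' n))) (a (r (r' n))) (b (r (r' n)))) \<longlonglongrightarrow> phi z a' b'"
    by (rule phi_limit[OF Zr i]) (rule that)
  have eq: "phi z a' b' = phi z a0 b0" using un r'(2) i0 unfolding unambiguous_def by blast
  then have "eventually (\<lambda>n. dist (phi (Z (r (r' n))) (a (r (r' n))) (b (r (r' n)))) (phi z a0 b0) < e) sequentially"
    using tendstoD[OF r'(3) e(1)] by (simp only: eq)
  then show False using r(2) by (auto simp: eventually_sequentially)
qed

text \<open>The planes in the totally isotropic 4-spaces which contain a fixed isotropic plane
  \<open>\<langle>a, b\<rangle>\<close> are cut out by a pencil. Its two degenerate members bound how far the values on the
  two families can differ: the difference is affine along the pencil and vanishes twice.\<close>

lemma phi_eq_residual: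
  assumes ab: "iso z a b" and \<theta>: "skew \<theta> a = 0" "skew \<theta> b = 0" "pf \<theta> = 0"
    and \<rho>: "\<And>x y. \<rho> x y = bil M' (ch z x) (kp (skew \<theta> y) 0)"
    and b0: "\<beta>0 = kf z a d * kf z b c - kf z a c * kf z b d" "\<beta>0 \<noteq> 0"
    and b1: "\<beta>1 = kf z a d * \<rho> b c + \<rho> a d * kf z b c - kf z a c * \<rho> b d - \<rho> a c * kf z b d"
    and b2: "\<beta>2 = \<rho> a d * \<rho> b c - \<rho> a c * \<rho> b d" "\<beta>2 \<noteq> 0"
    and disc: "\<beta>1\<^sup>2 - 4 * \<beta>0 * \<beta>2 \<noteq> 0"
  shows "\<exists>v. iso z a v \<and> kf z b v \<noteq> 0 \<and> phi z a v = phi z a b"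
proof -
  define k where "k t x y = kf (z + t *s \<theta>) x y" for t x y
  note ks = kf_simps[of "z + t *s \<theta>" for t, folded k_def]
  have kc: "k t x y = k t y x" for t x y unfolding k_def by (rule kf_commute)
  have ch_ab: "ch (z + t *s \<theta>) a = ch z a" "ch (z + t *s \<theta>) b = ch z b" for t
    by (simp_all add: ch_line \<theta> kp_0)
  have kab: "k t a a = 0" "k t a b = 0" "k t b b = 0" "k t b a = 0" for t
    using ab kf_commute[of z b a] unfolding k_def kf_def ch_ab iso_def by simp_all
  have kl: "k t a y = kf z a y + t * \<rho> a y" "k t b y = kf z b y + t * \<rho> b y" for t y
    unfolding k_def kf_def ch_ab ch_line[of z t \<theta> y] \<rho> by (simp_all add: bil_add_right bil_smult_right)
  \<comment> \<open>\<open>u t\<close> spans the part of \<open><c, d>\<close> orthogonal to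
    \<open>a\<close>, and \<open>f t\<close> is the second isotropic direction in
    \<open><b, u t>\<close>. So \<open><a, f t>\<close> is the other line through
    \<open>a\<close>.\<close>
  define u where "u t = k t a d *s c + (- k t a c) *s d" for t
  define bb where "bb t = k t b (u t)" for t
  define cc where "cc t = k t (u t) (u t)" for t
  define f where "f t = cc t *s b + (- 2 * bb t) *s u t" for t
  have bb: "bb t = \<beta>0 + \<beta>1 * t + \<beta>2 * t\<^sup>2" for t
    unfolding bb_def u_def ks kl b0 b1 b2 by (simp add: power2_eq_square algebra_simps)
  define T where "T = {t. bb t = 0}"
  have fin: "finite T"
  proof -
    have "T \<subseteq> {t. poly [:\<beta>0, \<beta>1, \<beta>2:] t = 0}" by (auto simp: T_def bb power2_eq_square algebra_simps)
    moreover have "finite {t. poly [:\<beta>0, \<beta>1, \<beta>2:] t = 0}" using b0(2) by (intro poly_roots_finite) simp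
    ultimately show ?thesis by (rule finite_subset)
  qed
  have au: "k t a (u t) = 0" for t by (simp add: u_def ks)
  have bf: "k t b (f t) = - 2 * (bb t)\<^sup>2" for t
    by (simp add: f_def ks kab power2_eq_square flip: bb_def)
  have iso_f: "iso (z + t *s \<theta>) a (f t)" if "t \<notin> T" for t
  proof -
    have nz: "bb t \<noteq> 0" using that by (simp add: T_def)
    have "indep2 a (f t)" unfolding indep2_def
    proof (intro allI impI)
      fix l m assume 0: "l *s a + m *s f t = 0"
      then have "k t b (l *s a + m *s f t) = 0" by (simp add: ks)
      then have "m = 0" using nz by (simp add: ks kab bf)
      then show "l = 0 \<and> m = 0" using 0 ab indep2_nonzero[of a b] by (simp add: iso_def)
    qed
    moreover have "k t a (f t) = 0" by (simp add: f_def ks kab au)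
    moreover have "k t (f t) (f t) = 0"
    proof -
      have "k t (u t) b = bb t" by (simp add: bb_def kc)
      then show ?thesis
        by (simp add: f_def ks kab power2_eq_square algebra_simps flip: bb_def cc_def)
    qed
    ultimately show ?thesis using kab by (simp add: iso_def k_def)
  qed
  have iso_ab: "iso (z + t *s \<theta>) a b" for t using ab kab unfolding iso_def k_def by simp
  define g where "g t = phi (z + t *s \<theta>) a (f t) - phi (z + t *s \<theta>) a b" for t
  have kh: "(\<lambda>t. k t (x t) (y t)) holomorphic_on UNIV"
    if "\<And>i. (\<lambda>t. x t $ i) holomorphic_on UNIV" "\<And>i. (\<lambda>t. y t $ i) holomorphic_on UNIV" for x y
    unfolding k_def by (intro kf_holomorphic that) (simp, intro holomorphic_intros)
  have uh: "(\<lambda>t. u t $ i) holomorphic_on UNIV" for i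
    unfolding u_def by (simp, intro holomorphic_intros kh)
  have fh: "(\<lambda>t. f t $ i) holomorphic_on UNIV" for i
    unfolding f_def cc_def bb_def by (simp, intro holomorphic_intros kh uh)
  have gh: "g holomorphic_on (- T)"
    unfolding g_def
    by (intro holomorphic_on_diff phi_holomorphic open_Compl finite_imp_closed fin holomorphic_on_subset[OF fh] iso_f iso_ab)
       (auto intro!: holomorphic_intros)
  obtain C where C: "C \<ge> 0" "\<And>z a b. iso z a b \<Longrightarrow> cmod (phi z a b) \<le> C * norm (pure z)" using phi_bound by metis
  obtain K where K: "K \<ge> 0" "\<And>t. norm (pure (z + t *s \<theta>)) \<le> K * (1 + cmod t)"
    using pure_line_bound[OF \<theta>(3)] by metis
  have "cmod (g t) \<le> (2 * C * K) * (1 + cmod t)" if "t \<notin> T" for t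
  proof -
    have "cmod (g t) \<le> C * norm (pure (z + t *s \<theta>)) + C * norm (pure (z + t *s \<theta>))"
      unfolding g_def using norm_triangle_ineq4 C(2)[OF iso_f[OF that]] C(2)[OF iso_ab[of t]] by (smt (verit))
    also have "\<dots> \<le> (2 * C) * (K * (1 + cmod t))"
      using mult_left_mono[OF K(2)[of t] C(1)] by simp
    finally show ?thesis by (simp add: mult.assoc)
  qed
  then obtain p q where pq: "\<And>t. t \<notin> T \<Longrightarrow> g t = p + q * t"
    using affine_if_linear_growth[OF fin gh] by metis
  have i4: "indep4 a b c d" unfolding indep4_def
  proof (intro allI impI)
    fix l m n s assume 0: "l *s a + m *s b + n *s c + s *s d = 0"
    have "k 0 a (l *s a + m *s b + n *s c + s *s d) = 0" "k 0 b (l *s a + m *s b + n *s c + s *s d) = 0"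
      unfolding 0 by (simp_all add: ks)
    then have "n * kf z a c + s * kf z a d = 0" "n * kf z b c + s * kf z b d = 0"
      by (simp_all add: ks kab) (simp_all add: k_def)
    then have "n * \<beta>0 = 0" "s * \<beta>0 = 0" unfolding b0 by algebra+
    then have ns: "n = 0" "s = 0" using b0(2) by auto
    then have "l = 0 \<and> m = 0" using indep2D[of a b l m] 0 ab by (simp add: iso_def)
    then show "l = 0 \<and> m = 0 \<and> n = 0 \<and> s = 0" using ns by simp
  qed
  \<comment> \<open>\<open>bb t\<close> is, up to sign, the determinant of the pairing between
    \<open><a, b>\<close> and \<open><c, d>\<close>. Where it vanishes, \<open><a, b>\<close>
    contains a nonzero vector of the radical.\<close>
  have un: "unambiguous (z + t *s \<theta>)" if "t \<in> T" for t
  proof (rule unambiguous_degenerate, rule ccontr)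
    assume D: "Dt (z + t *s \<theta>) \<noteq> 0"
    have "k t a c * k t b d - k t a d * k t b c = 0"
      using that by (simp add: T_def bb_def u_def ks algebra_simps)
    then obtain x y where xy: "x \<noteq> 0 \<or> y \<noteq> 0" "x * k t a c + y * k t b c = 0" "x * k t a d + y * k t b d = 0"
      using singular2 by blast
    have n0: "k t (x *s a + y *s b) w = 0" for w
    proof -
      obtain l m n s where "w = l *s a + m *s b + n *s c + s *s d" using indep4_spans[OF i4] by blast
      then have "k t (x *s a + y *s b) w = n * (x * k t a c + y * k t b c) + s * (x * k t a d + y * k t b d)"
        by (simp add: ks kab algebra_simps)
      then show ?thesis using xy by simp
    qed
    have "x *s a + y *s b = 0" by (rule kf_nondegenerate[OF D n0[unfolded k_def]])
    then show False using xy(1) ab indep2D[of a b] by (auto simp: iso_def)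
  qed
  \<comment> \<open>Both values in \<open>g\<close> have the same limit at a degenerate parameter,
    where only one value is possible.\<close>
  have zero: "p + q * t = 0" if "t \<in> T" for t
  proof -
    obtain x where x: "\<And>n. x n \<notin> T" "x \<longlonglongrightarrow> t" using sequence_avoiding_finite[OF fin] by metis
    have lim: "(\<lambda>n. z + x n *s \<theta>) \<longlonglongrightarrow> z + t *s \<theta>"
      by (intro tendsto_add tendsto_const vec_tendstoI) (simp, intro tendsto_intros x)
    have "(\<lambda>n. g (x n)) \<longlonglongrightarrow> phi (z + t *s \<theta>) a b - phi (z + t *s \<theta>) a b"
      unfolding g_def
      by (intro tendsto_diff phi_limit_unambiguous[OF lim _ un[OF that]] iso_ab iso_f x)
    then have "(\<lambda>n. p + q * x n) \<longlonglongrightarrow> 0" using pq x by simp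
    moreover have "(\<lambda>n. p + q * x n) \<longlonglongrightarrow> p + q * t" by (intro tendsto_intros x)
    ultimately show ?thesis using LIMSEQ_unique by blast
  qed
  define s where "s = csqrt (\<beta>1\<^sup>2 - 4 * \<beta>0 * \<beta>2)"
  have s: "s\<^sup>2 = \<beta>1\<^sup>2 - 4 * \<beta>0 * \<beta>2" "s \<noteq> 0" using disc by (simp_all add: s_def)
  define t1 t2 where "t1 = (- \<beta>1 + s) / (2 * \<beta>2)" and "t2 = (- \<beta>1 - s) / (2 * \<beta>2)"
  have "t1 \<in> T" "t2 \<in> T"
  proof -
    have e: "2 * \<beta>2 * t1 = - \<beta>1 + s" "2 * \<beta>2 * t2 = - \<beta>1 - s" using b2(2) by (simp_all add: t1_def t2_def)
    have "4 * \<beta>2 * bb t1 = 0" "4 * \<beta>2 * bb t2 = 0" unfolding bb using e s(1) by algebra+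
    then show "t1 \<in> T" "t2 \<in> T" using b2(2) by (simp_all add: T_def)
  qed
  then have "p + q * t1 = 0" "p + q * t2 = 0" using zero by auto
  then have "q * (t1 - t2) = 0" by algebra
  moreover have "t1 - t2 = s / \<beta>2" by (simp add: t1_def t2_def flip: diff_divide_distrib)
  ultimately have "q = 0" using s b2 by simp
  then have "p = 0" using \<open>p + q * t1 = 0\<close> by simp
  have T0: "0 \<notin> T" using b0(2) by (simp add: T_def bb)
  then have "g 0 = 0" using pq \<open>p = 0\<close> \<open>q = 0\<close> by simp
  then have "phi z a (f 0) = phi z a b" by (simp add: g_def)
  moreover have "iso z a (f 0)" using iso_f[OF T0] by simp
  moreover have "kf z b (f 0) \<noteq> 0" using bf[of 0] T0 by (simp add: T_def k_def)
  ultimately show ?thesis by blast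
qed

lemma kf_origin: "kf 0 a b = (\<Sum>i\<in>UNIV. p$i * a$i * b$i)"
  and bil_origin: "bil M' (ch 0 a) (kp x 0) = (\<Sum>i\<in>UNIV. r$i * a$i * x$i)"
proof -
  have b: "bil M' (kp x w) (kp x' w') = (\<Sum>i\<in>UNIV. p$i * (x$i * x'$i + w$i * w'$i) + r$i * (x$i * w'$i + x'$i * w$i))" for x w x' w'
  proof -
    have "2 * bil M' (kp x w) (kp x' w') = qform M' (kp (x + x') (w + w')) - qform M' (kp x w) - qform M' (kp x' w')"
      by (simp add: kp_add qform_add[OF sym'])
    also have "\<dots> = 2 * (\<Sum>i\<in>UNIV. p$i * (x$i * x'$i + w$i * w'$i) + r$i * (x$i * w'$i + x'$i * w$i))"
      unfolding q'_kp sum_4 by (simp add: power2_eq_square algebra_simps)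
    finally show ?thesis by simp
  qed
  show "kf 0 a b = (\<Sum>i\<in>UNIV. p$i * a$i * b$i)" "bil M' (ch 0 a) (kp x 0) = (\<Sum>i\<in>UNIV. r$i * a$i * x$i)"
    by (simp_all add: kf_def ch_def skew_linear b mult_ac)
qed

lemma Dt_origin: "Dt 0 \<noteq> 0"
proof
  assume "Dt 0 = 0"
  then obtain n where n: "n \<noteq> 0" "\<And>w. kf 0 n w = 0" using kf_radical by blast
  have "n $ i = 0" for i
  proof -
    have "kf 0 n (axis i 1) = (\<Sum>j\<in>UNIV. if j = i then p$j * n$j else 0)"
      unfolding kf_origin by (rule sum.cong) (auto simp: axis_def)
    then show ?thesis using n(2) p_nz[of i] by simp
  qed
  then show False using n by (simp add: vec_eq_iff)
qed

text \<open>The hypotheses of \<open>phi_eq_residual\<close> are nonvanishing conditions along a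
  holomorphic frame, so they need to be checked at \<open>t = 0\<close> only, where all the forms
  are diagonal. A whole neighbourhood is required to start the continuation.\<close>

lemma unambiguous_near_origin:
  "\<exists>V. open V \<and> 0 \<in> V \<and> (\<forall>t\<in>V. unambiguous (t *s z))"
proof -
  define x1 x2 x3 x4 where "x1 = csqrt (p$2)" and "x2 = \<i> * csqrt (p$1)"
    and "x3 = csqrt (p$4)" and "x4 = \<i> * csqrt (p$3)"
  have xn: "x1 \<noteq> 0" "x2 \<noteq> 0" "x3 \<noteq> 0" "x4 \<noteq> 0" using p_nz by (auto simp: x1_def x2_def x3_def x4_def)
  have xs: "x1\<^sup>2 = p$2" "x2\<^sup>2 = - p$1" "x3\<^sup>2 = p$4" "x4\<^sup>2 = - p$3"
    by (simp_all add: x1_def x2_def x3_def x4_def power_mult_distrib)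
  define e u where "e = vec4 x1 x2 0 0" and "u = vec4 0 0 x3 x4"
  have i0: "iso 0 e u"
  proof -
    have "indep2 e u" using xn unfolding indep2_def e_def u_def by (auto simp: vec_eq_iff forall_4)
    moreover have "kf 0 e e = p$1 * x1\<^sup>2 + p$2 * x2\<^sup>2" "kf 0 u u = p$3 * x3\<^sup>2 + p$4 * x4\<^sup>2" "kf 0 e u = 0"
      by (simp_all add: kf_origin sum_4 e_def u_def power2_eq_square)
    ultimately show ?thesis unfolding iso_def xs by simp
  qed
  obtain v w where vw: "kf 0 e v = 0" "kf 0 v v = 0" "kf 0 u v = 1" "kf 0 e w = 1"
    using hyperbolic_frame[OF Dt_origin i0] by metis
  have Zh: "(\<lambda>t. (t *s z) $ i) holomorphic_on U" for i U by (simp, intro holomorphic_intros)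
  obtain V e' u' v' where V: "open V" "0 \<in> V" "V \<subseteq> UNIV"
    "\<And>i. (\<lambda>t. e' t $ i) holomorphic_on V" "\<And>i. (\<lambda>t. u' t $ i) holomorphic_on V" "\<And>i. (\<lambda>t. v' t $ i) holomorphic_on V"
    "e' 0 = e" "u' 0 = u" "v' 0 = v"
    "\<And>t. t \<in> V \<Longrightarrow> iso (t *s z) (e' t) (u' t)"
  proof (rule frame_extend[of UNIV 0 "\<lambda>t. t *s z" e u v w])
  qed (use Zh i0 vw in auto)
  define \<theta> where "\<theta> t = kill (e' t) (u' t)" for t
  define \<rho> where "\<rho> t x y = bil M' (ch (t *s z) x) (kp (skew (\<theta> t) y) 0)" for t x y
  \<comment> \<open>With this choice, at \<open>t = 0\<close> the coefficient
    \<open>\<beta>1\<close> vanishes, \<open>\<beta>0\<close> is up to sign a product of entries of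
    \<open>p\<close> with \<open>x1\<close> and \<open>x3\<close>, and \<open>\<beta>2\<close> has
    the factors \<open>r$2 - r$1\<close> and \<open>r$3 - r$4\<close>. Here the distinctness of the
    entries of \<open>r\<close> enters.\<close>
  define c d where "c = (axis 1 1 :: complex ^ 4)" and "d = (axis 3 1 :: complex ^ 4)"
  define \<beta>0 where "\<beta>0 t = kf (t *s z) (e' t) d * kf (t *s z) (u' t) c - kf (t *s z) (e' t) c * kf (t *s z) (u' t) d" for t
  define \<beta>1 where "\<beta>1 t = kf (t *s z) (e' t) d * \<rho> t (u' t) c + \<rho> t (e' t) d * kf (t *s z) (u' t) c
    - kf (t *s z) (e' t) c * \<rho> t (u' t) d - \<rho> t (e' t) c * kf (t *s z) (u' t) d" for t
  define \<beta>2 where "\<beta>2 t = \<rho> t (e' t) d * \<rho> t (u' t) c - \<rho> t (e' t) c * \<rho> t (u' t) d" for t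
  have G: "f \<in> poly_functions {g. g holomorphic_on V}" if "f holomorphic_on V" for f
    by (rule poly_functions.gen) (simp add: that)
  have th: "(\<lambda>t. \<theta> t $ i) \<in> poly_functions {g. g holomorphic_on V}" for i
  proof -
    have "(\<lambda>t. \<theta> t $ 1) \<in> poly_functions {g. g holomorphic_on V}" "(\<lambda>t. \<theta> t $ 2) \<in> poly_functions {g. g holomorphic_on V}"
      "(\<lambda>t. \<theta> t $ 3) \<in> poly_functions {g. g holomorphic_on V}" "(\<lambda>t. \<theta> t $ 4) \<in> poly_functions {g. g holomorphic_on V}"
      "(\<lambda>t. \<theta> t $ 5) \<in> poly_functions {g. g holomorphic_on V}" "(\<lambda>t. \<theta> t $ 6) \<in> poly_functions {g. g holomorphic_on V}"
      unfolding \<theta>_def kill_def vec6_nth by (rule G, intro holomorphic_intros V)+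
    then show ?thesis using exhaust_6[of i] by (elim disjE) (simp_all only:)
  qed
  have \<rho>h: "(\<lambda>t. \<rho> t (a t) y) holomorphic_on V" if "\<And>i. (\<lambda>t. a t $ i) holomorphic_on V" for a y
    unfolding \<rho>_def
    by (rule poly_functions_closed_holomorphic, intro bil_poly ch_poly kp_poly skew_poly th poly_functions.const)
       (rule G, rule Zh, rule G, rule that)
  have kh: "(\<lambda>t. kf (t *s z) (a t) y) holomorphic_on V" if "\<And>i. (\<lambda>t. a t $ i) holomorphic_on V" for a y
    by (intro kf_holomorphic Zh that holomorphic_intros)
  have bh: "\<beta>0 holomorphic_on V" "\<beta>1 holomorphic_on V" "\<beta>2 holomorphic_on V"
    unfolding \<beta>0_def \<beta>1_def \<beta>2_def by (intro holomorphic_intros kh \<rho>h V)+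
  define W where "W = {t \<in> V. \<beta>0 t * \<beta>2 t * ((\<beta>1 t)\<^sup>2 - 4 * \<beta>0 t * \<beta>2 t) * Dt (t *s z) \<noteq> 0}"
  have Dh: "(\<lambda>t. Dt (t *s z)) holomorphic_on V"
    by (rule poly_functions_closed_holomorphic, intro Dt_poly, rule G, rule Zh)
  have "open W" unfolding W_def by (intro open_nonzero V holomorphic_intros bh Dh)
  moreover have "0 \<in> W"
  proof -
    have th0: "\<theta> 0 = vec6 0 (- (x2 * x4)) (x2 * x3) 0 (x1 * x3) (x1 * x4)"
      by (simp add: \<theta>_def V e_def u_def kill_def vec_eq_iff forall_6)
    have k0: "kf 0 e c = p$1 * x1" "kf 0 e d = 0" "kf 0 u c = 0" "kf 0 u d = p$3 * x3"
      by (simp_all add: kf_origin sum_4 e_def u_def c_def d_def axis_def)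
    have r0: "\<rho> 0 e c = 0" "\<rho> 0 u d = 0" "\<rho> 0 u c = x2 * x3 * x4 * (r$3 - r$4)" "\<rho> 0 e d = x1 * x2 * x4 * (r$2 - r$1)"
      unfolding \<rho>_def th0 vector_smult_lzero bil_origin sum_4
      by (simp_all add: e_def u_def c_def d_def axis_def algebra_simps)
    have "\<beta>0 0 = - (p$1 * x1 * (p$3 * x3))" "\<beta>1 0 = 0"
      "\<beta>2 0 = x1 * x2 * x4 * (r$2 - r$1) * (x2 * x3 * x4 * (r$3 - r$4))"
      by (simp_all add: \<beta>0_def \<beta>1_def \<beta>2_def V k0 r0)
    then show ?thesis using p_nz xn r_inj[of 1 2] r_inj[of 3 4] Dt_origin V(2) by (simp add: W_def)
  qed
  moreover have "unambiguous (t *s z)" if "t \<in> W" for t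
  proof -
    have t: "t \<in> V" "\<beta>0 t \<noteq> 0" "\<beta>2 t \<noteq> 0" "(\<beta>1 t)\<^sup>2 - 4 * \<beta>0 t * \<beta>2 t \<noteq> 0" "Dt (t *s z) \<noteq> 0"
      using that by (auto simp: W_def)
    note iso = V(10)[OF t(1)]
    obtain v where v: "iso (t *s z) (e' t) v" "kf (t *s z) (u' t) v \<noteq> 0" "phi (t *s z) (e' t) v = phi (t *s z) (e' t) (u' t)"
      using phi_eq_residual[OF iso kill[of "e' t" "u' t", folded \<theta>_def] \<rho>_def[of t] \<beta>0_def t(2) \<beta>1_def \<beta>2_def t(3,4)] by blast
    show ?thesis by (rule unambiguous_meet[OF t(5) iso v(1,2)]) (simp add: v)
  qed
  ultimately show ?thesis by blast
qed

text \<open>Continuation along the complex line through 0 and z, off the finitely many degenerate forms.\<close>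

lemma unambiguous: "unambiguous z"
proof (cases "Dt z = 0")
  case True
  then show ?thesis by (rule unambiguous_degenerate)
next
  case False
  define \<Omega> where "\<Omega> = - {t. Dt (t *s z) = 0}"
  have "finite {t. Dt (0 + t *s z) = 0}" using Dt_origin by (intro Dt_line_finite[of _ 0]) simp
  then have fin: "finite {t. Dt (t *s z) = 0}" by simp
  then have \<Omega>: "open \<Omega>" "connected \<Omega>"
    unfolding \<Omega>_def Compl_eq_Diff_UNIV
    using connected_open_delete_finite[of "UNIV :: complex set"] connected_UNIV[where 'a = complex]
    by (simp_all add: open_Diff finite_imp_closed)
  define S where "S = {t \<in> \<Omega>. unambiguous (t *s z)}"
  \<comment> \<open>The interior is open by construction, so that only closedness in
    \<open>\<Omega>\<close> is left to the continuation.\<close>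
  define S' where "S' = interior S"
  have S'\<Omega>: "S' \<subseteq> \<Omega>" unfolding S'_def S_def using interior_subset by blast
  have Zh: "(\<lambda>t. (t *s z) $ i) holomorphic_on U" for i U by (simp, intro holomorphic_intros)
  obtain V0 where V0: "open V0" "0 \<in> V0" "\<And>t. t \<in> V0 \<Longrightarrow> unambiguous (t *s z)"
    using unambiguous_near_origin[of z] by blast
  have "0 \<in> S'"
    unfolding S'_def
  proof (rule interiorI)
    show "open (V0 \<inter> \<Omega>)" using V0 \<Omega> by blast
    show "0 \<in> V0 \<inter> \<Omega>" using V0 Dt_origin by (simp add: \<Omega>_def)
    show "V0 \<inter> \<Omega> \<subseteq> S" using V0 by (auto simp: S_def)
  qed
  have closure: "t0 \<in> S'" if t0: "t0 \<in> \<Omega>" "t0 \<in> closure S'" for t0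
  proof -
    have D: "Dt (t0 *s z) \<noteq> 0" using t0 by (simp add: \<Omega>_def)
    obtain e u where eu: "iso (t0 *s z) e u" using iso_exists by blast
    obtain v w where vw: "kf (t0 *s z) e v = 0" "kf (t0 *s z) v v = 0" "kf (t0 *s z) u v = 1" "kf (t0 *s z) e w = 1"
      using hyperbolic_frame[OF D eu] by metis
    obtain V e' u' v' where V: "open V" "t0 \<in> V" "V \<subseteq> \<Omega>"
      "\<And>i. (\<lambda>t. e' t $ i) holomorphic_on V" "\<And>i. (\<lambda>t. u' t $ i) holomorphic_on V" "\<And>i. (\<lambda>t. v' t $ i) holomorphic_on V"
      "\<And>t. t \<in> V \<Longrightarrow> iso (t *s z) (e' t) (u' t)" "\<And>t. t \<in> V \<Longrightarrow> iso (t *s z) (e' t) (v' t)"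
      "\<And>t. t \<in> V \<Longrightarrow> kf (t *s z) (u' t) (v' t) \<noteq> 0"
    proof (rule frame_extend[of \<Omega> t0 "\<lambda>t. t *s z" e u v w])
    qed (use \<Omega> t0 Zh eu vw in auto)
    obtain \<epsilon> where \<epsilon>: "\<epsilon> > 0" "ball t0 \<epsilon> \<subseteq> V" using V openE by blast
    let ?B = "ball t0 \<epsilon>"
    have "?B \<inter> S' \<noteq> {}"
      using open_Int_closure_eq_empty[of ?B S'] t0(2) centre_in_ball[of t0 \<epsilon>] \<epsilon>(1) by blast
    \<comment> \<open>The values on the two lines through \<open>e' t\<close> are holomorphic on the
      ball and agree on its nonempty open intersection with \<open>S'\<close>.\<close>
    have eq: "phi (t *s z) (e' t) (u' t) = phi (t *s z) (e' t) (v' t)" if "t \<in> ?B" for t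
    proof (rule analytic_continuation_open[of "?B \<inter> S'" ?B "\<lambda>t. phi (t *s z) (e' t) (u' t)" "\<lambda>t. phi (t *s z) (e' t) (v' t)"])
      show "(\<lambda>t. phi (t *s z) (e' t) (u' t)) holomorphic_on ?B" "(\<lambda>t. phi (t *s z) (e' t) (v' t)) holomorphic_on ?B"
        by (intro phi_holomorphic V Zh holomorphic_on_subset[OF V(4) \<epsilon>(2)] holomorphic_on_subset[OF V(5) \<epsilon>(2)]
            holomorphic_on_subset[OF V(6) \<epsilon>(2)] open_ball; use \<epsilon> in blast)+
      show "phi (t *s z) (e' t) (u' t) = phi (t *s z) (e' t) (v' t)" if "t \<in> ?B \<inter> S'" for t
      proof -
        have "t \<in> V" "unambiguous (t *s z)" using that \<epsilon> interior_subset[of S] by (auto simp: S'_def S_def)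
        then show ?thesis using V(7,8) unfolding unambiguous_def by blast
      qed
    qed (use that \<open>?B \<inter> S' \<noteq> {}\<close> in \<open>auto simp: S'_def\<close>)
    have un: "unambiguous (t *s z)" if "t \<in> ?B" for t
    proof -
      have t: "t \<in> V" "t \<in> \<Omega>" using that \<epsilon>(2) V(3) by auto
      then have "Dt (t *s z) \<noteq> 0" by (simp add: \<Omega>_def)
      then show ?thesis using unambiguous_meet V(7-9)[OF t(1)] eq[OF that] by blast
    qed
    have "?B \<subseteq> S" using un \<epsilon>(2) V(3) by (auto simp: S_def simp del: mem_ball)
    then show ?thesis unfolding S'_def
      using interiorI[OF open_ball, of t0 t0 \<epsilon>] \<epsilon>(1) by simp
  qed
  have "S' = \<Omega>"
  proof -
    have "openin (top_of_set \<Omega>) S'" using S'\<Omega> by (simp add: S'_def open_openin_trans \<Omega>)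
    moreover have "closedin (top_of_set \<Omega>) S'"
      unfolding closedin_closed using closure S'\<Omega> closure_subset[of S']
      by (intro exI[of _ "closure S'"]) auto
    ultimately show ?thesis using \<Omega>(2) \<open>0 \<in> S'\<close> unfolding connected_clopen by blast
  qed
  moreover have "1 \<in> \<Omega>" using False by (simp add: \<Omega>_def)
  ultimately have "1 \<in> S" using interior_subset by (auto simp: S'_def)
  then show ?thesis by (simp add: S_def)
qed

end

section \<open>Linearity of a section on one chart\<close>

context spin_section
begin

definition Fv :: "complex ^ 6 \<Rightarrow> complex" where
  "Fv z = (let ab = SOME ab. iso z (fst ab) (snd ab) in phi z (fst ab) (snd ab))"

lemma Fv: "iso z a b \<Longrightarrow> phi z a b = Fv z"
proof -
  assume ab: "iso z a b"
  then have "iso z (fst (SOME ab. iso z (fst ab) (snd ab))) (snd (SOME ab. iso z (fst ab) (snd ab)))"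
    by (intro someI[of "\<lambda>ab. iso z (fst ab) (snd ab)" "(a, b)"]) simp
  then show ?thesis using unambiguous[of z] ab unfolding unambiguous_def Fv_def Let_def by blast
qed

lemma Fv_tendsto: assumes "Z \<longlonglongrightarrow> z" shows "(\<lambda>n. Fv (Z n)) \<longlonglongrightarrow> Fv z"
proof -
  have "\<forall>n. \<exists>a b. iso (Z n) a b" by (simp add: iso_exists)
  then obtain a b where ab: "\<And>n. iso (Z n) (a n) (b n)" by metis
  obtain a0 b0 where ab0: "iso z a0 b0" using iso_exists by blast
  have "(\<lambda>n. phi (Z n) (a n) (b n)) \<longlonglongrightarrow> phi z a0 b0"
    by (rule phi_limit_unambiguous[OF assms ab unambiguous ab0])
  then show ?thesis using Fv ab ab0 by simp
qed

lemma line_tendsto: "x \<longlonglongrightarrow> t \<Longrightarrow> (\<lambda>n. z + x n *s \<theta>) \<longlonglongrightarrow> z + t *s \<theta>" for z \<theta> :: "complex ^ 'k"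
  by (intro tendsto_add tendsto_const vec_tendstoI) (simp, intro tendsto_intros)

text \<open>Off finitely many degenerate parameters, local frames make \<open>Fv\<close> holomorphic
  along the line. It grows linearly, as the pure spinors do, hence it is affine there; continuity
  extends this to the degenerate parameters.\<close>

lemma Fv_line_nondegenerate:
  assumes \<theta>: "pf \<theta> = 0" and D: "Dt z \<noteq> 0"
  shows "Fv (z + t *s \<theta>) = Fv z + t * (Fv (z + \<theta>) - Fv z)"
proof -
  define T where "T = {t. Dt (z + t *s \<theta>) = 0}"
  have fin: "finite T" unfolding T_def by (rule Dt_line_finite[of z 0]) (simp add: D)
  have Zh: "(\<lambda>t. (z + t *s \<theta>) $ i) holomorphic_on U" for i U by (simp, intro holomorphic_intros)
  have op: "open (- T)" using fin by (simp add: finite_imp_closed open_Compl)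
  have "(\<lambda>t. Fv (z + t *s \<theta>)) field_differentiable at t0" if t0: "t0 \<in> - T" for t0
  proof -
    have D': "Dt (z + t0 *s \<theta>) \<noteq> 0" using t0 by (simp add: T_def)
    obtain e u where eu: "iso (z + t0 *s \<theta>) e u" using iso_exists by blast
    obtain v w where vw: "kf (z + t0 *s \<theta>) e v = 0" "kf (z + t0 *s \<theta>) v v = 0"
      "kf (z + t0 *s \<theta>) u v = 1" "kf (z + t0 *s \<theta>) e w = 1"
      using hyperbolic_frame[OF D' eu] by metis
    obtain V e' u' v' where V: "open V" "t0 \<in> V"
      "\<And>i. (\<lambda>t. e' t $ i) holomorphic_on V" "\<And>i. (\<lambda>t. u' t $ i) holomorphic_on V"
      "\<And>t. t \<in> V \<Longrightarrow> iso (z + t *s \<theta>) (e' t) (u' t)"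
      by (rule frame_extend[OF op t0, of "\<lambda>t. z + t *s \<theta>", OF Zh eu vw]) blast
    have "(\<lambda>t. phi (z + t *s \<theta>) (e' t) (u' t)) holomorphic_on V"
      by (rule phi_holomorphic[OF V(1,5) Zh V(3,4)])
    then have "(\<lambda>t. Fv (z + t *s \<theta>)) holomorphic_on V"
      by (rule holomorphic_transform) (simp add: Fv V(5))
    then show ?thesis using V by (intro holomorphic_on_imp_differentiable_at[of _ V])
  qed
  then have hol: "(\<lambda>t. Fv (z + t *s \<theta>)) holomorphic_on (- T)"
    using op by (simp add: holomorphic_on_open field_differentiable_def)
  obtain C where C: "C \<ge> 0" "\<And>z a b. iso z a b \<Longrightarrow> cmod (phi z a b) \<le> C * norm (pure z)" using phi_bound by metis
  obtain K where K: "K \<ge> 0" "\<And>t. norm (pure (z + t *s \<theta>)) \<le> K * (1 + cmod t)"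
    using pure_line_bound[OF \<theta>] by metis
  have "cmod (Fv (z + t *s \<theta>)) \<le> (C * K) * (1 + cmod t)" for t
  proof -
    obtain a b where ab: "iso (z + t *s \<theta>) a b" using iso_exists by blast
    have "cmod (Fv (z + t *s \<theta>)) \<le> C * norm (pure (z + t *s \<theta>))" using C(2)[OF ab] Fv[OF ab] by simp
    also have "\<dots> \<le> C * (K * (1 + cmod t))" by (intro mult_left_mono K C)
    finally show ?thesis by (simp add: mult.assoc)
  qed
  then obtain p' q' where pq: "\<And>t. t \<notin> T \<Longrightarrow> Fv (z + t *s \<theta>) = p' + q' * t"
    using affine_if_linear_growth[OF fin hol] by metis
  have all: "Fv (z + t *s \<theta>) = p' + q' * t" for t
  proof -
    obtain x where x: "\<And>n. x n \<notin> T" "x \<longlonglongrightarrow> t" using sequence_avoiding_finite[OF fin] by metis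
    have "(\<lambda>n. Fv (z + x n *s \<theta>)) \<longlonglongrightarrow> Fv (z + t *s \<theta>)" by (intro Fv_tendsto line_tendsto x)
    then have "(\<lambda>n. p' + q' * x n) \<longlonglongrightarrow> Fv (z + t *s \<theta>)" using pq x by simp
    moreover have "(\<lambda>n. p' + q' * x n) \<longlonglongrightarrow> p' + q' * t" by (intro tendsto_intros x)
    ultimately show ?thesis using LIMSEQ_unique by blast
  qed
  show ?thesis using all[of t] all[of 0] all[of 1] by (simp add: algebra_simps)
qed

text \<open>A degenerate \<open>z\<close> is a limit of nondegenerate points on its line through the
  origin, where the form is nondegenerate.\<close>

lemma Fv_line:
  assumes \<theta>: "pf \<theta> = 0"
  shows "Fv (z + t *s \<theta>) = Fv z + t * (Fv (z + \<theta>) - Fv z)"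
proof -
  have "finite {t. Dt (0 + t *s z) = 0}" by (rule Dt_line_finite[of 0 0]) (simp add: Dt_origin)
  then obtain x where x: "\<And>n. x n \<notin> {t. Dt (0 + t *s z) = 0}" "x \<longlonglongrightarrow> 1"
    using sequence_avoiding_finite by metis
  have 1: "(\<lambda>n. x n *s z) \<longlonglongrightarrow> z" using line_tendsto[OF x(2), of 0 z] by simp
  have "(\<lambda>n. Fv (x n *s z + t *s \<theta>)) \<longlonglongrightarrow> Fv (z + t *s \<theta>)"
    by (intro Fv_tendsto tendsto_add 1 tendsto_const)
  moreover have "(\<lambda>n. Fv (x n *s z + t *s \<theta>)) \<longlonglongrightarrow> Fv z + t * (Fv (z + \<theta>) - Fv z)"
  proof -
    have "Fv (x n *s z + t *s \<theta>) = Fv (x n *s z) + t * (Fv (x n *s z + \<theta>) - Fv (x n *s z))" for n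
      using x(1)[of n] by (intro Fv_line_nondegenerate \<theta>) simp
    then show ?thesis by (simp only:) (intro tendsto_intros Fv_tendsto 1)
  qed
  ultimately show ?thesis by (rule LIMSEQ_unique)
qed

text \<open>\<open>z + (\<theta> + \<theta>')\<close> is the midpoint of
  \<open>z + 2 *s \<theta>\<close> and \<open>z + 2 *s \<theta>'\<close>, and all three lines
  involved have null directions.\<close>

lemma Fv_add:
  assumes "pf \<theta> = 0" "pf \<theta>' = 0" "pf (\<theta>' - \<theta>) = 0"
  shows "Fv (z + (\<theta> + \<theta>')) - Fv z = (Fv (z + \<theta>) - Fv z) + (Fv (z + \<theta>') - Fv z)"
proof -
  have p: "pf (2 *s (\<theta>' - \<theta>)) = 0" using assms(3) by (simp add: pf_def algebra_simps) algebra
  have e: "(z + 2 *s \<theta>) + (1/2) *s (2 *s (\<theta>' - \<theta>)) = z + (\<theta> + \<theta>')"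
    "(z + 2 *s \<theta>) + 2 *s (\<theta>' - \<theta>) = z + 2 *s \<theta>'" by (simp_all add: vec_eq_iff algebra_simps)
  have "Fv (z + (\<theta> + \<theta>')) = Fv (z + 2 *s \<theta>) + (1/2) * (Fv (z + 2 *s \<theta>') - Fv (z + 2 *s \<theta>))"
    using Fv_line[OF p, of "z + 2 *s \<theta>" "1/2"] unfolding e .
  then have "2 * Fv (z + (\<theta> + \<theta>')) = Fv (z + 2 *s \<theta>) + Fv (z + 2 *s \<theta>')"
    by (simp add: diff_divide_distrib)
  also have "\<dots> = 2 * (Fv (z + \<theta>) + Fv (z + \<theta>') - Fv z)"
    unfolding Fv_line[OF assms(1)] Fv_line[OF assms(2)] by simp
  finally have "Fv (z + (\<theta> + \<theta>')) = Fv (z + \<theta>) + Fv (z + \<theta>') - Fv z"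
    by (simp only: mult_cancel_left) simp
  then show ?thesis by simp
qed

lemma Fv_linear3:
  assumes "\<And>a b c. pf (a *s \<theta>1 + b *s \<theta>2 + c *s \<theta>3) = 0"
  shows "Fv (z + (a *s \<theta>1 + b *s \<theta>2 + c *s \<theta>3)) =
    Fv z + a * (Fv (z + \<theta>1) - Fv z) + b * (Fv (z + \<theta>2) - Fv z) + c * (Fv (z + \<theta>3) - Fv z)"
proof -
  have 1: "pf (a *s \<theta>1 + b *s \<theta>2) = 0" "pf (c *s \<theta>3) = 0" "pf (c *s \<theta>3 - (a *s \<theta>1 + b *s \<theta>2)) = 0"
    using assms[of a b 0] assms[of 0 0 c] assms[of "-a" "-b" c] by (simp_all add: algebra_simps)
  have 2: "pf (a *s \<theta>1) = 0" "pf (b *s \<theta>2) = 0" "pf (b *s \<theta>2 - a *s \<theta>1) = 0"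
    using assms[of a 0 0] assms[of 0 b 0] assms[of "-a" b 0] by (simp_all add: algebra_simps)
  have 3: "pf \<theta>1 = 0" "pf \<theta>2 = 0" "pf \<theta>3 = 0"
    using assms[of 1 0 0] assms[of 0 1 0] assms[of 0 0 1] by simp_all
  show ?thesis
    using Fv_add[OF 1, of z] Fv_add[OF 2, of z] Fv_line[OF 3(1), of z a] Fv_line[OF 3(2), of z b] Fv_line[OF 3(3), of z c]
    by (simp add: algebra_simps)
qed

text \<open>The coordinates 1, 2, 3 and the coordinates 4, 5, 6 span null 3-spaces.
  \<open>Fv\<close> is affine along translates of either, so the only terms of higher degree are the
  mixed ones \<open>g i j\<close>. Those of orthogonal basis vectors vanish by
  \<open>Fv_add\<close>; applied to \<open>E 1 + E 2\<close> and \<open>E 4 - E 5\<close>, and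
  likewise with 3 and 6, it makes the other three equal, so that they add up to a multiple of
  \<open>pf\<close>.\<close>

lemma Fv_form: "\<exists>c d. \<exists>l :: complex ^ 6. \<forall>z. Fv z = c + (\<Sum>i\<in>UNIV. l$i * z$i) + d * pf z"
proof -
  define E where "E i = (axis i 1 :: complex ^ 6)" for i
  define c where "c = Fv 0"
  define l where "l i = Fv (E i) - c" for i
  define g where "g i j = Fv (E i + E j) - Fv (E i) - (Fv (E j) - c)" for i j
  have A: "Fv (z + (a *s E 1 + b *s E 2 + d *s E 3)) =
    Fv z + a * (Fv (z + E 1) - Fv z) + b * (Fv (z + E 2) - Fv z) + d * (Fv (z + E 3) - Fv z)" for z a b d
    by (rule Fv_linear3) (simp add: E_def pf_def axis_def)
  have B: "Fv (z + (a *s E 4 + b *s E 5 + d *s E 6)) =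
    Fv z + a * (Fv (z + E 4) - Fv z) + b * (Fv (z + E 5) - Fv z) + d * (Fv (z + E 6) - Fv z)" for z a b d
    by (rule Fv_linear3) (simp add: E_def pf_def axis_def)
  have form: "Fv z = c + (z$1 * l 1 + z$2 * l 2 + z$3 * l 3) + (z$4 * l 4 + z$5 * l 5 + z$6 * l 6)
    + (z$1 * (z$4 * g 1 4 + z$5 * g 1 5 + z$6 * g 1 6) + z$2 * (z$4 * g 2 4 + z$5 * g 2 5 + z$6 * g 2 6)
     + z$3 * (z$4 * g 3 4 + z$5 * g 3 5 + z$6 * g 3 6))" for z
  proof -
    let ?b = "z$4 *s E 4 + z$5 *s E 5 + z$6 *s E 6"
    have z: "z = ?b + (z$1 *s E 1 + z$2 *s E 2 + z$3 *s E 3)"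
      by (simp add: vec_eq_iff forall_6 E_def axis_def)
    have e: "?b + E i = E i + ?b" for i by (rule add.commute)
    have b: "Fv ?b = c + z$4 * l 4 + z$5 * l 5 + z$6 * l 6" using B[of 0] by (simp add: c_def l_def)
    have bi: "Fv (?b + E i) = Fv (E i) + z$4 * (Fv (E i + E 4) - Fv (E i)) + z$5 * (Fv (E i + E 5) - Fv (E i))
       + z$6 * (Fv (E i + E 6) - Fv (E i))" for i unfolding e by (rule B)
    have "Fv z = Fv (?b + (z$1 *s E 1 + z$2 *s E 2 + z$3 *s E 3))" using z by simp
    also have "\<dots> = Fv ?b + z$1 * (Fv (?b + E 1) - Fv ?b) + z$2 * (Fv (?b + E 2) - Fv ?b) + z$3 * (Fv (?b + E 3) - Fv ?b)"
      by (rule A)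
    also have "\<dots> = c + (z$1 * l 1 + z$2 * l 2 + z$3 * l 3) + (z$4 * l 4 + z$5 * l 5 + z$6 * l 6)
    + (z$1 * (z$4 * g 1 4 + z$5 * g 1 5 + z$6 * g 1 6) + z$2 * (z$4 * g 2 4 + z$5 * g 2 5 + z$6 * g 2 6)
     + z$3 * (z$4 * g 3 4 + z$5 * g 3 5 + z$6 * g 3 6))"
      unfolding bi b l_def g_def by (simp add: algebra_simps)
    finally show ?thesis .
  qed
  have off: "g 1 5 = 0" "g 1 6 = 0" "g 2 4 = 0" "g 2 6 = 0" "g 3 4 = 0" "g 3 5 = 0"
    using Fv_add[of "E 1" "E 5" 0] Fv_add[of "E 1" "E 6" 0] Fv_add[of "E 2" "E 4" 0] Fv_add[of "E 2" "E 6" 0]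
      Fv_add[of "E 3" "E 4" 0] Fv_add[of "E 3" "E 5" 0]
    by (simp_all add: E_def pf_def axis_def g_def c_def algebra_simps)
  have d1: "g 1 4 = g 2 5"
  proof -
    have "Fv (E 1 + E 2 + (E 4 - E 5)) - Fv 0 = (Fv (E 1 + E 2) - Fv 0) + (Fv (E 4 - E 5) - Fv 0)"
      using Fv_add[of "E 1 + E 2" "E 4 - E 5" 0] by (simp add: E_def pf_def axis_def)
    then show ?thesis unfolding form off by (simp add: E_def axis_def algebra_simps)
  qed
  have d2: "g 1 4 = g 3 6"
  proof -
    have "Fv (E 1 + E 3 + (E 4 - E 6)) - Fv 0 = (Fv (E 1 + E 3) - Fv 0) + (Fv (E 4 - E 6) - Fv 0)"
      using Fv_add[of "E 1 + E 3" "E 4 - E 6" 0] by (simp add: E_def pf_def axis_def)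
    then show ?thesis unfolding form off by (simp add: E_def axis_def algebra_simps)
  qed
  have U6: "UNIV = {1, 2, 3, 4, 5, 6 :: 6}" using exhaust_6 by blast
  have "Fv z = c + (\<Sum>i\<in>UNIV. (\<chi> i. l i)$i * z$i) + g 1 4 * pf z" for z
    unfolding form[of z] off d1[symmetric] d2[symmetric] U6 by (simp add: pf_def algebra_simps)
  then show ?thesis by blast
qed

text \<open>The polynomial of \<open>Fv_form\<close> is a linear form in the coordinates of
  \<open>pure z\<close>. Any spinor with \<open>s \<noteq> 0\<close> in a fibre is \<open>s\<close>
  times a pure one: two nonzero annihilating vectors determine its last coordinate to be the
  Pfaffian.\<close>

lemma chart_linear:
  "\<exists>L. (\<forall>u\<in>half_spin \<gamma> y0. \<forall>v\<in>half_spin \<gamma> y0. L (u + v) = L u + L v) \<and>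
     (\<forall>c. \<forall>u\<in>half_spin \<gamma> y0. L (c *s u) = c * L u) \<and>
     (\<forall>E\<in>X. \<forall>s z t. io s z t \<in> spinor_sub \<gamma> y0 E \<longrightarrow> s \<noteq> 0 \<longrightarrow> \<sigma> E (io s z t) = (L (io s z t) :: complex))"
proof -
  obtain c d and l :: "complex ^ 6" where form: "\<And>z. Fv z = c + (\<Sum>i\<in>UNIV. l$i * z$i) + d * pf z"
    using Fv_form by blast
  have inj: "s = s' \<and> z = z' \<and> t = t'" if "io s z t = io s' z' t'" for s z t s' z' t'
  proof -
    have "io (s - s') (z - z') (t - t') = 0"
      using io_add[of "s - s'" s' "z - z'" z' "t - t'" t'] that by simp
    then show ?thesis using io_eq_0 by auto
  qed
  define L where "L u = (let (s, z, t) = SOME (s, z, t). u = io s z t in c * s + (\<Sum>i\<in>UNIV. l$i * z$i) + d * t)" for u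
  have L: "L (io s z t) = c * s + (\<Sum>i\<in>UNIV. l$i * z$i) + d * t" for s z t
  proof -
    have "(SOME (s', z', t'). io s z t = io s' z' t') = (s, z, t)"
      by (rule some_equality) (auto dest: inj)
    then show ?thesis by (simp add: L_def)
  qed
  have "L (u + v) = L u + L v" if uv: "u \<in> half_spin \<gamma> y0" "v \<in> half_spin \<gamma> y0" for u v
  proof -
    obtain s z t s' z' t' where "u = io s z t" "v = io s' z' t'" using uv unfolding io_range by blast
    then show ?thesis by (simp add: L algebra_simps sum.distrib flip: io_add)
  qed
  moreover have "L (k *s u) = k * L u" if uh: "u \<in> half_spin \<gamma> y0" for u k
  proof -
    obtain s z t where "u = io s z t" using uh unfolding io_range by blast
    then show ?thesis by (simp add: L algebra_simps sum_distrib_left flip: io_smult)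
  qed
  moreover have "\<sigma> E (io s z t) = L (io s z t)" if E: "E \<in> X" and u: "io s z t \<in> spinor_sub \<gamma> y0 E" and s: "s \<noteq> 0" for E s z t
  proof -
    obtain \<xi> \<eta> where i: "indep2 \<xi> \<eta>" and E': "E = vec.span {\<xi>, \<eta>}" using X_basis[OF E] .
    obtain x w x' w' where k: "\<xi> = kp x w" "\<eta> = kp x' w'" using kp_surj by metis
    define Z where "Z = (1/s) *s z"
    define T where "T = t / s"
    have io: "io s z t = s *s io 1 Z T" using s io_smult[of s 1 Z T] by (simp add: Z_def T_def vec.scale_scale)
    have adm: "adm \<xi> \<eta> (io s z t)" using i E u by (simp add: adm_def E')
    then have adm1: "adm \<xi> \<eta> (io 1 Z T)"
      using s unfolding io adm_def spinor_sub_span cl_right_smult by (auto simp: io_range)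
    then have "cl \<xi> (io 1 Z T) = 0" "cl \<eta> (io 1 Z T) = 0" by (simp_all add: adm_def spinor_sub_span)
    then have r: "x = skew Z w" "T *s w = - skew (dual6 Z) x" "x' = skew Z w'"
      unfolding k cl_def rel by simp_all
    have xi: "\<xi> = ch Z w" "\<eta> = ch Z w'" by (simp_all add: k ch_def r)
    have "w \<noteq> 0" using indep2_nonzero[OF i] by (auto simp: xi ch_eq_0)
    moreover have "T *s w = pf Z *s w" using r(1,2) skew_dual[of Z w] by simp
    ultimately have T: "T = pf Z" by simp
    have "iso Z w w'"
      using i E X_span[OF i] unfolding iso_def kf_def xi indep2_ch E' by (simp add: qform_bil)
    then have "val \<xi> \<eta> (io 1 Z T) = Fv Z" unfolding xi T using Fv[of Z w w'] by (simp add: phi_def pure_def)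
    then have "\<sigma> E (io s z t) = s * Fv Z"
      using val_linear(2)[OF adm1 adm1, of s] by (simp add: val_def E' io)
    also have "\<dots> = c * s + (\<Sum>i\<in>UNIV. l$i * (s * Z$i)) + d * (s * T)"
      by (simp add: form T algebra_simps sum_distrib_left)
    also have "\<dots> = L (io s z t)" using s by (simp add: L Z_def T_def)
    finally show ?thesis .
  qed
  ultimately show ?thesis by blast
qed

end

section \<open>Passage from one chart to the whole half-spin module\<close>

lemma UNIV_6: "UNIV = {1, 2, 3, 4, 5, 6 :: 6}"
  using exhaust_6 by blast

lemma sum_6: "sum f (UNIV :: 6 set) = f 1 + f 2 + f 3 + f 4 + f 5 + f 6"
  unfolding UNIV_6 by (simp add: ac_simps)

text \<open>Eight affine charts cover the quadric of pure spinors. They are permuted by the following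
  changes of the hyperbolic basis.\<close>

definition sw_kp :: "(complex ^ 4 \<Rightarrow> complex ^ 4 \<Rightarrow> complex ^ 8) \<Rightarrow> complex ^ 4 \<Rightarrow> complex ^ 4 \<Rightarrow> complex ^ 8" where
  "sw_kp kp x w = kp (vec4 (w$1) (w$2) (x$3) (x$4)) (vec4 (x$1) (x$2) (w$3) (w$4))"

definition sw_io :: "(complex \<Rightarrow> complex ^ 6 \<Rightarrow> complex \<Rightarrow> complex ^ 16) \<Rightarrow> complex \<Rightarrow> complex ^ 6 \<Rightarrow> complex \<Rightarrow> complex ^ 16" where
  "sw_io io s z t = io (- z$1) (vec6 s (- z$6) (z$5) (- t) (- z$3) (z$2)) (z$4)"

definition rt_kp :: "(complex ^ 4 \<Rightarrow> complex ^ 4 \<Rightarrow> complex ^ 8) \<Rightarrow> complex ^ 4 \<Rightarrow> complex ^ 4 \<Rightarrow> complex ^ 8" where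
  "rt_kp kp x w = kp (vec4 (x$3) (x$1) (x$2) (x$4)) (vec4 (w$3) (w$1) (w$2) (w$4))"

definition rt_io :: "(complex \<Rightarrow> complex ^ 6 \<Rightarrow> complex \<Rightarrow> complex ^ 16) \<Rightarrow> complex \<Rightarrow> complex ^ 6 \<Rightarrow> complex \<Rightarrow> complex ^ 16" where
  "rt_io io s z t = io s (vec6 (- z$2) (- z$6) (z$4) (- z$5) (- z$3) (z$1)) t"

definition al_kp :: "(complex ^ 4 \<Rightarrow> complex ^ 4 \<Rightarrow> complex ^ 8) \<Rightarrow> complex ^ 4 \<Rightarrow> complex ^ 4 \<Rightarrow> complex ^ 8" where
  "al_kp kp x w = kp w x"

definition al_io :: "(complex \<Rightarrow> complex ^ 6 \<Rightarrow> complex \<Rightarrow> complex ^ 16) \<Rightarrow> complex \<Rightarrow> complex ^ 6 \<Rightarrow> complex \<Rightarrow> complex ^ 16" where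
  "al_io io s z t = io t (- dual6 z) s"

lemma vec4_add: "vec4 (a + a') (b + b') (c + c') (d + d') = vec4 a b c d + vec4 a' b' c' d'"
  and vec4_smult: "vec4 (k * a) (k * b) (k * c) (k * d) = k *s vec4 a b c d"
  and vec4_eq_0: "vec4 a b c d = 0 \<longleftrightarrow> a = 0 \<and> b = 0 \<and> c = 0 \<and> d = 0"
  and vec4_collapse: "vec4 (x$1) (x$2) (x$3) (x$4) = x"
  by (simp_all add: vec_eq_iff forall_4)

lemma vec6_add: "vec6 (a + a') (b + b') (c + c') (d + d') (e + e') (f + f')
    = vec6 a b c d e f + vec6 a' b' c' d' e' f'"
  and vec6_smult: "vec6 (k * a) (k * b) (k * c) (k * d) (k * e) (k * f) = k *s vec6 a b c d e f"
  and vec6_eq_0: "vec6 a b c d e f = 0 \<longleftrightarrow> a = 0 \<and> b = 0 \<and> c = 0 \<and> d = 0 \<and> e = 0 \<and> f = 0"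
  and vec6_collapse: "vec6 (z$1) (z$2) (z$3) (z$4) (z$5) (z$6) = z"
  by (simp_all add: vec_eq_iff forall_6)

lemma eq_0_4: "x = 0 \<longleftrightarrow> x$1 = 0 \<and> x$2 = 0 \<and> x$3 = 0 \<and> x$4 = 0" for x :: "complex ^ 4"
  by (simp add: vec_eq_iff forall_4)

lemma eq_0_6: "z = 0 \<longleftrightarrow> z$1 = 0 \<and> z$2 = 0 \<and> z$3 = 0 \<and> z$4 = 0 \<and> z$5 = 0 \<and> z$6 = 0" for z :: "complex ^ 6"
  by (simp add: vec_eq_iff forall_6)

text \<open>Written as eight scalar equations, which the relabellings only permute, up to
  sign.\<close>

lemma spin_relations:
  "s *s x = skew z w \<and> t *s w = - skew (dual6 z) x \<longleftrightarrow>
     s * x$1 - (z$1 * w$2 + z$2 * w$3 + z$3 * w$4) = 0 \<and>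
     s * x$2 + z$1 * w$1 - z$6 * w$3 + z$5 * w$4 = 0 \<and>
     s * x$3 + z$2 * w$1 + z$6 * w$2 - z$4 * w$4 = 0 \<and>
     s * x$4 + z$3 * w$1 - z$5 * w$2 + z$4 * w$3 = 0 \<and>
     t * w$1 + z$4 * x$2 + z$5 * x$3 + z$6 * x$4 = 0 \<and>
     t * w$2 - z$4 * x$1 + z$3 * x$3 - z$2 * x$4 = 0 \<and>
     t * w$3 - z$5 * x$1 - z$3 * x$2 + z$1 * x$4 = 0 \<and>
     t * w$4 - z$6 * x$1 + z$2 * x$2 - z$1 * x$3 = 0"
  unfolding vec_eq_iff forall_4 vector_smult_component vector_uminus_component skew_nth dual6_def vec6_nth conj_assoc
  by (intro arg_cong2[where f = "(\<and>)"]; rule iffI; algebra)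

context pencil_model
begin

lemma io_inj: "io s z t = io s' z' t' \<longleftrightarrow> s = s' \<and> z = z' \<and> t = t'"
  using io_add[of "s - s'" s' "z - z'" z' "t - t'" t'] io_eq_0[of "s - s'" "z - z'" "t - t'"] by auto

text \<open>The members of two hyperbolic pairs are exchanged. Their number is even, which preserves
  the half-spin module; the new first coordinate is that of the index pair 12, up to sign.\<close>

lemma swap12: "pencil_model M \<gamma> y0 (sw_kp kp) (sw_io io) M' p r"
proof (intro pencil_model.intro spin_model.intro pencil_model_axioms.intro clifford_axioms)
  fix x x' w w' :: "complex ^ 4" and c and \<xi> and z z' :: "complex ^ 6" and s s' t t' u and i j :: 4
  show "sw_kp kp (x + x') (w + w') = sw_kp kp x w + sw_kp kp x' w'"
    "sw_kp kp (c *s x) (c *s w) = c *s sw_kp kp x w"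
    by (simp_all add: sw_kp_def vec4_add vec4_smult kp_add kp_smult)
  show "sw_kp kp x w = 0 \<longleftrightarrow> x = 0 \<and> w = 0"
    by (auto simp: sw_kp_def kp_eq_0 vec4_eq_0 eq_0_4)
  show "\<exists>x w. \<xi> = sw_kp kp x w"
  proof -
    obtain x w where "\<xi> = kp x w" using kp_surj by blast
    then show ?thesis
      by (intro exI[of _ "vec4 (w$1) (w$2) (x$3) (x$4)"] exI[of _ "vec4 (x$1) (x$2) (w$3) (w$4)"])
         (simp add: sw_kp_def vec4_collapse)
  qed
  have n: "vec6 (s + s') (- z$6 - z'$6) (z$5 + z'$5) (- t - t') (- z$3 - z'$3) (z$2 + z'$2)
     = vec6 s (- z$6) (z$5) (- t) (- z$3) (z$2) + vec6 s' (- z'$6) (z'$5) (- t') (- z'$3) (z'$2)"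
    "vec6 (c * s) (- (c * z$6)) (c * z$5) (- (c * t)) (- (c * z$3)) (c * z$2) = c *s vec6 s (- z$6) (z$5) (- t) (- z$3) (z$2)"
    by (simp_all add: vec_eq_iff forall_6)
  show "sw_io io (s + s') (z + z') (t + t') = sw_io io s z t + sw_io io s' z' t'"
    "sw_io io (c * s) (c *s z) (c * t) = c *s sw_io io s z t"
    by (simp_all add: sw_io_def n flip: io_add io_smult)
  show "sw_io io s z t = 0 \<longleftrightarrow> s = 0 \<and> z = 0 \<and> t = 0"
    by (auto simp: sw_io_def io_eq_0 vec6_eq_0 eq_0_6)
  show "u \<in> half_spin \<gamma> y0 \<longleftrightarrow> (\<exists>s z t. u = sw_io io s z t)"
  proof
    assume "u \<in> half_spin \<gamma> y0"
    then obtain s z t where "u = io s z t" using io_range by blast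
    then have "u = sw_io io (z$1) (vec6 (- s) (z$6) (- z$5) t (z$3) (- z$2)) (- z$4)"
      by (simp add: sw_io_def vec6_collapse)
    then show "\<exists>s z t. u = sw_io io s z t" by blast
  qed (auto simp: sw_io_def io_range)
  show "\<gamma> (sw_kp kp x w) *v sw_io io s z t = 0 \<longleftrightarrow> s *s x = skew z w \<and> t *s w = - skew (dual6 z) x"
  proof -
    have e1: "(- z$1) * w$1 - (s * x$2 + (- z$6) * w$3 + z$5 * w$4) = 0 \<longleftrightarrow> s * x$2 + z$1 * w$1 - z$6 * w$3 + z$5 * w$4 = 0"
      by (rule iffI; algebra)
    have e2: "(- z$1) * w$2 + s * x$1 - z$2 * w$3 + (- z$3) * w$4 = 0 \<longleftrightarrow> s * x$1 - (z$1 * w$2 + z$2 * w$3 + z$3 * w$4) = 0"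
      by (rule iffI; algebra)
    have e3: "(- z$1) * x$3 + (- z$6) * x$1 + z$2 * x$2 - (- t) * w$4 = 0 \<longleftrightarrow> t * w$4 - z$6 * x$1 + z$2 * x$2 - z$1 * x$3 = 0"
      by (rule iffI; algebra)
    have e4: "(- z$1) * x$4 + z$5 * x$1 - (- z$3) * x$2 + (- t) * w$3 = 0 \<longleftrightarrow> t * w$3 - z$5 * x$1 - z$3 * x$2 + z$1 * x$4 = 0"
      by (rule iffI; algebra)
    have e5: "z$4 * x$1 + (- t) * w$2 + (- z$3) * x$3 + z$2 * x$4 = 0 \<longleftrightarrow> t * w$2 - z$4 * x$1 + z$3 * x$3 - z$2 * x$4 = 0"
      by (rule iffI; algebra)
    have e6: "z$4 * x$2 - (- t) * w$1 + z$5 * x$3 - (- z$6) * x$4 = 0 \<longleftrightarrow> t * w$1 + z$4 * x$2 + z$5 * x$3 + z$6 * x$4 = 0"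
      by (rule iffI; algebra)
    have e7: "z$4 * w$3 - (- z$3) * w$1 - z$5 * w$2 + s * x$4 = 0 \<longleftrightarrow> s * x$4 + z$3 * w$1 - z$5 * w$2 + z$4 * w$3 = 0"
      by (rule iffI; algebra)
    have e8: "z$4 * w$4 - z$2 * w$1 + (- z$6) * w$2 - s * x$3 = 0 \<longleftrightarrow> s * x$3 + z$2 * w$1 + z$6 * w$2 - z$4 * w$4 = 0"
      by (rule iffI; algebra)
    show ?thesis
      unfolding sw_kp_def sw_io_def rel spin_relations vec4_nth vec6_nth e1 e2 e3 e4 e5 e6 e7 e8 by blast
  qed
  show "qform M (sw_kp kp x w) = (\<Sum>i\<in>UNIV. x$i * w$i)"
    "qform M' (sw_kp kp x w) = (\<Sum>i\<in>UNIV. p$i * ((x$i)\<^sup>2 + (w$i)\<^sup>2) + 2 * r$i * x$i * w$i)"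
    by (simp_all add: sw_kp_def q_kp q'_kp sum_4 algebra_simps)
qed (use sym' p_nz r_inj in auto)

text \<open>Cyclic relabelling of the first three pairs. The signs in \<open>rt_io\<close> arise
  where an index pair is reversed.\<close>

lemma rotate: "pencil_model M \<gamma> y0 (rt_kp kp) (rt_io io) M' (vec4 (p$2) (p$3) (p$1) (p$4)) (vec4 (r$2) (r$3) (r$1) (r$4))"
proof (intro pencil_model.intro spin_model.intro pencil_model_axioms.intro clifford_axioms)
  fix x x' w w' :: "complex ^ 4" and c and \<xi> and z z' :: "complex ^ 6" and s s' t t' u and i j :: 4
  show "rt_kp kp (x + x') (w + w') = rt_kp kp x w + rt_kp kp x' w'"
    "rt_kp kp (c *s x) (c *s w) = c *s rt_kp kp x w"
    by (simp_all add: rt_kp_def vec4_add vec4_smult kp_add kp_smult)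
  show "rt_kp kp x w = 0 \<longleftrightarrow> x = 0 \<and> w = 0"
    by (auto simp: rt_kp_def kp_eq_0 vec4_eq_0 eq_0_4)
  show "\<exists>x w. \<xi> = rt_kp kp x w"
  proof -
    obtain x w where "\<xi> = kp x w" using kp_surj by blast
    then show ?thesis
      by (intro exI[of _ "vec4 (x$2) (x$3) (x$1) (x$4)"] exI[of _ "vec4 (w$2) (w$3) (w$1) (w$4)"])
         (simp add: rt_kp_def vec4_collapse)
  qed
  have n: "vec6 (- z$2 - z'$2) (- z$6 - z'$6) (z$4 + z'$4) (- z$5 - z'$5) (- z$3 - z'$3) (z$1 + z'$1)
     = vec6 (- z$2) (- z$6) (z$4) (- z$5) (- z$3) (z$1) + vec6 (- z'$2) (- z'$6) (z'$4) (- z'$5) (- z'$3) (z'$1)"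
    "vec6 (- (c * z$2)) (- (c * z$6)) (c * z$4) (- (c * z$5)) (- (c * z$3)) (c * z$1) = c *s vec6 (- z$2) (- z$6) (z$4) (- z$5) (- z$3) (z$1)"
    by (simp_all add: vec_eq_iff forall_6)
  show "rt_io io (s + s') (z + z') (t + t') = rt_io io s z t + rt_io io s' z' t'"
    "rt_io io (c * s) (c *s z) (c * t) = c *s rt_io io s z t"
    by (simp_all add: rt_io_def n flip: io_add io_smult)
  show "rt_io io s z t = 0 \<longleftrightarrow> s = 0 \<and> z = 0 \<and> t = 0"
    by (auto simp: rt_io_def io_eq_0 vec6_eq_0 eq_0_6)
  show "u \<in> half_spin \<gamma> y0 \<longleftrightarrow> (\<exists>s z t. u = rt_io io s z t)"
  proof
    assume "u \<in> half_spin \<gamma> y0"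
    then obtain s z t where "u = io s z t" using io_range by blast
    then have "u = rt_io io s (vec6 (z$6) (- z$1) (- z$5) (z$3) (- z$4) (- z$2)) t"
      by (simp add: rt_io_def vec6_collapse)
    then show "\<exists>s z t. u = rt_io io s z t" by blast
  qed (auto simp: rt_io_def io_range)
  show "\<gamma> (rt_kp kp x w) *v rt_io io s z t = 0 \<longleftrightarrow> s *s x = skew z w \<and> t *s w = - skew (dual6 z) x"
  proof -
    have e1: "s * x$3 - ((- z$2) * w$1 + (- z$6) * w$2 + z$4 * w$4) = 0 \<longleftrightarrow> s * x$3 + z$2 * w$1 + z$6 * w$2 - z$4 * w$4 = 0"
      by (rule iffI; algebra)
    have e2: "s * x$1 + (- z$2) * w$3 - z$1 * w$2 + (- z$3) * w$4 = 0 \<longleftrightarrow> s * x$1 - (z$1 * w$2 + z$2 * w$3 + z$3 * w$4) = 0"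
      by (rule iffI; algebra)
    have e3: "s * x$2 + (- z$6) * w$3 + z$1 * w$1 - (- z$5) * w$4 = 0 \<longleftrightarrow> s * x$2 + z$1 * w$1 - z$6 * w$3 + z$5 * w$4 = 0"
      by (rule iffI; algebra)
    have e4: "s * x$4 + z$4 * w$3 - (- z$3) * w$1 + (- z$5) * w$2 = 0 \<longleftrightarrow> s * x$4 + z$3 * w$1 - z$5 * w$2 + z$4 * w$3 = 0"
      by (rule iffI; algebra)
    have e5: "t * w$3 + (- z$5) * x$1 + (- z$3) * x$2 + z$1 * x$4 = 0 \<longleftrightarrow> t * w$3 - z$5 * x$1 - z$3 * x$2 + z$1 * x$4 = 0"
      by (rule iffI; algebra)
    have e6: "t * w$1 - (- z$5) * x$3 + z$4 * x$2 - (- z$6) * x$4 = 0 \<longleftrightarrow> t * w$1 + z$4 * x$2 + z$5 * x$3 + z$6 * x$4 = 0"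
      by (rule iffI; algebra)
    have e7: "t * w$2 - (- z$3) * x$3 - z$4 * x$1 + (- z$2) * x$4 = 0 \<longleftrightarrow> t * w$2 - z$4 * x$1 + z$3 * x$3 - z$2 * x$4 = 0"
      by (rule iffI; algebra)
    have e8: "t * w$4 - z$1 * x$3 + (- z$6) * x$1 - (- z$2) * x$2 = 0 \<longleftrightarrow> t * w$4 - z$6 * x$1 + z$2 * x$2 - z$1 * x$3 = 0"
      by (rule iffI; algebra)
    show ?thesis
      unfolding rt_kp_def rt_io_def rel spin_relations vec4_nth vec6_nth e1 e2 e3 e4 e5 e6 e7 e8 by blast
  qed
  show "qform M (rt_kp kp x w) = (\<Sum>i\<in>UNIV. x$i * w$i)"
    "qform M' (rt_kp kp x w) = (\<Sum>i\<in>UNIV. vec4 (p$2) (p$3) (p$1) (p$4)$i * ((x$i)\<^sup>2 + (w$i)\<^sup>2) + 2 * vec4 (r$2) (r$3) (r$1) (r$4)$i * x$i * w$i)"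
    by (simp_all add: rt_kp_def q_kp q'_kp sum_4 algebra_simps)
  show "vec4 (p$2) (p$3) (p$1) (p$4)$i \<noteq> 0" using exhaust_4[of i] p_nz by auto
  show "vec4 (r$2) (r$3) (r$1) (r$4)$i \<noteq> vec4 (r$2) (r$3) (r$1) (r$4)$j" if "i \<noteq> j"
    using that r_inj[of 1 2] r_inj[of 1 3] r_inj[of 1 4] r_inj[of 2 3] r_inj[of 2 4] r_inj[of 3 4]
      exhaust_4[of i] exhaust_4[of j] by auto
qed (use sym' in auto)

text \<open>Exchanging all four pairs interchanges the first and the last coordinate, so it relates
  the two opposite charts.\<close>

lemma swap_all: "pencil_model M \<gamma> y0 (al_kp kp) (al_io io) M' p r"
proof (intro pencil_model.intro spin_model.intro pencil_model_axioms.intro clifford_axioms)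
  fix x x' w w' :: "complex ^ 4" and c and \<xi> and z z' :: "complex ^ 6" and s s' t t' u and i j :: 4
  show "al_kp kp (x + x') (w + w') = al_kp kp x w + al_kp kp x' w'"
    "al_kp kp (c *s x) (c *s w) = c *s al_kp kp x w"
    by (simp_all add: al_kp_def kp_add kp_smult)
  show "al_kp kp x w = 0 \<longleftrightarrow> x = 0 \<and> w = 0" by (auto simp: al_kp_def kp_eq_0)
  show "\<exists>x w. \<xi> = al_kp kp x w" using kp_surj[of \<xi>] by (auto simp: al_kp_def)
  have n: "- dual6 (z + z') = - dual6 z + - dual6 z'" "- dual6 (c *s z) = c *s (- dual6 z)" "- dual6 (- dual6 z) = z"
    by (simp_all add: vec_eq_iff forall_6 dual6_def)
  show "al_io io (s + s') (z + z') (t + t') = al_io io s z t + al_io io s' z' t'"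
    "al_io io (c * s) (c *s z) (c * t) = c *s al_io io s z t"
    unfolding al_io_def n(1,2) io_add io_smult by (rule refl)+
  show "al_io io s z t = 0 \<longleftrightarrow> s = 0 \<and> z = 0 \<and> t = 0"
    by (auto simp: al_io_def io_eq_0 dual6_def vec6_eq_0 eq_0_6)
  show "u \<in> half_spin \<gamma> y0 \<longleftrightarrow> (\<exists>s z t. u = al_io io s z t)"
  proof
    assume "u \<in> half_spin \<gamma> y0"
    then obtain s z t where "u = io s z t" using io_range by blast
    moreover have "- dual6 (- dual6 z) = z" by (simp add: vec_eq_iff forall_6 dual6_def)
    ultimately have "u = al_io io t (- dual6 z) s" by (simp only: al_io_def)
    then show "\<exists>s z t. u = al_io io s z t" by blast
  qed (auto simp: al_io_def io_range)
  show "\<gamma> (al_kp kp x w) *v al_io io s z t = 0 \<longleftrightarrow> s *s x = skew z w \<and> t *s w = - skew (dual6 z) x"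
  proof -
    have "skew (- dual6 z) x = - skew (dual6 z) x" "- skew (dual6 (- dual6 z)) w = skew z w"
      by (simp_all add: vec_eq_iff forall_4 dual6_def)
    then show ?thesis unfolding al_kp_def al_io_def rel by auto
  qed
  show "qform M (al_kp kp x w) = (\<Sum>i\<in>UNIV. x$i * w$i)"
    "qform M' (al_kp kp x w) = (\<Sum>i\<in>UNIV. p$i * ((x$i)\<^sup>2 + (w$i)\<^sup>2) + 2 * r$i * x$i * w$i)"
    by (simp_all add: al_kp_def q_kp q'_kp sum_4 algebra_simps)
qed (use sym' p_nz r_inj in auto)

definition half_spin_linear :: "(complex ^ 16 \<Rightarrow> complex) \<Rightarrow> bool" where
  "half_spin_linear L \<longleftrightarrow> (\<forall>u\<in>half_spin \<gamma> y0. \<forall>v\<in>half_spin \<gamma> y0. L (u + v) = L u + L v) \<and>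
     (\<forall>c. \<forall>u\<in>half_spin \<gamma> y0. L (c *s u) = c * L u)"

lemma io_half_spin: "io s z t \<in> half_spin \<gamma> y0"
  using io_range by blast

lemma half_spin_linear_io:
  assumes "half_spin_linear L"
  shows "L (io s z t) = s * L (io 1 0 0) + (\<Sum>i\<in>UNIV. z$i * L (io 0 (axis i 1) 0)) + t * L (io 0 0 1)"
proof -
  have add: "L (io s z t + io s' z' t') = L (io s z t) + L (io s' z' t')" for s z t s' z' t'
    using assms io_half_spin unfolding half_spin_linear_def by blast
  have sm: "L (c *s io s z t) = c * L (io s z t)" for c s z t
    using assms io_half_spin unfolding half_spin_linear_def by blast
  have sum: "L (io 0 (\<Sum>i\<in>I. z$i *s axis i 1) 0) = (\<Sum>i\<in>I. z$i * L (io 0 (axis i 1) 0))" for I :: "6 set"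
  proof (induction I rule: infinite_finite_induct)
    case (insert i I)
    have "io 0 (\<Sum>i\<in>insert i I. z$i *s axis i 1) 0 = z$i *s io 0 (axis i 1) 0 + io 0 (\<Sum>i\<in>I. z$i *s axis i 1) 0"
      using insert io_smult[of "z$i" 0 "axis i 1" 0] io_add[of 0 0 "z$i *s axis i 1" "\<Sum>i\<in>I. z$i *s axis i 1" 0 0] by simp
    moreover have "io 0 (z$i *s axis i 1) 0 = z$i *s io 0 (axis i 1) 0"
      using io_smult[of "z$i" 0 "axis i 1" 0] by simp
    ultimately show ?case
      using insert add[of 0 "z$i *s axis i 1" 0 0 "\<Sum>i\<in>I. z$i *s axis i 1" 0] sm[of "z$i" 0 "axis i 1" 0] by simp
  qed (use sm[of 0 0 0 0] in \<open>simp_all add: io_0\<close>)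
  have "io s z t = (s *s io 1 0 0 + io 0 (\<Sum>i\<in>UNIV. z$i *s axis i 1) 0) + t *s io 0 0 1"
    using io_smult[of s 1 0 0] io_smult[of t 0 0 1] io_add[of s 0 0 z 0 0] io_add[of s 0 z 0 0 t]
    by (simp add: basis_expansion)
  then show ?thesis
    using add[of s 0 0 0 z 0] add[of s z 0 0 0 t] sm sum[of UNIV] io_add[of s 0 0 z 0 0]
      io_smult[of s 1 0 0] io_smult[of t 0 0 1]
    by (simp add: basis_expansion)
qed

lemma pure_in_spinor_sub: "\<exists>E\<in>X. pure z \<in> spinor_sub \<gamma> y0 E"
proof -
  obtain a b where "iso z a b" using iso_exists by blast
  from adm_ch[OF this] show ?thesis unfolding adm_def by blast
qed

end

text \<open>The pure spinors \<open>(1, z, pf z)\<close> with a nonzero coordinate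
  \<open>z$k\<close> span the half-spin module. It is enough to test the combinations of
  \<open>axis k 1\<close> with one other basis vector; the one dual to \<open>k\<close> detects
  \<open>d7\<close>.\<close>

lemma vanish_off_hyperplane:
  fixes d0 d7 :: complex and d :: "complex ^ 6"
  assumes f: "\<And>z. z$k \<noteq> 0 \<Longrightarrow> d0 + (\<Sum>i\<in>UNIV. z$i * d$i) + pf z * d7 = 0"
  shows "d0 = 0 \<and> d7 = 0 \<and> d = 0"
proof -
  have g: "d0 + a * d$k + b * d$j + a * b * pf (axis k 1 + axis j 1) * d7 = 0" if "a \<noteq> 0" "j \<noteq> k" for a b j
  proof -
    let ?z = "a *s axis k 1 + b *s axis j 1 :: complex ^ 6"
    have "?z $ k \<noteq> 0" using that by (simp add: axis_def)
    moreover have "(\<Sum>i\<in>UNIV. ?z$i * d$i) = a * d$k + b * d$j"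
    proof -
      have ax: "(\<Sum>i\<in>UNIV. (axis k 1 :: complex ^ 6)$i * d$i) = d$k" for k
      proof -
        have "(axis k 1 :: complex ^ 6)$i * d$i = (if i = k then d$i else 0)" for i by (simp add: axis_def)
        then show ?thesis by simp
      qed
      have "?z$i * d$i = a * ((axis k 1 :: complex ^ 6)$i * d$i) + b * ((axis j 1 :: complex ^ 6)$i * d$i)" for i
        by (simp add: algebra_simps)
      then have "(\<Sum>i\<in>UNIV. ?z$i * d$i) = (\<Sum>i\<in>UNIV. a * ((axis k 1 :: complex ^ 6)$i * d$i))
          + (\<Sum>i\<in>UNIV. b * ((axis j 1 :: complex ^ 6)$i * d$i))" by (simp only: sum.distrib)
      then show ?thesis by (simp only: sum_distrib_left[symmetric] ax)
    qed
    moreover have "pf ?z = a * b * pf (axis k 1 + axis j 1)"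
      using exhaust_6[of k] exhaust_6[of j] that(2) by (elim disjE; simp add: pf_def axis_def)
    ultimately show ?thesis using f[of ?z] by (simp add: algebra_simps)
  qed
  have other: "\<exists>j. j \<noteq> k" by (metis zero_neq_one)
  then obtain j0 where "j0 \<noteq> k" by blast
  then have "d0 + d$k = 0" "d0 - d$k = 0" using g[of 1 j0 0] g[of "-1" j0 0] by simp_all
  then have 0: "d0 = 0" "d$k = 0" by (simp_all add: eq_neg_iff_add_eq_0)
  have j: "d$j = 0 \<and> pf (axis k 1 + axis j 1) * d7 = 0" if "j \<noteq> k" for j
  proof -
    have 1: "d$j + pf (axis k 1 + axis j 1) * d7 = 0" "d$j + 2 * pf (axis k 1 + axis j 1) * d7 = 0"
      using g[of 1 j 1] g[of 2 j 1] that 0 by simp_all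
    then have "d$j = 0" by algebra
    then show ?thesis using 1 by simp
  qed
  have "\<exists>j. j \<noteq> k \<and> pf (axis k 1 + axis j 1 :: complex ^ 6) = 1"
    using exhaust_6[of k]
    by (elim disjE) (rule exI[of _ 4] exI[of _ 5] exI[of _ 6] exI[of _ 1] exI[of _ 2] exI[of _ 3], simp add: pf_def axis_def; fail)+
  then have "d7 = 0" using j by force
  moreover have "d = 0" using j 0 by (simp add: vec_eq_iff) metis
  ultimately show ?thesis using 0 by simp
qed

text \<open>The analogue for the chart in which the last coordinate \<open>pf z\<close> is nonzero,
  tested on the three hyperbolic planes.\<close>

lemma vanish_off_quadric:
  fixes d0 d7 :: complex and d :: "complex ^ 6"
  assumes f: "\<And>z. pf z \<noteq> 0 \<Longrightarrow> d0 + (\<Sum>i\<in>UNIV. z$i * d$i) + pf z * d7 = 0"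
  shows "d0 = 0 \<and> d7 = 0 \<and> d = 0"
proof -
  have g: "d0 + a * d$1 + b * d$4 + a * b * d7 = 0" "d0 + a * d$2 + b * d$5 + a * b * d7 = 0"
    "d0 + a * d$3 + b * d$6 + a * b * d7 = 0" if "a \<noteq> 0" "b \<noteq> 0" for a b
    using f[of "vec6 a 0 0 b 0 0"] f[of "vec6 0 a 0 0 b 0"] f[of "vec6 0 0 a 0 0 b"] that
    by (simp_all add: pf_def sum_6 algebra_simps)
  have s: "d0 = 0 \<and> x = 0 \<and> y = 0 \<and> d7 = 0" if "\<And>a b. a \<noteq> 0 \<Longrightarrow> b \<noteq> 0 \<Longrightarrow> d0 + a * x + b * y + a * b * d7 = 0" for x y
  proof -
    have 1: "d0 + x + y + d7 = 0" "d0 + x - y - d7 = 0" "d0 - x + y - d7 = 0" "d0 - x - y + d7 = 0"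
      using that[of 1 1] that[of 1 "-1"] that[of "-1" 1] that[of "-1" "-1"] by simp_all
    then have "4 * d0 = 0" "4 * x = 0" "4 * y = 0" "4 * d7 = 0" by algebra+
    then show ?thesis by simp
  qed
  show ?thesis using s[of "d$1" "d$4"] s[of "d$2" "d$5"] s[of "d$3" "d$6"] g by (simp add: eq_0_6)
qed

context spin_section
begin

definition linear_on_chart :: "(complex \<Rightarrow> complex ^ 6 \<Rightarrow> complex \<Rightarrow> complex) \<Rightarrow> (complex ^ 16 \<Rightarrow> complex) \<Rightarrow> bool" where
  "linear_on_chart co L \<longleftrightarrow> half_spin_linear L \<and>
     (\<forall>E\<in>X. \<forall>s z t. io s z t \<in> spinor_sub \<gamma> y0 E \<longrightarrow> co s z t \<noteq> 0 \<longrightarrow> \<sigma> E (io s z t) = L (io s z t))"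

text \<open>\<open>chart_linear\<close> in the other model. It concerns the same sections, since
  \<open>spinor_sections\<close> does not depend on the labelling, and \<open>co\<close> can be
  nonzero only where the first coordinate of that model is.\<close>

lemma linear_on_other_chart:
  assumes m: "pencil_model M \<gamma> y0 KP IO M' p' r'"
    and co: "\<And>s z t z' t'. io s z t = IO 0 z' t' \<Longrightarrow> co s z t = 0"
  shows "\<exists>L. linear_on_chart co L"
proof -
  interpret m: pencil_model M \<gamma> y0 KP IO M' p' r' by (rule m)
  interpret m: spin_section M \<gamma> y0 KP IO M' p' r' \<sigma>
    by unfold_locales (use sec in \<open>simp add: X_def m.X_def\<close>)
  obtain L where L: "half_spin_linear L"
    "\<And>E s z t. E \<in> X \<Longrightarrow> IO s z t \<in> spinor_sub \<gamma> y0 E \<Longrightarrow> s \<noteq> 0 \<Longrightarrow> \<sigma> E (IO s z t) = L (IO s z t)"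
    using m.chart_linear unfolding half_spin_linear_def X_def m.X_def by blast
  have "\<sigma> E (io s z t) = L (io s z t)"
    if "E \<in> X" "io s z t \<in> spinor_sub \<gamma> y0 E" "co s z t \<noteq> 0" for E s z t
  proof -
    obtain s' z' t' where e: "io s z t = IO s' z' t'" using m.io_range io_half_spin by blast
    then have "s' \<noteq> 0" using co[of s z t z' t'] that(3) by auto
    then show ?thesis using L(2) that e by metis
  qed
  then show ?thesis using L(1) unfolding linear_on_chart_def by blast
qed

text \<open>Two charts have enough common spinors to span the half-spin module, so functionals which
  agree there are equal.\<close>

lemma linear_functionals_agree:
  assumes L: "linear_on_chart (\<lambda>s z t. s) L" and L': "linear_on_chart co L'"
    and co: "(\<exists>k. co = (\<lambda>s z t. z$k)) \<or> co = (\<lambda>s z t. t)" and u: "u \<in> half_spin \<gamma> y0"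
  shows "L u = L' u"
proof -
  have lin: "half_spin_linear L" "half_spin_linear L'" using L L' by (auto simp: linear_on_chart_def)
  define d0 where "d0 = L (io 1 0 0) - L' (io 1 0 0)"
  define d7 where "d7 = L (io 0 0 1) - L' (io 0 0 1)"
  define d where "d = (\<chi> i. L (io 0 (axis i 1) 0) - L' (io 0 (axis i 1) 0))"
  have e: "L (io s z t) - L' (io s z t) = s * d0 + (\<Sum>i\<in>UNIV. z$i * d$i) + t * d7" for s z t
    unfolding half_spin_linear_io[OF lin(1), of s z t] half_spin_linear_io[OF lin(2), of s z t] d0_def d7_def d_def
    by (simp add: algebra_simps sum_subtractf)
  have f: "d0 + (\<Sum>i\<in>UNIV. z$i * d$i) + pf z * d7 = 0" if "co 1 z (pf z) \<noteq> 0" for z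
  proof -
    obtain E where "E \<in> X" "io 1 z (pf z) \<in> spinor_sub \<gamma> y0 E" using pure_in_spinor_sub[of z] by (auto simp: pure_def)
    then have "L (io 1 z (pf z)) = L' (io 1 z (pf z))" using L L' that unfolding linear_on_chart_def by force
    then show ?thesis using e[of 1 z "pf z"] by simp
  qed
  have "d0 = 0 \<and> d7 = 0 \<and> d = 0"
    using co
  proof
    assume "\<exists>k. co = (\<lambda>s z t. z$k)"
    then obtain k where "co = (\<lambda>s z t. z$k)" by blast
    then show ?thesis using f by (intro vanish_off_hyperplane[of k]) simp
  next
    assume "co = (\<lambda>s z t. t)"
    then show ?thesis using f by (intro vanish_off_quadric) simp
  qed
  moreover obtain s z t where "u = io s z t" using u io_range by blast
  ultimately show ?thesis using e[of s z t] by simp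
qed

theorem section_linear:
  "\<exists>L. half_spin_linear L \<and> (\<forall>E\<in>X. \<forall>u\<in>spinor_sub \<gamma> y0 E. \<sigma> E u = L u)"
proof -
  obtain L where L: "linear_on_chart (\<lambda>s z t. s) L"
    using chart_linear unfolding linear_on_chart_def half_spin_linear_def by blast
  \<comment> \<open>The swap after no, one or two rotations reaches the coordinates
    \<open>z$1\<close>, \<open>z$6\<close>, \<open>z$2\<close>. Exchanging all pairs in the original
    model and in these three reaches \<open>t\<close>, \<open>z$4\<close>, \<open>z$3\<close>,
    \<open>z$5\<close>.\<close>
  note rt = rotate pencil_model.rotate[OF rotate]
  note sw = swap12 pencil_model.swap12[OF rt(1)] pencil_model.swap12[OF rt(2)]
  note al = swap_all pencil_model.swap_all[OF sw(1)] pencil_model.swap_all[OF sw(2)] pencil_model.swap_all[OF sw(3)]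
  note defs = sw_io_def rt_io_def al_io_def io_inj dual6_def
  have c1: "\<exists>L. linear_on_chart (\<lambda>s z t. z$1) L"
    by (rule linear_on_other_chart[OF sw(1)]) (simp add: defs)
  have c2: "\<exists>L. linear_on_chart (\<lambda>s z t. z$6) L"
    by (rule linear_on_other_chart[OF sw(2)]) (simp add: defs)
  have c3: "\<exists>L. linear_on_chart (\<lambda>s z t. z$2) L"
    by (rule linear_on_other_chart[OF sw(3)]) (simp add: defs)
  have c4: "\<exists>L. linear_on_chart (\<lambda>s z t. t) L"
    by (rule linear_on_other_chart[OF al(1)]) (simp add: defs)
  have c5: "\<exists>L. linear_on_chart (\<lambda>s z t. z$4) L"
    by (rule linear_on_other_chart[OF al(2)]) (simp add: defs)
  have c6: "\<exists>L. linear_on_chart (\<lambda>s z t. z$3) L"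
    by (rule linear_on_other_chart[OF al(3)]) (simp add: defs)
  have c7: "\<exists>L. linear_on_chart (\<lambda>s z t. z$5) L"
    by (rule linear_on_other_chart[OF al(4)]) (simp add: defs)
  note charts = c1 c2 c3 c4 c5 c6 c7
  have co: "\<sigma> E (io s z t) = L (io s z t)"
    if h: "E \<in> X" "io s z t \<in> spinor_sub \<gamma> y0 E" "co s z t \<noteq> 0" "\<exists>L. linear_on_chart co L"
      "(\<exists>k. co = (\<lambda>s z t. z$k)) \<or> co = (\<lambda>s z t. t)" for E s z t co
  proof -
    obtain L' where L': "linear_on_chart co L'" using h(4) by blast
    then have "\<sigma> E (io s z t) = L' (io s z t)" using h(1-3) unfolding linear_on_chart_def by blast
    then show ?thesis using linear_functionals_agree[OF L L' h(5) io_half_spin] by simp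
  qed
  have "\<sigma> E u = L u" if E: "E \<in> X" and u: "u \<in> spinor_sub \<gamma> y0 E" for E u
  proof -
    obtain s z t where e: "u = io s z t" using u io_range by (auto simp: spinor_sub_iff)
    show ?thesis
    proof (cases "u = 0")
      case True
      obtain \<xi> \<eta> where i: "indep2 \<xi> \<eta>" "E = vec.span {\<xi>, \<eta>}" using X_basis[OF E] .
      then have "\<sigma> E 0 = 0" using val_zero[of \<xi> \<eta> u] E u by (simp add: adm_def val_def)
      moreover have "L 0 = 0" using half_spin_linear_io[of L 0 0 0] L by (simp add: io_0 linear_on_chart_def)
      ultimately show ?thesis using True by simp
    next
      case False
      then consider "s \<noteq> 0" | "t \<noteq> 0" | k where "z$k \<noteq> 0"
        unfolding e io_eq_0 by (auto simp: vec_eq_iff)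
      then show ?thesis
      proof cases
        case 1
        then show ?thesis using L E u e unfolding linear_on_chart_def by blast
      next
        case 2
        then show ?thesis using co[of E s z t "\<lambda>s z t. t"] E u e charts by blast
      next
        case 3
        have "\<exists>L. linear_on_chart (\<lambda>s z t. z$k) L"
          using charts exhaust_6[of k] by (elim disjE) simp_all
        then show ?thesis using co[of E s z t "\<lambda>s z t. z$k"] E u e 3 by blast
      qed
    qed
  qed
  then show ?thesis using L unfolding linear_on_chart_def by blast
qed

end

section \<open>Linear sections of the Segre fourfold\<close>

lemma sum_22: "(\<Sum>t\<in>(UNIV :: (2 \<times> 2 \<times> 2 \<times> 2) set). f t) = (\<Sum>i\<in>UNIV. \<Sum>j\<in>UNIV. \<Sum>k\<in>UNIV. \<Sum>l\<in>UNIV. f (i, j, k, l))"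
  by (simp add: sum.cartesian_product UNIV_Times_UNIV[symmetric] del: UNIV_Times_UNIV)

lemma line_eq_iff: "a \<noteq> 0 \<Longrightarrow> line (a :: complex ^ 'n) = line b \<longleftrightarrow> (\<exists>c. c \<noteq> 0 \<and> b = c *s a)"
proof
  assume a: "a \<noteq> 0" and e: "line a = line b"
  have "b \<in> line b" "a \<in> line a" unfolding line_def by (simp_all add: vec.span_base)
  then have "b \<in> line a" "a \<in> line b" unfolding e by simp_all
  then obtain c k where c: "b = c *s a" and k: "a = k *s b"
    unfolding line_def vec.span_singleton by blast
  have "c \<noteq> 0"
  proof
    assume "c = 0"
    then have "b = 0" using c by simp
    then show False using k a by simp
  qed
  then show "\<exists>c. c \<noteq> 0 \<and> b = c *s a" using c by blast
next
  assume "\<exists>c. c \<noteq> 0 \<and> b = c *s a"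
  then obtain c where c: "c \<noteq> 0" "b = c *s a" by blast
  have 1: "k *s a = (k / c) *s b" for k using c(1) unfolding c(2) by simp
  have 2: "k *s b = (k * c) *s a" for k unfolding c(2) by simp
  show "line a = line b" unfolding line_def vec.span_singleton using 1 2 by blast
qed

lemma line_mem: "x \<in> line a \<longleftrightarrow> (\<exists>c. x = c *s a)"
  by (auto simp: line_def vec.span_singleton)

lemma plucker_span: "plucker (vec.span {\<xi>, \<eta>}) = line (wedge \<xi> \<eta>)"
proof -
  have w: "wedge (a *s \<xi> + b *s \<eta>) (c *s \<xi> + d *s \<eta>) = (a * d - b * c) *s wedge \<xi> \<eta>" for a b c d
    by (simp add: vec_eq_iff wedge_def algebra_simps)
  have "{wedge \<xi>' \<eta>' |\<xi>' \<eta>'. \<xi>' \<in> vec.span {\<xi>, \<eta>} \<and> \<eta>' \<in> vec.span {\<xi>, \<eta>}} \<subseteq> line (wedge \<xi> \<eta>)"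
    unfolding line_def vec.span_singleton span2
  proof clarify
    fix a b c d
    show "wedge (a *s \<xi> + b *s \<eta>) (c *s \<xi> + d *s \<eta>) \<in> range (\<lambda>k. k *s wedge \<xi> \<eta>)"
      unfolding w by (rule rangeI)
  qed
  then have "plucker (vec.span {\<xi>, \<eta>}) \<subseteq> line (wedge \<xi> \<eta>)"
    unfolding plucker_def by (rule vec.span_minimal) (simp add: line_def vec.subspace_span)
  moreover have "line (wedge \<xi> \<eta>) \<subseteq> plucker (vec.span {\<xi>, \<eta>})"
    unfolding line_def plucker_def by (rule vec.span_mono) (auto intro: vec.span_base)
  ultimately show ?thesis by blast
qed

lemma hom_poly_linear: "hom_poly 1 (\<lambda>v. (A *v v) $ j)"
  unfolding hom_poly_def
proof
  show "(\<lambda>v. (A *v v) $ j) \<in> poly_functions (range (\<lambda>i v. v $ i))"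
    by (intro poly_functions_matrix_vector_mult poly_functions.const poly_functions.gen) auto
qed (simp add: vector_scalar_commute)

text \<open>Both directions are given by linear forms. The matrix \<open>B\<close> itself is the
  isomorphism of tautological line bundles, with constant denominator 1.\<close>

lemma biregular_linear:
  fixes A :: "complex ^ 'n ^ 'm" and B :: "complex ^ 'm ^ 'n"
  assumes BA: "B ** A = mat 1" and P: "\<And>t. t \<in> P \<Longrightarrow> t \<noteq> 0"
  shows "biregular ((\<lambda>t. line (A *v t)) ` P) (line ` P) (\<lambda>x. (*v) B ` x)"
    and "pulls_back_hyperplane_class ((\<lambda>t. line (A *v t)) ` P) (\<lambda>x. (*v) B ` x)"
proof -
  have BAt: "B *v (A *v t) = t" for t using BA by (simp add: matrix_vector_mul_assoc)
  have im: "(*v) C ` line t = line (C *v t)" for C :: "complex ^ 'k ^ 'l" and t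
    unfolding line_def vec.span_singleton by (auto simp: vector_scalar_commute image_iff)
  have ph: "(*v) B ` line (A *v t) = line t" for t unfolding im BAt ..
  let ?X = "(\<lambda>t. line (A *v t)) ` P"
  have bij: "bij_betw (\<lambda>x. (*v) B ` x) ?X (line ` P)"
    unfolding bij_betw_def
  proof
    show "inj_on (\<lambda>x. (*v) B ` x) ?X"
    proof (rule inj_onI)
      fix x y assume "x \<in> ?X" "y \<in> ?X" and e: "(*v) B ` x = (*v) B ` y"
      then obtain s t where x: "x = line (A *v s)" "y = line (A *v t)" by auto
      then have "line s = line t" using e by (simp add: ph)
      then have "(*v) A ` line s = (*v) A ` line t" by simp
      then show "x = y" by (simp add: im x)
    qed
    show "(\<lambda>x. (*v) B ` x) ` ?X = line ` P" by (auto simp: image_image ph)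
  qed
  have inv: "inv_into ?X (\<lambda>x. (*v) B ` x) (line t) = line (A *v t)" if "t \<in> P" for t
    using bij that by (intro inv_into_f_eq) (auto simp: bij_betw_def ph)
  have nzA: "A *v t \<noteq> 0" if "t \<noteq> 0" for t using BAt[of t] that by auto
  have r1: "regular_map ?X (line ` P) (\<lambda>x. (*v) B ` x)"
    unfolding regular_map_def
  proof (intro conjI ballI)
    show "(\<lambda>x. (*v) B ` x) ` ?X \<subseteq> line ` P" using bij by (auto simp: bij_betw_def)
    fix x assume "x \<in> ?X"
    then obtain t where x: "x = line (A *v t)" "t \<in> P" by auto
    show "\<exists>d F. (\<forall>j. hom_poly d (\<lambda>v. F v $ j)) \<and> (\<forall>v\<in>x. v \<noteq> 0 \<longrightarrow> F v \<noteq> 0) \<and>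
        (\<forall>x'\<in>?X. \<forall>v\<in>x'. F v \<noteq> 0 \<longrightarrow> (*v) B ` x' = line (F v))"
    proof (intro exI[of _ 1] exI[of _ "(*v) B"] conjI allI ballI impI hom_poly_linear)
      fix v assume "v \<in> x" "v \<noteq> 0"
      then obtain c where "v = c *s (A *v t)" by (auto simp: x line_mem)
      then have v: "v = A *v (c *s t)" by (simp add: vector_scalar_commute)
      then have "B *v v = c *s t" by (simp only: BAt)
      then show "B *v v \<noteq> 0" using v \<open>v \<noteq> 0\<close> by auto
    next
      fix x' v assume x': "x' \<in> ?X" and "v \<in> x'" "B *v v \<noteq> 0"
      then obtain t' where t': "x' = line (A *v t')" by auto
      obtain c where "v = c *s (A *v t')" using \<open>v \<in> x'\<close> by (auto simp: t' line_mem)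
      then have Bv: "B *v v = c *s t'" by (simp add: vector_scalar_commute BAt)
      then have "c \<noteq> 0" "t' \<noteq> 0" using \<open>B *v v \<noteq> 0\<close> by auto
      then show "(*v) B ` x' = line (B *v v)" unfolding t' ph Bv using line_eq_iff by blast
    qed
  qed
  have r2: "regular_map (line ` P) ?X (inv_into ?X (\<lambda>x. (*v) B ` x))"
    unfolding regular_map_def
  proof (intro conjI ballI)
    show "inv_into ?X (\<lambda>x. (*v) B ` x) ` (line ` P) \<subseteq> ?X" by (auto simp: inv)
    fix x assume "x \<in> line ` P"
    show "\<exists>d F. (\<forall>j. hom_poly d (\<lambda>v. F v $ j)) \<and> (\<forall>v\<in>x. v \<noteq> 0 \<longrightarrow> F v \<noteq> 0) \<and>
        (\<forall>x'\<in>line ` P. \<forall>v\<in>x'. F v \<noteq> 0 \<longrightarrow> inv_into ?X (\<lambda>x. (*v) B ` x) x' = line (F v))"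
    proof (intro exI[of _ 1] exI[of _ "(*v) A"] conjI allI ballI impI hom_poly_linear)
      fix v :: "complex ^ 'n" assume "v \<noteq> 0" then show "A *v v \<noteq> 0" by (rule nzA)
    next
      fix x' v assume "x' \<in> line ` P" "v \<in> x'" "A *v v \<noteq> 0"
      obtain t' where t0: "x' = line t'" "t' \<in> P" using \<open>x' \<in> line ` P\<close> by auto
      obtain c where "v = c *s t'" using \<open>v \<in> x'\<close> unfolding t0 line_mem by blast
      note t' = t0 this
      then have c: "c \<noteq> 0" using \<open>A *v v \<noteq> 0\<close> by auto
      have "A *v t' \<noteq> 0" using nzA P t'(2) by blast
      moreover have "A *v v = c *s (A *v t')" by (simp add: t' vector_scalar_commute)
      ultimately show "inv_into ?X (\<lambda>x. (*v) B ` x) x' = line (A *v v)"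
        unfolding t'(1) inv[OF t'(2)] using c line_eq_iff by blast
    qed
  qed
  show "biregular ?X (line ` P) (\<lambda>x. (*v) B ` x)" unfolding biregular_def using bij r1 r2 by blast
  show "pulls_back_hyperplane_class ?X (\<lambda>x. (*v) B ` x)"
    unfolding pulls_back_hyperplane_class_def
  proof (intro exI[of _ "(*v) B"] conjI ballI)
    fix x v assume "x \<in> ?X" "v \<in> x"
    obtain t where t0: "t \<in> P" "x = line (A *v t)" using \<open>x \<in> ?X\<close> by auto
    obtain c where c0: "v = c *s (A *v t)" using \<open>v \<in> x\<close> unfolding t0 line_mem by blast
    note t = t0(1) c0
    have "B *v v \<noteq> 0" if "v \<noteq> 0"
      using that by (auto simp: t vector_scalar_commute BAt P[OF t(1)])
    then show "B *v v \<in> (*v) B ` x" "v \<noteq> 0 \<longrightarrow> B *v v \<noteq> 0" "\<forall>c. B *v (c *s v) = c *s (B *v v)"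
      using \<open>v \<in> x\<close> by (auto simp: vector_scalar_commute)
  next
    fix x assume "x \<in> ?X"
    show "\<exists>d F g. (\<forall>j. hom_poly (Suc d) (\<lambda>v. F v $ j)) \<and> hom_poly d g \<and> (\<forall>v\<in>x. v \<noteq> 0 \<longrightarrow> g v \<noteq> 0) \<and>
             (\<forall>x'\<in>?X. \<forall>v\<in>x'. g v \<noteq> 0 \<longrightarrow> B *v v = (1 / g v) *s F v)"
      by (intro exI[of _ 0] exI[of _ "(*v) B"] exI[of _ "\<lambda>_. 1"])
         (use hom_poly_linear[of B] in \<open>simp add: hom_poly_def poly_functions.const\<close>)
  qed
qed

section \<open>Dimension counts, and isotropic vectors with few nonzero coordinates\<close>

lemma dim_functional_kernel:
  fixes W :: "(complex ^ 'n) set"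
  assumes W: "vec.subspace W" and f: "\<And>x y. f (x + y) = f x + f y" "\<And>c x. f (c *s x) = c * f x"
  shows "vec.subspace {x \<in> W. f x = (0 :: complex)}" "vec.dim W \<le> Suc (vec.dim {x \<in> W. f x = 0})"
proof -
  show s: "vec.subspace {x \<in> W. f x = 0}"
    using W f f(2)[of 0 0] unfolding vec.subspace_def by auto
  show "vec.dim W \<le> Suc (vec.dim {x \<in> W. f x = 0})"
  proof (cases "\<forall>x\<in>W. f x = 0")
    case True
    then have "{x \<in> W. f x = 0} = W" by auto
    then show ?thesis by simp
  next
    case False
    then obtain t where t: "t \<in> W" "f t \<noteq> 0" by blast
    have "W \<subseteq> vec.span (insert t {x \<in> W. f x = 0})"
    proof
      fix x assume x: "x \<in> W"
      have "f (x - (f x / f t) *s t) = 0"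
        using f(1)[of x "(- f x / f t) *s t"] f(2)[of "- f x / f t" t] t by simp
      then have "x - (f x / f t) *s t \<in> {x \<in> W. f x = 0}"
        using x t W by (simp add: vec.subspace_diff vec.subspace_scale)
      then show "x \<in> vec.span (insert t {x \<in> W. f x = 0})"
        unfolding vec.span_insert by (auto intro: vec.span_base)
    qed
    then have "vec.dim W \<le> vec.dim (vec.span (insert t {x \<in> W. f x = 0}))" by (rule vec.dim_subset)
    also have "\<dots> \<le> Suc (vec.dim {x \<in> W. f x = 0})" by (simp add: vec.dim_insert)
    finally show ?thesis .
  qed
qed

lemma subspace_of_dim:
  fixes W :: "(complex ^ 'n) set"
  assumes "n \<le> vec.dim W" "vec.subspace W"
  obtains M where "vec.subspace M" "M \<subseteq> W" "vec.dim M = n"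
proof -
  obtain B where B: "B \<subseteq> W" "vec.independent B" "card B = vec.dim W"
    by (rule vec.basis_exists[of W]) (rule that)
  have "n \<le> card B" using assms(1) unfolding B(3) .
  then obtain B' where B': "B' \<subseteq> B" "card B' = n"
    by (rule obtain_subset_with_card_n) (rule that)
  have "vec.independent B'" using B(2) B'(1) by (rule vec.independent_mono)
  then have "vec.dim (vec.span B') = n" using vec.dim_span_eq_card_independent B'(2) by metis
  moreover have "vec.span B' \<subseteq> W" using B(1) B'(1) assms(2) by (intro vec.span_minimal) auto
  ultimately show ?thesis using that[of "vec.span B'"] by simp
qed

lemma rank_one_2x2:
  fixes m11 m12 m21 m22 :: complex
  assumes "m11 * m22 = m12 * m21" "m11 \<noteq> 0 \<or> m12 \<noteq> 0 \<or> m21 \<noteq> 0 \<or> m22 \<noteq> 0"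
  obtains a b :: "complex ^ 2" where "a \<noteq> 0" "b \<noteq> 0"
    "m11 = a$1 * b$1" "m12 = a$1 * b$2" "m21 = a$2 * b$1" "m22 = a$2 * b$2"
proof -
  have v2: "vector [x, y] \<noteq> (0 :: complex ^ 2) \<longleftrightarrow> x \<noteq> 0 \<or> y \<noteq> 0" for x y
    by (simp add: vec_eq_iff forall_2)
  consider "m11 \<noteq> 0" | "m12 \<noteq> 0" | "m21 \<noteq> 0" | "m22 \<noteq> 0" using assms(2) by blast
  then show ?thesis
  proof cases
    case 1
    then have "m22 = m21 / m11 * m12" using assms(1) by (simp add: field_simps)
    then show ?thesis using 1
      by (intro that[of "vector [1, m21 / m11]" "vector [m11, m12]"]) (simp_all add: v2)
  next
    case 2
    then have "m21 = m22 / m12 * m11" using assms(1) by (simp add: field_simps)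
    then show ?thesis using 2
      by (intro that[of "vector [1, m22 / m12]" "vector [m11, m12]"]) (simp_all add: v2)
  next
    case 3
    then have "m12 = m11 / m21 * m22" using assms(1) by (simp add: field_simps)
    then show ?thesis using 3
      by (intro that[of "vector [m11 / m21, 1]" "vector [m21, m22]"]) (simp_all add: v2)
  next
    case 4
    then have "m11 = m12 / m22 * m21" using assms(1) by (simp add: field_simps)
    then show ?thesis using 4
      by (intro that[of "vector [m12 / m22, 1]" "vector [m21, m22]"]) (simp_all add: v2)
  qed
qed

lemma isotropic_two_coordinates:
  fixes a :: "complex ^ 4" and P :: "4 \<Rightarrow> 4 \<Rightarrow> complex"
  assumes "a \<noteq> 0" and q: "(\<Sum>i\<in>UNIV. \<Sum>j\<in>UNIV. a $ i * a $ j * P i j) = 0" and P: "\<And>i. P i i \<noteq> 0"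
  obtains i j where "i \<noteq> j" "a $ i \<noteq> 0" "a $ j \<noteq> 0"
proof (rule ccontr)
  note intro = that
  assume n: "\<not> thesis"
  obtain i where i: "a $ i \<noteq> 0" using assms(1) by (auto simp: vec_eq_iff)
  then have z: "a $ j = 0" if "j \<noteq> i" for j using n intro[OF that[symmetric]] by blast
  have s: "(\<Sum>k\<in>UNIV. a $ k * g k) = a $ i * g i" for g
    by (subst sum.remove[of UNIV i]) (auto simp: z intro!: sum.neutral)
  have "(\<Sum>i\<in>UNIV. \<Sum>j\<in>UNIV. a $ i * a $ j * P i j) = (\<Sum>i\<in>UNIV. a $ i * (\<Sum>j\<in>UNIV. a $ j * P i j))"
    by (simp add: sum_distrib_left mult.assoc)
  then have "a $ i * (a $ i * P i i) = 0" using q by (simp only: s)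
  then show False using i P by simp
qed

text \<open>On the coordinate line of \<open>i\<close> and \<open>j\<close> the linear form leaves
  only the point with coordinates \<open>l j\<close> and \<open>- l i\<close>, and
  \<open>gen\<close> says that this point is not isotropic.\<close>

lemma isotropic_three_coordinates:
  fixes a :: "complex ^ 4" and P :: "4 \<Rightarrow> 4 \<Rightarrow> complex"
  assumes "a \<noteq> 0" and q: "(\<Sum>i\<in>UNIV. \<Sum>j\<in>UNIV. a $ i * a $ j * P i j) = 0" and P: "\<And>i. P i i \<noteq> 0"
    and sy: "\<And>i j. P i j = P j i"
    and l: "(\<Sum>i\<in>UNIV. l i * a $ i) = 0"
    and gen: "\<And>i j. i \<noteq> j \<Longrightarrow> P i i * (l j)\<^sup>2 - 2 * P i j * l i * l j + P j j * (l i)\<^sup>2 \<noteq> 0"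
  obtains i j k where "i \<noteq> j" "i \<noteq> k" "j \<noteq> k" "a $ i \<noteq> 0" "a $ j \<noteq> 0" "a $ k \<noteq> 0"
proof (rule ccontr)
  note intro = that
  assume n: "\<not> thesis"
  obtain i j where ij: "i \<noteq> j" "a $ i \<noteq> 0" "a $ j \<noteq> 0"
    by (rule isotropic_two_coordinates[OF assms(1) q P]) (rule that)
  have z: "a $ k = 0" if "k \<noteq> i" "k \<noteq> j" for k
    using n intro[of i j k] that ij by auto
  have s: "(\<Sum>k\<in>UNIV. a $ k * g k) = a $ i * g i + a $ j * g j" for g
  proof -
    have "(\<Sum>k\<in>UNIV. a $ k * g k) = (\<Sum>k\<in>{i, j}. a $ k * g k)"
      by (rule sum.mono_neutral_right) (auto simp: z)
    then show ?thesis using ij(1) by simp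
  qed
  have "(\<Sum>i\<in>UNIV. \<Sum>j\<in>UNIV. a $ i * a $ j * P i j) = (\<Sum>i\<in>UNIV. a $ i * (\<Sum>j\<in>UNIV. a $ j * P i j))"
    by (simp add: sum_distrib_left mult.assoc)
  then have 1: "a $ i * (a $ i * P i i + a $ j * P i j) + a $ j * (a $ i * P i j + a $ j * P j j) = 0"
    using q by (simp only: s sy[of j i])
  have "(\<Sum>k\<in>UNIV. a $ k * l k) = 0" using l by (simp add: mult.commute)
  then have 2: "a $ i * l i + a $ j * l j = 0" by (simp only: s)
  have "(a $ j)\<^sup>2 * (P i i * (l j)\<^sup>2 - 2 * P i j * l i * l j + P j j * (l i)\<^sup>2) = 0"
    using 1 2 by algebra
  then show False using gen[OF ij(1)] ij(3) by simp
qed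

text \<open>The supports have at least three and two elements, so they cannot be disjoint in a set
  of four.\<close>

lemma isotropic_pair_not_complementary:
  fixes a b :: "complex ^ 4" and P N :: "4 \<Rightarrow> 4 \<Rightarrow> complex"
  assumes "a \<noteq> 0" "b \<noteq> 0"
    and "(\<Sum>i\<in>UNIV. \<Sum>j\<in>UNIV. a $ i * a $ j * P i j) = 0" "(\<Sum>i\<in>UNIV. \<Sum>j\<in>UNIV. b $ i * b $ j * N i j) = 0"
    and "\<And>i. P i i \<noteq> 0" "\<And>i. N i i \<noteq> 0"
    and "\<And>i j. P i j = P j i"
    and "(\<Sum>i\<in>UNIV. l i * a $ i) = 0"
    and "\<And>i j. i \<noteq> j \<Longrightarrow> P i i * (l j)\<^sup>2 - 2 * P i j * l i * l j + P j j * (l i)\<^sup>2 \<noteq> 0"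
    and ab: "\<And>i. a $ i * b $ i = 0"
  shows False
proof -
  obtain i j k where 1: "i \<noteq> j" "i \<noteq> k" "j \<noteq> k" "a $ i \<noteq> 0" "a $ j \<noteq> 0" "a $ k \<noteq> 0"
    by (rule isotropic_three_coordinates[of a P l]) (use assms in auto)
  obtain i' j' where 2: "i' \<noteq> j'" "b $ i' \<noteq> 0" "b $ j' \<noteq> 0"
    by (rule isotropic_two_coordinates[of b N]) (use assms in auto)
  have "i' \<notin> {i, j, k}" "j' \<notin> {i, j, k}" using 1 2 ab by auto
  then have "card {i', j', i, j, k} = 5" using 1 2 by auto
  moreover have "card {i', j', i, j, k} \<le> CARD(4)" by (rule card_mono) auto
  ultimately show False by simp
qed

text \<open>The form is chosen on a moment curve, with coordinates \<open>c ^ e i\<close>. Each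
  condition is a nonzero polynomial in \<open>c\<close>, because the exponents
  \<open>2 * e j\<close>, \<open>e i + e j\<close>, \<open>2 * e i\<close> are distinct and the
  coefficient of the first is a diagonal entry.\<close>

lemma generic_linear_form:
  fixes P N :: "4 \<Rightarrow> 4 \<Rightarrow> complex"
  assumes P: "\<And>i. P i i \<noteq> 0" and N: "\<And>i. N i i \<noteq> 0"
  obtains l :: "4 \<Rightarrow> complex"
    where "\<And>i j. i \<noteq> j \<Longrightarrow> P i i * (l j)\<^sup>2 - 2 * P i j * l i * l j + P j j * (l i)\<^sup>2 \<noteq> 0"
      "\<And>i j. i \<noteq> j \<Longrightarrow> N i i * (l j)\<^sup>2 - 2 * N i j * l i * l j + N j j * (l i)\<^sup>2 \<noteq> 0"
proof -
  obtain e :: "4 \<Rightarrow> nat" where e: "inj e" using finite_imp_inj_to_nat_seg[of "UNIV :: 4 set"] by auto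
  define h where "h Q i j = monom (Q i i) (2 * e j) - monom (2 * Q i j) (e i + e j) + monom (Q j j) (2 * e i)"
    for Q :: "4 \<Rightarrow> 4 \<Rightarrow> complex" and i j
  have h0: "h Q i j \<noteq> 0" if "i \<noteq> j" "Q i i \<noteq> 0" for Q i j
  proof -
    have "e i \<noteq> e j" using that e by (auto dest: injD)
    then have "coeff (h Q i j) (2 * e j) = Q i i" by (simp add: h_def)
    then show ?thesis using that by auto
  qed
  have hp: "poly (h Q i j) c = Q i i * (c ^ e j)\<^sup>2 - 2 * Q i j * c ^ e i * c ^ e j + Q j j * (c ^ e i)\<^sup>2" for Q i j c
    by (simp add: h_def poly_monom power_add power_mult power2_eq_square power_mult_distrib)
  have "finite ((\<Union>(i, j)\<in>{(i, j). i \<noteq> j}. {c. poly (h P i j) c = 0}) \<union> (\<Union>(i, j)\<in>{(i, j). i \<noteq> j}. {c. poly (h N i j) c = 0}))"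
    using h0 P N by (auto intro!: finite_UN_I finite_subset[OF subset_UNIV] poly_roots_finite)
  then obtain c where "c \<notin> (\<Union>(i, j)\<in>{(i, j). i \<noteq> j}. {c. poly (h P i j) c = 0}) \<union> (\<Union>(i, j)\<in>{(i, j). i \<noteq> j}. {c. poly (h N i j) c = 0})"
    using infinite_UNIV_char_0 ex_new_if_finite by blast
  then have "i \<noteq> j \<Longrightarrow> poly (h P i j) c \<noteq> 0 \<and> poly (h N i j) c \<noteq> 0" for i j by auto
  then show ?thesis by (intro that[of "\<lambda>i. c ^ e i"]) (simp_all add: hp)
qed

lemma dual_family_spans:
  fixes u :: "4 \<Rightarrow> complex ^ 4"
  assumes f: "\<And>a j. f j (\<Sum>i\<in>UNIV. a i *s u i) = a j * d j" and f0: "\<And>j. f j 0 = 0" and d: "\<And>j. d j \<noteq> (0 :: complex)"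
  shows "\<exists>a. y = (\<Sum>i\<in>UNIV. a i *s u i)"
proof -
  have s: "(\<Sum>i\<in>UNIV. vec4 a1 a2 a3 a4 $ i *s u i) = a1 *s u 1 + a2 *s u 2 + a3 *s u 3 + a4 *s u 4" for a1 a2 a3 a4
    by (simp add: sum_4)
  have "indep4 (u 1) (u 2) (u 3) (u 4)"
    unfolding indep4_def s[symmetric]
  proof (intro allI impI)
    fix a1 a2 a3 a4 assume 0: "(\<Sum>i\<in>UNIV. vec4 a1 a2 a3 a4 $ i *s u i) = 0"
    have "vec4 a1 a2 a3 a4 $ j = 0" for j
      using f[of j "\<lambda>i. vec4 a1 a2 a3 a4 $ i"] f0 d[of j] unfolding 0 by simp
    from this[of 1] this[of 2] this[of 3] this[of 4]
    show "a1 = 0 \<and> a2 = 0 \<and> a3 = 0 \<and> a4 = 0" by simp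
  qed
  from indep4_spans[OF this] show ?thesis unfolding s[symmetric] by blast
qed

text \<open>A relation \<open>m\<close> can be added to any matrix without changing the determinant.
  Adding it to the zero matrix and to the four elementary matrices reads off its entries.\<close>

lemma det_form_injective:
  fixes i j :: 2 and m :: "2 \<Rightarrow> 2 \<Rightarrow> complex"
  assumes Q: "\<And>m. Q (\<Sum>i\<in>UNIV. \<Sum>j\<in>UNIV. m i j *s \<alpha> i j) = 2 * (m 1 1 * m 2 2 - m 1 2 * m 2 1)"
    and 0: "(\<Sum>i\<in>UNIV. \<Sum>j\<in>UNIV. m i j *s \<alpha> i j) = (0 :: complex ^ 'n)"
  shows "m i j = 0"
proof -
  have e: "(m 1 1 + a) * (m 2 2 + b) - (m 1 2 + c) * (m 2 1 + e) = a * b - c * e" for a b c e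
  proof -
    define m' where "m' i j = (if i = 1 then (if j = 1 then a else c) else if j = 1 then e else b)" for i j :: 2
    have "(\<Sum>i\<in>UNIV. \<Sum>j\<in>UNIV. (m i j + m' i j) *s \<alpha> i j) =
        (\<Sum>i\<in>UNIV. \<Sum>j\<in>UNIV. m i j *s \<alpha> i j) + (\<Sum>i\<in>UNIV. \<Sum>j\<in>UNIV. m' i j *s \<alpha> i j)"
      by (simp add: vec.scale_left_distrib sum.distrib)
    from arg_cong[OF this, of Q] show ?thesis unfolding 0 add_0_left Q by (simp only: mult_cancel_left) (simp add: m'_def)
  qed
  from e[of 0 0 0 0] e[of 1 0 0 0] e[of 0 1 0 0] e[of 0 0 1 0] e[of 0 0 0 1]
  have "m 1 1 = 0 \<and> m 1 2 = 0 \<and> m 2 1 = 0 \<and> m 2 2 = 0" by (auto simp: algebra_simps)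
  then show ?thesis using exhaust_2[of i] exhaust_2[of j] by auto
qed

text \<open>Two complementary totally isotropic 4-spaces, in bases which diagonalize the pencil, and also in
  bases indexed by matrix positions such that the isotropic vectors are the matrices of rank one.\<close>

locale two_planes =
  fixes M M' :: "complex ^ 8 ^ 8" and jA jB :: "complex ^ 4 \<Rightarrow> complex ^ 8"
    and u v :: "4 \<Rightarrow> complex ^ 4" and d \<rho> :: "4 \<Rightarrow> complex" and \<alpha> \<beta> :: "2 \<Rightarrow> 2 \<Rightarrow> complex ^ 4"
  assumes jA_add: "jA (x + y) = jA x + jA y" and jA_smult: "jA (c *s x) = c *s jA x"
    and jB_add: "jB (x + y) = jB x + jB y" and jB_smult: "jB (c *s x) = c *s jB x"
    and symM: "transpose M = M" and symM': "transpose M' = M'"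
    and jA_isotropic: "bil M (jA x) (jA y) = 0" and jB_isotropic: "bil M (jB x) (jB y) = 0"
    and eigen: "bil M (jA (u i)) (jB (v j)) = (if i = j then d i else 0)"
    and eigen': "bil M' (jA (u i)) (jB (v j)) = (if i = j then \<rho> i * d i else 0)"
    and d_nz: "d i \<noteq> 0" and \<rho>_inj: "inj \<rho>"
    and u_nz: "bil M' (jA (u i)) (jA (u i)) \<noteq> 0" and v_nz: "bil M' (jB (v i)) (jB (v i)) \<noteq> 0"
    and \<alpha>_spans: "\<exists>m. y = (\<Sum>i\<in>UNIV. \<Sum>j\<in>UNIV. m i j *s \<alpha> i j)"
    and \<beta>_spans: "\<exists>m. y = (\<Sum>i\<in>UNIV. \<Sum>j\<in>UNIV. m i j *s \<beta> i j)"
    and \<alpha>_det: "qform M' (jA (\<Sum>i\<in>UNIV. \<Sum>j\<in>UNIV. m i j *s \<alpha> i j)) = 2 * (m 1 1 * m 2 2 - m 1 2 * m 2 1)"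
    and \<beta>_det: "qform M' (jB (\<Sum>i\<in>UNIV. \<Sum>j\<in>UNIV. m i j *s \<beta> i j)) = 2 * (m 1 1 * m 2 2 - m 1 2 * m 2 1)"
begin

definition "S = {vec.span {jA y, jB x} |y x. y \<noteq> 0 \<and> x \<noteq> 0 \<and> qform M' (jA y) = 0 \<and> qform M' (jB x) = 0 \<and>
   bil M (jA y) (jB x) = 0 \<and> bil M' (jA y) (jB x) = 0}"

abbreviation "mA m \<equiv> (\<Sum>i\<in>UNIV. \<Sum>j\<in>UNIV. m i j *s \<alpha> i j)"
abbreviation "mB m \<equiv> (\<Sum>i\<in>UNIV. \<Sum>j\<in>UNIV. m i j *s \<beta> i j)"

lemma j_zero: "jA 0 = 0" "jB 0 = 0"
  using jA_smult[of 0 0] jB_smult[of 0 0] by auto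

lemma jA_sum: "jA (\<Sum>i\<in>I. f i) = (\<Sum>i\<in>I. jA (f i))"
  by (induction I rule: infinite_finite_induct) (simp_all add: j_zero jA_add)

lemma jB_sum: "jB (\<Sum>i\<in>I. f i) = (\<Sum>i\<in>I. jB (f i))"
  by (induction I rule: infinite_finite_induct) (simp_all add: j_zero jB_add)

lemma mA_eq_0: "mA m = 0 \<Longrightarrow> m i j = 0"
  by (rule det_form_injective[of "\<lambda>y. qform M' (jA y)", OF \<alpha>_det])

lemma mB_eq_0: "mB m = 0 \<Longrightarrow> m i j = 0"
  by (rule det_form_injective[of "\<lambda>y. qform M' (jB y)", OF \<beta>_det])

lemma bil_eigen:
  "bil M (jA (\<Sum>i\<in>UNIV. a i *s u i)) (jB (v j)) = a j * d j"
  "bil M (jA (u j)) (jB (\<Sum>i\<in>UNIV. b i *s v i)) = b j * d j"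
  by (simp_all add: jA_sum jA_smult bil_sum_left bil_smult_left eigen jB_sum jB_smult bil_sum_right bil_smult_right
    if_distrib[where f = "(*) _"] cong: if_cong)

lemma u_spans: "\<exists>a. y = (\<Sum>i\<in>UNIV. a i *s u i)"
  by (rule dual_family_spans[of "\<lambda>j y. bil M (jA y) (jB (v j))", OF bil_eigen(1) _ d_nz]) (simp add: j_zero)

lemma v_spans: "\<exists>a. y = (\<Sum>i\<in>UNIV. a i *s v i)"
  by (rule dual_family_spans[of "\<lambda>j x. bil M (jA (u j)) (jB x)", OF bil_eigen(2) _ d_nz]) (simp add: j_zero)

definition "ca y i = bil M (jA y) (jB (v i)) / d i"
definition "cb x i = bil M (jA (u i)) (jB x) / d i"

lemma ca_sum: "y = (\<Sum>i\<in>UNIV. ca y i *s u i)"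
proof -
  obtain a where a: "y = (\<Sum>i\<in>UNIV. a i *s u i)" using u_spans by blast
  have "ca y i = a i" for i unfolding ca_def a bil_eigen using d_nz by simp
  then show ?thesis using a by simp
qed

lemma cb_sum: "x = (\<Sum>i\<in>UNIV. cb x i *s v i)"
proof -
  obtain a where a: "x = (\<Sum>i\<in>UNIV. a i *s v i)" using v_spans by blast
  have "cb x i = a i" for i unfolding cb_def a bil_eigen using d_nz by simp
  then show ?thesis using a by simp
qed

lemma ca_linear: "ca (y + y') i = ca y i + ca y' i" "ca (c *s y) i = c * ca y i"
  by (simp_all add: ca_def jA_add jA_smult bil_add_left bil_smult_left add_divide_distrib)

lemma cb_linear: "cb (y + y') i = cb y i + cb y' i" "cb (c *s y) i = c * cb y i"
  by (simp_all add: cb_def jB_add jB_smult bil_add_right bil_smult_right add_divide_distrib)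

lemma bil_M: "bil M (jA y) (jB x) = (\<Sum>i\<in>UNIV. ca y i * cb x i * d i)"
proof -
  have "bil M (jA y) (jB x) = (\<Sum>i\<in>UNIV. ca y i * bil M (jA (u i)) (jB x))"
    by (subst ca_sum[of y]) (simp add: jA_sum jA_smult bil_sum_left bil_smult_left)
  also have "\<dots> = (\<Sum>i\<in>UNIV. ca y i * cb x i * d i)" using d_nz by (simp add: cb_def)
  finally show ?thesis .
qed

lemma bil_M': "bil M' (jA y) (jB x) = (\<Sum>i\<in>UNIV. ca y i * cb x i * d i * \<rho> i)"
proof -
  have 1: "bil M' (jA (u i)) (jB x) = cb x i * d i * \<rho> i" for i
  proof -
    have "bil M' (jA (u i)) (jB x) = (\<Sum>j\<in>UNIV. cb x j * bil M' (jA (u i)) (jB (v j)))"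
      by (subst cb_sum[of x]) (simp add: jB_sum jB_smult bil_sum_right bil_smult_right)
    then show ?thesis by (simp add: eigen' if_distrib[where f = "(*) _"] cong: if_cong)
  qed
  have "bil M' (jA y) (jB x) = (\<Sum>i\<in>UNIV. ca y i * bil M' (jA (u i)) (jB x))"
    by (subst ca_sum[of y]) (simp add: jA_sum jA_smult bil_sum_left bil_smult_left)
  then show ?thesis by (simp add: 1 mult.assoc)
qed

lemma qform_A: "qform M' (jA y) = (\<Sum>i\<in>UNIV. \<Sum>j\<in>UNIV. ca y i * ca y j * bil M' (jA (u i)) (jA (u j)))"
  unfolding qform_bil
  by (subst (1 2) ca_sum[of y]) (simp add: jA_sum jA_smult bil_sum_left bil_smult_left bil_sum_right bil_smult_right
     sum_distrib_left mult.assoc bil_commute[OF symM'])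

lemma qform_B: "qform M' (jB x) = (\<Sum>i\<in>UNIV. \<Sum>j\<in>UNIV. cb x i * cb x j * bil M' (jB (v i)) (jB (v j)))"
  unfolding qform_bil
  by (subst (1 2) cb_sum[of x]) (simp add: jB_sum jB_smult bil_sum_left bil_smult_left bil_sum_right bil_smult_right
     sum_distrib_left mult.assoc bil_commute[OF symM'])

text \<open>The linear form on the tensor product which corresponds to a bilinear form, in
  coordinates with respect to \<open>\<alpha>\<close> and \<open>\<beta>\<close>.\<close>

definition lift :: "(complex ^ 4 \<Rightarrow> complex ^ 4 \<Rightarrow> complex) \<Rightarrow> complex ^ (2 \<times> 2 \<times> 2 \<times> 2) \<Rightarrow> complex" where
  "lift b t = (\<Sum>i\<in>UNIV. \<Sum>j\<in>UNIV. \<Sum>k\<in>UNIV. \<Sum>l\<in>UNIV. t $ (i, j, k, l) * b (\<alpha> i j) (\<beta> k l))"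

definition bilinear2 :: "(complex ^ 4 \<Rightarrow> complex ^ 4 \<Rightarrow> complex) \<Rightarrow> bool" where
  "bilinear2 b \<longleftrightarrow> (\<forall>y y' x. b (y + y') x = b y x + b y' x) \<and> (\<forall>y x x'. b y (x + x') = b y x + b y x') \<and>
     (\<forall>c y x. b (c *s y) x = c * b y x) \<and> (\<forall>c y x. b y (c *s x) = c * b y x)"

definition tens :: "(2 \<Rightarrow> 2 \<Rightarrow> complex) \<Rightarrow> (2 \<Rightarrow> 2 \<Rightarrow> complex) \<Rightarrow> complex ^ (2 \<times> 2 \<times> 2 \<times> 2)" where
  "tens m n = (\<chi> t. case t of (i, j, k, l) \<Rightarrow> m i j * n k l)"

lemma lift_linear: "lift b (t + t') = lift b t + lift b t'" "lift b (c *s t) = c * lift b t"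
  by (simp_all add: lift_def algebra_simps sum.distrib sum_distrib_left)

lemma lift_tens: "bilinear2 b \<Longrightarrow> lift b (tens m n) = b (mA m) (mB n)"
  unfolding bilinear2_def lift_def tens_def by (simp add: sum_2 algebra_simps)

lemma tensor4_tens: "tensor4 a b c e = tens (\<lambda>i j. a $ i * b $ j) (\<lambda>i j. c $ i * e $ j)"
  by (simp add: tensor4_def tens_def vec_eq_iff mult.assoc)

definition "K y x = bil M (jA y) (jB x)"
definition "K' y x = bil M' (jA y) (jB x)"

lemma bilinear2_K: "bilinear2 K" "bilinear2 K'"
  by (simp_all add: bilinear2_def K_def K'_def jA_add jB_add jA_smult jB_smult bil_add_left bil_add_right
     bil_smult_left bil_smult_right)

text \<open>Nested, so that \<open>dim_functional_kernel\<close> can be applied to one equation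
  after the other.\<close>

definition "L = {t \<in> {t. lift K t = 0}. lift K' t = 0}"

lemma subspace_ker: "vec.subspace {t. lift b t = 0}"
  using lift_linear[of b] lift_linear(2)[of b 0 0] unfolding vec.subspace_def by auto

lemma subspace_L: "vec.subspace L"
  unfolding L_def by (rule dim_functional_kernel(1)[OF subspace_ker lift_linear])

lemma strict_dim:
  assumes "vec.subspace V" "vec.subspace W" "V \<subseteq> W" "t \<in> W" "t \<notin> (V :: (complex ^ 'n) set)"
  shows "vec.dim V < vec.dim W"
proof -
  have "vec.dim V \<le> vec.dim W" using assms by (intro vec.dim_subset)
  moreover have "vec.dim V \<noteq> vec.dim W" using assms vec.subspace_dim_equal[of V W] by auto
  ultimately show ?thesis by simp
qed

text \<open>The two equations are independent because their values at the tensors of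
  \<open>u 1\<close>, \<open>v 1\<close> and of \<open>u 2\<close>, \<open>v 2\<close> have the
  different ratios \<open>\<rho> 1\<close> and \<open>\<rho> 2\<close>.\<close>

lemma dim_L: "vec.dim L = 14"
proof -
  obtain m n where m: "u 1 = mA m" "v 1 = mB n" using \<alpha>_spans \<beta>_spans by blast
  obtain m' n' where m': "u 2 = mA m'" "v 2 = mB n'" using \<alpha>_spans \<beta>_spans by blast
  have t: "lift K (tens m n) = d 1" "lift K' (tens m n) = \<rho> 1 * d 1"
    "lift K (tens m' n') = d 2" "lift K' (tens m' n') = \<rho> 2 * d 2"
    unfolding lift_tens[OF bilinear2_K(1)] lift_tens[OF bilinear2_K(2)] m[symmetric] m'[symmetric] K_def K'_def
    by (simp_all add: eigen eigen')
  define t where "t = d 2 *s tens m n + (- d 1) *s tens m' n'"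
  have "\<rho> 1 \<noteq> \<rho> 2" using \<rho>_inj by (auto dest: injD)
  then have tL: "lift K t = 0" "lift K' t \<noteq> 0"
    unfolding t_def lift_linear t using d_nz by (simp_all add: algebra_simps)
  have "vec.dim {t. lift K t = 0} < vec.dim (UNIV :: (complex ^ (2 \<times> 2 \<times> 2 \<times> 2)) set)"
    by (rule strict_dim[OF subspace_ker vec.subspace_UNIV, of _ "tens m n"]) (use t d_nz in auto)
  moreover have "vec.dim L < vec.dim {t. lift K t = 0}"
    by (rule strict_dim[OF subspace_L subspace_ker, of _ t]) (use tL in \<open>auto simp: L_def\<close>)
  moreover have "vec.dim {t. lift K t = 0} \<le> Suc (vec.dim L)"
    unfolding L_def by (rule dim_functional_kernel(2)[OF subspace_ker lift_linear])
  moreover have "vec.dim (UNIV :: (complex ^ (2 \<times> 2 \<times> 2 \<times> 2)) set) \<le> Suc (vec.dim {t \<in> UNIV. lift K t = 0})"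
    by (rule dim_functional_kernel(2)[OF vec.subspace_UNIV lift_linear])
  moreover have "vec.dim (UNIV :: (complex ^ (2 \<times> 2 \<times> 2 \<times> 2)) set) = 16" by (simp add: vec.dim_UNIV card_cart_basis)
  ultimately show ?thesis by simp
qed

lemma segre_point:
  assumes "a \<noteq> 0" "b \<noteq> 0" "c \<noteq> 0" "e \<noteq> 0" "tensor4 a b c e \<in> L"
  obtains y x where "y = mA (\<lambda>i j. a $ i * b $ j)" "x = mB (\<lambda>i j. c $ i * e $ j)" "y \<noteq> 0" "x \<noteq> 0"
    "qform M' (jA y) = 0" "qform M' (jB x) = 0" "K y x = 0" "K' y x = 0"
proof -
  have nz: "\<exists>i j. p $ i * q $ j \<noteq> 0" if "p \<noteq> 0" "q \<noteq> 0" for p q :: "complex ^ 2"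
  proof -
    from that have "\<exists>i. p $ i \<noteq> 0" "\<exists>j. q $ j \<noteq> 0" unfolding vec_eq_iff zero_index by blast+
    then obtain i j where "p $ i \<noteq> 0" "q $ j \<noteq> 0" by blast
    then show ?thesis by (intro exI[of _ i] exI[of _ j]) simp
  qed
  show ?thesis
  proof (rule that[OF refl refl])
    show "mA (\<lambda>i j. a $ i * b $ j) \<noteq> 0" using nz[OF assms(1,2)] mA_eq_0[of "\<lambda>i j. a $ i * b $ j"] by blast
    show "mB (\<lambda>i j. c $ i * e $ j) \<noteq> 0" using nz[OF assms(3,4)] mB_eq_0[of "\<lambda>i j. c $ i * e $ j"] by blast
  qed (use assms(5) in \<open>simp_all add: \<alpha>_det \<beta>_det L_def tensor4_tens lift_tens bilinear2_K\<close>)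
qed

lemma segre_point_exists:
  assumes "y \<noteq> 0" "x \<noteq> 0" "qform M' (jA y) = 0" "qform M' (jB x) = 0" "K y x = 0" "K' y x = 0"
  obtains a b c e where "y = mA (\<lambda>i j. a $ i * b $ j)" "x = mB (\<lambda>i j. c $ i * e $ j)"
    "a \<noteq> 0" "b \<noteq> 0" "c \<noteq> 0" "e \<noteq> 0" "tensor4 a b c e \<in> L"
proof -
  obtain m where m: "y = mA m" using \<alpha>_spans by blast
  obtain n where n: "x = mB n" using \<beta>_spans by blast
  have r: "\<exists>p q. p \<noteq> 0 \<and> q \<noteq> 0 \<and> (\<forall>i j. k i j = p $ i * q $ j)"
    if k: "k 1 1 * k 2 2 = k 1 2 * k 2 1" "k i j \<noteq> 0" for k :: "2 \<Rightarrow> 2 \<Rightarrow> complex" and i j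
  proof -
    have "k 1 1 \<noteq> 0 \<or> k 1 2 \<noteq> 0 \<or> k 2 1 \<noteq> 0 \<or> k 2 2 \<noteq> 0" using k(2) exhaust_2[of i] exhaust_2[of j] by auto
    then obtain p q :: "complex ^ 2" where "p \<noteq> 0" "q \<noteq> 0" "k 1 1 = p$1 * q$1" "k 1 2 = p$1 * q$2" "k 2 1 = p$2 * q$1" "k 2 2 = p$2 * q$2"
      by (rule rank_one_2x2[OF k(1)]) (rule that)
    then show ?thesis by (intro exI[of _ p] exI[of _ q]) (simp add: forall_2)
  qed
  have "\<exists>i j. m i j \<noteq> 0"
  proof (rule ccontr)
    assume "\<nexists>i j. m i j \<noteq> 0"
    then have "m i j = 0" for i j by blast
    then show False using assms(1) m by simp
  qed
  moreover have "m 1 1 * m 2 2 = m 1 2 * m 2 1" using assms(3) unfolding m \<alpha>_det by (simp only: mult_eq_0_iff) simp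
  ultimately obtain a b where ab: "a \<noteq> 0" "b \<noteq> 0" "\<And>i j. m i j = a $ i * b $ j" using r by blast
  have "\<exists>i j. n i j \<noteq> 0"
  proof (rule ccontr)
    assume "\<nexists>i j. n i j \<noteq> 0"
    then have "n i j = 0" for i j by blast
    then show False using assms(2) n by simp
  qed
  moreover have "n 1 1 * n 2 2 = n 1 2 * n 2 1" using assms(4) unfolding n \<beta>_det by (simp only: mult_eq_0_iff) simp
  ultimately obtain c e where ce: "c \<noteq> 0" "e \<noteq> 0" "\<And>i j. n i j = c $ i * e $ j" using r by blast
  have m': "m = (\<lambda>i j. a $ i * b $ j)" "n = (\<lambda>i j. c $ i * e $ j)" using ab ce by (intro ext; simp)+
  show ?thesis
  proof (rule that[of a b c e])
    show "tensor4 a b c e \<in> L" using assms(5,6) unfolding L_def tensor4_tens m n m'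
      by (simp add: lift_tens bilinear2_K)
  qed (use ab ce in \<open>simp_all add: m n m'\<close>)
qed

text \<open>Three more equations without a solution on the section are needed. The first two kill
  the products of eigencoordinates 1 and 2; the two equations of \<open>L\<close> then kill those of
  3 and 4, as \<open>\<rho> 3 \<noteq> \<rho> 4\<close>. So the two vectors have disjoint supports,
  and the last equation, saying that one of them lies in a generic hyperplane, excludes
  this.\<close>

lemma section_dimension: "dim_at_most 2 (segre4 \<inter> proj L)"
proof -
  obtain l :: "4 \<Rightarrow> complex" where l:
    "\<And>i j. i \<noteq> j \<Longrightarrow> bil M' (jA (u i)) (jA (u i)) * (l j)\<^sup>2 - 2 * bil M' (jA (u i)) (jA (u j)) * l i * l j + bil M' (jA (u j)) (jA (u j)) * (l i)\<^sup>2 \<noteq> 0"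
    "\<And>i j. i \<noteq> j \<Longrightarrow> bil M' (jB (v i)) (jB (v i)) * (l j)\<^sup>2 - 2 * bil M' (jB (v i)) (jB (v j)) * l i * l j + bil M' (jB (v j)) (jB (v j)) * (l i)\<^sup>2 \<noteq> 0"
    by (rule generic_linear_form[of "\<lambda>i j. bil M' (jA (u i)) (jA (u j))" "\<lambda>i j. bil M' (jB (v i)) (jB (v j))"])
      (use u_nz v_nz in auto)
  define z where "z i y x = ca y i * cb x i" for i y x
  \<comment> \<open>A product of linear forms is bilinear, so this is a hyperplane in the tensor
    product; on decomposable tensors it means that one of the two factors satisfies the equation
    \<open>l\<close>.\<close>
  define \<psi> where "\<psi> y x = (\<Sum>i\<in>UNIV. l i * ca y i) * (\<Sum>i\<in>UNIV. l i * cb x i)" for y x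
  have bz: "bilinear2 (z i)" for i
    by (simp add: bilinear2_def z_def ca_linear cb_linear algebra_simps)
  have "(\<Sum>i\<in>UNIV. l i * ca (y + y') i) = (\<Sum>i\<in>UNIV. l i * ca y i) + (\<Sum>i\<in>UNIV. l i * ca y' i)"
    "(\<Sum>i\<in>UNIV. l i * ca (c *s y) i) = c * (\<Sum>i\<in>UNIV. l i * ca y i)"
    "(\<Sum>i\<in>UNIV. l i * cb (y + y') i) = (\<Sum>i\<in>UNIV. l i * cb y i) + (\<Sum>i\<in>UNIV. l i * cb y' i)"
    "(\<Sum>i\<in>UNIV. l i * cb (c *s y) i) = c * (\<Sum>i\<in>UNIV. l i * cb y i)" for y y' c
    by (simp_all add: ca_linear cb_linear sum.distrib sum_distrib_left algebra_simps)
  then have b\<psi>: "bilinear2 \<psi>"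
    by (simp add: bilinear2_def \<psi>_def distrib_left distrib_right)
  define W1 where "W1 = {t \<in> UNIV. lift (z 1) t = 0}"
  define W2 where "W2 = {t \<in> W1. lift (z 2) t = 0}"
  define W3 where "W3 = {t \<in> W2. lift \<psi> t = 0}"
  note W1 = dim_functional_kernel[OF vec.subspace_UNIV lift_linear(1)[of "z 1"] lift_linear(2)[of "z 1"], folded W1_def]
  note W2 = dim_functional_kernel[OF W1(1) lift_linear(1)[of "z 2"] lift_linear(2)[of "z 2"], folded W2_def]
  note W3 = dim_functional_kernel[OF W2(1) lift_linear(1)[of \<psi>] lift_linear(2)[of \<psi>], folded W3_def]
  have "vec.dim (UNIV :: (complex ^ (2 \<times> 2 \<times> 2 \<times> 2)) set) = 16" by (simp add: vec.dim_UNIV card_cart_basis)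
  then have "13 \<le> vec.dim W3" using W1(2) W2(2) W3(2) by linarith
  then obtain V where V: "vec.subspace V" "V \<subseteq> W3" "vec.dim V = 13"
    by (rule subspace_of_dim[OF _ W3(1)]) (rule that)
  have "False" if p: "p \<in> segre4" "p \<in> proj L" "p \<in> proj V" for p
  proof -
    obtain a b c e where n: "a \<noteq> 0" "b \<noteq> 0" "c \<noteq> 0" "e \<noteq> 0" and pt: "p = line (tensor4 a b c e)"
      using p(1) unfolding segre4_def by blast
    have mem: "tensor4 a b c e \<in> U" if U: "vec.subspace U" "p \<in> proj U" for U
    proof -
      obtain t where t: "t \<in> U" "p = line t" using U(2) unfolding proj_def by blast
      have "tensor4 a b c e \<in> line t" using t pt by (metis line_def vec.span_base singletonI)
      then show ?thesis using U(1) t(1) unfolding line_mem by (auto intro: vec.subspace_scale)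
    qed
    have tL: "tensor4 a b c e \<in> L" by (rule mem[OF subspace_L p(2)])
    have tV: "tensor4 a b c e \<in> W3" using mem[OF V(1) p(3)] V(2) by blast
    obtain y x where yx: "y = mA (\<lambda>i j. a $ i * b $ j)" "x = mB (\<lambda>i j. c $ i * e $ j)" "y \<noteq> 0" "x \<noteq> 0"
      "qform M' (jA y) = 0" "qform M' (jB x) = 0" "K y x = 0" "K' y x = 0"
      by (rule segre_point[OF n tL]) (rule that)
    have zz: "z 1 y x = 0" "z 2 y x = 0" "\<psi> y x = 0"
      using tV unfolding W3_def W2_def W1_def tensor4_tens yx(1,2)
      by (simp_all add: lift_tens bz b\<psi>)
    have "(\<Sum>i\<in>UNIV. z i y x * d i) = 0" "(\<Sum>i\<in>UNIV. z i y x * d i * \<rho> i) = 0"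
      using yx(7,8) unfolding K_def K'_def bil_M bil_M' z_def by simp_all
    then have "z 3 y x * d 3 + z 4 y x * d 4 = 0" "z 3 y x * d 3 * \<rho> 3 + z 4 y x * d 4 * \<rho> 4 = 0"
      unfolding sum_4 zz by simp_all
    then have "z 3 y x * d 3 * (\<rho> 3 - \<rho> 4) = 0" "z 4 y x * d 4 * (\<rho> 3 - \<rho> 4) = 0" by algebra+
    moreover have "\<rho> 3 \<noteq> \<rho> 4" using \<rho>_inj by (auto dest: injD)
    ultimately have "z 3 y x = 0" "z 4 y x = 0" using d_nz by auto
    then have z0: "z i y x = 0" for i using zz exhaust_4[of i] by auto
    define A where "A = (\<chi> i. ca y i)"
    define B where "B = (\<chi> i. cb x i)"
    have "y = (\<Sum>i\<in>UNIV. A $ i *s u i)" "x = (\<Sum>i\<in>UNIV. B $ i *s v i)"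
      using ca_sum[of y] cb_sum[of x] by (simp_all add: A_def B_def)
    then have AB: "A \<noteq> 0" "B \<noteq> 0" using yx(3,4) by auto
    have q: "(\<Sum>i\<in>UNIV. \<Sum>j\<in>UNIV. A $ i * A $ j * bil M' (jA (u i)) (jA (u j))) = 0"
       "(\<Sum>i\<in>UNIV. \<Sum>j\<in>UNIV. B $ i * B $ j * bil M' (jB (v i)) (jB (v j))) = 0"
      using yx(5,6) unfolding qform_A qform_B A_def B_def by simp_all
    have ab: "A $ i * B $ i = 0" "B $ i * A $ i = 0" for i using z0[of i] by (auto simp: z_def A_def B_def)
    have "(\<Sum>i\<in>UNIV. l i * A $ i) = 0 \<or> (\<Sum>i\<in>UNIV. l i * B $ i) = 0"
      using zz(3) by (simp add: \<psi>_def A_def B_def)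
    then show False
    proof
      assume "(\<Sum>i\<in>UNIV. l i * A $ i) = 0"
      from isotropic_pair_not_complementary[OF AB q u_nz v_nz bil_commute[OF symM'] this l(1) ab(1)]
      show False by blast
    next
      assume "(\<Sum>i\<in>UNIV. l i * B $ i) = 0"
      from isotropic_pair_not_complementary[OF AB(2,1) q(2,1) v_nz u_nz bil_commute[OF symM'] this l(2) ab(2)]
      show False by blast
    qed
  qed
  then show ?thesis unfolding dim_at_most_def
    by (intro exI[of _ V]) (use V in auto)
qed

definition "\<Psi> = (\<chi> pq ijkl. case ijkl of (i, j, k, l) \<Rightarrow> wedge (jA (\<alpha> i j)) (jB (\<beta> k l)) $ pq)"

lemma \<Psi>_nth: "(\<Psi> *v t) $ pq = lift (\<lambda>y x. wedge (jA y) (jB x) $ pq) t"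
  by (simp add: \<Psi>_def matrix_vector_mult_def sum_22 lift_def mult.commute)

lemma \<Psi>_tens: "\<Psi> *v tens m n = wedge (jA (mA m)) (jB (mB n))"
  unfolding vec_eq_iff
proof
  fix pq :: "8 \<times> 8"
  have "bilinear2 (\<lambda>y x. wedge (jA y) (jB x) $ pq)"
    by (simp add: bilinear2_def wedge_def jA_add jB_add jA_smult jB_smult algebra_simps)
  then show "(\<Psi> *v tens m n) $ pq = wedge (jA (mA m)) (jB (mB n)) $ pq"
    unfolding \<Psi>_nth by (rule lift_tens)
qed

text \<open>Products of dual bases separate tensors; one factor is contracted at a time.\<close>

lemma lift_K_zero:
  assumes "\<And>i j. lift (\<lambda>y x. ca y i * cb x j) t = 0"
  shows "t = 0"
proof -
  have 1: "(\<Sum>k\<in>UNIV. \<Sum>l\<in>UNIV. t $ (i, j, k, l) * cb (\<beta> k l) q) = 0" for i j q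
  proof -
    define m where "m i j = (\<Sum>k\<in>UNIV. \<Sum>l\<in>UNIV. t $ (i, j, k, l) * cb (\<beta> k l) q)" for i j
    have "ca (mA m) p = lift (\<lambda>y x. ca y p * cb x q) t" for p
      by (simp add: m_def lift_def sum_2 ca_linear algebra_simps)
    then have "mA m = 0" using ca_sum[of "mA m"] assms by simp
    then show ?thesis using mA_eq_0[of m i j] by (simp add: m_def)
  qed
  have "t $ (i, j, k, l) = 0" for i j k l
  proof (rule mB_eq_0)
    have "cb (mB (\<lambda>k l. t $ (i, j, k, l))) q = 0" for q
      using 1[of i j q] by (simp add: sum_2 cb_linear algebra_simps)
    then show "mB (\<lambda>k l. t $ (i, j, k, l)) = 0"
      using cb_sum[of "mB (\<lambda>k l. t $ (i, j, k, l))"] by simp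
  qed
  then show ?thesis by (auto simp: vec_eq_iff)
qed

text \<open>Contracting a bivector with \<open>bil M (jB (v p))\<close> and \<open>bil M (jA (u q))\<close>, which vanish on one of
  the two isotropic 4-spaces each, recovers the tensor.\<close>

lemma \<Psi>_injective: "\<Psi> *v t = 0 \<Longrightarrow> t = 0"
proof (rule lift_K_zero)
  fix p q assume t: "\<Psi> *v t = 0"
  define f where "f \<xi> = bil M \<xi> (jB (v p)) / d p" for \<xi>
  define g where "g \<xi> = bil M (jA (u q)) \<xi> / d q" for \<xi>
  have f: "f \<xi> = (\<Sum>i\<in>UNIV. \<xi> $ i * f (axis i 1))" for \<xi>
  proof -
    have "\<xi> = (\<Sum>i\<in>UNIV. \<xi> $ i *s axis i 1)" by (simp add: basis_expansion)
    then have "f \<xi> = f (\<Sum>i\<in>UNIV. \<xi> $ i *s axis i 1)" by simp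
    then show ?thesis by (simp add: f_def bil_sum_left bil_smult_left sum_divide_distrib)
  qed
  have g: "g \<xi> = (\<Sum>i\<in>UNIV. \<xi> $ i * g (axis i 1))" for \<xi>
  proof -
    have "\<xi> = (\<Sum>i\<in>UNIV. \<xi> $ i *s axis i 1)" by (simp add: basis_expansion)
    then have "g \<xi> = g (\<Sum>i\<in>UNIV. \<xi> $ i *s axis i 1)" by simp
    then show ?thesis by (simp add: g_def bil_sum_right bil_smult_right sum_divide_distrib)
  qed
  have w: "ca y p * cb x q = (\<Sum>i\<in>UNIV. \<Sum>j\<in>UNIV. f (axis i 1) * g (axis j 1) * wedge (jA y) (jB x) $ (i, j))" for y x
  proof -
    have "ca y p * cb x q = f (jA y) * g (jB x) - f (jB x) * g (jA y)"
      by (simp add: ca_def cb_def f_def g_def jA_isotropic jB_isotropic)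
    also have "\<dots> = (\<Sum>i\<in>UNIV. \<Sum>j\<in>UNIV. f (axis i 1) * g (axis j 1) * wedge (jA y) (jB x) $ (i, j))"
      unfolding f[of "jA y"] f[of "jB x"] g[of "jA y"] g[of "jB x"]
        sum_product sum_subtractf[symmetric] by (simp add: wedge_def algebra_simps)
    finally show ?thesis .
  qed
  have ls: "lift (\<lambda>y x. \<Sum>i\<in>I. b i y x) t = (\<Sum>i\<in>I. lift (b i) t)" for b and I :: "8 set"
    by (induction I rule: infinite_finite_induct) (simp_all add: lift_def algebra_simps sum.distrib)
  have lc: "lift (\<lambda>y x. c * b y x) t = c * lift b t" for b c
    by (simp add: lift_def sum_distrib_left algebra_simps)
  have "lift (\<lambda>y x. wedge (jA y) (jB x) $ ij) t = 0" for ij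
    using t unfolding \<Psi>_nth[symmetric] by simp
  then show "lift (\<lambda>y x. ca y p * cb x q) t = 0" unfolding w ls lc by simp
qed

text \<open>The decomposable tensors in \<open>L\<close> parametrize both the linear section of the
  Segre variety and, through \<open>\<Psi>\<close>, the planes in \<open>S\<close>. As
  \<open>\<Psi>\<close> is injective, a left inverse gives the isomorphism.\<close>

theorem segre_section:
  "\<exists>Y \<phi>. segre4_section_codim2 Y \<and> biregular (plucker ` S) Y \<phi> \<and> pulls_back_hyperplane_class (plucker ` S) \<phi>"
proof -
  define P where "P = {t. (\<exists>a b c e. t = tensor4 a b c e \<and> a \<noteq> 0 \<and> b \<noteq> 0 \<and> c \<noteq> 0 \<and> e \<noteq> 0) \<and> t \<in> L}"
  have nz: "tensor4 a b c e \<noteq> 0" if "a \<noteq> 0" "b \<noteq> 0" "c \<noteq> 0" "e \<noteq> 0" for a b c e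
  proof -
    from that have "\<exists>i. a $ i \<noteq> 0" "\<exists>j. b $ j \<noteq> 0" "\<exists>k. c $ k \<noteq> 0" "\<exists>l. e $ l \<noteq> 0"
      unfolding vec_eq_iff zero_index by blast+
    then obtain i j k l where "a $ i \<noteq> 0" "b $ j \<noteq> 0" "c $ k \<noteq> 0" "e $ l \<noteq> 0" by blast
    then have "tensor4 a b c e $ (i, j, k, l) \<noteq> 0" by (simp add: tensor4_def)
    then show ?thesis by (metis zero_index)
  qed
  have nzP: "t \<noteq> 0" if h: "t \<in> P" for t
  proof -
    obtain a b c e where "t = tensor4 a b c e" "a \<noteq> 0" "b \<noteq> 0" "c \<noteq> 0" "e \<noteq> 0" using h unfolding P_def by blast
    then show ?thesis using nz[of a b c e] by simp
  qed
  obtain B where B: "B ** \<Psi> = mat 1"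
  proof -
    have "inj ((*v) \<Psi>)"
    proof (rule injI)
      fix x y assume "\<Psi> *v x = \<Psi> *v y"
      then have "\<Psi> *v (x - y) = 0" by (simp add: matrix_vector_mult_diff_distrib)
      then show "x = y" using \<Psi>_injective by fastforce
    qed
    then have "\<exists>B. B ** \<Psi> = mat 1" unfolding matrix_left_invertible_injective .
    then show ?thesis using that by blast
  qed
  have Y: "line ` P = segre4 \<inter> proj L"
  proof (intro equalityI subsetI)
    fix p assume "p \<in> line ` P"
    then obtain t where t: "t \<in> P" "p = line t" by blast
    then show "p \<in> segre4 \<inter> proj L" using nzP[of t] unfolding P_def segre4_def proj_def by blast
  next
    fix p assume p: "p \<in> segre4 \<inter> proj L"
    then obtain a b c e where n: "a \<noteq> 0" "b \<noteq> 0" "c \<noteq> 0" "e \<noteq> 0" and pt: "p = line (tensor4 a b c e)"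
      unfolding segre4_def by blast
    obtain t where t: "t \<in> L" "p = line t" using p unfolding proj_def by blast
    have "tensor4 a b c e \<in> line t" using t pt by (metis line_def vec.span_base singletonI)
    then have "tensor4 a b c e \<in> L" using subspace_L t(1) unfolding line_mem by (auto intro: vec.subspace_scale)
    then show "p \<in> line ` P" using n unfolding pt P_def by blast
  qed
  have S: "plucker ` S = (\<lambda>t. line (\<Psi> *v t)) ` P"
  proof (intro equalityI subsetI)
    fix p assume "p \<in> plucker ` S"
    then obtain y x where yx: "p = plucker (vec.span {jA y, jB x})" "y \<noteq> 0" "x \<noteq> 0" "qform M' (jA y) = 0" "qform M' (jB x) = 0"
      "K y x = 0" "K' y x = 0" unfolding S_def K_def K'_def by blast
    obtain a b c e where t: "y = mA (\<lambda>i j. a $ i * b $ j)" "x = mB (\<lambda>i j. c $ i * e $ j)"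
      "a \<noteq> 0" "b \<noteq> 0" "c \<noteq> 0" "e \<noteq> 0" "tensor4 a b c e \<in> L"
      by (rule segre_point_exists[OF yx(2-7)]) (rule that)
    have "p = line (\<Psi> *v tensor4 a b c e)"
      unfolding yx(1) plucker_span tensor4_tens \<Psi>_tens t(1,2)[symmetric] ..
    then show "p \<in> (\<lambda>t. line (\<Psi> *v t)) ` P" using t(3-7) unfolding P_def by blast
  next
    fix p assume "p \<in> (\<lambda>t. line (\<Psi> *v t)) ` P"
    then obtain a b c e where t: "a \<noteq> 0" "b \<noteq> 0" "c \<noteq> 0" "e \<noteq> 0" "tensor4 a b c e \<in> L"
      and p: "p = line (\<Psi> *v tensor4 a b c e)" unfolding P_def by blast
    obtain y x where yx: "y = mA (\<lambda>i j. a $ i * b $ j)" "x = mB (\<lambda>i j. c $ i * e $ j)" "y \<noteq> 0" "x \<noteq> 0"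
      "qform M' (jA y) = 0" "qform M' (jB x) = 0" "K y x = 0" "K' y x = 0"
      by (rule segre_point[OF t]) (rule that)
    have "p = plucker (vec.span {jA y, jB x})"
      unfolding p plucker_span tensor4_tens \<Psi>_tens yx(1,2)[symmetric] ..
    then show "p \<in> plucker ` S" using yx(3-8) unfolding S_def K_def K'_def by blast
  qed
  have "segre4_section_codim2 (segre4 \<inter> proj L)"
    unfolding segre4_section_codim2_def using subspace_L dim_L section_dimension by blast
  then show ?thesis
    using biregular_linear[OF B nzP, of P] unfolding S Y
    by (intro exI[of _ "segre4 \<inter> proj L"] exI[of _ "\<lambda>x. (*v) B ` x"] conjI)
qed

end

section \<open>Zero loci of sections given by pure spinors\<close>

text \<open>The polarization of \<open>pf\<close>: \<open>pf (z + x)\<close> is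
  \<open>pf z + pol z x + pf x\<close>.\<close>

definition pol :: "complex ^ 6 \<Rightarrow> complex ^ 6 \<Rightarrow> complex" where
  "pol z x = z$1 * x$4 + z$2 * x$5 + z$3 * x$6 + z$4 * x$1 + z$5 * x$2 + z$6 * x$3"

lemma skew_dual_polar: "skew (dual6 z) (skew x w) + skew (dual6 x) (skew z w) = - pol z x *s w"
  by (simp add: vec_eq_iff forall_4 dual6_def pol_def algebra_simps)

lemma dual6_linear: "dual6 (z + x) = dual6 z + dual6 x" "dual6 (c *s z) = c *s dual6 z" "dual6 (dual6 z) = z"
  by (simp_all add: vec_eq_iff forall_6 dual6_def)

definition dot4 :: "complex ^ 4 \<Rightarrow> complex ^ 4 \<Rightarrow> complex" where
  "dot4 x y = (\<Sum>i\<in>UNIV. x$i * y$i)"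

definition wedge6 :: "complex ^ 4 \<Rightarrow> complex ^ 4 \<Rightarrow> complex ^ 6" where
  "wedge6 a b = vec6 (a$1 * b$2 - a$2 * b$1) (a$1 * b$3 - a$3 * b$1) (a$1 * b$4 - a$4 * b$1)
     (a$3 * b$4 - a$4 * b$3) (a$4 * b$2 - a$2 * b$4) (a$2 * b$3 - a$3 * b$2)"

lemma skew_wedge6: "skew (wedge6 a b) y = dot4 b y *s a - dot4 a y *s b"
  by (simp add: vec_eq_iff forall_4 wedge6_def dot4_def sum_4 algebra_simps)

lemma dot4_simps: "dot4 (a + b) y = dot4 a y + dot4 b y" "dot4 y (a + b) = dot4 y a + dot4 y b"
   "dot4 (c *s a) y = c * dot4 a y" "dot4 y (c *s a) = c * dot4 y a" "dot4 a b = dot4 b a"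
  by (simp_all add: dot4_def sum_4 algebra_simps)

lemma dual_pair:
  fixes x1 x2 :: "complex ^ 4"
  assumes "indep2 x1 x2"
  obtains f1 f2 where "dot4 f1 x1 = 1" "dot4 f1 x2 = 0" "dot4 f2 x1 = 0" "dot4 f2 x2 = 1"
proof -
  obtain i j where m: "x1 $ i * x2 $ j - x1 $ j * x2 $ i \<noteq> 0" using assms by (auto simp: indep2_minor)
  define m where "m = x1 $ i * x2 $ j - x1 $ j * x2 $ i"
  have ij: "i \<noteq> j" "m \<noteq> 0" using m by (auto simp: m_def)
  have s: "dot4 (a *s axis i 1 + b *s axis j 1) x = a * x $ i + b * x $ j" for a b x
  proof -
    have "dot4 (axis k 1) x = x $ k" for k
      by (simp add: dot4_def axis_def if_distrib[where f = "\<lambda>t. t * _"] cong: if_cong)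
    then show ?thesis by (simp add: dot4_simps)
  qed
  show ?thesis
    by (rule that[of "(x2 $ j / m) *s axis i 1 + (- x2 $ i / m) *s axis j 1"
         "(- x1 $ j / m) *s axis i 1 + (x1 $ i / m) *s axis j 1"])
       (unfold s, use ij(2) in \<open>simp_all add: divide_simps\<close>, simp_all add: m_def algebra_simps)
qed

text \<open>The conditions on the dot products are those which a skew matrix imposes. In the
  witness, the first two terms take the right values up to multiples of \<open>f2\<close> and
  \<open>f1\<close>, and the third one cancels these.\<close>

lemma skew_interpolation:
  fixes x1 x2 y1 y2 :: "complex ^ 4"
  assumes "indep2 x1 x2" "dot4 x1 y1 = 0" "dot4 x2 y2 = 0" "dot4 x1 y2 + dot4 x2 y1 = 0"
  obtains z where "skew z x1 = - y1" "skew z x2 = - y2"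
proof -
  obtain f1 f2 where f: "dot4 f1 x1 = 1" "dot4 f1 x2 = 0" "dot4 f2 x1 = 0" "dot4 f2 x2 = 1"
    by (rule dual_pair[OF assms(1)]) (rule that)
  define z where "z = (-1) *s (wedge6 y1 f1 + (wedge6 y2 f2 + (- dot4 x1 y2) *s wedge6 f1 f2))"
  have a: "dot4 y1 x1 = 0" "dot4 y2 x2 = 0" "dot4 y2 x1 = dot4 x1 y2" "dot4 y1 x2 = - dot4 x1 y2"
    using assms(2-4) dot4_simps(5)[of x1 y1] dot4_simps(5)[of x2 y2] dot4_simps(5)[of x1 y2] dot4_simps(5)[of x2 y1]
    by (simp_all add: eq_neg_iff_add_eq_0 add.commute)
  have "skew (a + b) y = skew a y + skew b y" "skew (c *s a) y = c *s skew a y" for a b c y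
    by (simp_all add: vec_eq_iff forall_4 algebra_simps)
  note sk = this skew_wedge6 f a
  show ?thesis
  proof (rule that[of z])
    show "skew z x1 = - y1" "skew z x2 = - y2" unfolding z_def sk by (simp_all add: vec_eq_iff)
  qed
qed

context pencil_model
begin

lemma bil_kp: "2 * bil M (kp x w) (kp x' w') = dot4 x w' + dot4 x' w"
proof -
  have q: "qform M (kp x w) = dot4 x w" for x w unfolding q_kp dot4_def ..
  have "qform M (kp x w + kp x' w') = dot4 (x + x') (w + w')" unfolding kp_add[symmetric] q ..
  then show ?thesis unfolding qform_add[OF sym] q by (simp add: dot4_simps)
qed

text \<open>The left side is the pairing with \<open>pure x\<close> under the polarization of
  \<open>s * t - pf z\<close>. If the plane meets the isotropic 4-space of \<open>x\<close>, a
  common annihilating vector forces the pairing to vanish; if it does not, a spinor of the fibre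
  with pairing 1 is constructed.\<close>

theorem pure_zero_locus:
  assumes E: "E \<in> X"
  shows "(\<forall>s z t. io s z t \<in> spinor_sub \<gamma> y0 E \<longrightarrow> t - pol z x + pf x * s = 0) \<longleftrightarrow> (\<exists>y. y \<noteq> 0 \<and> ch x y \<in> E)"
proof
  assume "\<exists>y. y \<noteq> 0 \<and> ch x y \<in> E"
  then obtain w where w: "w \<noteq> 0" "ch x w \<in> E" by blast
  show "\<forall>s z t. io s z t \<in> spinor_sub \<gamma> y0 E \<longrightarrow> t - pol z x + pf x * s = 0"
  proof (intro allI impI)
    fix s z t assume "io s z t \<in> spinor_sub \<gamma> y0 E"
    then have "\<gamma> (kp (skew x w) w) *v io s z t = 0" using w(2) by (auto simp: spinor_sub_def ch_def)
    then have r: "s *s skew x w = skew z w" "t *s w = - skew (dual6 z) (skew x w)" unfolding rel by auto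
    have "skew (dual6 x) (skew z w) = - (s * pf x) *s w"
      unfolding r(1)[symmetric] skew_linear skew_dual by simp
    then have "- skew (dual6 z) (skew x w) = (pol z x - pf x * s) *s w"
      using skew_dual_polar[of z x w] by (simp add: vec_eq_iff algebra_simps)
    then have "(t - pol z x + pf x * s) *s w = 0" using r(2) by (simp add: vec_eq_iff algebra_simps)
    then show "t - pol z x + pf x * s = 0" using w(1) unfolding vec.scale_eq_0_iff by blast
  qed
next
  assume van: "\<forall>s z t. io s z t \<in> spinor_sub \<gamma> y0 E \<longrightarrow> t - pol z x + pf x * s = 0"
  obtain \<xi> \<eta> where i: "indep2 \<xi> \<eta>" and Es: "E = vec.span {\<xi>, \<eta>}" using X_basis[OF E] .
  obtain a1 y1 where k1: "\<xi> = kp a1 y1" using kp_surj by blast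
  obtain a2 y2 where k2: "\<eta> = kp a2 y2" using kp_surj by blast
  \<comment> \<open>\<open>x1\<close> and \<open>x2\<close> represent the basis modulo the isotropic
    4-space of \<open>x\<close>; the plane meets this space exactly if they are dependent.\<close>
  define x1 where "x1 = a1 - skew x y1"
  define x2 where "x2 = a2 - skew x y2"
  have iso: "qform M \<xi> = 0" "bil M \<xi> \<eta> = 0" "qform M \<eta> = 0" using E X_span[OF i] unfolding Es by auto
  have d: "dot4 a1 y1 = 0" "dot4 a2 y2 = 0" "dot4 a1 y2 + dot4 a2 y1 = 0"
    using iso bil_kp[of a1 y1 a2 y2] unfolding k1 k2 q_kp dot4_def[symmetric] by auto
  show "\<exists>y. y \<noteq> 0 \<and> ch x y \<in> E"
  proof (cases "indep2 x1 x2")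
    case False
    then obtain k l where kl: "k \<noteq> 0 \<or> l \<noteq> 0" "k *s x1 + l *s x2 = 0" unfolding indep2_def by blast
    define y where "y = k *s y1 + l *s y2"
    have "k *s a1 + l *s a2 = skew x y"
      using kl(2) unfolding y_def x1_def x2_def skew_linear by (simp add: vec_eq_iff algebra_simps)
    then have e: "k *s \<xi> + l *s \<eta> = ch x y"
      unfolding k1 k2 ch_def by (simp add: y_def flip: kp_add kp_smult)
    have "k *s \<xi> + l *s \<eta> \<in> E" unfolding Es span2 by blast
    moreover have "y \<noteq> 0"
    proof
      assume "y = 0"
      then have "k *s \<xi> + l *s \<eta> = 0" using e by (simp add: ch_eq_0)
      then show False using i kl(1) unfolding indep2_def by blast
    qed
    ultimately show ?thesis unfolding e by blast
  next
    case True
    have dd: "dot4 (a - skew x b) c = dot4 a c - dot4 (skew x b) c" for a b c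
      by (simp add: dot4_def sum_subtractf algebra_simps)
    have sk: "dot4 (skew x b) b = 0" "dot4 (skew x y1) y2 + dot4 (skew x y2) y1 = 0" for b
      by (simp_all add: dot4_def sum_4 algebra_simps)
    have "dot4 x1 y1 = 0" "dot4 x2 y2 = 0" "dot4 x1 y2 + dot4 x2 y1 = 0"
      unfolding x1_def x2_def dd using d sk(1)[of y1] sk(1)[of y2] sk(2) by (simp_all add: algebra_simps) algebra
    then obtain \<zeta> where \<zeta>: "skew \<zeta> x1 = - y1" "skew \<zeta> x2 = - y2"
      by (rule skew_interpolation[OF True]) (rule that)
    \<comment> \<open>The case \<open>x = 0\<close> has the solution with coordinates
      \<open>pf \<zeta>\<close>, \<open>dual6 \<zeta>\<close>, 1; it is shifted by \<open>x\<close>.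
      The summand 1 in \<open>t\<close> becomes the value of the pairing.\<close>
    define z where "z = dual6 \<zeta>"
    define s where "s = pf \<zeta>"
    define t where "t = 1 + pol z x + s * pf x"
    have r: "\<gamma> (kp (a + skew x y) y) *v io s (z + s *s x) t = 0" if h: "skew \<zeta> a = - y" for a y
    proof -
      have sy: "skew z y = s *s a"
      proof -
        have "skew z (skew \<zeta> a) = - s *s a" unfolding z_def s_def by (rule skew_dual)
        then show ?thesis unfolding h using skew_linear(2)[of z "-1" y] by (simp add: vec_eq_iff)
      qed
      have y: "y = - skew (dual6 z) a" using h unfolding z_def dual6_linear by simp
      have p: "skew (dual6 z) (skew x y) = - pol z x *s y - s *s skew (dual6 x) a"
        using skew_dual_polar[of z x y] unfolding sy skew_linear by (simp add: eq_diff_eq)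
      show ?thesis unfolding rel
      proof
        show "s *s (a + skew x y) = skew (z + s *s x) y"
          unfolding skew_linear sy by (simp add: vec_eq_iff algebra_simps)
        have "skew (dual6 (z + s *s x)) (a + skew x y)
           = skew (dual6 z) a + skew (dual6 z) (skew x y) + s *s skew (dual6 x) a + s *s skew (dual6 x) (skew x y)"
          unfolding dual6_linear skew_linear by (simp add: vec_eq_iff algebra_simps)
        also have "\<dots> = skew (dual6 z) a - (pol z x + s * pf x) *s y"
          unfolding p skew_dual by (simp add: vec_eq_iff algebra_simps)
        also have "\<dots> = - t *s y" using y unfolding t_def by (simp add: vec_eq_iff algebra_simps)
        finally show "t *s y = - skew (dual6 (z + s *s x)) (a + skew x y)" by (simp add: vec_eq_iff)
      qed
    qed
    have "\<gamma> \<xi> *v io s (z + s *s x) t = 0" "\<gamma> \<eta> *v io s (z + s *s x) t = 0"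
      using r[OF \<zeta>(1)] r[OF \<zeta>(2)] by (simp_all add: x1_def x2_def k1 k2)
    then have "io s (z + s *s x) t \<in> spinor_sub \<gamma> y0 E"
      unfolding Es spinor_sub_span cl_def using io_half_spin by blast
    then have "t - pol (z + s *s x) x + pf x * s = 0" using van by blast
    moreover have "pol (z + s *s x) x = pol z x + 2 * s * pf x" by (simp add: pol_def pf_def algebra_simps)
    ultimately show ?thesis by (simp add: t_def algebra_simps)
  qed
qed

text \<open>The same for pure functionals in the opposite chart, where the coefficient of
  \<open>s\<close> is normalized to 1, by exchanging all hyperbolic pairs.\<close>

lemma pure_zero_locus_swapped:
  assumes E: "E \<in> X"
  shows "(\<forall>s z t. io s z t \<in> spinor_sub \<gamma> y0 E \<longrightarrow> pf x * t + pol z (dual6 x) + s = 0) \<longleftrightarrow> (\<exists>y. y \<noteq> 0 \<and> kp y (skew x y) \<in> E)"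
proof -
  interpret m: pencil_model M \<gamma> y0 "al_kp kp" "al_io io" M' p r by (rule swap_all)
  have d: "- dual6 (- dual6 z) = z" for z by (simp add: vec_eq_iff forall_6 dual6_def)
  have a: "al_io io t (- dual6 z) s = io s z t" for s z t unfolding al_io_def d ..
  have pl: "pol (- dual6 z) x = - pol z (dual6 x)" for z by (simp add: pol_def dual6_def algebra_simps)
  have "(\<forall>s z t. al_io io s z t \<in> spinor_sub \<gamma> y0 E \<longrightarrow> t - pol z x + pf x * s = 0) \<longleftrightarrow>
     (\<forall>s z t. io s z t \<in> spinor_sub \<gamma> y0 E \<longrightarrow> pf x * t + pol z (dual6 x) + s = 0)" (is "?l \<longleftrightarrow> ?r")
  proof
    assume l: ?l
    show ?r
    proof (intro allI impI)
      fix s z t assume "io s z t \<in> spinor_sub \<gamma> y0 E"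
      then have "al_io io t (- dual6 z) s \<in> spinor_sub \<gamma> y0 E" unfolding a .
      from l[rule_format, OF this] have "s - pol (- dual6 z) x + pf x * t = 0" .
      then show "pf x * t + pol z (dual6 x) + s = 0" unfolding pl by (simp add: algebra_simps)
    qed
  next
    assume r: ?r
    show ?l
    proof (intro allI impI)
      fix s z t assume "al_io io s z t \<in> spinor_sub \<gamma> y0 E"
      then have "io t (- dual6 z) s \<in> spinor_sub \<gamma> y0 E" by (simp add: al_io_def)
      from r[rule_format, OF this] have "pf x * s + pol (- dual6 z) (dual6 x) + t = 0" .
      moreover have "pol (- dual6 z) (dual6 x) = - pol z x" by (simp add: pol_def dual6_def algebra_simps)
      ultimately show "t - pol z x + pf x * s = 0" by (simp add: algebra_simps)
    qed
  qed
  moreover have "m.ch x y = kp y (skew x y)" for y by (simp add: m.ch_def al_kp_def)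
  moreover have "E \<in> m.X" using E by (simp add: X_def m.X_def)
  ultimately show ?thesis using m.pure_zero_locus[of E x] by simp
qed

end

section \<open>Generic eigenbases\<close>

lemma poly_functions_linear_injective_open:
  fixes L :: "'a \<Rightarrow> complex ^ 'n \<Rightarrow> complex ^ 'm"
  assumes L: "\<And>v i. (\<lambda>x. L x v $ i) \<in> poly_functions G"
    and lin: "\<And>x v w. L x (v + w) = L x v + L x w" "\<And>x c v. L x (c *s v) = c *s L x v"
    and inj: "\<And>v. L a v = 0 \<Longrightarrow> v = 0"
  shows "\<exists>F\<in>poly_functions G. F a \<noteq> 0 \<and> (\<forall>x. F x \<noteq> 0 \<longrightarrow> (\<forall>v. L x v = 0 \<longrightarrow> v = 0))"
proof -
  have L0: "L x 0 = 0" for x using lin(2)[of x 0 0] by simp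
  have sum: "L x (\<Sum>i\<in>I. f i) = (\<Sum>i\<in>I. L x (f i))" for x f and I :: "'n set"
    by (induction I rule: infinite_finite_induct) (simp_all add: L0 lin)
  define A where "A x = (\<chi> i j. L x (axis j 1) $ i)" for x
  have A: "A x *v v = L x v" for x v
  proof -
    have "L x (\<Sum>i\<in>UNIV. v $ i *s axis i 1) = (\<Sum>i\<in>UNIV. v $ i *s L x (axis i 1))" unfolding sum lin ..
    then have "L x v = (\<Sum>i\<in>UNIV. v $ i *s L x (axis i 1))" by (simp only: basis_expansion)
    then show ?thesis by (simp add: vec_eq_iff A_def matrix_vector_mult_def sum_component mult.commute)
  qed
  have "(\<lambda>x. A x $ i $ j) \<in> poly_functions G" for i j unfolding A_def by (simp add: L)
  from poly_functions_injective_open[of A, OF this, of a] inj show ?thesis unfolding A by blast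
qed

text \<open>Combining the equations with the coefficients of the cubic which has the roots
  \<open>r1\<close>, \<open>r2\<close>, \<open>r3\<close> isolates \<open>c4\<close>.\<close>

lemma vandermonde4:
  fixes c1 c2 c3 c4 r1 r2 r3 r4 :: complex
  assumes "c1 + c2 + c3 + c4 = 0" "c1 * r1 + c2 * r2 + c3 * r3 + c4 * r4 = 0"
    "c1 * r1^2 + c2 * r2^2 + c3 * r3^2 + c4 * r4^2 = 0" "c1 * r1^3 + c2 * r2^3 + c3 * r3^3 + c4 * r4^3 = 0"
    and "r4 \<noteq> r1" "r4 \<noteq> r2" "r4 \<noteq> r3"
  shows "c4 = 0"
proof -
  have "c4 * ((r4 - r1) * (r4 - r2) * (r4 - r3)) = 0" using assms(1-4) by algebra
  then show ?thesis using assms(5-7) by simp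
qed

text \<open>Eigenvectors are not polynomial in a matrix. This map is linear in \<open>y\<close> and
  polynomial in \<open>R\<close>, \<open>S\<close>, \<open>P\<close>, so its injectivity is an open
  condition which can replace statements about all eigenvectors.\<close>

definition eigen_test :: "complex ^ 4 ^ 4 \<Rightarrow> complex ^ 4 ^ 4 \<Rightarrow> complex ^ 4 ^ 4 \<Rightarrow> complex ^ (4 \<times> 4) \<Rightarrow> complex ^ (4 \<times> 4 + 4)" where
  "eigen_test R S P y = (let Y = \<chi> i j. y $ (i, j) in
     \<chi> k. case k of Inl (i, j) \<Rightarrow> (R ** Y) $ i $ j - (Y ** S) $ i $ j
       | Inr k \<Rightarrow> (\<Sum>i\<in>UNIV. (P ** ((if k = 1 then mat 1 else if k = 2 then R else if k = 3 then R ** R else R ** (R ** R)) ** Y)) $ i $ i))"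

lemma eigen_test_linear:
  "eigen_test R S P (y + y') = eigen_test R S P y + eigen_test R S P y'"
  "eigen_test R S P (c *s y) = c *s eigen_test R S P y"
  by (auto simp: eigen_test_def vec_eq_iff Let_def matrix_matrix_mult_def algebra_simps sum.distrib sum_distrib_left split: sum.split)

lemma eigen_test_zero:
  assumes "eigen_test R S P y = 0" and Y: "Y = (\<chi> i j. y $ (i, j))"
  shows "R ** Y = Y ** S" "(\<Sum>i\<in>UNIV. (P ** Y) $ i $ i) = 0" "(\<Sum>i\<in>UNIV. (P ** (R ** Y)) $ i $ i) = 0"
   "(\<Sum>i\<in>UNIV. (P ** (R ** (R ** Y))) $ i $ i) = 0" "(\<Sum>i\<in>UNIV. (P ** (R ** (R ** (R ** Y)))) $ i $ i) = 0"
proof -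
  have 1: "eigen_test R S P y $ Inl (i, j) = 0" "eigen_test R S P y $ Inr k = 0" for i j k using assms(1) by simp_all
  show "R ** Y = Y ** S" using 1(1) by (simp add: eigen_test_def Let_def Y[symmetric] vec_eq_iff)
  show "(\<Sum>i\<in>UNIV. (P ** Y) $ i $ i) = 0" "(\<Sum>i\<in>UNIV. (P ** (R ** Y)) $ i $ i) = 0"
   "(\<Sum>i\<in>UNIV. (P ** (R ** (R ** Y))) $ i $ i) = 0" "(\<Sum>i\<in>UNIV. (P ** (R ** (R ** (R ** Y)))) $ i $ i) = 0"
    using 1(2)[of 1] 1(2)[of 2] 1(2)[of 3] 1(2)[of 4]
    by (simp_all add: eigen_test_def Let_def Y[symmetric] matrix_mul_assoc)
qed

lemma eigen_testI:
  assumes "Y = (\<chi> i j. y $ (i, j))" "R ** Y = Y ** S" "(\<Sum>i\<in>UNIV. (P ** Y) $ i $ i) = 0" "(\<Sum>i\<in>UNIV. (P ** (R ** Y)) $ i $ i) = 0"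
   "(\<Sum>i\<in>UNIV. (P ** (R ** (R ** Y))) $ i $ i) = 0" "(\<Sum>i\<in>UNIV. (P ** (R ** (R ** (R ** Y)))) $ i $ i) = 0"
  shows "eigen_test R S P y = 0"
  using assms(2-) unfolding eigen_test_def assms(1)[symmetric] Let_def
  by (auto simp: vec_eq_iff matrix_mul_assoc split: sum.split)

text \<open>A right eigenvector \<open>v\<close> of \<open>R\<close> and a left eigenvector \<open>w\<close> of \<open>S\<close> with the same eigenvalue
  give a matrix \<open>Y = v w\<^sup>T\<close> with \<open>R Y = Y S\<close>, and \<open>w\<^sup>T P v = 0\<close> means that all \<open>tr (P R\<^sup>m Y)\<close> vanish.\<close>

lemma eigen_test_eigenvectors:
  assumes inj: "\<And>y. eigen_test R S P y = 0 \<Longrightarrow> y = 0"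
    and v: "R *v v = l *s v" "v \<noteq> 0" and w: "w v* S = l *s w" "w \<noteq> 0"
  shows "dot4 w (P *v v) \<noteq> 0"
proof
  assume 0: "dot4 w (P *v v) = 0"
  define y where "y = (\<chi> ij. v $ fst ij * w $ snd ij)"
  define Y where "Y = (\<chi> i j. y $ (i, j))"
  have Yn: "Y $ i $ j = v $ i * w $ j" for i j by (simp add: Y_def y_def)
  have RY: "(Q ** Y) $ i $ j = (Q *v v) $ i * w $ j" for Q i j
    by (simp add: matrix_matrix_mult_def matrix_vector_mult_def Yn sum_distrib_left sum_distrib_right mult.assoc)
  have YS: "(Y ** S) $ i $ j = v $ i * (w v* S) $ j" for i j
    by (simp add: matrix_matrix_mult_def vector_matrix_mult_def Yn sum_distrib_left mult_ac)
  define sc :: "complex \<Rightarrow> complex ^ 4 ^ 4 \<Rightarrow> complex ^ 4 ^ 4" where "sc c Q = (\<chi> i j. c * Q $ i $ j)" for c Q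
  have R: "R ** Y = sc l Y" unfolding vec_eq_iff RY v(1) by (simp add: Yn sc_def)
  have P: "(\<Sum>i\<in>UNIV. (P ** Y) $ i $ i) = 0" using 0 by (simp add: RY dot4_def mult.commute)
  have s: "Q ** sc c T = sc c (Q ** T)" for Q T c
    by (simp add: sc_def vec_eq_iff matrix_matrix_mult_def sum_distrib_left mult_ac)
  have t: "(\<Sum>i\<in>UNIV. sc c T $ i $ i) = c * (\<Sum>i\<in>UNIV. T $ i $ i)" for c T
    by (simp add: sc_def sum_distrib_left)
  have "eigen_test R S P y = 0"
  proof (rule eigen_testI[OF Y_def _ P])
    show "R ** Y = Y ** S" unfolding vec_eq_iff RY YS v(1) w(1) by simp
  qed (simp_all add: R s t P)
  then have "y = 0" by (rule inj)
  moreover obtain i j where "v $ i \<noteq> 0" "w $ j \<noteq> 0" using v(2) w(2) unfolding vec_eq_iff zero_index by blast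
  then have "y $ (i, j) \<noteq> 0" by (simp add: y_def)
  ultimately show False by simp
qed

text \<open>Commuting with a diagonal matrix with distinct entries makes \<open>Y\<close> diagonal,
  and the four traces form a Vandermonde system for \<open>P $ i $ i * Y $ i $ i\<close>.\<close>

lemma eigen_test_diagonal:
  assumes r: "\<And>i j. i \<noteq> j \<Longrightarrow> r i \<noteq> r j" and P: "\<And>i. P $ i $ i \<noteq> 0"
    and z: "eigen_test (\<chi> i j. if i = j then r i else 0) (\<chi> i j. if i = j then r i else 0) P y = 0"
  shows "y = 0"
proof -
  define R where "R = (\<chi> i j :: 4. if i = j then r i else 0)"
  define Y where "Y = (\<chi> i j. y $ (i, j))"
  note z = eigen_test_zero[OF z[folded R_def] Y_def]
  have RY: "(R ** Q) $ i $ j = r i * Q $ i $ j" for Q :: "complex ^ 4 ^ 4" and i j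
    by (simp add: R_def matrix_matrix_mult_def if_distrib[where f = "\<lambda>t. t * _"] cong: if_cong)
  have YR: "(Q ** R) $ i $ j = Q $ i $ j * r j" for Q :: "complex ^ 4 ^ 4" and i j
    by (simp add: R_def matrix_matrix_mult_def if_distrib[where f = "\<lambda>t. _ * t"] cong: if_cong)
  have off: "Y $ i $ j = 0" if "i \<noteq> j" for i j
  proof -
    have "(R ** Y) $ i $ j = (Y ** R) $ i $ j" using z(1) by simp
    then have "(r i - r j) * Y $ i $ j = 0" unfolding RY YR by (simp add: algebra_simps)
    then show ?thesis using r[OF that] by simp
  qed
  have tr: "(\<Sum>i\<in>UNIV. (P ** Q) $ i $ i) = (\<Sum>i\<in>UNIV. P $ i $ i * Q $ i $ i)"
    if "\<And>i j. i \<noteq> j \<Longrightarrow> Q $ i $ j = 0" for Q :: "complex ^ 4 ^ 4"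
  proof (rule sum.cong[OF refl])
    fix i :: 4
    have "(P ** Q) $ i $ i = (\<Sum>k\<in>UNIV. P $ i $ k * Q $ k $ i)" by (simp add: matrix_matrix_mult_def)
    also have "\<dots> = (\<Sum>k\<in>{i}. P $ i $ k * Q $ k $ i)" by (rule sum.mono_neutral_right) (auto simp: that)
    finally show "(P ** Q) $ i $ i = P $ i $ i * Q $ i $ i" by simp
  qed
  define c where "c i = P $ i $ i * Y $ i $ i" for i
  have "(\<Sum>i\<in>UNIV. c i) = 0" "(\<Sum>i\<in>UNIV. c i * r i) = 0" "(\<Sum>i\<in>UNIV. c i * (r i)\<^sup>2) = 0" "(\<Sum>i\<in>UNIV. c i * (r i)^3) = 0"
    using z(2-) by (simp_all add: tr RY off c_def power2_eq_square power3_eq_cube mult_ac)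
  note e = this[unfolded sum_4]
  have d: "r 1 \<noteq> r 2" "r 1 \<noteq> r 3" "r 1 \<noteq> r 4" "r 2 \<noteq> r 3" "r 2 \<noteq> r 4" "r 3 \<noteq> r 4" by (rule r; simp)+
  have "c 4 = 0" by (rule vandermonde4[of "c 1" "c 2" "c 3" "c 4" "r 1" "r 2" "r 3" "r 4"]) (use e d in auto)
  moreover have "c 3 = 0" by (rule vandermonde4[of "c 1" "c 2" "c 4" "c 3" "r 1" "r 2" "r 4" "r 3"]) (use e d in \<open>auto simp: add_ac\<close>)
  moreover have "c 2 = 0" by (rule vandermonde4[of "c 1" "c 3" "c 4" "c 2" "r 1" "r 3" "r 4" "r 2"]) (use e d in \<open>auto simp: add_ac\<close>)
  moreover have "c 1 = 0" by (rule vandermonde4[of "c 2" "c 3" "c 4" "c 1" "r 2" "r 3" "r 4" "r 1"]) (use e d in \<open>auto simp: add_ac\<close>)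
  ultimately have "c i = 0" for i using exhaust_4[of i] by auto
  then have "Y $ i $ i = 0" for i using P by (auto simp: c_def)
  then have "Y $ i $ j = 0" for i j using off by (cases "i = j") auto
  then show "y = 0" by (auto simp: Y_def vec_eq_iff)
qed

lemma eigenpair_open:
  fixes R S P :: "'a \<Rightarrow> complex ^ 4 ^ 4"
  assumes R: "\<And>i j. (\<lambda>x. R x $ i $ j) \<in> poly_functions G" and S: "\<And>i j. (\<lambda>x. S x $ i $ j) \<in> poly_functions G"
    and P: "\<And>i j. (\<lambda>x. P x $ i $ j) \<in> poly_functions G"
    and a: "R a = (\<chi> i j. if i = j then r i else 0)" "S a = (\<chi> i j. if i = j then r i else 0)"
    and r: "\<And>i j. i \<noteq> j \<Longrightarrow> r i \<noteq> r j" and Pa: "\<And>i. P a $ i $ i \<noteq> 0"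
  shows "\<exists>F\<in>poly_functions G. F a \<noteq> 0 \<and> (\<forall>x. F x \<noteq> 0 \<longrightarrow>
    (\<forall>l v w. R x *v v = l *s v \<longrightarrow> v \<noteq> 0 \<longrightarrow> w v* S x = l *s w \<longrightarrow> w \<noteq> 0 \<longrightarrow> dot4 w (P x *v v) \<noteq> 0))"
proof -
  have "\<exists>F\<in>poly_functions G. F a \<noteq> 0 \<and> (\<forall>x. F x \<noteq> 0 \<longrightarrow> (\<forall>y. eigen_test (R x) (S x) (P x) y = 0 \<longrightarrow> y = 0))"
  proof (rule poly_functions_linear_injective_open[OF _ eigen_test_linear])
    fix y k
    have c: "(\<lambda>x. (\<chi> i j. y $ (i, j)) $ i $ j) \<in> poly_functions G" for i j :: 4
      by (rule poly_functions.const)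
    have m: "(\<lambda>x. (mat 1 :: complex ^ 4 ^ 4) $ i $ j) \<in> poly_functions G" for i j
      by (rule poly_functions.const)
    show "(\<lambda>x. eigen_test (R x) (S x) (P x) y $ k) \<in> poly_functions G"
    proof (cases k)
      case (Inl ij)
      obtain i j where "ij = (i, j)" by fastforce
      then show ?thesis unfolding eigen_test_def Let_def Inl
        by (simp del: vec_lambda_beta add: vec_lambda_beta[of "\<lambda>k. case k of Inl ij \<Rightarrow> _ ij | Inr k \<Rightarrow> _ k"])
           (intro poly_functions_intros poly_functions_matrix_mult R S c)
    next
      case (Inr i)
      consider "i = 1" | "i = 2" | "i = 3" | "i = 4" using exhaust_4[of i] by blast
      then show ?thesis unfolding eigen_test_def Let_def Inr
        by cases (simp_all del: vec_lambda_beta add: vec_lambda_beta[of "\<lambda>k. case k of Inl ij \<Rightarrow> _ ij | Inr k \<Rightarrow> _ k"],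
           (intro poly_functions_intros poly_functions_matrix_mult R P m c)+)
    qed
  next
    fix y assume "eigen_test (R a) (S a) (P a) y = 0"
    then show "y = 0" using eigen_test_diagonal[of r "P a" y] r Pa unfolding a by blast
  qed
  then obtain F where F: "F \<in> poly_functions G" "F a \<noteq> 0"
    "\<And>x y. F x \<noteq> 0 \<Longrightarrow> eigen_test (R x) (S x) (P x) y = 0 \<Longrightarrow> y = 0" by blast
  show ?thesis
  proof (intro bexI[OF _ F(1)] conjI allI impI)
    fix x l v w assume h: "F x \<noteq> 0" "R x *v v = l *s v" "v \<noteq> 0" "w v* S x = l *s w" "w \<noteq> 0"
    show "dot4 w (P x *v v) \<noteq> 0" by (rule eigen_test_eigenvectors[OF F(3)[OF h(1)] h(2-5)])
  qed (rule F(2))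
qed

text \<open>The vector p(R) y. The explicit summation bound lets a linear factor be split off
  without computing degrees.\<close>

definition pact :: "complex ^ 'n ^ 'n \<Rightarrow> nat \<Rightarrow> complex poly \<Rightarrow> complex ^ 'n \<Rightarrow> complex ^ 'n" where
  "pact R n p y = (\<Sum>i\<le>n. coeff p i *s ((*v) R ^^ i) y)"

lemma pact_linear_factor:
  assumes "degree q \<le> n"
  shows "pact R (Suc n) ([:- a, 1:] * q) y = pact R n q (R *v y - a *s y)"
proof -
  have pw: "((*v) R ^^ i) (R *v y - a *s y) = ((*v) R ^^ Suc i) y - a *s ((*v) R ^^ i) y" for i
    by (induction i) (simp_all add: matrix_vector_mult_diff_distrib vector_scalar_commute)
  have c: "coeff ([:- a, 1:] * q) i = - a * coeff q i + (case i of 0 \<Rightarrow> 0 | Suc j \<Rightarrow> coeff q j)" for i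
    by (cases i) simp_all
  have "coeff q (Suc n) = 0" using assms by (simp add: coeff_eq_0)
  then have 1: "(\<Sum>i\<le>Suc n. (- a * coeff q i) *s ((*v) R ^^ i) y) = (\<Sum>i\<le>n. (- a * coeff q i) *s ((*v) R ^^ i) y)"
    by simp
  have 2: "(\<Sum>i\<le>Suc n. (case i of 0 \<Rightarrow> 0 | Suc j \<Rightarrow> coeff q j) *s ((*v) R ^^ i) y) = (\<Sum>i\<le>n. coeff q i *s ((*v) R ^^ Suc i) y)"
    by (subst sum.atMost_Suc_shift) simp
  have "pact R (Suc n) ([:- a, 1:] * q) y = (\<Sum>i\<le>n. (- a * coeff q i) *s ((*v) R ^^ i) y) + (\<Sum>i\<le>n. coeff q i *s ((*v) R ^^ Suc i) y)"
    unfolding pact_def c vec.scale_left_distrib sum.distrib 1 2 ..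
  also have "\<dots> = pact R n q (R *v y - a *s y)"
    unfolding pact_def pw sum.distrib[symmetric]
    by (intro sum.cong refl) (simp add: vec_eq_iff algebra_simps)
  finally show ?thesis .
qed

text \<open>Split off a root \<open>a\<close> of \<open>p\<close>: either \<open>y\<close> is an
  eigenvector for \<open>a\<close>, or \<open>R *v y - a *s y\<close> is a nonzero vector of
  \<open>W\<close> which the quotient polynomial annihilates.\<close>

lemma eigenvector_in_invariant:
  assumes W: "vec.subspace W" "\<And>y. y \<in> W \<Longrightarrow> R *v y \<in> W"
  shows "degree p \<le> n \<Longrightarrow> p \<noteq> 0 \<Longrightarrow> y \<in> W \<Longrightarrow> y \<noteq> 0 \<Longrightarrow> pact R n p y = 0 \<Longrightarrow>
    \<exists>v\<in>W. v \<noteq> 0 \<and> (\<exists>l. R *v v = l *s v)"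
proof (induction n arbitrary: p y)
  case 0
  then have "coeff p 0 \<noteq> 0" by (metis le_zero_eq leading_coeff_0_iff)
  then show ?case using 0 by (simp add: pact_def)
next
  case (Suc n)
  show ?case
  proof (cases "degree p = 0")
    case True
    then obtain c where c: "p = [:c:]" by (rule degree_eq_zeroE)
    have "pact R (Suc n) p y = c *s y"
      unfolding pact_def c by (subst sum.atMost_Suc_shift) (simp add: coeff_pCons)
    then show ?thesis using Suc.prems c by simp
  next
    case False
    then have "coeff p 0 = 0 \<or> (\<exists>i\<in>{1..degree p}. coeff p i \<noteq> 0)"
      using Suc.prems(2) by (intro disjI2 bexI[of _ "degree p"]) auto
    then obtain a where "(\<Sum>i\<le>degree p. coeff p i * a ^ i) = 0"
      by (rule fundamental_theorem_of_algebra)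
    then have "poly p a = 0" by (simp add: poly_altdef)
    then obtain q where q: "p = [:- a, 1:] * q" unfolding poly_eq_0_iff_dvd by blast
    have q0: "q \<noteq> 0" using q Suc.prems(2) by auto
    then have "degree p = Suc (degree q)" unfolding q by (subst degree_mult_eq) auto
    then have dq: "degree q \<le> n" using Suc.prems(1) by simp
    show ?thesis
    proof (cases "R *v y - a *s y = 0")
      case True
      then show ?thesis using Suc.prems(3,4) by (metis eq_iff_diff_eq_0)
    next
      case False
      show ?thesis
      proof (rule Suc.IH[OF dq q0 _ False])
        show "R *v y - a *s y \<in> W" using W Suc.prems(3) by (intro vec.subspace_diff vec.subspace_scale) auto
        show "pact R n q (R *v y - a *s y) = 0" using Suc.prems(5) unfolding q pact_linear_factor[OF dq] .
      qed
    qed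
  qed
qed

lemma dependent_sequence:
  fixes f :: "nat \<Rightarrow> complex ^ 'n"
  shows "\<exists>c. (\<exists>i\<le>CARD('n). c i \<noteq> 0) \<and> (\<Sum>i\<le>CARD('n). c i *s f i) = 0"
proof (cases "inj_on f {..CARD('n)}")
  case True
  let ?S = "f ` {..CARD('n)}"
  have c: "card ?S = Suc (CARD('n))" using card_image[OF True] by simp
  have "vec.dim ?S \<le> CARD('n)"
    using vec.dim_subset[of ?S UNIV] by (simp add: vec.dim_UNIV card_cart_basis)
  then have "vec.dependent ?S" using vec.dim_eq_card_independent[of ?S] c by fastforce
  then obtain u where u: "\<exists>v\<in>?S. u v \<noteq> 0" "(\<Sum>v\<in>?S. u v *s v) = 0"
    using vec.dependent_finite[of ?S] by auto
  then show ?thesis by (intro exI[of _ "\<lambda>i. u (f i)"]) (auto simp: sum.reindex[OF True])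
next
  case False
  then obtain i j where ij: "i \<le> CARD('n)" "j \<le> CARD('n)" "i \<noteq> j" "f i = f j" by (auto simp: inj_on_def)
  let ?c = "\<lambda>k. if k = i then 1 else if k = j then - 1 else 0"
  have "(\<Sum>k\<le>CARD('n). ?c k *s f k) = (\<Sum>k\<in>{i, j}. ?c k *s f k)"
    using ij by (intro sum.mono_neutral_right) auto
  then show ?thesis using ij by (intro exI[of _ ?c]) auto
qed

lemma invariant_subspace_eigenvector:
  fixes R :: "complex ^ 'n ^ 'n"
  assumes W: "vec.subspace W" "\<And>y. y \<in> W \<Longrightarrow> R *v y \<in> W" and y: "y \<in> W" "y \<noteq> 0"
  shows "\<exists>v\<in>W. v \<noteq> 0 \<and> (\<exists>l. R *v v = l *s v)"
proof -
  obtain c where c: "\<exists>i\<le>CARD('n). c i \<noteq> 0" "(\<Sum>i\<le>CARD('n). c i *s ((*v) R ^^ i) y) = 0"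
    using dependent_sequence[of "\<lambda>i. ((*v) R ^^ i) y"] by blast
  define p where "p = (\<Sum>i\<le>CARD('n). monom (c i) i)"
  have co: "coeff p i = (if i \<le> CARD('n) then c i else 0)" for i
    by (simp add: p_def coeff_sum)
  have "pact R (CARD('n)) p y = 0" using c(2) by (simp add: pact_def co)
  moreover have "p \<noteq> 0" using c(1) co by (metis coeff_0)
  moreover have "degree p \<le> CARD('n)" by (rule degree_le) (simp add: co)
  ultimately show ?thesis using eigenvector_in_invariant[OF W, of p "CARD('n)" y] y by blast
qed

lemma left_eigenvector:
  fixes R :: "complex ^ 4 ^ 4"
  assumes "R *v v = l *s v" "v \<noteq> 0"
  obtains w where "w v* R = l *s w" "w \<noteq> 0"
proof -
  define Q where "Q = (\<chi> i j. R $ i $ j - (if i = j then l else 0))"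
  have Qv: "Q *v v = 0" using assms(1)
    by (simp add: Q_def vec_eq_iff matrix_vector_mult_def left_diff_distrib sum_subtractf if_distrib[where f = "\<lambda>t. t * _"] cong: if_cong)
  have "det Q = 0" using invertible_injective[OF _ Qv] assms(2) by blast
  then have "det (transpose Q) = 0" by simp
  then obtain w where w: "w \<noteq> 0" "transpose Q *v w = 0" using singular_kernel by blast
  have "w v* R = l *s w"
    using w(2) by (simp add: Q_def vec_eq_iff matrix_vector_mult_def vector_matrix_mult_def transpose_def left_diff_distrib
       sum_subtractf if_distrib[where f = "\<lambda>t. t * _"] cong: if_cong) (simp add: mult.commute)
  then show ?thesis using w(1) by (rule that)
qed

lemma dot4_left_eigen: "w v* R = l *s w \<Longrightarrow> dot4 w (R *v y) = l * dot4 w y"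
proof -
  assume w: "w v* R = l *s w"
  have "dot4 w (R *v y) = dot4 (w v* R) y"
    by (simp add: dot4_def sum_4 matrix_vector_mult_def vector_matrix_mult_def algebra_simps)
  then show ?thesis unfolding w by (simp add: dot4_simps)
qed

text \<open>The common kernel of three left eigenvectors is invariant and nonzero, so it contains an
  eigenvector. Its eigenvalue is new: for an old one, \<open>H\<close> would give a nonzero pairing
  with the old left eigenvector.\<close>

lemma eigenbasis_step:
  fixes R :: "complex ^ 4 ^ 4"
  assumes H: "\<And>l v w. R *v v = l *s v \<Longrightarrow> v \<noteq> 0 \<Longrightarrow> w v* R = l *s w \<Longrightarrow> w \<noteq> 0 \<Longrightarrow> dot4 w v \<noteq> 0"
    and w: "w1 v* R = l1 *s w1" "w2 v* R = l2 *s w2" "w3 v* R = l3 *s w3"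
  shows "\<exists>l v w. R *v v = l *s v \<and> v \<noteq> 0 \<and> w v* R = l *s w \<and> w \<noteq> 0 \<and>
    (w1 \<noteq> 0 \<longrightarrow> l \<noteq> l1) \<and> (w2 \<noteq> 0 \<longrightarrow> l \<noteq> l2) \<and> (w3 \<noteq> 0 \<longrightarrow> l \<noteq> l3)"
proof -
  define W where "W = {y. dot4 w1 y = 0 \<and> dot4 w2 y = 0 \<and> dot4 w3 y = 0}"
  have z: "dot4 w 0 = 0" for w by (simp add: dot4_def)
  have sub: "vec.subspace W" unfolding vec.subspace_def W_def by (auto simp: dot4_simps(2,4) z)
  have inv: "R *v y \<in> W" if "y \<in> W" for y using that by (simp add: W_def w[THEN dot4_left_eigen])
  define Q :: "complex ^ 4 ^ 4" where "Q = (\<chi> i. if i = 1 then w1 else if i = 2 then w2 else if i = 3 then w3 else 0)"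
  have "det Q = 0" by (rule det_zero_row[of 4]) (simp add: Q_def row_def vec_eq_iff)
  then obtain y where y: "y \<noteq> 0" "Q *v y = 0" using singular_kernel by blast
  have Qn: "(Q *v y) $ i = dot4 (Q $ i) y" for i by (simp add: matrix_vector_mult_def dot4_def)
  have "y \<in> W" using y(2) Qn[of 1] Qn[of 2] Qn[of 3] by (simp add: W_def Q_def)
  then obtain v l where v: "v \<in> W" "v \<noteq> 0" "R *v v = l *s v"
    using invariant_subspace_eigenvector[OF sub inv _ y(1)] by blast
  obtain w where ww: "w v* R = l *s w" "w \<noteq> 0" by (rule left_eigenvector[OF v(3,2)])
  have "dot4 w1 v = 0" "dot4 w2 v = 0" "dot4 w3 v = 0" using v(1) by (auto simp: W_def)
  then have "w1 \<noteq> 0 \<longrightarrow> l \<noteq> l1" "w2 \<noteq> 0 \<longrightarrow> l \<noteq> l2" "w3 \<noteq> 0 \<longrightarrow> l \<noteq> l3"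
    using H[OF v(3,2) _] w by auto
  then show ?thesis using v ww by blast
qed

lemma eigenbasis:
  fixes R :: "complex ^ 4 ^ 4"
  assumes H: "\<And>l v w. R *v v = l *s v \<Longrightarrow> v \<noteq> 0 \<Longrightarrow> w v* R = l *s w \<Longrightarrow> w \<noteq> 0 \<Longrightarrow> dot4 w v \<noteq> 0"
  obtains \<rho> :: "4 \<Rightarrow> complex" and v w where "inj \<rho>" "\<And>i. R *v v i = \<rho> i *s v i" "\<And>i. v i \<noteq> 0"
    "\<And>i. w i v* R = \<rho> i *s w i" "\<And>i. w i \<noteq> 0" "\<And>i j. i \<noteq> j \<Longrightarrow> dot4 (w i) (v j) = 0"
proof -
  \<comment> \<open>The zero vector stands for a left eigenvector not yet found, so that one lemma
    covers all four stages.\<close>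
  have z: "0 v* R = 0 *s (0 :: complex ^ 4)" by simp
  obtain l1 v1 w1 where 1: "R *v v1 = l1 *s v1" "v1 \<noteq> 0" "w1 v* R = l1 *s w1" "w1 \<noteq> 0"
    using eigenbasis_step[OF H z z z] by blast
  have "\<exists>l v w. R *v v = l *s v \<and> v \<noteq> 0 \<and> w v* R = l *s w \<and> w \<noteq> 0 \<and> l \<noteq> l1"
    using eigenbasis_step[OF H 1(3) z z] 1(4) by simp
  then obtain l2 v2 w2 where 2: "R *v v2 = l2 *s v2" "v2 \<noteq> 0" "w2 v* R = l2 *s w2" "w2 \<noteq> 0" "l2 \<noteq> l1" by blast
  have "\<exists>l v w. R *v v = l *s v \<and> v \<noteq> 0 \<and> w v* R = l *s w \<and> w \<noteq> 0 \<and> l \<noteq> l1 \<and> l \<noteq> l2"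
    using eigenbasis_step[OF H 1(3) 2(3) z] 1(4) 2(4) by simp
  then obtain l3 v3 w3 where 3: "R *v v3 = l3 *s v3" "v3 \<noteq> 0" "w3 v* R = l3 *s w3" "w3 \<noteq> 0" "l3 \<noteq> l1" "l3 \<noteq> l2" by blast
  have "\<exists>l v w. R *v v = l *s v \<and> v \<noteq> 0 \<and> w v* R = l *s w \<and> w \<noteq> 0 \<and> l \<noteq> l1 \<and> l \<noteq> l2 \<and> l \<noteq> l3"
    using eigenbasis_step[OF H 1(3) 2(3) 3(3)] 1(4) 2(4) 3(4) by simp
  then obtain l4 v4 w4 where 4: "R *v v4 = l4 *s v4" "v4 \<noteq> 0" "w4 v* R = l4 *s w4" "w4 \<noteq> 0" "l4 \<noteq> l1" "l4 \<noteq> l2" "l4 \<noteq> l3" by blast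
  define \<rho> where "\<rho> i = (if i = 1 then l1 else if i = 2 then l2 else if i = 3 then l3 else l4)" for i :: 4
  define v where "v i = (if i = 1 then v1 else if i = 2 then v2 else if i = 3 then v3 else v4)" for i :: 4
  define w where "w i = (if i = 1 then w1 else if i = 2 then w2 else if i = 3 then w3 else w4)" for i :: 4
  have inj: "inj \<rho>"
  proof (rule injI)
    fix i j assume "\<rho> i = \<rho> j"
    then show "i = j" using exhaust_4[of i] exhaust_4[of j] 2(5) 3(5,6) 4(5-7) by (auto simp: \<rho>_def)
  qed
  have e: "R *v v i = \<rho> i *s v i" "v i \<noteq> 0" "w i v* R = \<rho> i *s w i" "w i \<noteq> 0" for i
    using 1 2 3 4 by (simp_all add: v_def w_def \<rho>_def)
  have "dot4 (w i) (v j) = 0" if "i \<noteq> j" for i j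
  proof -
    have "\<rho> j * dot4 (w i) (v j) = \<rho> i * dot4 (w i) (v j)"
      using dot4_left_eigen[OF e(3)[of i], of "v j"] unfolding e(1) dot4_simps(4) .
    then show ?thesis using injD[OF inj, of i j] that by auto
  qed
  then show ?thesis by (rule that[OF inj e])
qed

text \<open>The adjugate, by Cramer's rule. It replaces the inverse because its entries are
  polynomial.\<close>

definition adjm :: "complex ^ 'n ^ 'n \<Rightarrow> complex ^ 'n ^ 'n" where
  "adjm Z = (\<chi> i j. det (\<chi> k l. if l = i then axis j 1 $ k else Z $ k $ l))"

lemma adjm_mult:
  assumes "det Z \<noteq> 0" shows "Z *v (adjm Z *v b) = det Z *s b"
proof -
  obtain B where B: "Z ** B = mat 1" using assms invertible_det_nz[of Z] unfolding invertible_def by blast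
  have col: "column j (adjm Z) = det Z *s (B *v axis j 1)" for j
  proof -
    have e: "Z *v (B *v axis j 1) = axis j 1" by (simp add: matrix_vector_mul_assoc B)
    have "column j (adjm Z) $ i = (B *v axis j 1) $ i * det Z" for i
      using cramer_lemma[of i Z "B *v axis j 1"] unfolding e by (simp add: column_def adjm_def)
    then show ?thesis by (simp add: vec_eq_iff mult.commute)
  qed
  have "(adjm Z *v b) $ i = det Z * (B *v b) $ i" for i
  proof -
    have "adjm Z $ i $ j = det Z * B $ i $ j" for j
      using arg_cong[OF col[of j], of "\<lambda>v. v $ i"] by (simp add: column_def matrix_vector_mult_def axis_def if_distrib[where f = "\<lambda>t. _ * t"] cong: if_cong)
    then show ?thesis by (simp add: matrix_vector_mult_def sum_distrib_left mult.assoc)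
  qed
  then have "adjm Z *v b = det Z *s (B *v b)" by (simp add: vec_eq_iff)
  then show ?thesis by (simp add: vector_scalar_commute matrix_vector_mul_assoc B)
qed

lemma adjm_poly:
  assumes "\<And>i j. (\<lambda>x. Z x $ i $ j) \<in> poly_functions G"
  shows "(\<lambda>x. adjm (Z x) $ i $ j) \<in> poly_functions G"
  unfolding adjm_def
proof (simp, intro poly_functions_det)
  fix k l
  show "(\<lambda>x. (\<chi> k l. if l = i then axis j 1 $ k else Z x $ k $ l) $ k $ l) \<in> poly_functions G"
    by (cases "l = i") (simp_all add: assms poly_functions.const)
qed


text \<open>\<open>R\<close> is the determinant of \<open>Z\<close> times the inverse of
  \<open>Z\<close> times \<open>C\<close>. Right eigenvectors \<open>v\<close> of \<open>R\<close>,
  together with left eigenvectors \<open>w\<close> transformed to \<open>u\<close> by the adjugate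
  of \<open>transpose Z\<close>, diagonalize both pairings at once. The eigenvalues are those of the
  pencil times \<open>det (Z x)\<close>.\<close>

lemma generic_eigenbasis:
  fixes Z C KA KB :: "'a \<Rightarrow> complex ^ 4 ^ 4"
  assumes Z: "\<And>i j. (\<lambda>x. Z x $ i $ j) \<in> poly_functions G" and C: "\<And>i j. (\<lambda>x. C x $ i $ j) \<in> poly_functions G"
    and KA: "\<And>i j. (\<lambda>x. KA x $ i $ j) \<in> poly_functions G" and KB: "\<And>i j. (\<lambda>x. KB x $ i $ j) \<in> poly_functions G"
    and Za: "Z a = (\<chi> i j. if i = j then z else 0)" "z \<noteq> 0" and Ca: "C a = (\<chi> i j. if i = j then r i else 0)"
    and r: "\<And>i j. i \<noteq> j \<Longrightarrow> r i \<noteq> r j"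
    and KAa: "\<And>i. KA a $ i $ i \<noteq> 0" and KBa: "\<And>i. KB a $ i $ i \<noteq> 0"
  shows "\<exists>F\<in>poly_functions G. F a \<noteq> 0 \<and> (\<forall>x. F x \<noteq> 0 \<longrightarrow> det (Z x) \<noteq> 0 \<and>
    (\<exists>u v d (\<rho> :: 4 \<Rightarrow> complex). (\<forall>i j. dot4 (u i) (Z x *v v j) = (if i = j then d i else 0)) \<and>
       (\<forall>i j. dot4 (u i) (C x *v v j) = (if i = j then \<rho> i * d i else 0)) \<and> (\<forall>i. d i \<noteq> 0) \<and> inj \<rho> \<and>
       (\<forall>i. dot4 (u i) (KA x *v u i) \<noteq> 0) \<and> (\<forall>i. dot4 (v i) (KB x *v v i) \<noteq> 0)))"
proof -
  define R where "R x = adjm (Z x) ** C x" for x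
  define U where "U x = adjm (transpose (Z x))" for x
  define N where "N x = transpose (U x) ** (KA x ** U x)" for x
  have tr: "(\<lambda>x. transpose (Q x) $ i $ j) \<in> poly_functions G"
    if "\<And>i j. (\<lambda>x. Q x $ i $ j) \<in> poly_functions G" for Q :: "'a \<Rightarrow> complex ^ 4 ^ 4" and i j
    using that by (simp add: transpose_def)
  have Rp: "(\<lambda>x. R x $ i $ j) \<in> poly_functions G" for i j
    unfolding R_def by (intro poly_functions_matrix_mult adjm_poly Z C)
  have Up: "(\<lambda>x. U x $ i $ j) \<in> poly_functions G" for i j
    unfolding U_def by (intro adjm_poly tr Z)
  have Np: "(\<lambda>x. N x $ i $ j) \<in> poly_functions G" for i j
    unfolding N_def by (intro poly_functions_matrix_mult tr Up KA)
  define k where "k = det (Z a) / z"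
  have "det (Z a) = z ^ 4"
    unfolding Za(1) by (subst det_diagonal) (simp_all add: prod.remove[of UNIV])
  then have dZ: "det (Z a) \<noteq> 0" and k: "k \<noteq> 0" using Za(2) by (auto simp: k_def)
  have dm: "(\<chi> i j. if i = j then e i else 0) *v b = (\<chi> i. e i * b $ i)" for e :: "4 \<Rightarrow> complex" and b
    by (simp add: vec_eq_iff matrix_vector_mult_def if_distrib[where f = "\<lambda>t. t * _"] cong: if_cong)
  have ak: "adjm (Z a) *v b = k *s b" for b
  proof -
    have "Z a *v (adjm (Z a) *v b) = det (Z a) *s b" by (rule adjm_mult[OF dZ])
    then show ?thesis using Za(2) unfolding Za(1) dm by (simp add: vec_eq_iff k_def Za(1)[symmetric] field_simps)
  qed
  have adj: "adjm (Z a) $ i $ j = (if i = j then k else 0)" for i j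
  proof -
    have "(adjm (Z a) *v axis j 1) $ i = adjm (Z a) $ i $ j"
      by (simp add: matrix_vector_mult_def axis_def if_distrib[where f = "\<lambda>t. _ * t"] cong: if_cong)
    then show ?thesis unfolding ak by (auto simp: axis_def)
  qed
  have tZ: "transpose (Z a) = Z a" unfolding Za(1) by (simp add: transpose_def vec_eq_iff)
  have Ra: "R a = (\<chi> i j. if i = j then k * r i else 0)"
    unfolding R_def Ca by (simp add: vec_eq_iff matrix_matrix_mult_def adj if_distrib[where f = "\<lambda>t. t * _"] cong: if_cong)
  have tRa: "transpose (R a) = (\<chi> i j. if i = j then k * r i else 0)"
    unfolding Ra by (simp add: transpose_def vec_eq_iff)
  have Na: "N a $ i $ i \<noteq> 0" for i
  proof -
    have "N a $ i $ i = k * k * KA a $ i $ i"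
      unfolding N_def U_def tZ by (simp add: matrix_matrix_mult_def transpose_def adj if_distrib[where f = "\<lambda>t. t * _"] if_distrib[where f = "\<lambda>t. _ * t"] cong: if_cong)
    then show ?thesis using k KAa by simp
  qed
  have kr: "k * r i \<noteq> k * r j" if "i \<noteq> j" for i j using k r[OF that] by simp
  have one: "(\<lambda>x. (mat 1 :: complex ^ 4 ^ 4) $ i $ j) \<in> poly_functions G" for i j by (rule poly_functions.const)
  have one1: "(mat 1 :: complex ^ 4 ^ 4) $ i $ i \<noteq> 0" for i by (simp add: mat_def)
  \<comment> \<open>Three eigenvector tests. The identity gives simple spectrum. In the second test
    left eigenvectors of \<open>transpose (R x)\<close> are right eigenvectors of
    \<open>R x\<close>, so a vector can be paired with itself under \<open>KB\<close>; the third
    does the same for left eigenvectors, where \<open>N\<close> is \<open>KA\<close> pulled back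
    along \<open>U\<close>.\<close>
  obtain F1 where F1: "F1 \<in> poly_functions G" "F1 a \<noteq> 0" "\<And>x l v w. F1 x \<noteq> 0 \<Longrightarrow> R x *v v = l *s v \<Longrightarrow> v \<noteq> 0 \<Longrightarrow>
      w v* R x = l *s w \<Longrightarrow> w \<noteq> 0 \<Longrightarrow> dot4 w (mat 1 *v v) \<noteq> 0"
    using eigenpair_open[OF Rp Rp one Ra Ra kr one1] by blast
  obtain F2 where F2: "F2 \<in> poly_functions G" "F2 a \<noteq> 0" "\<And>x l v w. F2 x \<noteq> 0 \<Longrightarrow> R x *v v = l *s v \<Longrightarrow> v \<noteq> 0 \<Longrightarrow>
      w v* transpose (R x) = l *s w \<Longrightarrow> w \<noteq> 0 \<Longrightarrow> dot4 w (KB x *v v) \<noteq> 0"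
    using eigenpair_open[OF Rp tr[OF Rp] KB Ra tRa kr KBa] by blast
  obtain F3 where F3: "F3 \<in> poly_functions G" "F3 a \<noteq> 0" "\<And>x l v w. F3 x \<noteq> 0 \<Longrightarrow> transpose (R x) *v v = l *s v \<Longrightarrow> v \<noteq> 0 \<Longrightarrow>
      w v* R x = l *s w \<Longrightarrow> w \<noteq> 0 \<Longrightarrow> dot4 w (N x *v v) \<noteq> 0"
    using eigenpair_open[OF tr[OF Rp] Rp Np tRa Ra kr Na] by blast
  have vt: "w v* transpose Q = Q *v w" "transpose Q *v w = w v* Q" for Q :: "complex ^ 4 ^ 4" and w
    by (simp_all add: vec_eq_iff vector_matrix_mult_def matrix_vector_mult_def transpose_def mult.commute)
  have dt: "dot4 x (Q *v y) = dot4 (transpose Q *v x) y" for Q :: "complex ^ 4 ^ 4" and x y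
    by (simp add: dot4_def sum_4 matrix_vector_mult_def transpose_def algebra_simps)
  show ?thesis
  proof (rule bexI[of _ "\<lambda>x. det (Z x) * (F1 x * (F2 x * F3 x))"], intro conjI allI impI)
    show "(\<lambda>x. det (Z x) * (F1 x * (F2 x * F3 x))) \<in> poly_functions G"
      by (intro poly_functions_intros poly_functions_det Z F1 F2 F3)
    show "det (Z a) * (F1 a * (F2 a * F3 a)) \<noteq> 0" using dZ F1(2) F2(2) F3(2) by simp
    fix x assume "det (Z x) * (F1 x * (F2 x * F3 x)) \<noteq> 0"
    then have nz: "det (Z x) \<noteq> 0" "F1 x \<noteq> 0" "F2 x \<noteq> 0" "F3 x \<noteq> 0" by auto
    show "det (Z x) \<noteq> 0" by (rule nz(1))
    have H: "dot4 w v \<noteq> 0" if "R x *v v = l *s v" "v \<noteq> 0" "w v* R x = l *s w" "w \<noteq> 0" for l v w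
      using F1(3)[OF nz(2) that] by simp
    obtain \<rho> :: "4 \<Rightarrow> complex" and v w where e: "inj \<rho>" "\<And>i. R x *v v i = \<rho> i *s v i" "\<And>i. v i \<noteq> 0"
      "\<And>i. w i v* R x = \<rho> i *s w i" "\<And>i. w i \<noteq> 0" "\<And>i j. i \<noteq> j \<Longrightarrow> dot4 (w i) (v j) = 0"
    proof (rule eigenbasis[of "R x"])
      fix l v w assume "R x *v v = l *s v" "v \<noteq> 0" "w v* R x = l *s w" "w \<noteq> 0"
      then show "dot4 w v \<noteq> 0" by (rule H)
    qed (rule that)
    define D where "D = det (Z x)"
    have D: "D \<noteq> 0" using nz by (simp add: D_def)
    define u where "u i = U x *v w i" for i
    have ZR: "Z x *v (R x *v y) = D *s (C x *v y)" for y
      unfolding R_def matrix_vector_mul_assoc[symmetric] D_def by (rule adjm_mult[OF nz(1)])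
    have Zu: "transpose (Z x) *v u i = D *s w i" for i
      unfolding u_def U_def D_def using adjm_mult[of "transpose (Z x)" "w i"] nz(1) by simp
    have uZ: "dot4 (u i) (Z x *v y) = D * dot4 (w i) y" for i y
      unfolding dt Zu by (simp add: dot4_simps(3))
    have uC: "dot4 (u i) (C x *v v j) = \<rho> j * dot4 (w i) (v j)" for i j
    proof -
      have "D * dot4 (u i) (C x *v v j) = dot4 (u i) (Z x *v (R x *v v j))"
        unfolding ZR dot4_simps(4) ..
      also have "\<dots> = D * (\<rho> j * dot4 (w i) (v j))" unfolding uZ e(2) dot4_simps(4) ..
      finally show ?thesis using D by simp
    qed
    have wv: "dot4 (w i) (v i) \<noteq> 0" for i using H[OF e(2) e(3) e(4) e(5)] .
    have "dot4 (u i) (KA x *v u i) \<noteq> 0" for i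
    proof -
      have "dot4 (w i) (N x *v w i) \<noteq> 0" by (rule F3(3)[OF nz(4) _ e(5) e(4) e(5)]) (simp add: vt e(4))
      moreover have "dot4 (w i) (N x *v w i) = dot4 (u i) (KA x *v u i)"
        unfolding N_def u_def matrix_vector_mul_assoc[symmetric] dt[of _ "transpose (U x)"] by simp
      ultimately show ?thesis by simp
    qed
    moreover have "dot4 (v i) (KB x *v v i) \<noteq> 0" for i
      by (rule F2(3)[OF nz(3) e(2) e(3) _ e(3)]) (simp add: vt e(2))
    moreover have "inj (\<lambda>i. \<rho> i / D)" using e(1) D by (auto simp: inj_def)
    ultimately show "\<exists>u v d (\<rho> :: 4 \<Rightarrow> complex). (\<forall>i j. dot4 (u i) (Z x *v v j) = (if i = j then d i else 0)) \<and>
       (\<forall>i j. dot4 (u i) (C x *v v j) = (if i = j then \<rho> i * d i else 0)) \<and> (\<forall>i. d i \<noteq> 0) \<and> inj \<rho> \<and>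
       (\<forall>i. dot4 (u i) (KA x *v u i) \<noteq> 0) \<and> (\<forall>i. dot4 (v i) (KB x *v v i) \<noteq> 0)"
      using D wv by (intro exI[of _ u] exI[of _ v] exI[of _ "\<lambda>i. D * dot4 (w i) (v i)"] exI[of _ "\<lambda>i. \<rho> i / D"])
        (auto simp: uZ uC e(6))
  qed
qed

section \<open>Common zero loci of two generic sections\<close>

definition gram :: "complex ^ 8 ^ 8 \<Rightarrow> (complex ^ 4 \<Rightarrow> complex ^ 8) \<Rightarrow> (complex ^ 4 \<Rightarrow> complex ^ 8) \<Rightarrow> complex ^ 4 ^ 4" where
  "gram N f g = (\<chi> i j. bil N (f (axis i 1)) (g (axis j 1)))"

lemma gram_bil:
  assumes f: "\<And>x y. f (x + y) = f x + f y" "\<And>c x. f (c *s x) = c *s f x"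
    and g: "\<And>x y. g (x + y) = g x + g y" "\<And>c x. g (c *s x) = c *s g x"
  shows "dot4 u (gram N f g *v w) = bil N (f u) (g w)"
proof -
  have f0: "f 0 = 0" and g0: "g 0 = 0" using f(2)[of 0 0] g(2)[of 0 0] by auto
  have fs: "f (\<Sum>i\<in>I. h i) = (\<Sum>i\<in>I. f (h i))" and gs: "g (\<Sum>i\<in>I. h i) = (\<Sum>i\<in>I. g (h i))" for I :: "4 set" and h
    by (induction I rule: infinite_finite_induct) (simp_all add: f0 g0 f g)
  have "bil N (f (\<Sum>i\<in>UNIV. u $ i *s axis i 1)) (g (\<Sum>i\<in>UNIV. w $ i *s axis i 1))
      = (\<Sum>i\<in>UNIV. \<Sum>j\<in>UNIV. u $ i * (w $ j * bil N (f (axis i 1)) (g (axis j 1))))"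
    unfolding fs gs f(2) g(2) bil_sum_left bil_sum_right bil_smult_left bil_smult_right
    by (subst sum.swap) (simp add: sum_distrib_left mult_ac)
  then show ?thesis
    by (simp add: basis_expansion dot4_def gram_def matrix_vector_mult_def sum_distrib_left mult_ac)
qed

context pencil_model
begin

text \<open>Two orthogonal hyperbolic pairs \<open>e\<close>, \<open>w2\<close> and
  \<open>u\<close>, \<open>v\<close> are arranged in a 2x2 matrix, which makes the quadratic form
  twice a determinant.\<close>

lemma hyperbolic_basis:
  assumes "Dt z \<noteq> 0"
  obtains \<alpha> :: "2 \<Rightarrow> 2 \<Rightarrow> complex ^ 4"
    where "\<And>y. \<exists>m. y = (\<Sum>i\<in>UNIV. \<Sum>j\<in>UNIV. m i j *s \<alpha> i j)"
      "\<And>m. qform M' (ch z (\<Sum>i\<in>UNIV. \<Sum>j\<in>UNIV. m i j *s \<alpha> i j)) = 2 * (m 1 1 * m 2 2 - m 1 2 * m 2 1)"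
proof -
  obtain e u where eu: "iso z e u" using iso_exists by blast
  obtain v w where vw: "kf z e v = 0" "kf z v v = 0" "kf z u v = 1" "kf z e w = 1"
    by (rule hyperbolic_frame[OF assms eu]) (rule that)
  have eu': "kf z e e = 0" "kf z e u = 0" "kf z u u = 0" using eu by (auto simp: iso_def)
  define w1 where "w1 = w - kf z w v *s u - kf z w u *s v"
  define w2 where "w2 = w1 - (kf z w1 w1 / 2) *s e"
  note co = kf_commute[of z u e] kf_commute[of z v e] kf_commute[of z v u] kf_commute[of z w e] kf_commute[of z u w] kf_commute[of z v w]
  have w1: "kf z w1 e = 1" "kf z w1 u = 0" "kf z w1 v = 0"
    by (simp_all add: w1_def kf_simps co vw eu')
  have w2: "kf z w2 e = 1" "kf z w2 u = 0" "kf z w2 v = 0" "kf z w2 w2 = 0"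
    using kf_commute[of z e w1] by (simp_all add: w2_def kf_simps vw eu' w1)
  note co2 = kf_commute[of z e w2] kf_commute[of z u w2] kf_commute[of z v w2]
  \<comment> \<open>The sign at \<open>v\<close> produces the minus sign of the determinant.\<close>
  define \<alpha> where "\<alpha> i j = (if i = 1 then (if j = 1 then e else u) else if j = 1 then - v else w2)" for i j :: 2
  have s: "(\<Sum>i\<in>UNIV. \<Sum>j\<in>UNIV. m i j *s \<alpha> i j) = m 1 1 *s e + m 1 2 *s u + (- m 2 1) *s v + m 2 2 *s w2" for m
    by (simp add: sum_2 \<alpha>_def add.assoc)
  have ind: "indep4 e u v w2" unfolding indep4_def
  proof (intro allI impI)
    fix a b c d assume 0: "a *s e + b *s u + c *s v + d *s w2 = 0"
    have *: "kf z (a *s e + b *s u + c *s v + d *s w2) y = 0" for y unfolding 0 by (simp add: kf_simps)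
    show "a = 0 \<and> b = 0 \<and> c = 0 \<and> d = 0"
      using *[of e] *[of u] *[of v] *[of w2] by (simp add: kf_simps vw eu' w2 co co2)
  qed
  show ?thesis
  proof (rule that[of \<alpha>])
    fix y
    obtain a b c d where y: "y = a *s e + b *s u + c *s v + d *s w2" using indep4_spans[OF ind] by blast
    show "\<exists>m. y = (\<Sum>i\<in>UNIV. \<Sum>j\<in>UNIV. m i j *s \<alpha> i j)"
      unfolding s y by (rule exI[of _ "\<lambda>i j. if i = 1 then (if j = 1 then a else b) else if j = 1 then - c else d"]) simp
  next
    fix m :: "2 \<Rightarrow> 2 \<Rightarrow> complex"
    have "qform M' (ch z y) = kf z y y" for y by (simp add: qform_bil kf_def)
    then show "qform M' (ch z (\<Sum>i\<in>UNIV. \<Sum>j\<in>UNIV. m i j *s \<alpha> i j)) = 2 * (m 1 1 * m 2 2 - m 1 2 * m 2 1)"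
      unfolding s by (simp add: kf_simps vw eu' w2 co co2 algebra_simps)
  qed
qed

lemma Dt_nonzero:
  assumes h: "\<And>y. h y = c *s ch z y" and lin: "\<And>x y. h (x + y) = h x + h y" "\<And>k y. h (k *s y) = k *s h y"
    and d: "det (gram M' h h) \<noteq> 0"
  shows "Dt z \<noteq> 0"
proof
  assume "Dt z = 0"
  then obtain n where n: "n \<noteq> 0" "\<And>w. kf z n w = 0" using kf_radical by blast
  have "dot4 w (gram M' h h *v n) = 0" for w
    unfolding gram_bil[OF lin lin] h bil_smult_left bil_smult_right using n(2)[of w] kf_commute[of z n w] by (simp add: kf_def)
  then have "(gram M' h h *v n) $ i = 0" for i
    using spec[of "\<lambda>w. dot4 w _ = 0" "axis i 1"] by (simp add: dot4_def axis_def if_distrib[where f = "\<lambda>t. t * _"] cong: if_cong)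
  then have "gram M' h h *v n = 0" by (simp add: vec_eq_iff)
  then show False using invertible_injective[OF d] n(1) by blast
qed

text \<open>Homogeneous versions of the charts of pure spinors with nonzero first and last coordinate.
  All genericity arguments take place near \<open>hA c 0\<close> and \<open>hB e 0\<close>, where every Gram matrix is diagonal.\<close>

definition hA :: "complex \<Rightarrow> complex ^ 6 \<Rightarrow> complex ^ 4 \<Rightarrow> complex ^ 8" where
  "hA c z y = kp (skew z y) (c *s y)"

definition hB :: "complex \<Rightarrow> complex ^ 6 \<Rightarrow> complex ^ 4 \<Rightarrow> complex ^ 8" where
  "hB c z y = kp (c *s y) (- skew (dual6 z) y)"

lemma hA_linear: "hA c z (x + y) = hA c z x + hA c z y" "hA c z (k *s y) = k *s hA c z y"
  by (simp_all only: hA_def skew_linear vec.scale_right_distrib vec.scale_left_commute[of c] kp_smult kp_add)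

lemma hB_linear: "hB c z (x + y) = hB c z x + hB c z y" "hB c z (k *s y) = k *s hB c z y"
proof -
  have "- (a + b) = - a + - b" "- (k *s a) = k *s (- a)" for a b :: "complex ^ 4" by (simp_all add: vec_eq_iff)
  then show "hB c z (x + y) = hB c z x + hB c z y" "hB c z (k *s y) = k *s hB c z y"
    by (simp_all only: hB_def skew_linear vec.scale_right_distrib vec.scale_left_commute[of c] kp_smult kp_add)
qed

lemma hA_ch: "c \<noteq> 0 \<Longrightarrow> hA c z y = c *s ch ((1 / c) *s z) y"
  by (simp add: hA_def ch_def skew_linear flip: kp_smult)

lemma hB_ch: "c \<noteq> 0 \<Longrightarrow> hB c z y = c *s kp y (skew ((- 1 / c) *s dual6 z) y)"
  unfolding skew_linear kp_smult[symmetric] hB_def by (simp add: vec_eq_iff)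

text \<open>A plane which meets both isotropic 4-spaces is spanned by one vector from each, as the
  spaces are complementary. Such planes form the set \<open>S\<close> of
  \<open>two_planes\<close>.\<close>

theorem segre_of_pure_pair:
  assumes c: "cA \<noteq> 0" "cB \<noteq> 0" and dZ: "det (gram M (hA cA zA) (hB cB zB)) \<noteq> 0"
    and dA: "det (gram M' (hA cA zA) (hA cA zA)) \<noteq> 0" and dB: "det (gram M' (hB cB zB) (hB cB zB)) \<noteq> 0"
    and e: "\<And>i j. dot4 (u i) (gram M (hA cA zA) (hB cB zB) *v v j) = (if i = j then d i else 0)"
      "\<And>i j. dot4 (u i) (gram M' (hA cA zA) (hB cB zB) *v v j) = (if i = j then \<rho> i * d i else 0)"
    and d: "\<And>i. d i \<noteq> 0" and \<rho>: "inj (\<rho> :: 4 \<Rightarrow> complex)"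
    and u: "\<And>i. dot4 (u i) (gram M' (hA cA zA) (hA cA zA) *v u i) \<noteq> 0"
    and v: "\<And>i. dot4 (v i) (gram M' (hB cB zB) (hB cB zB) *v v i) \<noteq> 0"
    and S: "S = {E \<in> X. (\<exists>y. y \<noteq> 0 \<and> ch ((1 / cA) *s zA) y \<in> E) \<and> (\<exists>y. y \<noteq> 0 \<and> kp y (skew ((- 1 / cB) *s dual6 zB) y) \<in> E)}"
  shows "\<exists>Y \<phi>. segre4_section_codim2 Y \<and> biregular (plucker ` S) Y \<phi> \<and> pulls_back_hyperplane_class (plucker ` S) \<phi>"
proof -
  interpret m: pencil_model M \<gamma> y0 "al_kp kp" "al_io io" M' p r by (rule swap_all)
  define a where "a = (1 / cA) *s zA"
  define b where "b = (- 1 / cB) *s dual6 zB"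
  define jB where "jB y = kp y (skew b y)" for y
  have mch: "m.ch b y = jB y" for y by (simp add: m.ch_def al_kp_def jB_def)
  have hA: "hA cA zA y = cA *s ch a y" for y unfolding a_def by (rule hA_ch[OF c(1)])
  have hB: "hB cB zB y = cB *s jB y" for y unfolding b_def jB_def by (rule hB_ch[OF c(2)])
  note gb = gram_bil[OF hA_linear hB_linear] gram_bil[OF hA_linear hA_linear] gram_bil[OF hB_linear hB_linear]
  note bs = bil_smult_left bil_smult_right
  have jBl: "jB (x + y) = jB x + jB y" "jB (k *s y) = k *s jB y" for x y k
    using m.ch_add[of b x y] m.ch_smult[of b k y] unfolding mch by auto
  have DA: "Dt a \<noteq> 0" by (rule Dt_nonzero[OF hA hA_linear dA])
  have DB: "m.Dt b \<noteq> 0" by (rule m.Dt_nonzero[OF hB[folded mch] hB_linear dB])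
  obtain \<alpha> :: "2 \<Rightarrow> 2 \<Rightarrow> complex ^ 4" where \<alpha>: "\<And>y. \<exists>m. y = (\<Sum>i\<in>UNIV. \<Sum>j\<in>UNIV. m i j *s \<alpha> i j)"
      "\<And>m. qform M' (ch a (\<Sum>i\<in>UNIV. \<Sum>j\<in>UNIV. m i j *s \<alpha> i j)) = 2 * (m 1 1 * m 2 2 - m 1 2 * m 2 1)"
    by (rule hyperbolic_basis[OF DA]) (rule that)
  obtain \<beta> :: "2 \<Rightarrow> 2 \<Rightarrow> complex ^ 4" where \<beta>: "\<And>y. \<exists>m. y = (\<Sum>i\<in>UNIV. \<Sum>j\<in>UNIV. m i j *s \<beta> i j)"
      "\<And>m. qform M' (m.ch b (\<Sum>i\<in>UNIV. \<Sum>j\<in>UNIV. m i j *s \<beta> i j)) = 2 * (m 1 1 * m 2 2 - m 1 2 * m 2 1)"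
    by (rule m.hyperbolic_basis[OF DB]) (rule that)
  define k where "k = cA * cB"
  have k: "k \<noteq> 0" using c by (simp add: k_def)
  have e': "k * bil M (ch a (u i)) (jB (v j)) = (if i = j then d i else 0)"
    "k * bil M' (ch a (u i)) (jB (v j)) = (if i = j then \<rho> i * d i else 0)" for i j
    using e[of i j] unfolding gb hA hB bs by (simp_all only: k_def mult_ac)
  \<comment> \<open>\<open>hA\<close> and \<open>hB\<close> differ from the charts by the factors
    \<open>cA\<close> and \<open>cB\<close>; the division by \<open>k\<close> takes care of
    these.\<close>
  interpret t: two_planes M M' "ch a" jB u v "\<lambda>i. d i / k" \<rho> \<alpha> \<beta>
  proof (unfold_locales, goal_cases)
    case (9 i j) show ?case using e'(1)[of i j] k by (simp add: field_simps split: if_splits)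
  next
    case (10 i j) show ?case using e'(2)[of i j] k by (simp add: field_simps split: if_splits)
  next
    case (13 i) show ?case using u[of i] c(1) unfolding gb hA bs by simp
  next
    case (14 i) show ?case using v[of i] c(2) unfolding gb hB bs by simp
  next
    case (8 x y) show ?case using m.bil_ch[of b x y] unfolding mch .
  qed (use sym sym' ch_add ch_smult jBl bil_ch d k \<rho> \<alpha> \<beta> in \<open>simp_all add: mch\<close>)
  \<comment> \<open>A common vector would be orthogonal to the whole second 4-space, which is
    isotropic, although the pairing of the two 4-spaces is nondegenerate.\<close>
  have AB: "y = 0 \<and> x = 0" if h: "ch a y = jB x" for y x
  proof -
    have "dot4 y (gram M (hA cA zA) (hB cB zB) *v w) = 0" for w
      unfolding gb hA hB bs h using m.bil_ch[of b x w] by (simp add: mch)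
    then have "(transpose (gram M (hA cA zA) (hB cB zB)) *v y) $ i = 0" for i
      using spec[of "\<lambda>w. dot4 y (_ *v w) = 0" "axis i 1"]
      by (simp add: dot4_def axis_def matrix_vector_mult_def transpose_def sum_distrib_left mult_ac if_distrib[where f = "\<lambda>t. t * _"] if_distrib[where f = "\<lambda>t. _ * t"] cong: if_cong)
    then have "transpose (gram M (hA cA zA) (hB cB zB)) *v y = 0" by (simp add: vec_eq_iff)
    then have "y = 0" using invertible_injective[of "transpose (gram M (hA cA zA) (hB cB zB))" y] dZ by simp
    moreover from this have "m.ch b x = 0" using h mch[of x] ch_eq_0[of a 0] by simp
    ultimately show ?thesis by (simp add: m.ch_eq_0)
  qed
  have ind: "indep2 (ch a y) (jB x)" if "y \<noteq> 0" "x \<noteq> 0" for y x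
    unfolding indep2_def
  proof (intro allI impI)
    fix k l assume "k *s ch a y + l *s jB x = 0"
    then have "ch a (k *s y) = jB (- l *s x)" unfolding ch_smult jBl by (simp add: eq_neg_iff_add_eq_0)
    from AB[OF this] that show "k = 0 \<and> l = 0" by auto
  qed
  have "S = t.S"
  proof (intro equalityI subsetI)
    fix E assume "E \<in> S"
    then obtain y x where E: "E \<in> X" and yx: "y \<noteq> 0" "ch a y \<in> E" "x \<noteq> 0" "jB x \<in> E"
      unfolding S a_def b_def jB_def by blast
    obtain \<xi> \<eta> where E': "E = vec.span {\<xi>, \<eta>}" using X_basis[OF E] .
    have span: "E = vec.span {ch a y, jB x}"
      using indep2_span_eq(1)[OF ind[OF yx(1,3)]] yx(2,4) unfolding E' by simp
    show "E \<in> t.S" using E yx(1,3) unfolding span X_span[OF ind[OF yx(1,3)]] t.S_def by blast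
  next
    fix E assume "E \<in> t.S"
    then obtain y x where E: "E = vec.span {ch a y, jB x}" and yx: "y \<noteq> 0" "x \<noteq> 0"
      and q: "qform M' (ch a y) = 0" "qform M' (jB x) = 0" "bil M (ch a y) (jB x) = 0" "bil M' (ch a y) (jB x) = 0"
      unfolding t.S_def by blast
    have "E \<in> X" unfolding E X_span[OF ind[OF yx]]
      using q m.qform_ch[of b x] by (simp add: qform_ch mch)
    moreover have "ch a y \<in> E" "jB x \<in> E" unfolding E by (auto intro: vec.span_base)
    ultimately show "E \<in> S" using yx unfolding S a_def[symmetric] b_def[symmetric] jB_def by blast
  qed
  then show ?thesis using t.segre_section by simp
qed

end

section \<open>Generic pairs of linear functionals on the half-spin module\<close>

lemma monic_quadratic_roots:
  fixes b c :: complex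
  obtains t where "t\<^sup>2 + b * t + c = 0" "(- b - t)\<^sup>2 + b * (- b - t) + c = 0"
proof -
  define s where "s = csqrt (b\<^sup>2 - 4 * c)"
  have s: "s\<^sup>2 = b\<^sup>2 - 4 * c" by (simp add: s_def)
  show ?thesis
  proof (rule that[of "(s - b) / 2"])
    have "((s - b) / 2)\<^sup>2 + b * ((s - b) / 2) + c = (s\<^sup>2 - (b\<^sup>2 - 4 * c)) / 4"
      by (simp add: field_simps power2_eq_square)
    then show 1: "((s - b) / 2)\<^sup>2 + b * ((s - b) / 2) + c = 0" using s by simp
    have "(- b - x)\<^sup>2 + b * (- b - x) + c = x\<^sup>2 + b * x + c" for x by (simp add: algebra_simps power2_eq_square)
    then show "(- b - (s - b) / 2)\<^sup>2 + b * (- b - (s - b) / 2) + c = 0" using 1 by simp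
  qed
qed

lemma dual6_poly:
  assumes "\<And>i. (\<lambda>x. Z x $ i) \<in> poly_functions G"
  shows "(\<lambda>x. dual6 (Z x) $ i) \<in> poly_functions G"
  using exhaust_6[of i] by (elim disjE) (simp_all add: dual6_def assms)

context pencil_model
begin

lemma h_poly:
  assumes c: "c \<in> poly_functions G" and Z: "\<And>i. (\<lambda>x. Z x $ i) \<in> poly_functions G"
  shows "(\<lambda>x. hA (c x) (Z x) y $ i) \<in> poly_functions G" "(\<lambda>x. hB (c x) (Z x) y $ i) \<in> poly_functions G"
proof -
  have 1: "(\<lambda>x. (c x *s y) $ i) \<in> poly_functions G" for i
    unfolding vector_smult_component by (intro poly_functions_intros c)
  have 2: "(\<lambda>x. (- skew (dual6 (Z x)) y) $ i) \<in> poly_functions G" for i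
    unfolding vector_uminus_component by (intro poly_functions_uminus skew_poly dual6_poly Z poly_functions.const)
  show "(\<lambda>x. hA (c x) (Z x) y $ i) \<in> poly_functions G"
    unfolding hA_def by (intro kp_poly skew_poly Z poly_functions.const 1)
  show "(\<lambda>x. hB (c x) (Z x) y $ i) \<in> poly_functions G"
    unfolding hB_def by (intro kp_poly 1 2)
qed

lemma gram_base:
  "gram M (hA c 0) (hB e 0) = (\<chi> i j. if i = j then c * e / 2 else 0)"
  "gram M' (hA c 0) (hB e 0) = (\<chi> i j. if i = j then c * e * r $ i else 0)"
  "gram M' (hA c 0) (hA c 0) = (\<chi> i j. if i = j then c * c * p $ i else 0)"
  "gram M' (hB c 0) (hB c 0) = (\<chi> i j. if i = j then c * c * p $ i else 0)"
proof -
  have d: "dual6 0 = 0" by (simp add: dual6_def vec_eq_iff forall_6)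
  have k: "hA c 0 y = c *s kp 0 y" "hB c 0 y = c *s kp y 0" for c y
    by (simp_all add: hA_def hB_def d skew_linear flip: kp_smult)
  have b: "2 * bil M' (kp x w) (kp x' w') = (\<Sum>i\<in>UNIV. 2 * p$i * (x$i * x'$i + w$i * w'$i) + 2 * r$i * (x$i * w'$i + x'$i * w$i))" for x w x' w'
  proof -
    have "qform M' (kp x w + kp x' w') = qform M' (kp x w) + 2 * bil M' (kp x w) (kp x' w') + qform M' (kp x' w')"
      by (rule qform_add[OF sym'])
    then show ?thesis unfolding kp_add[symmetric] q'_kp sum_4 by (simp add: power2_eq_square algebra_simps)
  qed
  have ax: "(\<Sum>k\<in>UNIV. f k * ((axis i 1 :: complex ^ 4) $ k * (axis j 1 :: complex ^ 4) $ k)) = (if i = j then f i else 0)" for f i j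
    by (auto simp: axis_def if_distrib[where f = "\<lambda>t. t * _"] if_distrib[where f = "\<lambda>t. _ * t"] cong: if_cong)
  have b1: "2 * bil M' (kp 0 (axis i 1)) (kp (axis j 1) 0) = 2 * (if i = j then r $ i else 0)" for i j
    unfolding b using ax[of "\<lambda>k. 2 * r $ k" j i] by (cases "i = j") simp_all
  have b2: "2 * bil M' (kp 0 (axis i 1)) (kp 0 (axis j 1)) = 2 * (if i = j then p $ i else 0)"
    "2 * bil M' (kp (axis i 1) 0) (kp (axis j 1) 0) = 2 * (if i = j then p $ i else 0)" for i j
    using ax[of "\<lambda>k. 2 * p $ k" i j] unfolding b by simp_all
  have b3: "2 * bil M (kp 0 (axis i 1)) (kp (axis j 1) 0) = (if i = j then 1 else 0)" for i j
    unfolding bil_kp dot4_def using ax[of "\<lambda>k. 1" j i] by simp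
  note bb = b1[unfolded mult_cancel_left, simplified] b2[unfolded mult_cancel_left, simplified]
  have b3': "bil M (kp 0 (axis i 1)) (kp (axis j 1) 0) = (if i = j then 1 / 2 else 0)" for i j
    using b3[of i j] by (simp add: field_simps split: if_splits)
  show "gram M (hA c 0) (hB e 0) = (\<chi> i j. if i = j then c * e / 2 else 0)"
    "gram M' (hA c 0) (hB e 0) = (\<chi> i j. if i = j then c * e * r $ i else 0)"
    "gram M' (hA c 0) (hA c 0) = (\<chi> i j. if i = j then c * c * p $ i else 0)"
    "gram M' (hB c 0) (hB c 0) = (\<chi> i j. if i = j then c * c * p $ i else 0)"
    by (simp_all add: gram_def k bil_smult_left bil_smult_right vec_eq_iff bb b3')
qed

text \<open>The pairing of the half-spinor with coordinates \<open>P\<close> and the one with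
  coordinates \<open>s\<close>, \<open>z\<close>, \<open>t\<close> under the polarization of
  \<open>s * t - pf z\<close>. Hence pure functionals are those whose outer coordinates multiply to
  the Pfaffian of the middle one.\<close>

definition lp :: "complex \<times> (complex ^ 6) \<times> complex \<Rightarrow> complex \<Rightarrow> complex ^ 6 \<Rightarrow> complex \<Rightarrow> complex" where
  "lp P s z t = fst P * t - pol z (fst (snd P)) + snd (snd P) * s"

text \<open>Two generic linear functionals span a line in the projective space of half-spinors. It meets the quadric of
  pure spinors in two points, and the common zero locus does not change when the functionals are replaced
  with these points. They are interchanged by monodromy, so the polynomial condition on the pair of points
  descends to a condition on the pair of functionals by elimination of a root of a quadratic equation.\<close>

theorem generic_segre:
  fixes P Q :: "'a \<Rightarrow> complex \<times> (complex ^ 6) \<times> complex"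
  assumes P: "(\<lambda>x. fst (P x)) \<in> poly_functions G" "\<And>i. (\<lambda>x. fst (snd (P x)) $ i) \<in> poly_functions G" "(\<lambda>x. snd (snd (P x))) \<in> poly_functions G"
    and Q: "(\<lambda>x. fst (Q x)) \<in> poly_functions G" "\<And>i. (\<lambda>x. fst (snd (Q x)) $ i) \<in> poly_functions G" "(\<lambda>x. snd (snd (Q x))) \<in> poly_functions G"
    and a: "P a = (1, 0, -1)" "Q a = (1, 0, 1)"
  shows "\<exists>F\<in>poly_functions G. F a \<noteq> 0 \<and> (\<forall>x. F x \<noteq> 0 \<longrightarrow> (\<forall>S. S = {E \<in> X. \<forall>s z t. io s z t \<in> spinor_sub \<gamma> y0 E \<longrightarrow> lp (P x) s z t = 0 \<and> lp (Q x) s z t = 0} \<longrightarrow>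
     (\<exists>Y \<phi>. segre4_section_codim2 Y \<and> biregular (plucker ` S) Y \<phi> \<and> pulls_back_hyperplane_class (plucker ` S) \<phi>)))"
proof -
  define P0 where "P0 x = fst (P x)" for x
  define Pz where "Pz x = fst (snd (P x))" for x
  define P4 where "P4 x = snd (snd (P x))" for x
  define Q0 where "Q0 x = fst (Q x)" for x
  define Qz where "Qz x = fst (snd (Q x))" for x
  define Q4 where "Q4 x = snd (snd (Q x))" for x
  have pp: "P0 \<in> poly_functions G" "\<And>i. (\<lambda>x. Pz x $ i) \<in> poly_functions G" "P4 \<in> poly_functions G"
    "Q0 \<in> poly_functions G" "\<And>i. (\<lambda>x. Qz x $ i) \<in> poly_functions G" "Q4 \<in> poly_functions G"
    unfolding P0_def Pz_def P4_def Q0_def Qz_def Q4_def by (rule P Q)+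
  \<comment> \<open>\<open>N1\<close> and \<open>N2\<close> are the values of the quadric of pure
    spinors at \<open>P\<close> and \<open>Q\<close>, and \<open>N12\<close> is its polar
    form.\<close>
  define N1 where "N1 x = P0 x * P4 x - pf (Pz x)" for x
  define N2 where "N2 x = Q0 x * Q4 x - pf (Qz x)" for x
  define N12 where "N12 x = P0 x * Q4 x + Q0 x * P4 x - pol (Pz x) (Qz x)" for x
  have N: "N1 \<in> poly_functions G" "N2 \<in> poly_functions G" "N12 \<in> poly_functions G"
    unfolding N1_def N2_def N12_def pf_def pol_def by (intro poly_functions_intros pp)+
  define G' where "G' = {\<lambda>(x :: 'a, t :: complex). g x |g. g \<in> G} \<union> {snd}"
  have lift: "(\<lambda>xt. g (fst xt)) \<in> poly_functions G'" if "g \<in> poly_functions G" for g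
    using that
  proof (rule poly_functions_compose)
    fix g assume "g \<in> G"
    then show "(\<lambda>xt. g (fst xt)) \<in> poly_functions G'"
      by (intro poly_functions.gen) (auto simp: G'_def split_beta')
  qed
  have t: "(\<lambda>xt. snd xt) \<in> poly_functions G'" by (intro poly_functions.gen) (auto simp: G'_def)
  \<comment> \<open>The quadric takes the value
    \<open>N2 x * (t\<^sup>2 + N12 x * t + N1 x * N2 x)\<close> at \<open>N2 x\<close> times
    \<open>P x\<close> plus \<open>t\<close> times \<open>Q x\<close>. The factor
    \<open>N2 x\<close> keeps the equation for \<open>t\<close> monic without a division.
    \<open>B\<close> belongs to the other root \<open>c\<close>.\<close>
  define A0 where "A0 xt = N2 (fst xt) * P0 (fst xt) + snd xt * Q0 (fst xt)" for xt
  define Az where "Az xt = N2 (fst xt) *s Pz (fst xt) + snd xt *s Qz (fst xt)" for xt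
  define A4 where "A4 xt = N2 (fst xt) * P4 (fst xt) + snd xt * Q4 (fst xt)" for xt
  define c where "c xt = - N12 (fst xt) - snd xt" for xt
  define B0 where "B0 xt = N2 (fst xt) * P0 (fst xt) + c xt * Q0 (fst xt)" for xt
  define Bz where "Bz xt = N2 (fst xt) *s Pz (fst xt) + c xt *s Qz (fst xt)" for xt
  define B4 where "B4 xt = N2 (fst xt) * P4 (fst xt) + c xt * Q4 (fst xt)" for xt
  have cp: "c \<in> poly_functions G'" unfolding c_def by (intro poly_functions_intros t lift N)
  have ap: "A0 \<in> poly_functions G'" "\<And>i. (\<lambda>xt. Az xt $ i) \<in> poly_functions G'"
    "\<And>i. (\<lambda>xt. Bz xt $ i) \<in> poly_functions G'" "B4 \<in> poly_functions G'"
    unfolding A0_def Az_def B4_def Bz_def vector_add_component vector_smult_component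
    by (intro poly_functions_intros t lift[OF N(2)] lift[OF pp(1)] lift[OF pp(2)] lift[OF pp(3)] lift[OF pp(4)] lift[OF pp(5)] lift[OF pp(6)] cp)+
  \<comment> \<open>At the base point the roots are 1 and -1, so \<open>A\<close> and
    \<open>B\<close> are the sum and the difference of \<open>P a\<close> and
    \<open>Q a\<close>.\<close>
  have base: "P0 a = 1" "Pz a = 0" "P4 a = -1" "Q0 a = 1" "Qz a = 0" "Q4 a = 1"
    by (simp_all add: P0_def Pz_def P4_def Q0_def Qz_def Q4_def a)
  have Nb: "N1 a = -1" "N2 a = 1" "N12 a = 0" by (simp_all add: N1_def N2_def N12_def base pf_def pol_def)
  have ab: "A0 (a, 1) = 2" "Az (a, 1) = 0" "Bz (a, 1) = 0" "B4 (a, 1) = -2"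
    by (simp_all add: A0_def Az_def Bz_def B4_def c_def base Nb)
  define Z where "Z xt = gram M (hA (A0 xt) (Az xt)) (hB (B4 xt) (Bz xt))" for xt
  define C where "C xt = gram M' (hA (A0 xt) (Az xt)) (hB (B4 xt) (Bz xt))" for xt
  define KA where "KA xt = gram M' (hA (A0 xt) (Az xt)) (hA (A0 xt) (Az xt))" for xt
  define KB where "KB xt = gram M' (hB (B4 xt) (Bz xt)) (hB (B4 xt) (Bz xt))" for xt
  note hp = h_poly(1)[OF ap(1,2)] h_poly(2)[OF ap(4,3)]
  have gp: "(\<lambda>xt. Z xt $ i $ j) \<in> poly_functions G'" "(\<lambda>xt. C xt $ i $ j) \<in> poly_functions G'"
    "(\<lambda>xt. KA xt $ i $ j) \<in> poly_functions G'" "(\<lambda>xt. KB xt $ i $ j) \<in> poly_functions G'" for i j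
    unfolding Z_def C_def KA_def KB_def gram_def vec_lambda_beta by (intro bil_poly hp)+
  have gb: "Z (a, 1) = (\<chi> i j. if i = j then - 2 else 0)" "C (a, 1) = (\<chi> i j. if i = j then - 4 * r $ i else 0)"
    "KA (a, 1) = (\<chi> i j. if i = j then 4 * p $ i else 0)" "KB (a, 1) = (\<chi> i j. if i = j then 4 * p $ i else 0)"
    unfolding Z_def C_def KA_def KB_def ab gram_base by (simp_all add: vec_eq_iff)
  have dd: "det (KA (a, 1)) \<noteq> 0" "det (KB (a, 1)) \<noteq> 0"
    unfolding gb by (subst det_diagonal; simp add: p_nz)+
  obtain F where F: "F \<in> poly_functions G'" "F (a, 1) \<noteq> 0" and
    Fx: "\<And>xt. F xt \<noteq> 0 \<Longrightarrow> det (Z xt) \<noteq> 0 \<and>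
     (\<exists>u v d (\<rho> :: 4 \<Rightarrow> complex). (\<forall>i j. dot4 (u i) (Z xt *v v j) = (if i = j then d i else 0)) \<and>
       (\<forall>i j. dot4 (u i) (C xt *v v j) = (if i = j then \<rho> i * d i else 0)) \<and> (\<forall>i. d i \<noteq> 0) \<and> inj \<rho> \<and>
       (\<forall>i. dot4 (u i) (KA xt *v u i) \<noteq> 0) \<and> (\<forall>i. dot4 (v i) (KB xt *v v i) \<noteq> 0))"
  proof -
    have r: "- 4 * r $ i \<noteq> - 4 * r $ j" if "i \<noteq> j" for i j using r_inj[OF that] by simp
    have "KA (a, 1) $ i $ i \<noteq> 0" "KB (a, 1) $ i $ i \<noteq> 0" for i unfolding gb using p_nz by simp_all
    from generic_eigenbasis[OF gp gb(1) _ gb(2) r this] that show thesis by auto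
  qed
  define f where "f xt = A0 xt * (B4 xt * (det (KA xt) * (det (KB xt) * F xt)))" for xt
  have "f \<in> poly_functions ({\<lambda>(x :: 'a, t :: complex). g x |g. g \<in> G} \<union> {snd})"
    unfolding f_def G'_def[symmetric] by (intro poly_functions_intros ap F poly_functions_det gp)
  from poly_functions_eliminate_root[OF this N(3), of "\<lambda>x. N1 x * N2 x"] obtain g h where
    gh: "g \<in> poly_functions G" "h \<in> poly_functions G"
    "\<And>x t. t\<^sup>2 + N12 x * t + N1 x * N2 x = 0 \<Longrightarrow> f (x, t) = g x + h x * t"
    using N by (auto intro: poly_functions.mult)
  have "f (a, 1) \<noteq> 0" unfolding f_def ab using F(2) dd by simp
  moreover have "f (a, 1) = g a + h a * 1" by (rule gh(3)) (simp add: Nb)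
  ultimately have "g a \<noteq> 0 \<or> h a \<noteq> 0" by auto
  \<comment> \<open>Whichever coefficient of the remainder is nonzero at the base point serves as
    the condition on \<open>x\<close>.\<close>
  then obtain k where k: "k = g \<or> k = h" "k a \<noteq> 0" by blast
  define D where "D x = (N12 x)\<^sup>2 - 4 * N1 x * N2 x" for x
  show ?thesis
  proof (rule bexI[of _ "\<lambda>x. N2 x * (D x * k x)"], intro conjI allI impI)
    show "(\<lambda>x. N2 x * (D x * k x)) \<in> poly_functions G"
      unfolding D_def using k(1) gh(1,2) by (auto intro!: poly_functions_intros N)
    show "N2 a * (D a * k a) \<noteq> 0" using k(2) by (simp add: D_def Nb)
    fix x S assume nz: "N2 x * (D x * k x) \<noteq> 0"
      and S: "S = {E \<in> X. \<forall>s z t. io s z t \<in> spinor_sub \<gamma> y0 E \<longrightarrow> lp (P x) s z t = 0 \<and> lp (Q x) s z t = 0}"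
    obtain t0 where t0: "t0\<^sup>2 + N12 x * t0 + N1 x * N2 x = 0"
      "(- N12 x - t0)\<^sup>2 + N12 x * (- N12 x - t0) + N1 x * N2 x = 0"
      by (rule monic_quadratic_roots) (rule that)
    have "D x = (t0 - (- N12 x - t0))\<^sup>2" unfolding D_def using t0 by algebra
    then have ne: "t0 \<noteq> - N12 x - t0" using nz by auto
    \<comment> \<open>If \<open>f\<close> vanished at both of the distinct roots, its linear
      remainder would vanish identically. So one of the two assignments of the roots to
      \<open>A\<close> and \<open>B\<close> works.\<close>
    have "\<exists>t. t\<^sup>2 + N12 x * t + N1 x * N2 x = 0 \<and> (- N12 x - t)\<^sup>2 + N12 x * (- N12 x - t) + N1 x * N2 x = 0
        \<and> t \<noteq> - N12 x - t \<and> f (x, t) \<noteq> 0"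
    proof (rule ccontr)
      assume n: "\<not> ?thesis"
      have "f (x, t0) = 0" using n t0 ne by blast
      moreover have "f (x, - N12 x - t0) = 0"
      proof (rule ccontr)
        assume "f (x, - N12 x - t0) \<noteq> 0"
        moreover have "- N12 x - (- N12 x - t0) = t0" by simp
        ultimately show False using n t0 ne by metis
      qed
      ultimately have 1: "g x + h x * t0 = 0" "g x + h x * (- N12 x - t0) = 0" using gh(3) t0 by metis+
      then have "h x * (t0 - (- N12 x - t0)) = 0" by algebra
      then have "h x = 0" using ne unfolding mult_eq_0_iff right_minus_eq by blast
      then show False using 1 k nz by auto
    qed
    then obtain t where t1: "t\<^sup>2 + N12 x * t + N1 x * N2 x = 0" and t2: "(- N12 x - t)\<^sup>2 + N12 x * (- N12 x - t) + N1 x * N2 x = 0"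
      and tne: "t \<noteq> - N12 x - t" and ft: "f (x, t) \<noteq> 0" by blast
    let ?x = "(x, t)"
    have n0: "A0 ?x \<noteq> 0" "B4 ?x \<noteq> 0" "det (KA ?x) \<noteq> 0" "det (KB ?x) \<noteq> 0" "F ?x \<noteq> 0"
      using ft unfolding f_def by auto
    have cx: "c ?x = - N12 x - t" by (simp add: c_def)
    have pfl: "pf (n *s y + m *s y') = n\<^sup>2 * pf y + n * m * pol y y' + m\<^sup>2 * pf y'" for n m y y'
      by (simp add: pf_def pol_def power2_eq_square algebra_simps)
    have pA: "A0 ?x * A4 ?x = pf (Az ?x)"
    proof -
      have "A0 ?x * A4 ?x - pf (Az ?x) = N2 x * (t\<^sup>2 + N12 x * t + N1 x * N2 x)"
        unfolding A0_def A4_def Az_def pfl fst_conv snd_conv N1_def N2_def N12_def by algebra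
      then show ?thesis using t1 by simp
    qed
    have pB: "B0 ?x * B4 ?x = pf (Bz ?x)"
    proof -
      have "B0 ?x * B4 ?x - pf (Bz ?x) = N2 x * ((c ?x)\<^sup>2 + N12 x * c ?x + N1 x * N2 x)"
        unfolding B0_def B4_def Bz_def pfl fst_conv snd_conv N1_def N2_def N12_def by algebra
      then show ?thesis using t2 unfolding cx by simp
    qed
    have poll: "pol z (n *s y + m *s y') = n * pol z y + m * pol z y'" for z n m y y'
      by (simp add: pol_def algebra_simps)
    have lA: "A0 ?x * s1 - pol z (Az ?x) + A4 ?x * s = N2 x * lp (P x) s z s1 + t * lp (Q x) s z s1" for s z s1
      unfolding A0_def A4_def Az_def poll lp_def P0_def Pz_def P4_def Q0_def Qz_def Q4_def fst_conv snd_conv by algebra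
    have lB: "B0 ?x * s1 - pol z (Bz ?x) + B4 ?x * s = N2 x * lp (P x) s z s1 + c ?x * lp (Q x) s z s1" for s z s1
      unfolding B0_def B4_def Bz_def poll lp_def P0_def Pz_def P4_def Q0_def Qz_def Q4_def fst_conv snd_conv by algebra
    have both: "lp (P x) s z s1 = 0 \<and> lp (Q x) s z s1 = 0 \<longleftrightarrow>
        A0 ?x * s1 - pol z (Az ?x) + A4 ?x * s = 0 \<and> B0 ?x * s1 - pol z (Bz ?x) + B4 ?x * s = 0" for s z s1
    proof
      assume "A0 ?x * s1 - pol z (Az ?x) + A4 ?x * s = 0 \<and> B0 ?x * s1 - pol z (Bz ?x) + B4 ?x * s = 0"
      then have e: "N2 x * lp (P x) s z s1 + t * lp (Q x) s z s1 = 0" "N2 x * lp (P x) s z s1 + c ?x * lp (Q x) s z s1 = 0"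
        unfolding lA lB by auto
      then have "(t - c ?x) * lp (Q x) s z s1 = 0" by algebra
      then have "lp (Q x) s z s1 = 0"
        using tne unfolding cx mult_eq_0_iff right_minus_eq by blast
      then show "lp (P x) s z s1 = 0 \<and> lp (Q x) s z s1 = 0" using e nz by auto
    qed (simp add: lA lB)
    let ?a = "(1 / A0 ?x) *s Az ?x" and ?b = "(- 1 / B4 ?x) *s dual6 (Bz ?x)"
    have sc: "pf (k *s y) = k\<^sup>2 * pf y" "pf (dual6 y) = pf y" "pol z (k *s y) = k * pol z y" for k y z
      by (simp_all add: pf_def pol_def dual6_def power2_eq_square algebra_simps)
    have "pf ?a = pf (Az ?x) / (A0 ?x)\<^sup>2" unfolding sc by (simp add: power2_eq_square)
    then have pfa: "pf ?a = A4 ?x / A0 ?x" unfolding pA[symmetric] using n0 by (simp add: power2_eq_square)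
    have "pf ?b = pf (Bz ?x) / (B4 ?x)\<^sup>2" unfolding sc by (simp add: power2_eq_square)
    then have pfb: "pf ?b = B0 ?x / B4 ?x" unfolding pB[symmetric] using n0 by (simp add: power2_eq_square)
    have "pol z ?a = pol z (Az ?x) / A0 ?x" for z unfolding sc by simp
    then have zA: "s1 - pol z ?a + pf ?a * s = 0 \<longleftrightarrow> A0 ?x * s1 - pol z (Az ?x) + A4 ?x * s = 0" for s z s1
      unfolding pfa using n0(1) by (simp add: field_simps)
    have "pol z (dual6 ?b) = - pol z (Bz ?x) / B4 ?x" for z unfolding dual6_linear sc by simp
    then have zB: "pf ?b * s1 + pol z (dual6 ?b) + s = 0 \<longleftrightarrow> B0 ?x * s1 - pol z (Bz ?x) + B4 ?x * s = 0" for s z s1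
      unfolding pfb using n0(2) by (simp add: field_simps)
    have S': "S = {E \<in> X. (\<exists>y. y \<noteq> 0 \<and> ch ?a y \<in> E) \<and> (\<exists>y. y \<noteq> 0 \<and> kp y (skew ?b y) \<in> E)}"
    proof -
      have "(\<forall>s z s1. io s z s1 \<in> spinor_sub \<gamma> y0 E \<longrightarrow> lp (P x) s z s1 = 0 \<and> lp (Q x) s z s1 = 0) \<longleftrightarrow>
          (\<exists>y. y \<noteq> 0 \<and> ch ?a y \<in> E) \<and> (\<exists>y. y \<noteq> 0 \<and> kp y (skew ?b y) \<in> E)" if E: "E \<in> X" for E
        unfolding pure_zero_locus[OF E, symmetric] pure_zero_locus_swapped[OF E, symmetric] zA zB both by blast
      then show ?thesis unfolding S by blast
    qed
    obtain u v d and \<rho> :: "4 \<Rightarrow> complex" where e: "\<And>i j. dot4 (u i) (Z ?x *v v j) = (if i = j then d i else 0)"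
      "\<And>i j. dot4 (u i) (C ?x *v v j) = (if i = j then \<rho> i * d i else 0)" "\<And>i. d i \<noteq> 0" "inj \<rho>"
      "\<And>i. dot4 (u i) (KA ?x *v u i) \<noteq> 0" "\<And>i. dot4 (v i) (KB ?x *v v i) \<noteq> 0"
      using Fx[OF n0(5)] by blast
    have dZ: "det (Z ?x) \<noteq> 0" using Fx[OF n0(5)] by blast
    show "\<exists>Y \<phi>. segre4_section_codim2 Y \<and> biregular (plucker ` S) Y \<phi> \<and> pulls_back_hyperplane_class (plucker ` S) \<phi>"
      by (rule segre_of_pure_pair[OF n0(1,2) dZ[unfolded Z_def] n0(3)[unfolded KA_def] n0(4)[unfolded KB_def]
           e(1)[unfolded Z_def] e(2)[unfolded C_def] e(3,4) e(5)[unfolded KA_def] e(6)[unfolded KB_def] S'])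
  qed
qed

end

section \<open>From linear functionals back to sections\<close>

context pencil_model
begin

text \<open>A choice of plane for each pure spinor, needed because a section takes a plane as
  argument. By \<open>section_linear\<close> the value of a section at the spinor does not depend on
  it.\<close>

definition point :: "complex ^ 6 \<Rightarrow> (complex ^ 8) set" where
  "point z = (SOME E. E \<in> X \<and> pure z \<in> spinor_sub \<gamma> y0 E)"

definition ev :: "complex ^ 6 \<Rightarrow> ((complex ^ 8) set \<Rightarrow> complex ^ 16 \<Rightarrow> complex) \<Rightarrow> complex" where
  "ev z \<sigma> = \<sigma> (point z) (pure z)"

text \<open>Coordinates of the linear functional on the half-spin module which corresponds to a section.\<close>

definition coords :: "((complex ^ 8) set \<Rightarrow> complex ^ 16 \<Rightarrow> complex) \<Rightarrow> complex \<times> (complex ^ 6) \<times> complex" where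
  "coords \<sigma> = (ev (axis 1 1 + axis 4 1) \<sigma> - ev (axis 1 1) \<sigma> - ev (axis 4 1) \<sigma> + ev 0 \<sigma>,
     - dual6 (\<chi> i. ev (axis i 1) \<sigma> - ev 0 \<sigma>), ev 0 \<sigma>)"

lemma point: "point z \<in> X" "pure z \<in> spinor_sub \<gamma> y0 (point z)"
proof -
  have "point z \<in> X \<and> pure z \<in> spinor_sub \<gamma> y0 (point z)"
    unfolding point_def by (rule someI_ex) (use pure_in_spinor_sub[of z] in blast)
  then show "point z \<in> X" "pure z \<in> spinor_sub \<gamma> y0 (point z)" by auto
qed

lemma section_coords:
  assumes \<sigma>: "\<sigma> \<in> spinor_sections \<gamma> y0 X" and E: "E \<in> X" and u: "io s z t \<in> spinor_sub \<gamma> y0 E"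
  shows "\<sigma> E (io s z t) = lp (coords \<sigma>) s z t"
proof -
  interpret c: spin_section M \<gamma> y0 kp io M' p r \<sigma> by unfold_locales (rule \<sigma>)
  obtain L where L: "half_spin_linear L" "\<And>E u. E \<in> X \<Longrightarrow> u \<in> spinor_sub \<gamma> y0 E \<Longrightarrow> \<sigma> E u = L u"
    using c.section_linear by blast
  have ev: "ev z \<sigma> = L (io 1 0 0) + (\<Sum>i\<in>UNIV. z$i * L (io 0 (axis i 1) 0)) + pf z * L (io 0 0 1)" for z
    using L(2)[OF point, of z] half_spin_linear_io[OF L(1), of 1 z "pf z"] by (simp add: ev_def pure_def)
  have ax: "ev (axis k 1) \<sigma> = L (io 1 0 0) + L (io 0 (axis k 1) 0)" for k
  proof -
    have "(\<Sum>i\<in>UNIV. (axis k 1 :: complex ^ 6)$i * L (io 0 (axis i 1) 0)) = L (io 0 (axis k 1) 0)"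
      by (simp add: axis_def if_distrib[where f = "\<lambda>t. t * _"] cong: if_cong)
    moreover have "pf (axis k 1) = 0" using exhaust_6[of k] by (elim disjE) (simp_all add: pf_def axis_def)
    ultimately show ?thesis unfolding ev by simp
  qed
  have e0: "ev 0 \<sigma> = L (io 1 0 0)" unfolding ev by (simp add: pf_def)
  \<comment> \<open>The basis vectors have Pfaffian 0 and this sum has Pfaffian 1, so the second
    difference isolates the coefficient of the last coordinate.\<close>
  have "ev (axis 1 1 + axis 4 1) \<sigma> = L (io 1 0 0) + (L (io 0 (axis 1 1) 0) + L (io 0 (axis 4 1) 0)) + L (io 0 0 1)"
    unfolding ev sum_6 by (simp add: axis_def pf_def)
  then have co: "coords \<sigma> = (L (io 0 0 1), - dual6 (\<chi> i. L (io 0 (axis i 1) 0)), L (io 1 0 0))"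
    unfolding coords_def ax e0 by simp
  show ?thesis
    unfolding L(2)[OF E u] half_spin_linear_io[OF L(1), of s z t] lp_def co
    by (simp add: sum_6 pol_def dual6_def algebra_simps)
qed

text \<open>A functional on the half-spin module is extended to all spinors with a left inverse of
  the inclusion. Its coefficients \<open>N\<close> are constants, that is, homogeneous of degree 0,
  and serve as a global local form.\<close>

lemma constant_section:
  obtains \<sigma> where "\<sigma> \<in> spinor_sections \<gamma> y0 X" "coords \<sigma> = (c, 0, e)"
proof -
  define T where "T v = io (v$0) (vec6 (v$1) (v$2) (v$3) (v$4) (v$5) (v$6)) (v$7)" for v :: "complex ^ 8"
  define A where "A = (\<chi> k j. T (axis j 1) $ k)"
  have add: "T (v + w) = T v + T w" for v w
    unfolding T_def io_add[symmetric] vec6_add[symmetric] by simp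
  have sm: "T (k *s v) = k *s T v" for k v
    unfolding T_def io_smult[symmetric] vec6_smult[symmetric] by simp
  have T0: "T 0 = 0" using sm[of 0 0] by simp
  have sum: "T (\<Sum>i\<in>I. f i) = (\<Sum>i\<in>I. T (f i))" for f and I :: "8 set"
    by (induction I rule: infinite_finite_induct) (simp_all add: T0 add)
  have A: "A *v v = T v" for v
  proof -
    have "T (\<Sum>i\<in>UNIV. v $ i *s axis i 1) = (\<Sum>i\<in>UNIV. v $ i *s T (axis i 1))" unfolding sum sm ..
    then have "T v = (\<Sum>i\<in>UNIV. v $ i *s T (axis i 1))" by (simp only: basis_expansion)
    then show ?thesis by (simp add: vec_eq_iff A_def matrix_vector_mult_def sum_component mult.commute)
  qed
  have "inj ((*v) A)"
  proof (rule injI)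
    fix v w assume "A *v v = A *v w"
    then have "v $ 0 = w $ 0 \<and> vec6 (v$1) (v$2) (v$3) (v$4) (v$5) (v$6) = vec6 (w$1) (w$2) (w$3) (w$4) (w$5) (w$6) \<and> v $ 7 = w $ 7"
      unfolding A T_def io_inj .
    then show "v = w" by (auto simp: vec_eq_iff forall_6 forall_8)
  qed
  then obtain B where B: "B ** A = mat 1" using matrix_left_invertible_injective by blast
  define N where "N = (\<chi> k. c * B $ 7 $ k + e * B $ 0 $ k)"
  have N: "(\<Sum>k\<in>UNIV. N $ k * io s z t $ k) = c * t + e * s" for s z t
  proof -
    define v :: "complex ^ 8" where "v = (\<chi> i. if i = 0 then s else if i = 1 then z$1 else if i = 2 then z$2
       else if i = 3 then z$3 else if i = 4 then z$4 else if i = 5 then z$5 else if i = 6 then z$6 else t)"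
    have "T v = io s z t" by (simp add: T_def v_def vec6_collapse)
    then have "B *v io s z t = v" using A[of v] B by (metis matrix_vector_mul_assoc matrix_vector_mul_lid)
    then have "(B *v io s z t) $ 7 = t" "(B *v io s z t) $ 0 = s" by (simp_all add: v_def)
    then show ?thesis
      by (simp add: N_def matrix_vector_mult_def algebra_simps sum.distrib flip: sum_distrib_left)
  qed
  define \<sigma> where "\<sigma> E s = (if E \<in> X \<and> s \<in> spinor_sub \<gamma> y0 E then (\<Sum>k\<in>UNIV. N $ k * s $ k) else 0)" for E s
  have "\<sigma> \<in> spinor_sections \<gamma> y0 X"
    unfolding spinor_sections_def
  proof (intro CollectI conjI ballI)
    show "\<forall>E s. \<not> (E \<in> X \<and> s \<in> spinor_sub \<gamma> y0 E) \<longrightarrow> \<sigma> E s = 0" by (auto simp: \<sigma>_def)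
    fix E assume "E \<in> X"
    show "\<exists>d K g. (\<forall>j. hom_poly d (\<lambda>w. K w $ j)) \<and> hom_poly d g \<and>
            (\<forall>w\<in>plucker E. w \<noteq> 0 \<longrightarrow> g w \<noteq> 0) \<and>
            (\<forall>E'\<in>X. \<forall>w\<in>plucker E'. w \<noteq> 0 \<and> g w \<noteq> 0 \<longrightarrow>
               (\<forall>s\<in>spinor_sub \<gamma> y0 E'. \<sigma> E' s = (\<Sum>j\<in>UNIV. K w $ j * s $ j) / g w))"
      by (intro exI[of _ 0] exI[of _ "\<lambda>_. N"] exI[of _ "\<lambda>_. 1"]) (simp add: hom_poly_def poly_functions.const \<sigma>_def)
  qed
  moreover have "ev z \<sigma> = c * pf z + e" for z
    using point[of z] N[of 1 z "pf z"] by (simp add: ev_def \<sigma>_def pure_def)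
  then have "coords \<sigma> = (c, 0, e)"
  proof -
    assume ev: "\<And>z. ev z \<sigma> = c * pf z + e"
    have "pf (axis k 1) = 0" for k using exhaust_6[of k] by (elim disjE) (simp_all add: pf_def axis_def)
    moreover have "pf (axis 1 1 + axis 4 1) = 1" "pf 0 = 0" by (simp_all add: pf_def axis_def)
    ultimately show ?thesis unfolding coords_def ev by (simp add: vec_eq_iff forall_6 dual6_def)
  qed
  ultimately show ?thesis by (rule that)
qed

theorem general_pair_segre:
  "general_pair (spinor_sections \<gamma> y0 X)
     (\<lambda>s1 s2. \<exists>Y \<phi>. let S = zero_locus \<gamma> y0 X s1 \<inter> zero_locus \<gamma> y0 X s2
        in segre4_section_codim2 Y \<and> biregular (plucker ` S) Y \<phi> \<and> pulls_back_hyperplane_class (plucker ` S) \<phi>)"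
proof -
  let ?H = "spinor_sections \<gamma> y0 X"
  define G where "G = {\<lambda>st. l (fst st) |l. l \<in> linear_functionals ?H} \<union> {\<lambda>st. l (snd st) |l. l \<in> linear_functionals ?H}"
  have l: "ev z \<in> linear_functionals ?H" for z
    unfolding linear_functionals_def by (simp add: ev_def)
  have g: "(\<lambda>st. ev z (fst st)) \<in> poly_functions G" "(\<lambda>st. ev z (snd st)) \<in> poly_functions G" for z
    unfolding G_def by (rule poly_functions.gen, use l in blast)+
  have co: "(\<lambda>st. fst (coords (h st))) \<in> poly_functions G" "(\<lambda>st. fst (snd (coords (h st))) $ i) \<in> poly_functions G"
    "(\<lambda>st. snd (snd (coords (h st)))) \<in> poly_functions G" if h: "\<And>z. (\<lambda>st. ev z (h st)) \<in> poly_functions G" for h i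
  proof -
    show "(\<lambda>st. fst (coords (h st))) \<in> poly_functions G" "(\<lambda>st. snd (snd (coords (h st)))) \<in> poly_functions G"
      unfolding coords_def fst_conv snd_conv by (intro poly_functions_intros h)+
    show "(\<lambda>st. fst (snd (coords (h st))) $ i) \<in> poly_functions G"
      unfolding coords_def fst_conv snd_conv vector_uminus_component
      by (intro poly_functions_uminus dual6_poly) (simp, intro poly_functions_intros h)
  qed
  \<comment> \<open>The difference and the sum of the last and the first coordinate. These
    coordinates themselves are pure functionals, for which \<open>N2\<close> vanishes and the
    parametrization of the line by \<open>t\<close> degenerates.\<close>
  obtain \<sigma>1 where \<sigma>1: "\<sigma>1 \<in> ?H" "coords \<sigma>1 = (1, 0, -1)" by (rule constant_section)
  obtain \<sigma>2 where \<sigma>2: "\<sigma>2 \<in> ?H" "coords \<sigma>2 = (1, 0, 1)" by (rule constant_section)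
  have b: "coords (fst (\<sigma>1, \<sigma>2)) = (1, 0, -1)" "coords (snd (\<sigma>1, \<sigma>2)) = (1, 0, 1)" using \<sigma>1 \<sigma>2 by simp_all
  obtain F where F: "F \<in> poly_functions G" "F (\<sigma>1, \<sigma>2) \<noteq> 0" and
    Fx: "\<forall>x. F x \<noteq> 0 \<longrightarrow> (\<forall>S. S = {E \<in> X. \<forall>s z t. io s z t \<in> spinor_sub \<gamma> y0 E \<longrightarrow> lp (coords (fst x)) s z t = 0 \<and> lp (coords (snd x)) s z t = 0} \<longrightarrow>
     (\<exists>Y \<phi>. segre4_section_codim2 Y \<and> biregular (plucker ` S) Y \<phi> \<and> pulls_back_hyperplane_class (plucker ` S) \<phi>))"
    using generic_segre[of "\<lambda>x. coords (fst x)" G "\<lambda>x. coords (snd x)", OF co[OF g(1)] co[OF g(2)] b]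
    by (elim bexE conjE) (rule that)
  have zl: "zero_locus \<gamma> y0 X s1 \<inter> zero_locus \<gamma> y0 X s2 =
      {E \<in> X. \<forall>s z t. io s z t \<in> spinor_sub \<gamma> y0 E \<longrightarrow> lp (coords s1) s z t = 0 \<and> lp (coords s2) s z t = 0}"
    if s: "s1 \<in> ?H" "s2 \<in> ?H" for s1 s2
  proof -
    have "(\<forall>u\<in>spinor_sub \<gamma> y0 E. s1 E u = 0) \<longleftrightarrow> (\<forall>s z t. io s z t \<in> spinor_sub \<gamma> y0 E \<longrightarrow> lp (coords s1) s z t = 0)"
      if E: "E \<in> X" and s1: "s1 \<in> ?H" for E s1
    proof -
      have "(\<forall>u\<in>spinor_sub \<gamma> y0 E. s1 E u = 0) \<longleftrightarrow> (\<forall>s z t. io s z t \<in> spinor_sub \<gamma> y0 E \<longrightarrow> s1 E (io s z t) = 0)"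
      proof
        assume r: "\<forall>s z t. io s z t \<in> spinor_sub \<gamma> y0 E \<longrightarrow> s1 E (io s z t) = 0"
        show "\<forall>u\<in>spinor_sub \<gamma> y0 E. s1 E u = 0"
        proof
          fix u assume u: "u \<in> spinor_sub \<gamma> y0 E"
          then obtain s z t where "u = io s z t" using io_range by (auto simp: spinor_sub_iff)
          then show "s1 E u = 0" using r u by blast
        qed
      qed blast
      then show ?thesis using section_coords[OF s1 E] by auto
    qed
    from this[OF _ s(1)] this[OF _ s(2)] show ?thesis unfolding zero_locus_def by blast
  qed
  show ?thesis
    unfolding general_pair_def G_def[symmetric]
  proof (rule bexI[OF _ F(1)], intro conjI)
    show "\<exists>s\<in>?H. \<exists>t\<in>?H. F (s, t) \<noteq> 0" using \<sigma>1(1) \<sigma>2(1) F(2) by blast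
    show "\<forall>s\<in>?H. \<forall>t\<in>?H. F (s, t) \<noteq> 0 \<longrightarrow> (\<exists>Y \<phi>. let S = zero_locus \<gamma> y0 X s \<inter> zero_locus \<gamma> y0 X t
        in segre4_section_codim2 Y \<and> biregular (plucker ` S) Y \<phi> \<and> pulls_back_hyperplane_class (plucker ` S) \<phi>)"
    proof (intro ballI impI)
      fix s t assume st: "s \<in> ?H" "t \<in> ?H" "F (s, t) \<noteq> 0"
      show "\<exists>Y \<phi>. let S = zero_locus \<gamma> y0 X s \<inter> zero_locus \<gamma> y0 X t
        in segre4_section_codim2 Y \<and> biregular (plucker ` S) Y \<phi> \<and> pulls_back_hyperplane_class (plucker ` S) \<phi>"
        unfolding Let_def by (rule Fx[rule_format, OF st(3)]) (simp add: zl[OF st(1,2)])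
    qed
  qed
qed

end

section \<open>Simultaneous diagonalization of a simple pencil\<close>

lemma bil_mult: "bil N x y = (\<Sum>i\<in>UNIV. x $ i * (N *v y) $ i)"
  by (simp add: bil_def matrix_vector_mult_def sum_distrib_left mult_ac)

text \<open>In a basis which contains \<open>v\<close>, the row and the column of \<open>v\<close> in the Gram matrix of \<open>N + t K\<close> are
  divisible by \<open>t\<close> and have a zero in common.\<close>

lemma det_isotropic_kernel:
  assumes N: "transpose N = N" and K: "transpose K = K" and v: "v \<noteq> 0" "N *v v = 0" "bil K v v = 0"
  obtains h where "h holomorphic_on UNIV" "\<And>t. det (\<chi> i j. N $ i $ j + t * K $ i $ j) = t\<^sup>2 * h t"
proof -
  obtain k where k: "v $ k \<noteq> 0" using v(1) by (auto simp: vec_eq_iff)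
  define q where "q j = (if j = k then v else axis j 1)" for j :: 8
  define Q where "Q = (\<chi> i j. q j $ i)"
  have "det Q = v $ k"
  proof -
    have "Q = (\<chi> i j. if j = k then (mat 1 *v v) $ i else mat 1 $ i $ j)"
      unfolding matrix_vector_mul_lid by (auto simp: Q_def q_def vec_eq_iff mat_def axis_def)
    then show ?thesis using cramer_lemma[of k "mat 1" v] by simp
  qed
  then have dQ: "det Q \<noteq> 0" using k by simp
  define R where "R = (\<chi> j. bil K v (q j))"
  define B2 where "B2 t = (\<chi> i. if i = k then (\<chi> j. if j = k then 0 else bil K (q j) v)
      else (\<chi> j. if j = k then R $ i else bil N (q j) (q i) + t * bil K (q j) (q i)))" for t
  have Nv: "bil N y v = 0" "bil N v y = 0" for y
    using bil_commute[OF N, of y v] by (simp_all add: bil_mult[of N y] v(2))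
  have 1: "transpose Q ** ((\<chi> i j. N $ i $ j + t * K $ i $ j) ** Q) = (\<chi> i j. bil N (q i) (q j) + t * bil K (q i) (q j))" for t
  proof -
    have "(transpose Q ** (A ** Q)) $ i $ j = bil A (q i) (q j)" for A i j
      by (simp add: matrix_matrix_mult_def transpose_def Q_def bil_def sum_distrib_left mult_ac)
    moreover have "bil (\<chi> i j. N $ i $ j + t * K $ i $ j) x y = bil N x y + t * bil K x y" for x y
      by (simp add: bil_def algebra_simps sum.distrib sum_distrib_left)
    ultimately show ?thesis by (simp add: vec_eq_iff)
  qed
  have 2: "det (\<chi> i j. bil N (q i) (q j) + t * bil K (q i) (q j)) = t * (t * det (B2 t))" for t
  proof -
    define B1 where "B1 = (\<chi> i. if i = k then R else (\<chi> j. bil N (q i) (q j) + t * bil K (q i) (q j)))"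
    have "(\<chi> i j. bil N (q i) (q j) + t * bil K (q i) (q j)) = (\<chi> i. if i = k then t *s R else (\<chi> j. bil N (q i) (q j) + t * bil K (q i) (q j)))"
      by (auto simp: vec_eq_iff R_def q_def Nv)
    then have "det (\<chi> i j. bil N (q i) (q j) + t * bil K (q i) (q j)) = t * det B1"
      unfolding B1_def by (simp only: det_row_mul)
    also have "det B1 = det (transpose B1)" by simp
    also have "transpose B1 = (\<chi> i. if i = k then t *s (\<chi> j. if j = k then 0 else bil K (q j) v)
      else (\<chi> j. if j = k then R $ i else bil N (q j) (q i) + t * bil K (q j) (q i)))"
      by (auto simp: vec_eq_iff B1_def transpose_def R_def q_def Nv v(3))
    also have "det \<dots> = t * det (B2 t)" unfolding B2_def by (simp only: det_row_mul)
    finally show ?thesis .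
  qed
  show ?thesis
  proof (rule that[of "\<lambda>t. det (B2 t) / (det Q)\<^sup>2"])
    have "(\<lambda>t. B2 t $ i $ j) holomorphic_on UNIV" for i j
      by (cases "i = k"; cases "j = k") (auto simp: B2_def intro!: holomorphic_intros)
    then show "(\<lambda>t. det (B2 t) / (det Q)\<^sup>2) holomorphic_on UNIV"
      unfolding det_def using dQ by (intro holomorphic_intros) auto
    fix t
    have "(det Q)\<^sup>2 * det (\<chi> i j. N $ i $ j + t * K $ i $ j) = t\<^sup>2 * det (B2 t)"
      using arg_cong[OF 1[of t], of det] unfolding 2 det_mul det_transpose by (simp add: power2_eq_square mult_ac)
    then show "det (\<chi> i j. N $ i $ j + t * K $ i $ j) = t\<^sup>2 * (det (B2 t) / (det Q)\<^sup>2)"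
      using dQ by (simp add: field_simps)
  qed
qed

text \<open>An isotropic kernel vector makes the determinant vanish to second order.\<close>

lemma deriv_det_isotropic_kernel:
  assumes N: "transpose N = N" and K: "transpose K = K" and v: "v \<noteq> 0" "N *v v = 0" "bil K v v = 0"
    and f: "\<And>t. f t = det (\<chi> i j. N $ i $ j + (t - c) * K $ i $ j)"
  shows "deriv f c = 0"
proof -
  obtain h where h: "h holomorphic_on UNIV" "\<And>t. det (\<chi> i j. N $ i $ j + t * K $ i $ j) = t\<^sup>2 * h t"
    by (rule det_isotropic_kernel[OF N K v]) (rule that)
  have f': "f = (\<lambda>t. (t - c)\<^sup>2 * h (t - c))" using f h(2) by (intro ext) simp
  obtain h' where h': "(h has_field_derivative h') (at (c - c))"
    using h(1) holomorphic_on_imp_differentiable_at[of h UNIV "c - c"] unfolding field_differentiable_def by auto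
  have "((\<lambda>t. t - c) has_field_derivative 1) (at c)" by (auto intro!: derivative_eq_intros)
  from DERIV_chain2[OF h' this] have "((\<lambda>t. h (t - c)) has_field_derivative h' * 1) (at c)" .
  then have "(f has_field_derivative 0) (at c)" unfolding f' by (auto intro!: derivative_eq_intros)
  then show ?thesis by (rule DERIV_imp_deriv)
qed

text \<open>If both forms vanished at the kernel vector, both partial derivatives of the
  discriminant would be zero, so the curve would be singular at the point with
  \<open>y = 0\<close>.\<close>

lemma simple_pencil_kernel:
  assumes sp: "simple_pencil M1 M2" and x: "(x1, x2) \<noteq> (0, 0)" and v: "v \<noteq> 0" "pencil M1 M2 x1 x2 *v v = 0"
  shows "bil M1 v v \<noteq> 0 \<or> bil M2 v v \<noteq> 0"
proof (rule ccontr)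
  assume "\<not> ?thesis"
  then have b: "bil M1 v v = 0" "bil M2 v v = 0" by auto
  have s: "transpose M1 = M1" "transpose M2 = M2" using sp by (auto simp: simple_pencil_def)
  have e: "M1 $ j $ i = M1 $ i $ j" "M2 $ j $ i = M2 $ i $ j" for i j
    using arg_cong[OF s(1), of "\<lambda>A. A $ i $ j"] arg_cong[OF s(2), of "\<lambda>A. A $ i $ j"] by (simp_all add: transpose_def)
  have N: "transpose (pencil M1 M2 x1 x2) = pencil M1 M2 x1 x2"
    by (simp add: transpose_def pencil_def vec_eq_iff e)
  have K: "transpose (- M2) = - M2" by (simp add: transpose_def vec_eq_iff e)
  have "bil (- M2) v v = 0" using b(2) by (simp add: bil_def sum_negf)
  then have "deriv (\<lambda>t. disc M1 M2 x1 t) x2 = 0"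
    by (rule deriv_det_isotropic_kernel[OF N K v]) (simp add: disc_def pencil_def algebra_simps)
  moreover have "deriv (\<lambda>t. disc M1 M2 t x2) x1 = 0"
    by (rule deriv_det_isotropic_kernel[OF N s(1) v b(1)]) (simp add: disc_def pencil_def algebra_simps)
  moreover have "disc M1 M2 x1 x2 = 0"
    using invertible_injective[OF _ v(2)] v(1) unfolding disc_def by blast
  then have "(0 :: complex)\<^sup>2 = disc M1 M2 x1 x2" by simp
  moreover have "(x1, x2, 0 :: complex) \<noteq> (0, 0, 0)" using x by auto
  ultimately show False using sp unfolding simple_pencil_def by fastforce
qed

text \<open>The spectral theorem, with \<open>H\<close> in place of positivity. The orthogonal
  complement of the vectors found so far is invariant, and an eigenvector in it can be scaled to
  length 1 because it is not isotropic.\<close>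

lemma orthonormal_eigenbasis:
  fixes M M' :: "complex ^ 8 ^ 8"
  assumes sM: "transpose M = M" and sM': "transpose M' = M'" and dM: "det M \<noteq> 0"
    and H: "\<And>v l. v \<noteq> 0 \<Longrightarrow> M' *v v = l *s (M *v v) \<Longrightarrow> bil M v v \<noteq> 0"
  obtains v :: "8 \<Rightarrow> complex ^ 8" and l where "\<And>i j. bil M (v i) (v j) = (if i = j then 1 else 0)"
    "\<And>i. M' *v v i = l i *s (M *v v i)" "inj l"
proof -
  obtain B where B: "M ** B = mat 1" "B ** M = mat 1" using dM invertible_det_nz[of M] unfolding invertible_def by blast
  define R where "R = B ** M'"
  have R: "R *v y = l *s y \<longleftrightarrow> M' *v y = l *s (M *v y)" for y l
  proof
    assume "R *v y = l *s y"
    then have "M *v (R *v y) = l *s (M *v y)" by (simp add: vector_scalar_commute)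
    then show "M' *v y = l *s (M *v y)" by (simp add: R_def matrix_vector_mul_assoc matrix_mul_assoc B)
  next
    assume "M' *v y = l *s (M *v y)"
    then have "B *v (M' *v y) = l *s (B *v (M *v y))" by (simp add: vector_scalar_commute)
    then show "R *v y = l *s y" by (simp add: R_def matrix_vector_mul_assoc B)
  qed
  have bR: "bil M x (R *v y) = bil M' x y" for x y
    unfolding bil_mult by (simp add: R_def matrix_vector_mul_assoc matrix_mul_assoc B)
  have be: "bil M' x y = l * bil M x y" if "M' *v x = l *s (M *v x)" for x y l
  proof -
    have "bil M' y x = l * bil M y x" unfolding bil_mult that by (simp add: sum_distrib_left mult_ac)
    then show ?thesis using bil_commute[OF sM', of x y] bil_commute[OF sM, of x y] by simp
  qed
  have "\<exists>v l. \<forall>i\<in>I. M' *v v i = l i *s (M *v v i) \<and> (\<forall>j\<in>I. bil M (v i) (v j) = (if i = j then 1 else 0))" for I :: "8 set"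
  proof (induction I rule: infinite_finite_induct)
    case (insert k I)
    then obtain v l where v: "\<And>i. i \<in> I \<Longrightarrow> M' *v v i = l i *s (M *v v i)"
      "\<And>i j. i \<in> I \<Longrightarrow> j \<in> I \<Longrightarrow> bil M (v i) (v j) = (if i = j then 1 else 0)" by blast
    define W where "W = {y. \<forall>i\<in>I. bil M (v i) y = 0}"
    have sub: "vec.subspace W" unfolding vec.subspace_def W_def by (auto simp: bil_add_right bil_smult_right)
    have inv: "R *v y \<in> W" if "y \<in> W" for y using that by (simp add: W_def bR be[OF v(1)])
    define Q where "Q = (\<chi> i. if i \<in> I then M *v v i else 0)"
    \<comment> \<open>The row of the index \<open>k\<close> not yet treated is zero, so the
      orthogonal complement \<open>W\<close> is nonzero.\<close>
    have "det Q = 0" by (rule det_zero_row[of k]) (use insert.hyps in \<open>simp add: Q_def row_def vec_eq_iff\<close>)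
    then obtain y where y: "y \<noteq> 0" "Q *v y = 0" using singular_kernel by blast
    have "bil M (v i) y = 0" if "i \<in> I" for i
    proof -
      have "bil M y (v i) = 0"
        using arg_cong[OF y(2), of "\<lambda>x. x $ i"] that
        unfolding bil_mult by (simp add: Q_def matrix_vector_mult_def[of "\<chi> i. _ i"] mult.commute)
      then show ?thesis using bil_commute[OF sM, of "v i" y] by simp
    qed
    then have "y \<in> W" by (simp add: W_def)
    then obtain x m where x: "x \<in> W" "x \<noteq> 0" "M' *v x = m *s (M *v x)"
      using invariant_subspace_eigenvector[OF sub inv _ y(1)] unfolding R by blast
    have nx: "bil M x x \<noteq> 0" by (rule H[OF x(2,3)])
    define c where "c = 1 / csqrt (bil M x x)"
    have c: "c * c * bil M x x = 1" using nx by (simp add: c_def field_simps flip: power2_eq_square)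
    define w where "w = c *s x"
    have w: "M' *v w = m *s (M *v w)" "bil M w w = 1" "\<And>i. i \<in> I \<Longrightarrow> bil M (v i) w = 0" "\<And>i. i \<in> I \<Longrightarrow> bil M w (v i) = 0"
      using x c bil_commute[OF sM] by (simp_all add: w_def vector_scalar_commute bil_smult_left bil_smult_right W_def mult_ac vec_eq_iff)
    show ?case
    proof (intro exI[of _ "v(k := w)"] exI[of _ "l(k := m)"] ballI conjI)
      fix i assume i: "i \<in> insert k I"
      show "M' *v (v(k := w)) i = (l(k := m)) i *s (M *v (v(k := w)) i)"
        using i v(1) w(1) by auto
      fix j assume j: "j \<in> insert k I"
      show "bil M ((v(k := w)) i) ((v(k := w)) j) = (if i = j then 1 else 0)"
        using i j insert.hyps(2) v(2) w by auto
    qed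
  qed auto
  from this[of UNIV] obtain v :: "8 \<Rightarrow> complex ^ 8" and l where
    "\<forall>i\<in>UNIV. M' *v v i = l i *s (M *v v i) \<and> (\<forall>j\<in>UNIV. bil M (v i) (v j) = (if i = j then 1 else 0))"
    by (elim exE) (rule that)
  then have v: "\<And>i. M' *v v i = l i *s (M *v v i)" "\<And>i j. bil M (v i) (v j) = (if i = j then 1 else 0)"
    by simp_all
  have "inj l"
  proof (rule injI, rule ccontr)
    fix i j assume l: "l i = l j" and ij: "i \<noteq> j"
    \<comment> \<open>For equal eigenvalues this isotropic vector would be an eigenvector.\<close>
    let ?x = "v i + \<i> *s v j"
    have "M' *v ?x = l j *s (M *v ?x)"
      using v(1)[of i] v(1)[of j] unfolding l
      by (simp add: matrix_vector_right_distrib vector_scalar_commute vec_eq_iff algebra_simps)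
    moreover have "bil M ?x ?x = 0" using ij
      by (simp add: bil_add_left bil_add_right bil_smult_left bil_smult_right v(2))
    moreover have "bil M (v i) ?x = 1" using ij by (simp add: bil_add_right bil_smult_right v(2))
    then have "?x \<noteq> 0" by auto
    ultimately show False using H by blast
  qed
  from that[OF v(2,1) this] show ?thesis .
qed

text \<open>An ordering by a generic real linear function makes the sums of consecutive pairs distinct.\<close>

lemma distinct_pair_sums:
  fixes l :: "8 \<Rightarrow> complex"
  assumes "inj l"
  obtains \<pi> :: "8 \<Rightarrow> 8" and \<phi> :: "complex \<Rightarrow> real" where "inj \<pi>" "\<And>x y. \<phi> (x + y) = \<phi> x + \<phi> y"
    "\<phi> (l (\<pi> 0)) < \<phi> (l (\<pi> 1))" "\<phi> (l (\<pi> 1)) < \<phi> (l (\<pi> 2))" "\<phi> (l (\<pi> 2)) < \<phi> (l (\<pi> 3))" "\<phi> (l (\<pi> 3)) < \<phi> (l (\<pi> 4))"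
    "\<phi> (l (\<pi> 4)) < \<phi> (l (\<pi> 5))" "\<phi> (l (\<pi> 5)) < \<phi> (l (\<pi> 6))" "\<phi> (l (\<pi> 6)) < \<phi> (l (\<pi> 7))"
proof -
  have fin: "finite {c :: real. Re d + c * Im d = 0}" if "d \<noteq> 0" for d
  proof -
    have "{c. Re d + c * Im d = 0} \<subseteq> {- Re d / Im d}"
    proof
      fix c assume "c \<in> {c. Re d + c * Im d = 0}"
      then have c: "c * Im d = - Re d" by simp
      then have "Im d \<noteq> 0" using that by (auto simp: complex_eq_iff)
      then show "c \<in> {- Re d / Im d}" using c nonzero_eq_divide_eq[of "Im d" c "- Re d"] by blast
    qed
    then show ?thesis by (rule finite_subset) simp
  qed
  have "finite (\<Union>i. \<Union>j\<in>- {i}. {c. Re (l i - l j) + c * Im (l i - l j) = 0})"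
  proof (intro finite_UN_I fin)
    fix i j :: 8 assume "j \<in> - {i}"
    then show "l i - l j \<noteq> 0" using injD[OF assms, of i j] unfolding right_minus_eq by blast
  qed simp_all
  from ex_new_if_finite[OF infinite_UNIV_char_0 this] obtain c where
    c: "c \<notin> (\<Union>i. \<Union>j\<in>- {i}. {c. Re (l i - l j) + c * Im (l i - l j) = 0})" by blast
  \<comment> \<open>A real linear function which separates the eigenvalues; sums can then be
    compared through it, although the eigenvalues are complex.\<close>
  define \<phi> where "\<phi> z = Re z + c * Im z" for z
  have add: "\<phi> (x + y) = \<phi> x + \<phi> y" for x y by (simp add: \<phi>_def algebra_simps)
  have inj: "inj (\<lambda>i. \<phi> (l i))"
  proof (rule injI, rule ccontr)
    fix i j assume e: "\<phi> (l i) = \<phi> (l j)" and n: "i \<noteq> j"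
    have "Re (l i - l j) + c * Im (l i - l j) = 0" using e by (simp add: \<phi>_def algebra_simps)
    then have "c \<in> (\<Union>i. \<Union>j\<in>- {i}. {c. Re (l i - l j) + c * Im (l i - l j) = 0})"
      by (intro UN_I[of i] UN_I[of j]) (use n in simp_all)
    then show False using c by (rule notE[rotated])
  qed
  define xs where "xs = sorted_list_of_set (range (\<lambda>i. \<phi> (l i)))"
  have "length xs = 8" using card_image[OF inj] by (simp add: xs_def)
  then obtain a0 a1 a2 a3 a4 a5 a6 a7 where xs: "xs = [a0, a1, a2, a3, a4, a5, a6, a7]"
    by (auto simp: numeral_eq_Suc length_Suc_conv)
  have "set xs = range (\<lambda>i. \<phi> (l i))" by (simp add: xs_def)
  then have "a0 \<in> range (\<lambda>i. \<phi> (l i))" "a1 \<in> range (\<lambda>i. \<phi> (l i))" "a2 \<in> range (\<lambda>i. \<phi> (l i))" "a3 \<in> range (\<lambda>i. \<phi> (l i))"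
    "a4 \<in> range (\<lambda>i. \<phi> (l i))" "a5 \<in> range (\<lambda>i. \<phi> (l i))" "a6 \<in> range (\<lambda>i. \<phi> (l i))" "a7 \<in> range (\<lambda>i. \<phi> (l i))"
    unfolding xs by auto
  then obtain i0 i1 i2 i3 i4 i5 i6 i7 where i: "a0 = \<phi> (l i0)" "a1 = \<phi> (l i1)" "a2 = \<phi> (l i2)" "a3 = \<phi> (l i3)"
    "a4 = \<phi> (l i4)" "a5 = \<phi> (l i5)" "a6 = \<phi> (l i6)" "a7 = \<phi> (l i7)" by blast
  have "sorted_wrt (<) xs" unfolding xs_def by (rule strict_sorted_list_of_set)
  then have o: "\<phi> (l i0) < \<phi> (l i1)" "\<phi> (l i1) < \<phi> (l i2)" "\<phi> (l i2) < \<phi> (l i3)" "\<phi> (l i3) < \<phi> (l i4)"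
    "\<phi> (l i4) < \<phi> (l i5)" "\<phi> (l i5) < \<phi> (l i6)" "\<phi> (l i6) < \<phi> (l i7)"
    unfolding xs i by simp_all
  define \<pi> where "\<pi> j = (if j = 0 then i0 else if j = 1 then i1 else if j = 2 then i2 else if j = 3 then i3
     else if j = 4 then i4 else if j = 5 then i5 else if j = 6 then i6 else i7)" for j :: 8
  have \<pi>: "\<pi> 0 = i0" "\<pi> 1 = i1" "\<pi> 2 = i2" "\<pi> 3 = i3" "\<pi> 4 = i4" "\<pi> 5 = i5" "\<pi> 6 = i6" "\<pi> 7 = i7"
    by (simp_all add: \<pi>_def)
  have "surj \<pi>"
  proof -
    have "range (\<lambda>i. \<phi> (l i)) \<subseteq> (\<lambda>i. \<phi> (l i)) ` range \<pi>"
    proof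
      fix a assume "a \<in> range (\<lambda>i. \<phi> (l i))"
      then have "a \<in> set xs" by (simp add: xs_def)
      then have "a \<in> {\<phi> (l (\<pi> 0)), \<phi> (l (\<pi> 1)), \<phi> (l (\<pi> 2)), \<phi> (l (\<pi> 3)), \<phi> (l (\<pi> 4)), \<phi> (l (\<pi> 5)), \<phi> (l (\<pi> 6)), \<phi> (l (\<pi> 7))}"
        unfolding xs i \<pi> by simp
      then show "a \<in> (\<lambda>i. \<phi> (l i)) ` range \<pi>" by blast
    qed
    then show ?thesis using inj by (metis inj_image_subset_iff top.extremum_uniqueI)
  qed
  then have "inj \<pi>" by (simp add: finite_UNIV_surj_inj)
  then show ?thesis using that[of \<pi> \<phi>, OF _ add] o unfolding \<pi> by blast
qed

text \<open>The coordinates of \<open>kap v x w\<close> on a pair of basis vectors are half the sum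
  and \<open>\<i>\<close> times half the difference of \<open>x$i\<close> and \<open>w$i\<close>.
  Expanding their squares yields the binary forms of \<open>pencil_model\<close>.\<close>

lemma qform_kap:
  assumes c: "\<And>i j. bil N (v i) (v j) = (if i = j then c i else 0)"
  shows "qform N (kap v x w) =
    (c 0 - c 1) / 4 * ((x$1)\<^sup>2 + (w$1)\<^sup>2) + (c 0 + c 1) / 2 * x$1 * w$1 +
    ((c 2 - c 3) / 4 * ((x$2)\<^sup>2 + (w$2)\<^sup>2) + (c 2 + c 3) / 2 * x$2 * w$2) +
    ((c 4 - c 5) / 4 * ((x$3)\<^sup>2 + (w$3)\<^sup>2) + (c 4 + c 5) / 2 * x$3 * w$3) +
    ((c 6 - c 7) / 4 * ((x$4)\<^sup>2 + (w$4)\<^sup>2) + (c 6 + c 7) / 2 * x$4 * w$4)"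
proof -
  define e where "e k = (if k = 0 then (x$1 + w$1) / 2 else if k = 1 then \<i> * (x$1 - w$1) / 2
    else if k = 2 then (x$2 + w$2) / 2 else if k = 3 then \<i> * (x$2 - w$2) / 2
    else if k = 4 then (x$3 + w$3) / 2 else if k = 5 then \<i> * (x$3 - w$3) / 2
    else if k = 6 then (x$4 + w$4) / 2 else \<i> * (x$4 - w$4) / 2)" for k :: 8
  have e: "e 0 = (x$1 + w$1) / 2" "e 1 = \<i> * (x$1 - w$1) / 2" "e 2 = (x$2 + w$2) / 2" "e 3 = \<i> * (x$2 - w$2) / 2"
    "e 4 = (x$3 + w$3) / 2" "e 5 = \<i> * (x$3 - w$3) / 2" "e 6 = (x$4 + w$4) / 2" "e 7 = \<i> * (x$4 - w$4) / 2"
    by (simp_all add: e_def)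
  have k: "kap v x w = (\<Sum>k\<in>UNIV. e k *s v k)"
    unfolding kap_def sum_4 sum_8 e hypa_def hypb_def by (simp add: vec_eq_iff field_simps)
  have "qform N (kap v x w) = (\<Sum>i\<in>UNIV. \<Sum>j\<in>UNIV. e i * (e j * (if i = j then c i else 0)))"
    unfolding k qform_bil bil_sum_left bil_sum_right bil_smult_left bil_smult_right c
    by (subst sum.swap) (simp add: mult_ac if_distrib eq_commute cong: if_cong)
  also have "\<dots> = (\<Sum>i\<in>UNIV. e i * (e i * c i))"
    by (simp add: if_distrib[where f = "\<lambda>t. _ * t"] cong: if_cong)
  also have "\<dots> = (e 0 * (e 0 * c 0) + e 1 * (e 1 * c 1)) + (e 2 * (e 2 * c 2) + e 3 * (e 3 * c 3)) +
     (e 4 * (e 4 * c 4) + e 5 * (e 5 * c 5)) + (e 6 * (e 6 * c 6) + e 7 * (e 7 * c 7))"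
    unfolding sum_8 by (simp only: add.assoc)
  finally have q: "qform N (kap v x w) = \<dots>" .
  have "(a + b) / 2 * ((a + b) / 2 * k) + \<i> * (a - b) / 2 * (\<i> * (a - b) / 2 * k') =
      (k - k') / 4 * (a\<^sup>2 + b\<^sup>2) + (k + k') / 2 * a * b" for a b k k'
  proof -
    have "\<i> * (a - b) / 2 * (\<i> * (a - b) / 2 * k') = - ((a - b) / 2 * ((a - b) / 2 * k'))"
      by (simp add: mult_ac)
    then show ?thesis by (simp add: field_simps power2_eq_square)
  qed
  then show ?thesis unfolding q e by simp
qed

lemma pencil_model_exists:
  assumes cl: "clifford M \<gamma>" and sM': "transpose M' = M'" and y: "y\<^sup>2 = det M" "det M \<noteq> 0"
    and H: "\<And>v l. v \<noteq> 0 \<Longrightarrow> M' *v v = l *s (M *v v) \<Longrightarrow> bil M v v \<noteq> 0"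
  shows "\<exists>kp io p r. pencil_model M \<gamma> y kp io M' p r"
proof -
  interpret clifford M \<gamma> by (rule cl)
  obtain v0 :: "8 \<Rightarrow> complex ^ 8" and l where v0: "\<And>i j. bil M (v0 i) (v0 j) = (if i = j then 1 else 0)"
    "\<And>i. M' *v v0 i = l i *s (M *v v0 i)" and l: "inj l"
  proof (rule orthonormal_eigenbasis[OF sym sM' y(2)])
    fix v l assume "v \<noteq> 0" "M' *v v = l *s (M *v v)"
    then show "bil M v v \<noteq> 0" by (rule H)
  qed (rule that)
  obtain \<pi> :: "8 \<Rightarrow> 8" and \<phi> :: "complex \<Rightarrow> real" where \<pi>: "inj \<pi>" and add: "\<And>x y. \<phi> (x + y) = \<phi> x + \<phi> y"
    and o: "\<phi> (l (\<pi> 0)) < \<phi> (l (\<pi> 1))" "\<phi> (l (\<pi> 1)) < \<phi> (l (\<pi> 2))" "\<phi> (l (\<pi> 2)) < \<phi> (l (\<pi> 3))" "\<phi> (l (\<pi> 3)) < \<phi> (l (\<pi> 4))"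
    "\<phi> (l (\<pi> 4)) < \<phi> (l (\<pi> 5))" "\<phi> (l (\<pi> 5)) < \<phi> (l (\<pi> 6))" "\<phi> (l (\<pi> 6)) < \<phi> (l (\<pi> 7))"
    by (rule distinct_pair_sums[OF l]) (rule that)
  define m where "m i = l (\<pi> i)" for i
  define w where "w i = v0 (\<pi> i)" for i
  have w: "bil M (w i) (w j) = (if i = j then 1 else 0)" "M' *v w i = m i *s (M *v w i)" for i j
    using \<pi> by (auto simp: w_def m_def v0 inj_eq)
  define V where "V = (\<chi> i. w i)"
  have "(V ** (M ** transpose V)) $ i $ j = bil M (w i) (w j)" for i j
    by (simp add: V_def matrix_matrix_mult_def transpose_def bil_def sum_distrib_left mult_ac)
  then have "V ** (M ** transpose V) = mat 1" by (simp add: vec_eq_iff w mat_def)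
  from arg_cong[OF this, of det] have "det V * (det M * det V) = 1" by (simp add: det_mul)
  \<comment> \<open>Since \<open>det V\<close> has the square \<open>1 / det M\<close>, the product
    is a sign. Reversing one basis vector corrects it, which selects the half-spin module belonging
    to \<open>y\<close> and not the one of \<open>- y\<close>.\<close>
  then have "(y * det V - 1) * (y * det V + 1) = 0" using y(1) by algebra
  then have yV: "y * det V = 1 \<or> y * det V = -1" by (auto simp: eq_neg_iff_add_eq_0)
  have "\<exists>v. (\<forall>i j. bil M (v i) (v j) = (if i = j then 1 else 0)) \<and> (\<forall>i. M' *v v i = m i *s (M *v v i)) \<and> y * det (\<chi> i. v i) = 1"
    using yV
  proof
    assume "y * det V = 1"
    then show ?thesis using w by (intro exI[of _ w]) (auto simp: V_def)
  next
    assume yV: "y * det V = -1"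
    define v where "v i = (if i = 0 then (-1) *s w i else w i)" for i
    have "det (\<chi> i. v i) = (-1) * det (\<chi> i. if i = 0 then w i else w i)"
      unfolding v_def by (rule det_row_mul)
    then have "y * det (\<chi> i. v i) = 1" using yV by (simp add: V_def)
    moreover have "bil M (v i) (v j) = (if i = j then 1 else 0)" for i j
      by (simp add: v_def bil_smult_left bil_smult_right w)
    moreover have "M' *v v i = m i *s (M *v v i)" for i
    proof -
      have "M' *v ((-1) *s w i) = m i *s (M *v ((-1) *s w i))"
        unfolding vector_scalar_commute w(2) by (simp add: vec_eq_iff)
      then show ?thesis using w(2)[of i] unfolding v_def by presburger
    qed
    ultimately show ?thesis by blast
  qed
  then obtain v where v: "\<And>i j. bil M (v i) (v j) = (if i = j then 1 else 0)" "\<And>i. M' *v v i = m i *s (M *v v i)"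
    "y * det (\<chi> i. v i) = 1" by blast
  obtain io where "spin_model \<gamma> y (kap v) io" using spin_model_exists[OF v(1,3)] by blast
  then interpret spin_model \<gamma> y "kap v" io .
  have v': "bil M' (v i) (v j) = (if i = j then m i else 0)" for i j
  proof -
    have "bil M' (v i) (v j) = m j * bil M (v i) (v j)" unfolding bil_mult v(2) by (simp add: sum_distrib_left mult_ac)
    then show ?thesis by (simp add: v(1))
  qed
  \<comment> \<open>Differences and sums of the eigenvalues of consecutive basis vectors. The
    denominator of \<open>r\<close> is 4 and not 2 because the mixed coefficient in
    \<open>pencil_model\<close> is \<open>2 * r$i\<close>.\<close>
  define p where "p = vec4 ((m 0 - m 1) / 4) ((m 2 - m 3) / 4) ((m 4 - m 5) / 4) ((m 6 - m 7) / 4)"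
  define r where "r = vec4 ((m 0 + m 1) / 4) ((m 2 + m 3) / 4) ((m 4 + m 5) / 4) ((m 6 + m 7) / 4)"
  note o = o[folded m_def]
  have "pencil_model M \<gamma> y (kap v) io M' p r"
  proof unfold_locales
    show "transpose M' = M'" by (rule sM')
    fix x w :: "complex ^ 4"
    show "qform M (kap v x w) = (\<Sum>i\<in>UNIV. x $ i * w $ i)"
      unfolding qform_kap[of M v "\<lambda>_. 1", OF v(1)] sum_4 by simp
    show "qform M' (kap v x w) = (\<Sum>i\<in>UNIV. p $ i * ((x $ i)\<^sup>2 + (w $ i)\<^sup>2) + 2 * r $ i * x $ i * w $ i)"
    proof -
      have "(m 0 + m 1) / 2 = 2 * r $ 1" "(m 2 + m 3) / 2 = 2 * r $ 2" "(m 4 + m 5) / 2 = 2 * r $ 3" "(m 6 + m 7) / 2 = 2 * r $ 4"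
        by (simp_all add: r_def)
      then show ?thesis unfolding qform_kap[of M' v m, OF v'] sum_4 by (simp add: p_def)
    qed
    fix i j :: 4
    have "m 0 \<noteq> m 1" "m 2 \<noteq> m 3" "m 4 \<noteq> m 5" "m 6 \<noteq> m 7" using o by auto
    then show "p $ i \<noteq> 0" using exhaust_4[of i] by (auto simp: p_def)
    assume ij: "i \<noteq> j"
    \<comment> \<open>In increasing order of \<open>\<phi>\<close>, the sums of consecutive pairs
      increase strictly.\<close>
    define s where "s i = \<phi> (4 * r $ i)" for i
    have "4 * r $ 1 = m 0 + m 1" "4 * r $ 2 = m 2 + m 3" "4 * r $ 3 = m 4 + m 5" "4 * r $ 4 = m 6 + m 7"
      unfolding r_def vec4_nth by (simp_all only: times_divide_eq_right nonzero_mult_div_cancel_left numeral_neq_zero not_False_eq_True)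
    then have "s 1 = \<phi> (m 0) + \<phi> (m 1)" "s 2 = \<phi> (m 2) + \<phi> (m 3)" "s 3 = \<phi> (m 4) + \<phi> (m 5)" "s 4 = \<phi> (m 6) + \<phi> (m 7)"
      unfolding add[symmetric] s_def by (simp_all only:)
    then have "s 1 < s 2" "s 2 < s 3" "s 3 < s 4" using o by linarith+
    then have "s i \<noteq> s j" using ij exhaust_4[of i] exhaust_4[of j] by auto
    then show "r $ i \<noteq> r $ j" by (auto simp: s_def)
  qed
  then show ?thesis by blast
qed

section \<open>Homogeneity of the discriminant and the branch points\<close>

lemma disc_homogeneous: "disc M1 M2 (c * x1) (c * x2) = c ^ 8 * disc M1 M2 x1 x2"
proof -
  have "pencil M1 M2 (c * x1) (c * x2) = (\<chi> i. c *s (pencil M1 M2 x1 x2 $ i))"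
    by (simp add: pencil_def vec_eq_iff algebra_simps)
  then show ?thesis unfolding disc_def by (simp add: det_rows_mul)
qed

lemma disc_zero: "disc M1 M2 0 0 = 0"
  using disc_homogeneous[of M1 M2 0 0 0] by simp

lemma orbit114_scale: "c \<noteq> 0 \<Longrightarrow> orbit114 (c * x1) (c * x2) (c ^ 4 * y) = orbit114 x1 x2 y"
proof (intro equalityI subsetI)
  fix q assume c: "c \<noteq> 0" and "q \<in> orbit114 (c * x1) (c * x2) (c ^ 4 * y)"
  then obtain k where k: "k \<noteq> 0" "q = (k * (c * x1), k * (c * x2), k ^ 4 * (c ^ 4 * y))" unfolding orbit114_def by blast
  have "q = ((k * c) * x1, (k * c) * x2, (k * c) ^ 4 * y)" unfolding k by (simp add: power_mult_distrib mult.assoc)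
  then show "q \<in> orbit114 x1 x2 y" unfolding orbit114_def using k(1) c by (intro CollectI exI[of _ "k * c"]) simp
next
  fix q assume c: "c \<noteq> 0" and "q \<in> orbit114 x1 x2 y"
  then obtain k where k: "k \<noteq> 0" "q = (k * x1, k * x2, k ^ 4 * y)" unfolding orbit114_def by blast
  have "q = ((k / c) * (c * x1), (k / c) * (c * x2), (k / c) ^ 4 * (c ^ 4 * y))"
    unfolding k using c by (simp add: power_divide)
  then show "q \<in> orbit114 (c * x1) (c * x2) (c ^ 4 * y)" unfolding orbit114_def
    using k(1) c by (intro CollectI exI[of _ "k / c"]) simp
qed

text \<open>A discriminant vanishing at all points with second coordinate 1 would by homogeneity
  vanish on the other coordinate axis too, and the curve would be singular over the point (0,
  1).\<close>

lemma finite_branch_points: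
  assumes sp: "simple_pencil M1 M2"
  shows "finite {t. disc M1 M2 t 1 = 0}"
proof -
  have "\<exists>t. disc M1 M2 t 1 \<noteq> 0"
  proof (rule ccontr)
    assume "\<not> ?thesis"
    then have 0: "disc M1 M2 t 1 = 0" for t by blast
    have 1: "disc M1 M2 0 t = 0" for t
    proof (cases "t = 0")
      case False
      then show ?thesis using disc_homogeneous[of M1 M2 t 0 1] 0 by simp
    qed (simp add: disc_zero)
    have "deriv (\<lambda>t. disc M1 M2 t 1) 0 = 0" "deriv (\<lambda>t. disc M1 M2 0 t) 1 = 0"
      unfolding 0 1 by simp_all
    moreover have "(0 :: complex)\<^sup>2 = disc M1 M2 0 1" using 0 by simp
    ultimately show False using sp unfolding simple_pencil_def by fastforce
  qed
  then obtain a where a: "disc M1 M2 a 1 \<noteq> 0" by blast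
  show ?thesis
  proof (rule poly_functions_finite_zeros[of "\<lambda>t. disc M1 M2 t 1", OF _ a])
    show "(\<lambda>t. disc M1 M2 t 1) \<in> poly_functions {\<lambda>t. t}"
      unfolding disc_def pencil_def
      by (intro poly_functions_det) (simp, intro poly_functions_intros poly_functions.gen, simp)
  qed
qed

text \<open>Any second member \<open>M'\<close> independent of \<open>M\<close> spans the same
  pencil. A generalized eigenvector isotropic for \<open>M\<close> would be isotropic for the whole
  pencil, which smoothness of the curve excludes.\<close>

lemma general_pair_pencil:
  assumes sp: "simple_pencil M1 M2" and d: "disc M1 M2 x1 x2 \<noteq> 0" and y: "y\<^sup>2 = disc M1 M2 x1 x2"
    and \<gamma>: "spin_module (pencil M1 M2 x1 x2) \<gamma>"
  shows "general_pair (spinor_sections \<gamma> y (Gr_pencil M1 M2))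
            (\<lambda>s1 s2. \<exists>Y \<phi>.
               let S = zero_locus \<gamma> y (Gr_pencil M1 M2) s1 \<inter> zero_locus \<gamma> y (Gr_pencil M1 M2) s2
               in segre4_section_codim2 Y \<and> biregular (plucker ` S) Y \<phi> \<and>
                  pulls_back_hyperplane_class (plucker ` S) \<phi>)"
proof -
  have s: "transpose M1 = M1" "transpose M2 = M2" using sp by (auto simp: simple_pencil_def)
  have e: "M1 $ j $ i = M1 $ i $ j" "M2 $ j $ i = M2 $ i $ j" for i j
    using arg_cong[OF s(1), of "\<lambda>A. A $ i $ j"] arg_cong[OF s(2), of "\<lambda>A. A $ i $ j"] by (simp_all add: transpose_def)
  have sym: "transpose (pencil M1 M2 a b) = pencil M1 M2 a b" for a b
    by (simp add: transpose_def pencil_def vec_eq_iff e)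
  have q: "qform (pencil M1 M2 a b) \<xi> = a * qform M1 \<xi> - b * qform M2 \<xi>" for a b \<xi>
    by (simp add: qform_def pencil_def sum_distrib_left sum_subtractf algebra_simps)
  have pv: "pencil M1 M2 a b *v \<xi> = a *s (M1 *v \<xi>) - b *s (M2 *v \<xi>)" for a b \<xi>
    by (simp add: pencil_def matrix_vector_mult_def vec_eq_iff sum_distrib_left sum_subtractf algebra_simps)
  have "(x1, x2) \<noteq> (0, 0)" using d disc_zero by auto
  then obtain c1 c2 where c: "x1 * c2 - x2 * c1 \<noteq> 0"
  proof (cases "x1 = 0")
    case True
    then show ?thesis using \<open>(x1, x2) \<noteq> (0, 0)\<close> that[of 0 1] by simp
  next
    case False
    then show ?thesis using that[of 1 0] by simp
  qed
  define M where "M = pencil M1 M2 x1 x2"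
  define M' where "M' = pencil M1 M2 c1 c2"
  have "clifford M \<gamma>" unfolding clifford_def M_def using sym \<gamma> by blast
  moreover have "bil M v v \<noteq> 0" if v: "v \<noteq> 0" "M' *v v = l *s (M *v v)" for v l
  proof
    assume "bil M v v = 0"
    then have 1: "x1 * qform M1 v - x2 * qform M2 v = 0" unfolding qform_bil[symmetric] M_def q .
    have "pencil M1 M2 (c1 - l * x1) (c2 - l * x2) *v v = 0"
      using v(2) unfolding M_def M'_def pv by (simp add: vec_eq_iff algebra_simps)
    moreover have "(c1 - l * x1, c2 - l * x2) \<noteq> (0, 0)"
    proof
      assume "(c1 - l * x1, c2 - l * x2) = (0, 0)"
      then have "c1 - l * x1 = 0" "c2 - l * x2 = 0" by simp_all
      then have "x1 * c2 - x2 * c1 = 0" by algebra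
      then show False using c by simp
    qed
    ultimately have nz: "qform M1 v \<noteq> 0 \<or> qform M2 v \<noteq> 0" and k: "pencil M1 M2 (c1 - l * x1) (c2 - l * x2) *v v = 0"
      using simple_pencil_kernel[OF sp _ v(1)] unfolding qform_bil by blast+
    have "qform (pencil M1 M2 (c1 - l * x1) (c2 - l * x2)) v = 0" unfolding qform_bil bil_mult k by simp
    then have 2: "(c1 - l * x1) * qform M1 v - (c2 - l * x2) * qform M2 v = 0" unfolding q .
    \<comment> \<open>The equations 1 and 2 form a linear system for \<open>qform M1 v\<close> and
      \<open>qform M2 v\<close> whose determinant is, up to sign, \<open>x1 * c2 - x2 * c1\<close>,
      whatever \<open>l\<close> is.\<close>
    have "(x1 * c2 - x2 * c1) * qform M1 v = 0" "(x1 * c2 - x2 * c1) * qform M2 v = 0" using 1 2 by algebra+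
    then show False using c nz by simp
  qed
  moreover have "y\<^sup>2 = det M" "det M \<noteq> 0" using y d by (simp_all add: disc_def M_def)
  ultimately obtain kp io p r where "pencil_model M \<gamma> y kp io M' p r"
    using pencil_model_exists[of M \<gamma> M' y] sym unfolding M'_def by blast
  then interpret m: pencil_model M \<gamma> y kp io M' p r .
  have "m.X = Gr_pencil M1 M2"
  proof -
    have "qform M \<xi> = 0 \<and> qform M' \<xi> = 0 \<longleftrightarrow> qform M1 \<xi> = 0 \<and> qform M2 \<xi> = 0" for \<xi>
    proof
      assume "qform M \<xi> = 0 \<and> qform M' \<xi> = 0"
      then have "x1 * qform M1 \<xi> - x2 * qform M2 \<xi> = 0" "c1 * qform M1 \<xi> - c2 * qform M2 \<xi> = 0"
        unfolding M_def M'_def q by auto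
      then have "(x1 * c2 - x2 * c1) * qform M1 \<xi> = 0" "(x1 * c2 - x2 * c1) * qform M2 \<xi> = 0" by algebra+
      then show "qform M1 \<xi> = 0 \<and> qform M2 \<xi> = 0" using c by simp
    qed (simp add: M_def M'_def q)
    then show ?thesis unfolding m.X_def Gr_pencil_def Gr_quadric_def by blast
  qed
  then show ?thesis using m.general_pair_segre by simp
qed

theorem theorem2p2:
  fixes M1 M2 :: "complex ^ 8 ^ 8"
  assumes "simple_pencil M1 M2"
  shows "general_point (hyperelliptic_curve M1 M2)
    (\<lambda>p. \<forall>x1 x2 y. (x1, x2, y) \<in> p \<longrightarrow>
       disc M1 M2 x1 x2 \<noteq> 0 \<and>
       (\<forall>\<gamma>. spin_module (pencil M1 M2 x1 x2) \<gamma> \<longrightarrow>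
          general_pair (spinor_sections \<gamma> y (Gr_pencil M1 M2))
            (\<lambda>s1 s2. \<exists>Y \<phi>.
               let S = zero_locus \<gamma> y (Gr_pencil M1 M2) s1 \<inter> zero_locus \<gamma> y (Gr_pencil M1 M2) s2
               in segre4_section_codim2 Y \<and> biregular (plucker ` S) Y \<phi> \<and>
                  pulls_back_hyperplane_class (plucker ` S) \<phi>)))"
  (is "general_point _ ?P")
proof -
  \<comment> \<open>Only points over zeros of the discriminant can fail. There \<open>y\<close> is
    0, so each zero carries one point, and scaling makes the second coordinate 1, or the first one
    if the second is 0.\<close>
  have "{p \<in> hyperelliptic_curve M1 M2. \<not> ?P p} \<subseteq> insert (orbit114 1 0 0) ((\<lambda>t. orbit114 t 1 0) ` {t. disc M1 M2 t 1 = 0})"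
  proof
    fix p assume "p \<in> {p \<in> hyperelliptic_curve M1 M2. \<not> ?P p}"
    then have "p \<in> hyperelliptic_curve M1 M2" and nP: "\<not> ?P p" by blast+
    then obtain a b y where p: "p = orbit114 a b y" "(a, b, y) \<noteq> (0, 0, 0)" "y\<^sup>2 = disc M1 M2 a b"
      unfolding hyperelliptic_curve_def by blast
    have d: "disc M1 M2 a b = 0"
    proof (rule ccontr)
      assume d: "disc M1 M2 a b \<noteq> 0"
      have "?P p"
      proof (intro allI impI)
        fix x1 x2 z assume "(x1, x2, z) \<in> p"
        then obtain c where c: "c \<noteq> 0" "x1 = c * a" "x2 = c * b" "z = c ^ 4 * y" unfolding p(1) orbit114_def by blast
        have d': "disc M1 M2 x1 x2 \<noteq> 0" unfolding c disc_homogeneous using c(1) d by simp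
        moreover have "z\<^sup>2 = disc M1 M2 x1 x2" unfolding c disc_homogeneous p(3)[symmetric] by (simp add: power_mult_distrib flip: power_mult)
        ultimately show "disc M1 M2 x1 x2 \<noteq> 0 \<and>
       (\<forall>\<gamma>. spin_module (pencil M1 M2 x1 x2) \<gamma> \<longrightarrow>
          general_pair (spinor_sections \<gamma> z (Gr_pencil M1 M2))
            (\<lambda>s1 s2. \<exists>Y \<phi>.
               let S = zero_locus \<gamma> z (Gr_pencil M1 M2) s1 \<inter> zero_locus \<gamma> z (Gr_pencil M1 M2) s2
               in segre4_section_codim2 Y \<and> biregular (plucker ` S) Y \<phi> \<and>
                  pulls_back_hyperplane_class (plucker ` S) \<phi>))"
          using general_pair_pencil[OF assms] by blast
      qed
      then show False using nP by blast
    qed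
    then have y: "y = 0" using p(3) by simp
    show "p \<in> insert (orbit114 1 0 0) ((\<lambda>t. orbit114 t 1 0) ` {t. disc M1 M2 t 1 = 0})"
    proof (cases "b = 0")
      case True
      then have "a \<noteq> 0" using p(2) y by simp
      then have "p = orbit114 1 0 0" using orbit114_scale[of a 1 0 0] unfolding p(1) y True by simp
      then show ?thesis by simp
    next
      case False
      then have "p = orbit114 (a / b) 1 0" using orbit114_scale[of b "a / b" 1 0] unfolding p(1) y by simp
      moreover have "disc M1 M2 (a / b) 1 = 0" using disc_homogeneous[of M1 M2 b "a / b" 1] False d by simp
      ultimately show ?thesis by blast
    qed
  qed
  then show ?thesis unfolding general_point_def
    by (rule finite_subset) (simp add: finite_branch_points[OF assms])
qed

end
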